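(* Let $K$ be a global field with base field $\mathbf{k}$ ($\mathbf{k}=\mathbb{Q}$ or $\mathbf{k}=\mathbb{F}_q(T)$). For every positive integer $m$ there is an effectively computable constant $c=c(\mathbf{k},m)$ such that the following holds. Let $V\subseteq\mathbb{P}^m$ be an irreducible projective variety defined over $K$. Then there exists a finite map $\varphi:V\to\mathbb{P}^{\dim(V)}$, defined over $\mathbf{k}$, of the form $$\varphi(\mathbf{x})=(L_0(\mathbf{x}):\ldots:L_{\dim(V)}(\mathbf{x})),$$ where $L_0,\ldots,L_{\dim(V)}$ are linear forms with coefficients in $\mathbf{k}$ of height at most $c\,(\deg V)^{m-\dim(V)}$. Moreover, each fibre of $\varphi$ has at most $\deg(V)$ elements. In particular, the same statement holds for an irreducible affine variety $Z\subseteq\mathbb{A}^m$ defined over $K$: there is a finite map $Z\to\mathbb{A}^{\dim(Z)}$ given by linear forms with coefficients in $\mathbf{k}$ of height at most $c\,(\deg Z)^{m-\dim(Z)}$, each of whose fibres has at most $\deg(Z)$ elements.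
   Context: A global field $K$ is either a number field (base field $\mathbf{k}=\mathbb{Q}$), or a finite separable extension of $\mathbf{k}=\mathbb{F}_q(T)$ with field of constants $\mathbb{F}_q$. The height of an element $x$ is the absolute multiplicative height $H(x)=H(1:x)$; for $x\in\mathbf{k}$ it is $H(x)=\prod_{v}\max\{1,\|x\|_v\}$, the product over all places of $\mathbf{k}$ with the standard normalization ($\|x\|_\infty=|x|$ and $\|x\|_p=p^{-\mathrm{ord}_p(x)}$ for $\mathbb{Q}$; $\|x\|_{\mathfrak{p}}=q^{-\deg(\mathfrak{p})\,\mathrm{ord}_{\mathfrak{p}}(x)}$ for $\mathbb{F}_q(T)$, over all places including infinity). "Finite map" means finite morphism, "defined over $\mathbf{k}$" means given by polynomials with coefficients in $\mathbf{k}$, and fibres are taken on points over the algebraic closure. *)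

theory Defs
  imports "HOL-Computational_Algebra.Computational_Algebra" "HOL-Library.Poly_Mapping"
begin

section \<open>Computable functions\<close>

text \<open>
  The total recursive functions, as the closure of the basic functions under composition,
  primitive recursion and minimisation of regular functions. An \<open>n\<close>-ary function is a function
  on lists, of which only the values on lists of length \<open>n\<close> matter.
\<close>

inductive total_recursive :: "nat \<Rightarrow> (nat list \<Rightarrow> nat) \<Rightarrow> bool" where
  zero: "total_recursive n (\<lambda>_. 0)"
| succ: "total_recursive 1 (\<lambda>xs. Suc (xs ! 0))"
| proj: "i < n \<Longrightarrow> total_recursive n (\<lambda>xs. xs ! i)"
| comp: "total_recursive (length fs) g \<Longrightarrow> \<forall>f\<in>set fs. total_recursive n f \<Longrightarrow>
    total_recursive n (\<lambda>xs. g (map (\<lambda>f. f xs) fs))"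
| prec: "total_recursive n g \<Longrightarrow> total_recursive (Suc (Suc n)) h \<Longrightarrow>
    total_recursive (Suc n) (\<lambda>xs. rec_nat (g (tl xs)) (\<lambda>y r. h (y # r # tl xs)) (hd xs))"
| minim: "total_recursive (Suc n) g \<Longrightarrow> \<forall>xs. length xs = n \<longrightarrow> (\<exists>y. g (y # xs) = 0) \<Longrightarrow>
    total_recursive n (\<lambda>xs. LEAST y. g (y # xs) = 0)"

definition computable2 :: "(nat \<Rightarrow> nat \<Rightarrow> nat) \<Rightarrow> bool" where
  "computable2 c \<longleftrightarrow> (\<exists>f. total_recursive 2 f \<and> (\<forall>a b. c a b = f [a, b]))"


section \<open>Global fields\<close>

text \<open>
  All fields are subfields of one ambient algebraically closed field, the type \<^typ>\<open>'a\<close>.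
\<close>

definition is_subfield :: "'a::field set \<Rightarrow> bool" where
  "is_subfield S \<longleftrightarrow> 0 \<in> S \<and> 1 \<in> S \<and>
     (\<forall>x\<in>S. \<forall>y\<in>S. x + y \<in> S \<and> x - y \<in> S \<and> x * y \<in> S) \<and> (\<forall>x\<in>S. inverse x \<in> S)"

definition polys_over :: "'a::zero set \<Rightarrow> 'a poly set" where
  "polys_over S = {p. \<forall>i. coeff p i \<in> S}"

definition algebraic_over :: "'a::field set \<Rightarrow> 'a \<Rightarrow> bool" where
  "algebraic_over S x \<longleftrightarrow> (\<exists>p\<in>polys_over S. p \<noteq> 0 \<and> poly p x = 0)"

text \<open>
  In an algebraically closed field \<^const>\<open>rsquarefree\<close> says that all roots are simple, i.e. that
  the polynomial is separable.
\<close>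

definition separable_over :: "'a::alg_closed_field set \<Rightarrow> 'a \<Rightarrow> bool" where
  "separable_over S x \<longleftrightarrow> (\<exists>p\<in>polys_over S. rsquarefree p \<and> poly p x = 0)"

definition finite_extension :: "'a::field set \<Rightarrow> 'a set \<Rightarrow> bool" where
  "finite_extension k K \<longleftrightarrow> k \<subseteq> K \<and>
     (\<exists>B\<subseteq>K. finite B \<and> (\<forall>x\<in>K. \<exists>a. (\<forall>b\<in>B. a b \<in> k) \<and> x = (\<Sum>b\<in>B. a b * b)))"

text \<open>
  \<open>Rationals\<close> stands for the prime field, in characteristic \<open>0\<close>; \<open>RatFun F T\<close> stands for the
  field \<open>F(T)\<close>, where \<open>F\<close> is a finite subfield and \<open>T\<close> is transcendental over \<open>F\<close>.
\<close>

datatype 'a base_field = Rationals | RatFun "'a set" 'a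

fun is_base_field :: "'a::field base_field \<Rightarrow> bool" where
  "is_base_field Rationals \<longleftrightarrow> CHAR('a) = 0"
| "is_base_field (RatFun F T) \<longleftrightarrow> is_subfield F \<and> finite F \<and> \<not> algebraic_over F T"

fun base_set :: "'a::field base_field \<Rightarrow> 'a set" where
  "base_set Rationals = {of_int a / of_int b | a b. b \<noteq> 0}"
| "base_set (RatFun F T) =
     {poly a T / poly b T | a b. a \<in> polys_over F \<and> b \<in> polys_over F \<and> b \<noteq> 0}"

text \<open>A natural number describing the base field: \<open>q\<close> for \<open>F\<^sub>q(T)\<close>, and \<open>0\<close> for the rationals.\<close>

fun base_code :: "'a base_field \<Rightarrow> nat" where
  "base_code Rationals = 0"
| "base_code (RatFun F T) = card F"

definition global_field :: "'a::alg_closed_field base_field \<Rightarrow> 'a set \<Rightarrow> bool" where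
  "global_field k K \<longleftrightarrow> is_base_field k \<and> is_subfield K \<and> finite_extension (base_set k) K \<and>
     (case k of
        Rationals \<Rightarrow> True
      | RatFun F T \<Rightarrow> (\<forall>x\<in>K. separable_over (base_set k) x) \<and> (\<forall>x\<in>K. algebraic_over F x \<longrightarrow> x \<in> F))"


section \<open>Heights of elements of the base field\<close>

text \<open>
  The orders below do not depend on the chosen representation as a fraction. The product
  \<^const>\<open>Prod_any\<close> over all values of a type is the product of the finitely many factors
  different from \<open>1\<close>.
\<close>

definition int_frac :: "'a::field \<Rightarrow> int \<times> int" where
  "int_frac x = (SOME (a, b). b \<noteq> 0 \<and> x = of_int a / of_int b)"

definition rat_abs_inf :: "'a::field \<Rightarrow> real" where
  "rat_abs_inf x = (case int_frac x of (a, b) \<Rightarrow> \<bar>real_of_int a / real_of_int b\<bar>)"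

definition rat_abs :: "int \<Rightarrow> 'a::field \<Rightarrow> real" where
  "rat_abs p x = (if x = 0 then 0 else
     case int_frac x of (a, b) \<Rightarrow>
       real_of_int p powi (- (int (multiplicity p a) - int (multiplicity p b))))"

definition poly_frac :: "'a::field set \<Rightarrow> 'a \<Rightarrow> 'a \<Rightarrow> 'a poly \<times> 'a poly" where
  "poly_frac F T x = (SOME (a, b). a \<in> polys_over F \<and> b \<in> polys_over F \<and> b \<noteq> 0 \<and>
     x = poly a T / poly b T)"

text \<open>The finite places of \<open>F(T)\<close> correspond to the monic irreducible elements of \<open>F[X]\<close>.\<close>

definition monic_irreducible_over :: "'a::field set \<Rightarrow> 'a poly \<Rightarrow> bool" where
  "monic_irreducible_over F p \<longleftrightarrow> p \<in> polys_over F \<and> lead_coeff p = 1 \<and> degree p > 0 \<and>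
     (\<forall>a\<in>polys_over F. \<forall>b\<in>polys_over F. p = a * b \<longrightarrow> degree a = 0 \<or> degree b = 0)"

definition ratfun_abs_inf :: "'a::field set \<Rightarrow> 'a \<Rightarrow> 'a \<Rightarrow> real" where
  "ratfun_abs_inf F T x = (if x = 0 then 0 else
     case poly_frac F T x of (a, b) \<Rightarrow>
       real (card F) powi (int (degree a) - int (degree b)))"

definition multiplicity_over :: "'a::field set \<Rightarrow> 'a poly \<Rightarrow> 'a poly \<Rightarrow> nat" where
  "multiplicity_over F p a = (GREATEST n. \<exists>b\<in>polys_over F. a = p ^ n * b)"

definition ratfun_abs :: "'a::field set \<Rightarrow> 'a \<Rightarrow> 'a poly \<Rightarrow> 'a \<Rightarrow> real" where
  "ratfun_abs F T p x = (if x = 0 then 0 else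
     case poly_frac F T x of (a, b) \<Rightarrow>
       real (card F) powi
         (- (int (degree p) * (int (multiplicity_over F p a) - int (multiplicity_over F p b)))))"

fun height :: "'a::field base_field \<Rightarrow> 'a \<Rightarrow> real" where
  "height Rationals x =
     max 1 (rat_abs_inf x) * Prod_any (\<lambda>p. if prime p then max 1 (rat_abs p x) else 1)"
| "height (RatFun F T) x =
     max 1 (ratfun_abs_inf F T x) *
       Prod_any (\<lambda>p. if monic_irreducible_over F p then max 1 (ratfun_abs F T p x) else 1)"


section \<open>Multivariate polynomials\<close>

type_synonym 'a mpol = "(nat \<Rightarrow>\<^sub>0 nat) \<Rightarrow>\<^sub>0 'a"

definition mp_eval :: "'a::comm_ring_1 mpol \<Rightarrow> (nat \<Rightarrow> 'a) \<Rightarrow> 'a" where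
  "mp_eval f x = (\<Sum>\<mu>\<in>Poly_Mapping.keys f. Poly_Mapping.lookup f \<mu> *
     (\<Prod>i\<in>Poly_Mapping.keys \<mu>. x i ^ Poly_Mapping.lookup \<mu> i))"

definition mp_var :: "nat \<Rightarrow> 'a::comm_ring_1 mpol" where
  "mp_var i = Poly_Mapping.single (Poly_Mapping.single i 1) 1"

definition mpols :: "'a::comm_ring_1 set \<Rightarrow> nat \<Rightarrow> 'a mpol set" where
  "mpols S n = {f. (\<forall>\<mu>. Poly_Mapping.lookup f \<mu> \<in> S) \<and>
     (\<forall>\<mu>\<in>Poly_Mapping.keys f. Poly_Mapping.keys \<mu> \<subseteq> {..<n})}"

text \<open>Forms of degree \<open>d\<close> in the variables \<open>0, \<dots>, n - 1\<close>; the zero polynomial is included.\<close>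

definition forms :: "'a::comm_ring_1 set \<Rightarrow> nat \<Rightarrow> nat \<Rightarrow> 'a mpol set" where
  "forms S n d = {f \<in> mpols S n. \<forall>\<mu>\<in>Poly_Mapping.keys f.
     (\<Sum>i\<in>Poly_Mapping.keys \<mu>. Poly_Mapping.lookup \<mu> i) = d}"

definition lin_coeff :: "'a::comm_ring_1 mpol \<Rightarrow> nat \<Rightarrow> 'a" where
  "lin_coeff f j = Poly_Mapping.lookup f (Poly_Mapping.single j 1)"

definition mp_scale :: "'a::field \<Rightarrow> 'a mpol \<Rightarrow> 'a mpol" where
  "mp_scale a f = Poly_Mapping.single 0 a * f"

global_interpretation mp: vector_space mp_scale
  by unfold_locales
    (simp_all add: mp_scale_def algebra_simps single_add mult_single flip: mult.assoc)


section \<open>Affine and projective algebraic sets\<close>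

text \<open>
  Affine \<open>n\<close>-space consists of the functions on \<open>nat\<close> vanishing from \<open>n\<close> on. Points of projective
  \<open>m\<close>-space are the classes of nonzero vectors with \<open>m + 1\<close> coordinates up to scaling.
\<close>

definition vecs :: "nat \<Rightarrow> (nat \<Rightarrow> 'a::field) set" where
  "vecs n = {x. \<forall>i\<ge>n. x i = 0}"

type_synonym 'a ppoint = "(nat \<Rightarrow> 'a) set"

definition ppt :: "(nat \<Rightarrow> 'a::field) \<Rightarrow> 'a ppoint" where
  "ppt x = {\<lambda>i. a * x i | a. a \<noteq> 0}"

definition proj_space :: "nat \<Rightarrow> 'a::field ppoint set" where
  "proj_space m = ppt ` {x \<in> vecs (Suc m). \<exists>i. x i \<noteq> 0}"

definition affine_closed :: "'a::field set \<Rightarrow> nat \<Rightarrow> (nat \<Rightarrow> 'a) set \<Rightarrow> bool" where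
  "affine_closed K m Z \<longleftrightarrow>
     (\<exists>G\<subseteq>mpols K m. Z = {x \<in> vecs m. \<forall>g\<in>G. mp_eval g x = 0})"

definition proj_closed :: "'a::field set \<Rightarrow> nat \<Rightarrow> 'a ppoint set \<Rightarrow> bool" where
  "proj_closed K m V \<longleftrightarrow>
     (\<exists>G\<subseteq>(\<Union>d. forms K (Suc m) d). V = {P \<in> proj_space m. \<forall>x\<in>P. \<forall>g\<in>G. mp_eval g x = 0})"

text \<open>Irreducibility and dimension for the topology whose closed sets are given by \<open>closd\<close>.\<close>

definition irreducible_closed :: "('x set \<Rightarrow> bool) \<Rightarrow> 'x set \<Rightarrow> bool" where
  "irreducible_closed closd V \<longleftrightarrow> closd V \<and> V \<noteq> {} \<and>
     (\<forall>A B. closd A \<and> closd B \<and> V = A \<union> B \<longrightarrow> V = A \<or> V = B)"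

definition krull_dim :: "('x set \<Rightarrow> bool) \<Rightarrow> 'x set \<Rightarrow> nat" where
  "krull_dim closd V = Sup {n. \<exists>Z. (\<forall>i\<le>n. irreducible_closed closd (Z i) \<and> Z i \<subseteq> V) \<and>
     (\<forall>i<n. Z i \<subset> Z (Suc i))}"

text \<open>
  Varieties defined over \<open>K\<close> are irreducible for the topology given by polynomials over \<open>K\<close>;
  they may be reducible over the algebraic closure.
\<close>

definition affine_variety :: "'a::field set \<Rightarrow> nat \<Rightarrow> (nat \<Rightarrow> 'a) set \<Rightarrow> bool" where
  "affine_variety K m Z \<longleftrightarrow> irreducible_closed (affine_closed K m) Z"

definition proj_variety :: "'a::field set \<Rightarrow> nat \<Rightarrow> 'a ppoint set \<Rightarrow> bool" where
  "proj_variety K m V \<longleftrightarrow> irreducible_closed (proj_closed K m) V"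

definition affine_dim :: "nat \<Rightarrow> (nat \<Rightarrow> 'a::field) set \<Rightarrow> nat" where
  "affine_dim m Z = krull_dim (affine_closed UNIV m) Z"

definition proj_dim :: "nat \<Rightarrow> 'a::field ppoint set \<Rightarrow> nat" where
  "proj_dim m V = krull_dim (proj_closed UNIV m) V"


section \<open>Degree\<close>

definition vanishing_forms :: "nat \<Rightarrow> 'a::field ppoint set \<Rightarrow> nat \<Rightarrow> 'a mpol set" where
  "vanishing_forms m V t = {f \<in> forms UNIV (Suc m) t. \<forall>P\<in>V. \<forall>x\<in>P. mp_eval f x = 0}"

text \<open>The dimension of the degree \<open>t\<close> part of the homogeneous coordinate ring of \<open>V\<close>.\<close>

definition hilbert_function :: "nat \<Rightarrow> 'a::field ppoint set \<Rightarrow> nat \<Rightarrow> nat" where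
  "hilbert_function m V t =
     mp.dim (forms UNIV (Suc m) t :: 'a mpol set) - mp.dim (vanishing_forms m V t)"

definition hilbert_poly :: "nat \<Rightarrow> 'a::field ppoint set \<Rightarrow> real poly" where
  "hilbert_poly m V =
     (THE p. eventually (\<lambda>t. poly p (real t) = real (hilbert_function m V t)) sequentially)"

definition proj_degree :: "nat \<Rightarrow> 'a::field ppoint set \<Rightarrow> real" where
  "proj_degree m V = fact (proj_dim m V) * coeff (hilbert_poly m V) (proj_dim m V)"

text \<open>The homogenising coordinate is the last one, with index \<open>m\<close>.\<close>

definition proj_closure :: "nat \<Rightarrow> (nat \<Rightarrow> 'a::field) set \<Rightarrow> 'a ppoint set" where
  "proj_closure m Z = \<Inter> {W. proj_closed UNIV m W \<and> (\<forall>z\<in>Z. ppt (z(m := 1)) \<in> W)}"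

definition affine_degree :: "nat \<Rightarrow> (nat \<Rightarrow> 'a::field) set \<Rightarrow> real" where
  "affine_degree m Z = proj_degree m (proj_closure m Z)"


section \<open>Finite morphisms\<close>

text \<open>
  Pulling back along \<open>\<phi>\<close> makes the ring \<open>A\<close> of functions on \<open>X\<close> a finitely generated module over
  the ring \<open>B\<close> of functions on the target. The elements of \<open>A\<close> are given as functions on a larger
  set, and equality is tested on \<open>X\<close>.
\<close>

definition finite_over ::
    "'x set \<Rightarrow> ('x \<Rightarrow> 'y) \<Rightarrow> ('y \<Rightarrow> 'a::field) set \<Rightarrow> ('x \<Rightarrow> 'a) set \<Rightarrow> bool" where
  "finite_over X \<phi> B A \<longleftrightarrow> (\<exists>G\<subseteq>A. finite G \<and>
     (\<forall>f\<in>A. \<exists>b. (\<forall>g\<in>G. b g \<in> B) \<and> (\<forall>x\<in>X. f x = (\<Sum>g\<in>G. b g (\<phi> x) * g x))))"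

definition poly_map :: "nat \<Rightarrow> (nat \<Rightarrow> 'a::field mpol) \<Rightarrow> (nat \<Rightarrow> 'a) \<Rightarrow> (nat \<Rightarrow> 'a)" where
  "poly_map n F x = (\<lambda>i. if i < n then mp_eval (F i) x else 0)"

definition affine_finite_map :: "nat \<Rightarrow> nat \<Rightarrow> (nat \<Rightarrow> 'a::field) set \<Rightarrow> (nat \<Rightarrow> 'a mpol) \<Rightarrow> bool" where
  "affine_finite_map m n Z F \<longleftrightarrow> (\<forall>i<n. F i \<in> mpols UNIV m) \<and>
     finite_over Z (poly_map n F) (mp_eval ` mpols UNIV n) (mp_eval ` mpols UNIV m)"

text \<open>The map \<open>x \<mapsto> (F\<^sub>0(x) : \<dots> : F\<^sub>n(x))\<close>.\<close>

definition proj_map :: "nat \<Rightarrow> (nat \<Rightarrow> 'a::field mpol) \<Rightarrow> 'a ppoint \<Rightarrow> 'a ppoint" where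
  "proj_map n F P = (\<Union>x\<in>P. ppt (poly_map (Suc n) F x))"

text \<open>
  The regular functions on the affine open set \<open>h \<noteq> 0\<close> of a projective variety, for a form \<open>h\<close>
  of degree \<open>e > 0\<close>: the degree \<open>0\<close> part of the localisation of the homogeneous coordinate ring
  at \<open>h\<close>, as functions of the homogeneous coordinates.
\<close>

definition local_functions :: "nat \<Rightarrow> nat \<Rightarrow> 'a::field mpol \<Rightarrow> ((nat \<Rightarrow> 'a) \<Rightarrow> 'a) set" where
  "local_functions m e h =
     {\<lambda>x. mp_eval f x / mp_eval h x ^ d | f d. f \<in> forms UNIV (Suc m) (d * e)}"

text \<open>
  Forms \<open>F\<^sub>0, \<dots>, F\<^sub>n\<close> of the same degree without common zero on \<open>V\<close>, such that over each
  standard affine open set \<open>y\<^sub>i \<noteq> 0\<close> of the target the map is a finite morphism of affine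
  varieties. The preimage of that set is the affine open set \<open>F\<^sub>i \<noteq> 0\<close> of \<open>V\<close>.
\<close>

definition proj_finite_map :: "nat \<Rightarrow> nat \<Rightarrow> 'a::field ppoint set \<Rightarrow> (nat \<Rightarrow> 'a mpol) \<Rightarrow> bool" where
  "proj_finite_map m n V F \<longleftrightarrow> (\<exists>e>0. (\<forall>i\<le>n. F i \<in> forms UNIV (Suc m) e) \<and>
     (\<forall>P\<in>V. \<forall>x\<in>P. \<exists>i\<le>n. mp_eval (F i) x \<noteq> 0) \<and>
     (\<forall>i\<le>n. finite_over {x \<in> \<Union>V. mp_eval (F i) x \<noteq> 0} (poly_map (Suc n) F)
        (local_functions n 1 (mp_var i)) (local_functions m e (F i))))"

end

theory Submission
  imports Defs "HOL-Library.Function_Algebras"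
begin

text \<open>
  The proof replaces a projective variety \<open>V\<close> by the cone \<open>X\<close> over it in affine \<open>n\<close>-space, \<open>n = m + 1\<close>,
  and an affine variety by the cone over its points \<open>(z : 1)\<close>. Dimension and degree are read off the
  Hilbert function of \<open>X\<close>, and a finite map given by linear forms \<open>L\<^sub>0, \<dots>, L\<^sub>d\<close> is one for which the
  forms on \<open>X\<close> are a finite module over the forms in \<open>L\<^sub>0, \<dots>, L\<^sub>d\<close> (\<open>FG\<close>).

  The linear forms come from repeated projections. The identity map is finite. If \<open>r + 1\<close> linear
  forms \<open>M\<^sub>0, \<dots>, M\<^sub>r\<close> give a finite map, \<open>f\<close> is a form that vanishes on the image and \<open>p\<close> is a point
  with \<open>p\<^sub>0 = 1\<close> and \<open>f(p) \<noteq> 0\<close>, then the \<open>r\<close> forms \<open>M\<^sub>i - p\<^sub>i M\<^sub>0\<close> give a finite map again, because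
  \<open>f\<close> turns into a relation for \<open>M\<^sub>0\<close> over them whose leading coefficient is the constant \<open>f(p)\<close>
  (\<open>projection_step\<close>). After \<open>m - d\<close> steps, with \<open>d\<close> the dimension, \<open>d + 1\<close> forms are left. A form
  of degree \<open>e\<close> that is not zero has a nonzero value at a point whose coordinates come from any given
  set of \<open>e + 1\<close> elements. So if \<open>f\<close> can be chosen of degree at most \<open>D = deg V\<close>, then \<open>p\<close> can be
  chosen with integral coordinates of size at most \<open>D\<close>, one step multiplies the size of the
  coefficients by at most \<open>2 D\<close>, and the final bound is \<open>(2 D)\<close> to the power \<open>m - d\<close>
  (\<open>small_projection_step\<close>, \<open>small_normalization\<close>). Hence the constant \<open>c = 2\<^sup>m\<close>.

  A form of degree at most \<open>D\<close> is found as follows (\<open>integral_relation_degree_le\<close>). Let \<open>L\<^sub>0, \<dots>, L\<^sub>d\<close>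
  be some finite projection of the image and \<open>g\<close> a linear form. If \<open>1, g, \<dots>\<close>, up to the power
  \<open>e - 1\<close>, have no relation with coefficients in the ring of the \<open>L\<^sub>i\<close>, then the Hilbert function of
  \<open>X\<close> is at least the sum of \<open>e\<close> shifted copies of that of a polynomial ring in \<open>d + 1\<close> variables, so
  \<open>e \<le> D\<close>. So \<open>g\<close> satisfies a relation of degree at most \<open>D\<close>. As \<open>g\<close> is integral and the ring of
  the \<open>L\<^sub>i\<close> is integrally closed, the relation of least degree is monic up to a factor that does not
  vanish on \<open>X\<close>. With \<open>g = M\<^sub>0\<close> the relation is the wanted \<open>f\<close>: it is not zero at a point where all
  \<open>L\<^sub>i\<close> vanish and \<open>M\<^sub>0\<close> does not. With a \<open>g\<close> that separates the points of a fibre, the relation shows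
  that there are at most \<open>D\<close> of them (\<open>fibre_bound\<close>).

  That this factor can be removed is due to the irreducibility of \<open>X\<close>, which is given for polynomials
  over \<open>K\<close> only, whereas degree and dimension are defined over the algebraic closure. Therefore all relations are taken with
  coefficients in the perfect closure \<open>E\<close> of \<open>K\<close>: raising to a power of the characteristic shows
  that \<open>X\<close> is irreducible over \<open>E\<close> (\<open>prime_on_perfect_closure\<close>), and Galois descent shows that forms
  over \<open>E\<close> that are linearly independent on \<open>X\<close> over \<open>E\<close> are independent over the algebraic closure
  (\<open>descent\<close>).

  Finally, the Krull dimension is the degree of the Hilbert polynomial (\<open>krull_dim_eq_degree\<close>): the
  degree drops in strict inclusions of irreducible sets, and the preimage of a hyperplane under a finite
  projection has dimension one less, by lying over (\<open>lift_step\<close>). In the base field, the only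
  place that contributes to the height of an integer, or of a polynomial in \<open>T\<close>, is the infinite one.
\<close>

section \<open>Polynomial functions\<close>

text \<open>
  Forms of degree \<open>t\<close> over \<open>E\<close> in the first \<open>n\<close> coordinates, as functions. Over an infinite field a
  function determines the form, and the closure rules below are all that most arguments need; the
  coefficients are recovered in \<open>hp_normal_form\<close>.
\<close>

inductive hp :: "'a::field set => nat => nat => ((nat => 'a) => 'a) => bool" for E n where
  zero: "hp E n t (\<lambda>x. 0)"
| const: "c \<in> E ==> hp E n 0 (\<lambda>x. c)"
| var: "i < n ==> hp E n (Suc 0) (\<lambda>x. x i)"
| add: "hp E n t f ==> hp E n t g ==> hp E n t (\<lambda>x. f x + g x)"
| mult: "hp E n s f ==> hp E n t g ==> hp E n (s + t) (\<lambda>x. f x * g x)"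

text \<open>
  Polynomial functions without homogeneity.
\<close>

inductive pf :: "'a::field set => nat => ((nat => 'a) => 'a) => bool" for E n where
  const: "c \<in> E ==> pf E n (\<lambda>x. c)"
| var: "i < n ==> pf E n (\<lambda>x. x i)"
| add: "pf E n f ==> pf E n g ==> pf E n (\<lambda>x. f x + g x)"
| mult: "pf E n f ==> pf E n g ==> pf E n (\<lambda>x. f x * g x)"

lemma subfieldD:
  assumes "is_subfield E"
  shows "0 \<in> E" "1 \<in> E" "x \<in> E ==> y \<in> E ==> x + y \<in> E" "x \<in> E ==> y \<in> E ==> x - y \<in> E"
    "x \<in> E ==> y \<in> E ==> x * y \<in> E" "x \<in> E ==> inverse x \<in> E" "x \<in> E ==> - x \<in> E"
    "x \<in> E ==> y \<in> E ==> x / y \<in> E" "x \<in> E ==> x ^ k \<in> E"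
proof -
  show *: "0 \<in> E" "1 \<in> E" "x \<in> E ==> y \<in> E ==> x + y \<in> E" "x \<in> E ==> y \<in> E ==> x - y \<in> E"
    "x \<in> E ==> y \<in> E ==> x * y \<in> E" "x \<in> E ==> inverse x \<in> E" for x y
    using assms by (auto simp: is_subfield_def)
  show "x \<in> E ==> - x \<in> E" using *(4)[OF *(1), of x] by simp
  show "x \<in> E ==> y \<in> E ==> x / y \<in> E" using *(5)[of x "inverse y"] *(6)[of y] by (simp add: field_simps)
  show "x \<in> E ==> x ^ k \<in> E" by (induction k) (use * in auto)
qed

lemma subfield_UNIV: "is_subfield UNIV"
  by (simp add: is_subfield_def)

lemma hp_var1: "i < n ==> hp E n 1 (\<lambda>x. x i)"
  using hp.var by simp

lemma hp_multI: "hp E n s f ==> hp E n t g ==> u = s + t ==> hp E n u (\<lambda>x. f x * g x)"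
  using hp.mult by blast

lemma hp_cmult: "hp E n t f ==> c \<in> E ==> hp E n t (\<lambda>x. c * f x)"
  using hp.mult[OF hp.const, of c E n t f] by simp

lemma hp_uminus: "is_subfield E ==> hp E n t f ==> hp E n t (\<lambda>x. - f x)"
  using hp_cmult[of E n t f "- 1"] by (simp add: subfieldD)

lemma hp_diff: "is_subfield E ==> hp E n t f ==> hp E n t g ==> hp E n t (\<lambda>x. f x - g x)"
  using hp.add[OF _ hp_uminus, of E n t f g] by simp

lemma hp_sum: "(\<And>i. i \<in> I ==> hp E n t (f i)) ==> hp E n t (\<lambda>x. \<Sum>i\<in>I. f i x)"
  by (induction I rule: infinite_finite_induct) (auto intro: hp.zero hp.add)

lemma hp_power: "hp E n t f ==> 1 \<in> E ==> hp E n (k * t) (\<lambda>x. f x ^ k)"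
  by (induction k) (auto intro: hp.intros)

lemma hp_power1: "hp E n 1 f ==> 1 \<in> E ==> hp E n k (\<lambda>x. f x ^ k)"
  using hp_power[of E n 1 f k] by simp

lemma hp_prod:
  assumes "1 \<in> E"
  shows "(\<And>i. i \<in> I ==> hp E n (d i) (f i)) ==> hp E n (\<Sum>i\<in>I. d i) (\<lambda>x. \<Prod>i\<in>I. f i x)"
  by (induction I rule: infinite_finite_induct) (auto intro: assms hp.mult hp.const)

lemma hp_mono: "hp E n t f ==> E \<subseteq> E' ==> n \<le> n' ==> hp E' n' t f"
  by (induction rule: hp.induct) (auto intro: hp.intros)

lemma hp_subst:
  assumes "hp E r t f" "\<And>i. i < r ==> hp E n 1 (M i)"
  shows "hp E n t (\<lambda>x. f (\<lambda>i. M i x))"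
  using assms by (induction rule: hp.induct) (auto intro: hp.intros)

lemma hp_cong: "hp E n t f ==> (\<And>i. i < n ==> x i = y i) ==> f x = f y"
  by (induction rule: hp.induct) auto

lemma hp_scale: "hp E n t f ==> f (\<lambda>i. a * x i) = a ^ t * f x"
  by (induction rule: hp.induct) (auto simp: algebra_simps power_add)

lemma hp_zero_pos:
  assumes "hp E n t f" "t > 0" "\<And>i. i < n ==> x i = 0"
  shows "f x = 0"
proof -
  have "f x = f (\<lambda>i. 0 * x i)" by (rule hp_cong[OF assms(1)]) (use assms in auto)
  also have "... = 0" using hp_scale[OF assms(1), of 0 x] assms(2) by (metis mult_zero_left zero_power)
  finally show ?thesis .
qed

lemma hp_degree0: "hp E n t f ==> t = 0 ==> is_subfield E ==> \<exists>c\<in>E. \<forall>x. f x = c"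
proof (induction rule: hp.induct)
  case (add t f g)
  then show ?case by (metis subfieldD(3))
next
  case (mult s f t g)
  then show ?case by (metis subfieldD(5) add_is_0)
qed (auto simp: subfieldD)

lemma hp_closed_value: "hp E n t f ==> is_subfield E ==> (\<And>i. i < n ==> x i \<in> E) ==> f x \<in> E"
  by (induction rule: hp.induct) (auto simp: subfieldD)

lemma pf_of_hp: "hp E n t f ==> 0 \<in> E ==> pf E n f"
  by (induction rule: hp.induct) (auto intro: pf.intros)

lemma pf_sum: "0 \<in> E ==> (\<And>i. i \<in> I ==> pf E n (f i)) ==> pf E n (\<lambda>x. \<Sum>i\<in>I. f i x)"
  by (induction I rule: infinite_finite_induct) (auto intro: pf.intros)

lemma pf_diff: "is_subfield E ==> pf E n f ==> pf E n g ==> pf E n (\<lambda>x. f x - g x)"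
  using pf.add[OF _ pf.mult[OF pf.const], of E n f "-1" g] by (simp add: subfieldD)

lemma pf_decomp:
  assumes "pf E n f" "0 \<in> E"
  shows "\<exists>T c. (\<forall>t. hp E n t (c t)) \<and> (\<forall>t>T. c t = (\<lambda>_. 0)) \<and> f = (\<lambda>x. \<Sum>t\<le>T. c t x)"
  using assms
proof (induction rule: pf.induct)
  case (const c)
  then show ?case
    by (intro exI[of _ 0] exI[of _ "\<lambda>t. if t = 0 then (\<lambda>_. c) else (\<lambda>_. 0)"]) (auto intro: hp.intros)
next
  case (var i)
  then show ?case
    by (intro exI[of _ 1] exI[of _ "\<lambda>t. if t = 1 then (\<lambda>x. x i) else (\<lambda>_. 0)"]) (auto intro: hp.intros)
next
  case (add f g)
  then obtain S c T d where *: "\<forall>t. hp E n t (c t)" "\<forall>t>S. c t = (\<lambda>_. 0)" "f = (\<lambda>x. \<Sum>t\<le>S. c t x)"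
    "\<forall>t. hp E n t (d t)" "\<forall>t>T. d t = (\<lambda>_. 0)" "g = (\<lambda>x. \<Sum>t\<le>T. d t x)" by blast
  have "(\<Sum>t\<le>S. c t x) = (\<Sum>t\<le>max S T. c t x)" for x
    by (rule sum.mono_neutral_left) (use * in auto)
  moreover have "(\<Sum>t\<le>T. d t x) = (\<Sum>t\<le>max S T. d t x)" for x
    by (rule sum.mono_neutral_left) (use * in auto)
  ultimately show ?case
    by (intro exI[of _ "max S T"] exI[of _ "\<lambda>t x. c t x + d t x"]) (use * in \<open>auto intro: hp.add simp: sum.distrib\<close>)
next
  case (mult f g)
  then obtain S c T d where *: "\<forall>t. hp E n t (c t)" "\<forall>t>S. c t = (\<lambda>_. 0)" "f = (\<lambda>x. \<Sum>t\<le>S. c t x)"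
    "\<forall>t. hp E n t (d t)" "\<forall>t>T. d t = (\<lambda>_. 0)" "g = (\<lambda>x. \<Sum>t\<le>T. d t x)" by blast
  have eq: "f x * g x = (\<Sum>r\<le>S + T. \<Sum>k\<le>r. c k x * d (r - k) x)" for x
    using polynomial_product[of S "\<lambda>i. c i x" T "\<lambda>i. d i x" 1] * by simp
  show ?case
  proof (intro exI[of _ "S + T"] exI[of _ "\<lambda>r x. \<Sum>k\<le>r. c k x * d (r - k) x"] conjI allI impI)
    fix t show "hp E n t (\<lambda>x. \<Sum>k\<le>t. c k x * d (t - k) x)"
      by (rule hp_sum, rule hp_multI) (use * in auto)
    assume "t > S + T"
    have "c k x * d (t - k) x = 0" if "k \<le> t" for k x
      by (cases "k > S") (use * \<open>t > S + T\<close> that in auto)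
    then show "(\<lambda>x. \<Sum>k\<le>t. c k x * d (t - k) x) = (\<lambda>_. 0)"
      by (auto intro!: sum.neutral)
  qed (use eq in auto)
qed

text \<open>
  The coefficients \<open>A\<^sub>l\<close> of a form of degree \<open>t\<close> in \<open>n + 1\<close> variables, expanded in powers of one of
  them: \<open>A\<^sub>l\<close> has degree \<open>t - l\<close>.
\<close>

definition graded_coeffs :: "'a::field set => nat => nat => (nat => (nat => 'a) => 'a) => bool" where
  "graded_coeffs E n t A \<longleftrightarrow> (\<forall>l\<le>t. hp E n (t - l) (A l)) \<and> (\<forall>l>t. A l = (\<lambda>_. 0))"

lemma graded_coeffs_convolution:
  assumes "graded_coeffs E n s A" "graded_coeffs E n t B"
  shows "graded_coeffs E n (s + t) (\<lambda>r x. \<Sum>k\<le>r. A k x * B (r - k) x)"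
  unfolding graded_coeffs_def
proof (intro conjI allI impI)
  fix r assume r: "r \<le> s + t"
  show "hp E n (s + t - r) (\<lambda>x. \<Sum>k\<le>r. A k x * B (r - k) x)"
  proof (rule hp_sum)
    fix k assume "k \<in> {..r}"
    show "hp E n (s + t - r) (\<lambda>x. A k x * B (r - k) x)"
    proof (cases "k \<le> s \<and> r - k \<le> t")
      case True
      then show ?thesis using assms r \<open>k \<in> {..r}\<close>
        by (intro hp_multI[where s = "s - k" and t = "t - (r - k)"]) (auto simp: graded_coeffs_def)
    next
      case False
      then have "(\<lambda>x. A k x * B (r - k) x) = (\<lambda>x. 0)"
        using assms by (auto simp: graded_coeffs_def fun_eq_iff not_le)
      then show ?thesis by (simp add: hp.zero)
    qed
  qed
next
  fix r assume r: "r > s + t"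
  have "A k x * B (r - k) x = 0" if "k \<le> r" for k x
    by (cases "k > s") (use assms r that in \<open>auto simp: graded_coeffs_def\<close>)
  then show "(\<lambda>x. \<Sum>k\<le>r. A k x * B (r - k) x) = (\<lambda>_. 0)"
    by (auto intro!: sum.neutral)
qed

lemma hp_taylor:
  assumes "hp E n t f" "0 \<in> E" "\<And>i. i < n ==> b i \<in> E"
  shows "\<exists>A. graded_coeffs E n t A \<and> (\<forall>z \<tau>. f (\<lambda>i. z i + \<tau> * b i) = (\<Sum>l\<le>t. A l z * \<tau> ^ l))"
  using assms
proof (induction rule: hp.induct)
  case (zero t)
  then show ?case
    by (intro exI[of _ "\<lambda>l _. 0"]) (auto simp: graded_coeffs_def intro: hp.zero)
next
  case (const c)
  then show ?case
    by (intro exI[of _ "\<lambda>l _. if l = 0 then c else 0"]) (auto simp: graded_coeffs_def intro: hp.const)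
next
  case (var i)
  then show ?case
    by (intro exI[of _ "\<lambda>l x. if l = 0 then x i else if l = 1 then b i else 0"])
       (auto simp: graded_coeffs_def le_Suc_eq intro: hp.const hp.var)
next
  case (add t f g)
  from add.IH(1)[OF add.prems] obtain A where A: "graded_coeffs E n t A"
    "\<And>z \<tau>. f (\<lambda>i. z i + \<tau> * b i) = (\<Sum>l\<le>t. A l z * \<tau> ^ l)" by blast
  from add.IH(2)[OF add.prems] obtain B where B: "graded_coeffs E n t B"
    "\<And>z \<tau>. g (\<lambda>i. z i + \<tau> * b i) = (\<Sum>l\<le>t. B l z * \<tau> ^ l)" by blast
  have "graded_coeffs E n t (\<lambda>l x. A l x + B l x)"
    using A(1) B(1) by (auto simp: graded_coeffs_def intro: hp.add)
  then show ?case
    using A(2) B(2) by (intro exI[of _ "\<lambda>l x. A l x + B l x"]) (simp add: distrib_right sum.distrib)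
next
  case (mult s f t g)
  from mult.IH(1)[OF mult.prems] mult.IH(2)[OF mult.prems] obtain A B where
    *: "graded_coeffs E n s A" "\<forall>z \<tau>. f (\<lambda>i. z i + \<tau> * b i) = (\<Sum>l\<le>s. A l z * \<tau> ^ l)"
    "graded_coeffs E n t B" "\<forall>z \<tau>. g (\<lambda>i. z i + \<tau> * b i) = (\<Sum>l\<le>t. B l z * \<tau> ^ l)" by blast
  have "f (\<lambda>i. z i + \<tau> * b i) * g (\<lambda>i. z i + \<tau> * b i) =
      (\<Sum>r\<le>s + t. (\<Sum>k\<le>r. A k z * B (r - k) z) * \<tau> ^ r)" for z \<tau>
    using polynomial_product[of s "\<lambda>i. A i z" t "\<lambda>i. B i z" \<tau>] * by (simp add: graded_coeffs_def)
  then show ?case using graded_coeffs_convolution[OF *(1,3)] by blast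
qed

text \<open>
  The top coefficient of the restriction to a line has degree \<open>0\<close>, so it does not depend on the base
  point \<open>z\<close>, and at \<open>z = 0\<close> only the top term is left.
\<close>

lemma hp_taylor_lead:
  fixes f :: "(nat => 'a::field) => 'a"
  assumes "hp UNIV n t f" "graded_coeffs UNIV n t A"
    "\<And>z \<tau>. f (\<lambda>i. z i + \<tau> * b i) = (\<Sum>l\<le>t. A l z * \<tau> ^ l)"
  shows "A t z = f b"
proof -
  have "A t z = A t (\<lambda>_. 0)"
  proof -
    have "hp UNIV n (t - t) (A t)" using assms(2) unfolding graded_coeffs_def by blast
    then show ?thesis using hp_degree0[of UNIV n "t - t" "A t"] subfield_UNIV by fastforce
  qed
  also have "... = (\<Sum>l\<le>t. A l (\<lambda>_. 0) * 1 ^ l)"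
  proof -
    have "A l (\<lambda>_. 0) = 0" if "l < t" for l
    proof -
      have "hp UNIV n (t - l) (A l)" using assms(2) that unfolding graded_coeffs_def by simp
      then show ?thesis using hp_zero_pos[of UNIV n "t - l" "A l" "\<lambda>_. 0"] that by auto
    qed
    then have "(\<Sum>l\<le>t. A l (\<lambda>_. 0) * 1 ^ l) = (\<Sum>l\<in>{t}. A l (\<lambda>_. 0) * 1 ^ l)"
      by (intro sum.mono_neutral_right) auto
    then show ?thesis by simp
  qed
  also have "... = f (\<lambda>i. 0 + 1 * b i)" by (rule assms(3)[symmetric])
  finally show ?thesis by simp
qed

lemma hp_line:
  fixes f :: "(nat => 'a::field) => 'a"
  assumes "hp UNIV n t f"
  shows "\<exists>p. degree p \<le> t \<and> coeff p t = f b \<and> (\<forall>s. poly p s = f (\<lambda>i. z i + s * b i))"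
proof -
  obtain A where A: "graded_coeffs UNIV n t A" "\<forall>z \<tau>. f (\<lambda>i. z i + \<tau> * b i) = (\<Sum>l\<le>t. A l z * \<tau> ^ l)"
    using hp_taylor[OF assms, of b] by auto
  let ?p = "\<Sum>l\<le>t. monom (A l z) l"
  have "degree ?p \<le> t" by (rule degree_sum_le) (auto intro: order_trans[OF degree_monom_le])
  moreover have "coeff ?p t = A t z" by (simp add: coeff_sum)
  moreover have "A t z = f b" using hp_taylor_lead[OF assms A(1)] A(2) by blast
  moreover have "poly ?p s = f (\<lambda>i. z i + s * b i)" for s
    using A(2) by (simp add: poly_sum poly_monom)
  ultimately show ?thesis by metis
qed

lemma pf_line:
  fixes f :: "(nat => 'a::field) => 'a"
  assumes "pf UNIV n f"
  shows "\<exists>p. \<forall>s. poly p s = f (\<lambda>i. z i + s * b i)"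
  using assms
proof (induction rule: pf.induct)
  case (const c)
  show ?case by (rule exI[of _ "[:c:]"]) simp
next
  case (var i)
  show ?case by (rule exI[of _ "[:z i, b i:]"]) simp
next
  case (add f g)
  then show ?case by (metis poly_add)
next
  case (mult f g)
  then show ?case by (metis poly_mult)
qed

text \<open>
  A polynomial in the scalar \<open>a\<close> with infinitely many zeros is zero. This is why the vanishing ideal
  of a cone is homogeneous.
\<close>

lemma homogeneous_components_vanish:
  fixes c :: "nat => (nat => 'a::field) => 'a"
  assumes "infinite (UNIV :: 'a set)" "\<And>t x a. c t (\<lambda>i. a * x i) = a ^ t * c t x"
    "\<And>a. a \<noteq> 0 ==> (\<Sum>t\<le>T. c t (\<lambda>i. a * x i)) = 0" "t \<le> T"
  shows "c t x = 0"
proof -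
  let ?p = "\<Sum>t\<le>T. monom (c t x) t"
  have "poly ?p a = (\<Sum>t\<le>T. c t (\<lambda>i. a * x i))" for a
    by (simp add: poly_sum poly_monom assms(2) mult.commute)
  then have "UNIV - {0} \<subseteq> {a. poly ?p a = 0}" using assms(3) by auto
  then have "infinite {a. poly ?p a = 0}"
    using assms(1) by (metis finite_subset finite_Diff2 finite.emptyI finite_insert)
  then have "?p = 0" using poly_roots_finite[of ?p] by argo
  then have "coeff ?p t = 0" by simp
  then show ?thesis using assms(4) by (simp add: coeff_sum)
qed

lemma poly_nonzero_in_set:
  fixes p :: "'a::field poly"
  assumes "p \<noteq> 0" "degree p < card S \<or> infinite S"
  shows "\<exists>s\<in>S. poly p s \<noteq> 0"
proof (rule ccontr)
  assume "\<not> ?thesis"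
  then have sub: "S \<subseteq> {x. poly p x = 0}" by auto
  have fin: "finite {x. poly p x = 0}" using assms(1) by (rule poly_roots_finite)
  have "card S \<le> degree p"
    using card_mono[OF fin sub] card_poly_roots_bound[OF assms(1)] by linarith
  then show False using assms(2) finite_subset[OF sub fin] by auto
qed

text \<open>
  The coordinates in \<open>J\<close> are moved into \<open>S\<close> one after the other: along each of them the form is a
  polynomial of degree at most \<open>t\<close>, which cannot vanish on all of \<open>S\<close>.
\<close>

lemma hp_nonvanishing_in_set:
  fixes f :: "(nat => 'a::field) => 'a"
  assumes "hp UNIV n t f" "t < card S \<or> infinite S" "f q \<noteq> 0" "finite J"
  shows "\<exists>p. f p \<noteq> 0 \<and> (\<forall>i\<in>J. p i \<in> S) \<and> (\<forall>i. i \<notin> J --> p i = q i)"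
  using assms(4)
proof (induction J rule: finite_induct)
  case empty
  then show ?case using assms(3) by auto
next
  case (insert j J)
  then obtain p where p: "f p \<noteq> 0" "\<forall>i\<in>J. p i \<in> S" "\<forall>i. i \<notin> J --> p i = q i" by blast
  define b where "b = (\<lambda>i. if i = j then 1 else (0::'a))"
  define z where "z = p(j := 0)"
  obtain P where P: "degree P \<le> t" "\<forall>s. poly P s = f (\<lambda>i. z i + s * b i)"
    using hp_line[OF assms(1)] by metis
  have zb: "(\<lambda>i. z i + s * b i) = p(j := s)" for s
    by (auto simp: z_def b_def)
  have "poly P (p j) \<noteq> 0" using P(2) p(1) by (simp add: zb)
  then have "P \<noteq> 0" by auto
  moreover have "degree P < card S \<or> infinite S" using P(1) assms(2) by auto
  ultimately obtain s where s: "s \<in> S" "poly P s \<noteq> 0" using poly_nonzero_in_set by blast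
  have "f (p(j := s)) \<noteq> 0" using s(2) P(2) by (simp only: zb not_False_eq_True)
  moreover have "\<forall>i\<in>insert j J. (p(j := s)) i \<in> S" using s(1) p(2) by simp
  moreover have "\<forall>i. i \<notin> insert j J --> (p(j := s)) i = q i" using p(3) by simp
  ultimately show ?case by blast
qed

section \<open>Monomials\<close>

abbreviation "pkeys \<equiv> Poly_Mapping.keys"
abbreviation "plookup \<equiv> Poly_Mapping.lookup"

definition mon :: "(nat \<Rightarrow>\<^sub>0 nat) => (nat => 'a::field) => 'a" where
  "mon \<mu> x = (\<Prod>i\<in>pkeys \<mu>. x i ^ plookup \<mu> i)"

definition mdeg :: "(nat \<Rightarrow>\<^sub>0 nat) => nat" where
  "mdeg \<mu> = (\<Sum>i\<in>pkeys \<mu>. plookup \<mu> i)"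

definition Mon :: "nat => nat => (nat \<Rightarrow>\<^sub>0 nat) set" where
  "Mon n t = {\<mu>. pkeys \<mu> \<subseteq> {..<n} \<and> mdeg \<mu> = t}"

lemma mon_superset: "finite S ==> pkeys \<mu> \<subseteq> S ==> mon \<mu> x = (\<Prod>i\<in>S. x i ^ plookup \<mu> i)"
  unfolding mon_def by (rule prod.mono_neutral_left) (auto simp: in_keys_iff)

lemma mdeg_superset: "finite S ==> pkeys \<mu> \<subseteq> S ==> mdeg \<mu> = (\<Sum>i\<in>S. plookup \<mu> i)"
  unfolding mdeg_def by (rule sum.mono_neutral_left) (auto simp: in_keys_iff)

lemma mon_add: "mon (\<mu> + \<nu>) x = mon \<mu> x * mon \<nu> x"
proof -
  let ?S = "pkeys \<mu> \<union> pkeys \<nu>"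
  have "pkeys (\<mu> + \<nu>) \<subseteq> ?S" by (rule Poly_Mapping.keys_add)
  then show ?thesis
    by (simp add: mon_superset[of ?S] lookup_add power_add prod.distrib)
qed

lemma mdeg_add: "mdeg (\<mu> + \<nu>) = mdeg \<mu> + mdeg \<nu>"
proof -
  let ?S = "pkeys \<mu> \<union> pkeys \<nu>"
  have "pkeys (\<mu> + \<nu>) \<subseteq> ?S" by (rule Poly_Mapping.keys_add)
  then show ?thesis
    by (simp add: mdeg_superset[of ?S] lookup_add sum.distrib)
qed

lemma Mon_add: "\<mu> \<in> Mon n s ==> \<nu> \<in> Mon n t ==> \<mu> + \<nu> \<in> Mon n (s + t)"
  using Poly_Mapping.keys_add[of \<mu> \<nu>] by (auto simp: Mon_def mdeg_add)

lemma mdeg_single [simp]: "mdeg (Poly_Mapping.single i a) = a"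
  by (simp add: mdeg_def)

lemma mdeg_zero [simp]: "mdeg 0 = 0"
  by (simp add: mdeg_def)

lemma mon_zero [simp]: "mon 0 x = 1"
  by (simp add: mon_def)

lemma mon_single [simp]: "mon (Poly_Mapping.single i a) x = x i ^ a"
  by (simp add: mon_def)

lemma zero_in_Mon [simp]: "0 \<in> Mon n 0"
  by (simp add: Mon_def)

lemma single_in_Mon: "i < n ==> Poly_Mapping.single i a \<in> Mon n a"
  by (auto simp: Mon_def)

lemma lookup_le_mdeg: "plookup \<mu> i \<le> mdeg \<mu>"
proof (cases "i \<in> pkeys \<mu>")
  case True
  then show ?thesis unfolding mdeg_def by (intro member_le_sum) auto
qed (simp add: in_keys_iff)

lemma finite_Mon: "finite (Mon n t)"
proof -
  have "finite {f :: nat => nat. \<forall>i. (i \<in> {..<n} --> f i \<in> {..t}) \<and> (i \<notin> {..<n} --> f i = 0)}"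
    by (rule finite_set_of_finite_funs) auto
  moreover have "plookup ` Mon n t \<subseteq>
      {f. \<forall>i. (i \<in> {..<n} --> f i \<in> {..t}) \<and> (i \<notin> {..<n} --> f i = 0)}"
  proof (intro image_subsetI CollectI allI conjI impI)
    fix \<mu> i assume \<mu>: "\<mu> \<in> Mon n t"
    show "plookup \<mu> i \<in> {..t}" using lookup_le_mdeg[of \<mu> i] \<mu> by (simp add: Mon_def)
    assume "i \<notin> {..<n}"
    then have "i \<notin> pkeys \<mu>" using \<mu> by (auto simp: Mon_def)
    then show "plookup \<mu> i = 0" by (simp add: in_keys_iff)
  qed
  ultimately have "finite (plookup ` Mon n t)" by (rule rev_finite_subset)
  then show ?thesis by (rule finite_imageD) (auto intro: inj_onI poly_mapping_eqI)
qed

lemma hp_mon: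
  assumes "\<mu> \<in> Mon n t" "1 \<in> E"
  shows "hp E n t (mon \<mu>)"
proof -
  have 1: "hp E n (\<Sum>i\<in>pkeys \<mu>. plookup \<mu> i) (\<lambda>x. \<Prod>i\<in>pkeys \<mu>. x i ^ plookup \<mu> i)"
    by (rule hp_prod[OF assms(2)], rule hp_power1[OF hp_var1]) (use assms in \<open>auto simp: Mon_def\<close>)
  have 2: "mon \<mu> = (\<lambda>x. \<Prod>i\<in>pkeys \<mu>. x i ^ plookup \<mu> i)" by (simp add: mon_def fun_eq_iff)
  have 3: "(\<Sum>i\<in>pkeys \<mu>. plookup \<mu> i) = t" using assms(1) by (simp add: Mon_def mdeg_def)
  show ?thesis unfolding 2 using 1 unfolding 3 .
qed

lemma hp_normal_form:
  assumes "hp E n t f" "is_subfield E"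
  shows "\<exists>c. (\<forall>\<mu>. c \<mu> \<in> E) \<and> f = (\<lambda>x. \<Sum>\<mu>\<in>Mon n t. c \<mu> * mon \<mu> x)"
  using assms
proof (induction rule: hp.induct)
  case (zero t)
  then show ?case by (intro exI[of _ "\<lambda>_. 0"]) (simp add: subfieldD)
next
  case (const c)
  have "Mon n 0 = {0}" by (auto simp: Mon_def mdeg_def in_keys_iff intro!: poly_mapping_eqI) 
  then show ?case using const by (intro exI[of _ "\<lambda>_. c"]) simp
next
  case (var i)
  have "(\<Sum>\<mu>\<in>Mon n (Suc 0). (if \<mu> = Poly_Mapping.single i 1 then 1 else 0) * mon \<mu> x) = x i" for x :: "nat => 'a"
  proof -
    have "(\<Sum>\<mu>\<in>Mon n (Suc 0). (if \<mu> = Poly_Mapping.single i 1 then 1 else 0) * mon \<mu> x) =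
      (\<Sum>\<mu>\<in>Mon n (Suc 0). if \<mu> = Poly_Mapping.single i 1 then mon \<mu> x else 0)"
      by (rule sum.cong) auto
    also have "... = mon (Poly_Mapping.single i 1) x"
      using single_in_Mon[OF var(1), of 1] finite_Mon[of n 1] by (simp add: sum.delta)
    finally show ?thesis by simp
  qed
  then show ?case using var
    by (intro exI[of _ "\<lambda>\<mu>. if \<mu> = Poly_Mapping.single i 1 then 1 else 0"]) (auto simp: subfieldD)
next
  case (add t f g)
  then obtain c d where *: "\<forall>\<mu>. c \<mu> \<in> E" "f = (\<lambda>x. \<Sum>\<mu>\<in>Mon n t. c \<mu> * mon \<mu> x)"
    "\<forall>\<mu>. d \<mu> \<in> E" "g = (\<lambda>x. \<Sum>\<mu>\<in>Mon n t. d \<mu> * mon \<mu> x)" by blast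
  then show ?case using add(5)
    by (intro exI[of _ "\<lambda>\<mu>. c \<mu> + d \<mu>"]) (simp add: subfieldD sum.distrib distrib_right)
next
  case (mult s f t g)
  then obtain c d where *: "\<forall>\<mu>. c \<mu> \<in> E" "f = (\<lambda>x. \<Sum>\<mu>\<in>Mon n s. c \<mu> * mon \<mu> x)"
    "\<forall>\<mu>. d \<mu> \<in> E" "g = (\<lambda>x. \<Sum>\<mu>\<in>Mon n t. d \<mu> * mon \<mu> x)" by blast
  define e where "e = (\<lambda>\<kappa>. \<Sum>\<mu>\<in>Mon n s. \<Sum>\<nu>\<in>Mon n t. if \<mu> + \<nu> = \<kappa> then c \<mu> * d \<nu> else 0)"
  have sumE: "(\<Sum>i\<in>I. h i) \<in> E" if "\<And>i. i \<in> I ==> h i \<in> E" for I :: "(nat \<Rightarrow>\<^sub>0 nat) set" and h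
    using that by (induction I rule: infinite_finite_induct) (auto simp: subfieldD mult.prems)
  have "e \<kappa> \<in> E" for \<kappa>
    unfolding e_def using * mult.prems by (auto intro!: sumE simp: subfieldD)
  moreover have "f x * g x = (\<Sum>\<kappa>\<in>Mon n (s + t). e \<kappa> * mon \<kappa> x)" for x
  proof -
    have "(\<Sum>\<kappa>\<in>Mon n (s + t). e \<kappa> * mon \<kappa> x) =
      (\<Sum>\<kappa>\<in>Mon n (s + t). \<Sum>\<mu>\<in>Mon n s. \<Sum>\<nu>\<in>Mon n t. if \<mu> + \<nu> = \<kappa> then c \<mu> * d \<nu> * mon \<kappa> x else 0)"
      unfolding e_def sum_distrib_right by (intro sum.cong refl) auto
    also have "... = (\<Sum>\<mu>\<in>Mon n s. \<Sum>\<kappa>\<in>Mon n (s + t). \<Sum>\<nu>\<in>Mon n t. if \<mu> + \<nu> = \<kappa> then c \<mu> * d \<nu> * mon \<kappa> x else 0)"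
      by (rule sum.swap)
    also have "... = (\<Sum>\<mu>\<in>Mon n s. \<Sum>\<nu>\<in>Mon n t. \<Sum>\<kappa>\<in>Mon n (s + t). if \<mu> + \<nu> = \<kappa> then c \<mu> * d \<nu> * mon \<kappa> x else 0)"
      by (intro sum.cong refl sum.swap)
    also have "... = (\<Sum>\<mu>\<in>Mon n s. \<Sum>\<nu>\<in>Mon n t. c \<mu> * d \<nu> * mon (\<mu> + \<nu>) x)"
      by (intro sum.cong refl) (simp add: sum.delta' finite_Mon Mon_add)
    also have "... = f x * g x"
      unfolding * by (simp add: sum_product mon_add algebra_simps)
    finally show ?thesis by simp
  qed
  ultimately show ?case by blast
qed

lemma hp_of_normal_form:
  assumes "is_subfield E" "\<And>\<mu>. \<mu> \<in> Mon n t ==> c \<mu> \<in> E"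
  shows "hp E n t (\<lambda>x. \<Sum>\<mu>\<in>Mon n t. c \<mu> * mon \<mu> x)"
  using assms by (auto intro!: hp_sum hp_cmult hp_mon simp: subfieldD)

text \<open>
  Induction on the number of variables: as a polynomial in the last one, each coefficient vanishes.
\<close>

lemma monomials_independent:
  fixes c :: "(nat \<Rightarrow>\<^sub>0 nat) => 'a::field"
  assumes "infinite (UNIV :: 'a set)" "finite A" "\<And>\<mu>. \<mu> \<in> A ==> pkeys \<mu> \<subseteq> {..<n}"
    "\<And>x. (\<Sum>\<mu>\<in>A. c \<mu> * mon \<mu> x) = 0" "\<mu> \<in> A"
  shows "c \<mu> = 0"
  using assms(2-5)
proof (induction n arbitrary: A c \<mu>)
  case 0
  then have "A = {0}" by auto
  then show ?case using 0(3)[of undefined] 0(4) by simp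
next
  case (Suc n)
  \<comment> \<open>the monomial without its last variable\<close>
  define r where "r = (\<lambda>\<nu>::nat \<Rightarrow>\<^sub>0 nat. Poly_Mapping.update n 0 \<nu>)"
  have look: "plookup (r \<nu>) i = (if i = n then 0 else plookup \<nu> i)" for \<nu> i
    by (simp add: r_def lookup_update)
  have keys: "pkeys (r \<nu>) = pkeys \<nu> - {n}" for \<nu>
    by (auto simp: in_keys_iff look split: if_splits)
  have monr: "mon \<nu> (x(n := s)) = mon (r \<nu>) x * s ^ plookup \<nu> n" if "\<nu> \<in> A" for \<nu> x and s :: 'a
  proof -
    have "pkeys \<nu> \<subseteq> {..<Suc n}" using Suc.prems(2) that by blast
    then have "mon \<nu> (x(n := s)) = (\<Prod>i<Suc n. (x(n := s)) i ^ plookup \<nu> i)"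
      by (intro mon_superset) auto
    also have "... = (\<Prod>i<n. x i ^ plookup (r \<nu>) i) * s ^ plookup \<nu> n"
      by (simp add: look)
    also have "(\<Prod>i<n. x i ^ plookup (r \<nu>) i) = mon (r \<nu>) x"
      using \<open>pkeys \<nu> \<subseteq> {..<Suc n}\<close> by (intro mon_superset[symmetric]) (auto simp: keys less_Suc_eq)
    finally show ?thesis .
  qed
  define a where "a = plookup \<mu> n"
  define B where "B = {\<nu>\<in>A. plookup \<nu> n = a}"
  have eq0: "(\<Sum>\<nu>\<in>B. c \<nu> * mon (r \<nu>) x) = 0" for x
  proof -
    let ?p = "\<Sum>\<nu>\<in>A. monom (c \<nu> * mon (r \<nu>) x) (plookup \<nu> n)"
    have "poly ?p s = (\<Sum>\<nu>\<in>A. c \<nu> * mon \<nu> (x(n := s)))" for s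
      by (simp add: poly_sum poly_monom monr mult.assoc)
    then have "poly ?p s = 0" for s using Suc.prems(3) by simp
    then have "infinite {s. poly ?p s = 0}" using assms(1) by simp
    then have "?p = 0" using poly_roots_finite[of ?p] by argo
    then have "coeff ?p a = 0" by simp
    then have "(\<Sum>\<nu>\<in>A. if plookup \<nu> n = a then c \<nu> * mon (r \<nu>) x else 0) = 0"
      by (simp add: coeff_sum)
    then show ?thesis unfolding B_def using Suc.prems(1) by (simp add: sum.inter_filter)
  qed
  have inj: "inj_on r B"
  proof (rule inj_onI)
    fix \<nu> \<nu>' assume *: "\<nu> \<in> B" "\<nu>' \<in> B" "r \<nu> = r \<nu>'"
    show "\<nu> = \<nu>'"
    proof (rule poly_mapping_eqI)
      fix i show "plookup \<nu> i = plookup \<nu>' i"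
        using look[of \<nu> i] look[of \<nu>' i] * by (cases "i = n") (auto simp: B_def)
    qed
  qed
  have "c (inv_into B r (r \<mu>)) = 0"
  proof (rule Suc.IH[of "r ` B" "\<lambda>\<nu>. c (inv_into B r \<nu>)"])
    show "finite (r ` B)" using Suc.prems(1) by (simp add: B_def)
    show "pkeys \<nu> \<subseteq> {..<n}" if "\<nu> \<in> r ` B" for \<nu>
      using that Suc.prems(2) by (fastforce simp: keys B_def)
    show "(\<Sum>\<nu>\<in>r ` B. c (inv_into B r \<nu>) * mon \<nu> x) = 0" for x
      using eq0[of x] by (simp add: sum.reindex[OF inj] inj inv_into_f_f)
    show "r \<mu> \<in> r ` B" using Suc.prems(4) by (simp add: B_def a_def)
  qed
  then show ?case using inj Suc.prems(4) by (simp add: B_def a_def inv_into_f_f)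
qed

section \<open>Dickson's lemma and Hilbert polynomials of monomial ideals\<close>

definition upclosed :: "nat => (nat \<Rightarrow>\<^sub>0 nat) set => bool" where
  "upclosed n U \<longleftrightarrow> (\<forall>\<mu>\<in>U. \<forall>\<nu>. pkeys \<nu> \<subseteq> {..<n} --> \<mu> + \<nu> \<in> U)"

lemma nat_seq_mono_subseq:
  fixes f :: "nat => nat"
  shows "\<exists>r::nat => nat. strict_mono r \<and> (\<forall>i j. i \<le> j --> f (r i) \<le> f (r j))"
proof -
  obtain r :: "nat => nat" where r: "strict_mono r" "monoseq (\<lambda>n. f (r n))"
    using seq_monosub[of f] by (auto simp: monoseq_def)
  show ?thesis
  proof (cases "\<forall>m n. m \<le> n --> f (r m) \<le> f (r n)")
    case True
    then show ?thesis using r(1) by blast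
  next
    case False
    then have dec: "\<forall>m n. m \<le> n --> f (r n) \<le> f (r m)"
      using r(2) by (auto simp: monoseq_def)
    define m where "m = (LEAST v. v \<in> range (\<lambda>n. f (r n)))"
    have "m \<in> range (\<lambda>n. f (r n))" unfolding m_def by (rule LeastI[of _ "f (r 0)"]) auto
    then obtain k where k: "f (r k) = m" by auto
    have "f (r (k + i)) = m" for i
      using dec[rule_format, of k "k + i"] k Least_le[of "\<lambda>v. v \<in> range (\<lambda>n. f (r n))" "f (r (k + i))"]
      by (auto simp: m_def)
    then show ?thesis using r(1)
      by (intro exI[of _ "\<lambda>i. r (k + i)"]) (auto simp: strict_mono_def)
  qed
qed

text \<open>
  Dickson's lemma: pass to a subsequence on which every exponent is monotone.
\<close>

lemma dickson:
  fixes \<mu> :: "nat => (nat \<Rightarrow>\<^sub>0 nat)"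
  assumes "\<And>k. pkeys (\<mu> k) \<subseteq> {..<n}"
  shows "\<exists>i j. i < j \<and> (\<exists>\<nu>. pkeys \<nu> \<subseteq> {..<n} \<and> \<mu> j = \<mu> i + \<nu>)"
proof -
  have "\<exists>r::nat => nat. strict_mono r \<and> (\<forall>v<n'. \<forall>i j. i \<le> j --> plookup (\<mu> (r i)) v \<le> plookup (\<mu> (r j)) v)" for n'
  proof (induction n')
    case 0
    then show ?case by (intro exI[of _ id]) (auto simp: strict_mono_def)
  next
    case (Suc n')
    then obtain r :: "nat => nat" where r: "strict_mono r"
      "\<forall>v<n'. \<forall>i j. i \<le> j --> plookup (\<mu> (r i)) v \<le> plookup (\<mu> (r j)) v" by blast
    obtain s :: "nat => nat" where s: "strict_mono s"
      "\<forall>i j. i \<le> j --> plookup (\<mu> (r (s i))) n' \<le> plookup (\<mu> (r (s j))) n'"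
      using nat_seq_mono_subseq[of "\<lambda>i. plookup (\<mu> (r i)) n'"] by blast
    have "s i \<le> s j" if "i \<le> j" for i j
      using s(1) that by (simp add: strict_mono_less_eq)
    then show ?case using r s
      by (intro exI[of _ "r \<circ> s"]) (auto simp: less_Suc_eq strict_mono_def)
  qed
  then obtain r :: "nat => nat" where r: "strict_mono r"
    "\<forall>v<n. \<forall>i j. i \<le> j --> plookup (\<mu> (r i)) v \<le> plookup (\<mu> (r j)) v" by blast
  have le: "plookup (\<mu> (r 0)) v \<le> plookup (\<mu> (r 1)) v" for v
  proof (cases "v < n")
    case False
    then have "v \<notin> pkeys (\<mu> (r 0))" using assms[of "r 0"] by auto
    then show ?thesis by (simp add: in_keys_iff)
  qed (use r in auto)
  have eq: "\<mu> (r 1) = \<mu> (r 0) + (\<mu> (r 1) - \<mu> (r 0))"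
    by (rule poly_mapping_eqI) (use le in \<open>simp add: lookup_add lookup_minus\<close>)
  have "pkeys (\<mu> (r 1) - \<mu> (r 0)) \<subseteq> {..<n}"
    using assms[of "r 1"] by (auto simp: in_keys_iff lookup_minus subset_iff)
  then show ?thesis using r(1) eq by (meson strict_mono_less zero_less_one)
qed

definition evpoly :: "(nat => real) => bool" where
  "evpoly f \<longleftrightarrow> (\<exists>p. eventually (\<lambda>t. poly p (real t) = f t) sequentially)"

text \<open>
  Subtracting the difference of a multiple of \<open>x\<close> to the power \<open>n + 1\<close> lowers the degree \<open>n\<close> of the
  right-hand side.
\<close>

lemma poly_antidifference:
  fixes p :: "real poly"
  shows "\<exists>P. \<forall>x. poly P (x + 1) - poly P x = poly p x"
proof -
  have "(\<forall>i\<ge>n. coeff p i = 0) ==> \<exists>P. \<forall>x. poly P (x + 1) - poly P x = poly p x" for n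
  proof (induction n arbitrary: p)
    case 0
    then have "p = 0" by (intro poly_eqI) auto
    then show ?case by (intro exI[of _ 0]) auto
  next
    case (Suc n)
    define c where "c = coeff p n / real (Suc n)"
    \<comment> \<open>the difference of \<open>c\<close> times the power \<open>n + 1\<close> of the variable; its top coefficient is that of \<open>p\<close>\<close>
    define R where "R = (\<Sum>k\<le>n. monom (c * real (Suc n choose k)) k)"
    have R: "poly R x = c * (x + 1) ^ Suc n - c * x ^ Suc n" for x
      unfolding R_def binomial_ring by (simp add: poly_sum poly_monom sum_distrib_left algebra_simps)
    have "\<forall>i\<ge>n. coeff (p - R) i = 0"
      using Suc.prems by (auto simp: R_def coeff_sum c_def le_Suc_eq Suc_le_eq)
    from Suc.IH[OF this] obtain P where P: "\<forall>x. poly P (x + 1) - poly P x = poly (p - R) x" by blast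
    show ?case
      by (rule exI[of _ "P + monom c (Suc n)"]) (use P R in \<open>simp add: poly_monom algebra_simps\<close>)
  qed
  from this[of "Suc (degree p)"] show ?thesis by (auto simp: coeff_eq_0)
qed

lemma evpoly_add: "evpoly f ==> evpoly g ==> evpoly (\<lambda>t. f t + g t)"
  unfolding evpoly_def
proof (elim exE)
  fix p q assume "\<forall>\<^sub>F t in sequentially. poly p (real t) = f t" "\<forall>\<^sub>F t in sequentially. poly q (real t) = g t"
  then have "\<forall>\<^sub>F t in sequentially. poly (p + q) (real t) = f t + g t" by eventually_elim simp
  then show "\<exists>p. \<forall>\<^sub>F t in sequentially. poly p (real t) = f t + g t" by blast
qed

lemma evpoly_cong: "evpoly f ==> (\<And>t. t \<ge> N ==> g t = f t) ==> evpoly g"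
  unfolding evpoly_def eventually_sequentially by (metis nat_le_linear order_trans)

lemma evpoly_shift: "evpoly f ==> evpoly (\<lambda>t. f (t - a))"
proof -
  assume "evpoly f"
  then obtain p N where p: "\<forall>t\<ge>N. poly p (real t) = f t" by (auto simp: evpoly_def eventually_sequentially)
  have "\<forall>t\<ge>N + a. poly (pcompose p [:- real a, 1:]) (real t) = f (t - a)"
  proof (intro allI impI)
    fix t assume t: "t \<ge> N + a"
    then have "poly p (real (t - a)) = f (t - a)" by (intro p[rule_format]) simp
    then show "poly (pcompose p [:- real a, 1:]) (real t) = f (t - a)" using t by (simp add: poly_pcompose of_nat_diff)
  qed
  then show ?thesis by (auto simp: evpoly_def eventually_sequentially)
qed

lemma evpoly_sum_le: "evpoly f ==> evpoly (\<lambda>t. \<Sum>s\<le>t. f s)"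
proof -
  assume "evpoly f"
  then obtain p N where p: "\<forall>t\<ge>N. poly p (real t) = f t" by (auto simp: evpoly_def eventually_sequentially)
  obtain P where P: "\<And>x. poly P (x + 1) - poly P x = poly p x" using poly_antidifference by blast
  define C where "C = (\<Sum>s\<le>N. f s) - poly P (real N + 1)"
  have "(\<Sum>s\<le>N + t. f s) = poly P (real (N + t) + 1) + C" for t
  proof (induction t)
    case (Suc t)
    have "f (Suc (N + t)) = poly p (real (N + t) + 1)" using p[rule_format, of "Suc (N + t)"] by (simp add: add_ac)
    then show ?case using Suc P[of "real (N + t) + 1"] by (simp add: algebra_simps)
  qed (simp add: C_def)
  then have "\<forall>t\<ge>N. poly (pcompose P [:1, 1:] + [:C:]) (real t) = (\<Sum>s\<le>t. f s)"
    by (metis (no_types, lifting) le_iff_add poly_add poly_const_conv poly_pcompose poly_pCons poly_0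
          mult_zero_right add.right_neutral mult.right_neutral add.commute)
  then show ?thesis unfolding evpoly_def eventually_sequentially by blast
qed

lemma Mon_Suc: "Mon (Suc n) t = (\<Union>a\<le>t. (\<lambda>\<mu>. \<mu> + Poly_Mapping.single n a) ` Mon n (t - a))"
proof (intro equalityI subsetI)
  fix \<mu> assume \<mu>: "\<mu> \<in> Mon (Suc n) t"
  define a where "a = plookup \<mu> n"
  define \<nu> where "\<nu> = Poly_Mapping.update n 0 \<mu>"
  have look: "plookup \<nu> i = (if i = n then 0 else plookup \<mu> i)" for i
    by (simp add: \<nu>_def lookup_update)
  have eq: "\<mu> = \<nu> + Poly_Mapping.single n a"
    by (rule poly_mapping_eqI) (simp add: lookup_add look lookup_single when_def a_def)
  have "pkeys \<nu> \<subseteq> {..<n}"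
  proof
    fix i assume "i \<in> pkeys \<nu>"
    then have "i \<noteq> n" "i \<in> pkeys \<mu>" by (auto simp: in_keys_iff look split: if_splits)
    then show "i \<in> {..<n}" using \<mu> by (auto simp: Mon_def)
  qed
  moreover have "mdeg \<mu> = mdeg \<nu> + a" unfolding eq by (simp add: mdeg_add)
  ultimately have "\<nu> \<in> Mon n (t - a)" "a \<le> t" using \<mu> by (auto simp: Mon_def)
  then show "\<mu> \<in> (\<Union>a\<le>t. (\<lambda>\<mu>. \<mu> + Poly_Mapping.single n a) ` Mon n (t - a))" using eq by blast
next
  fix \<mu> assume "\<mu> \<in> (\<Union>a\<le>t. (\<lambda>\<mu>. \<mu> + Poly_Mapping.single n a) ` Mon n (t - a))"
  then obtain a \<nu> where a: "a \<le> t" "\<nu> \<in> Mon n (t - a)" "\<mu> = \<nu> + Poly_Mapping.single n a" by auto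
  have "\<nu> \<in> Mon (Suc n) (t - a)" using a(2) by (auto simp: Mon_def)
  then show "\<mu> \<in> Mon (Suc n) t"
    using Mon_add[of \<nu> "Suc n" "t - a" "Poly_Mapping.single n a" a] single_in_Mon[of n "Suc n" a] a by simp
qed

lemma lookup_Mon_out: "\<mu> \<in> Mon n t ==> plookup \<mu> n = 0"
  by (auto simp: Mon_def in_keys_iff subset_iff)

lemma card_Mon_Suc_filter:
  "card {\<mu>\<in>Mon (Suc n) t. P \<mu>} = (\<Sum>a\<le>t. card {\<mu>\<in>Mon n (t - a). P (\<mu> + Poly_Mapping.single n a)})"
proof -
  let ?B = "\<lambda>a. (\<lambda>\<mu>. \<mu> + Poly_Mapping.single n a) ` {\<mu>\<in>Mon n (t - a). P (\<mu> + Poly_Mapping.single n a)}"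
  have "{\<mu>\<in>Mon (Suc n) t. P \<mu>} = (\<Union>a\<in>{..t}. ?B a)" by (auto simp: Mon_Suc)
  also have "card \<dots> = (\<Sum>a\<le>t. card (?B a))"
  proof (rule card_UN_disjoint)
    show "\<forall>i\<in>{..t}. \<forall>j\<in>{..t}. i \<noteq> j --> ?B i \<inter> ?B j = {}"
    proof (intro ballI impI)
      fix i j :: nat assume "i \<noteq> j"
      have *: "plookup \<mu> n = a" if "\<mu> \<in> ?B a" for \<mu> a
        using that lookup_Mon_out by (auto simp: lookup_add)
      show "?B i \<inter> ?B j = {}"
      proof (rule equals0I)
        fix \<mu> assume "\<mu> \<in> ?B i \<inter> ?B j"
        then have "plookup \<mu> n = i" "plookup \<mu> n = j" using *[of \<mu> i] *[of \<mu> j] by simp_all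
        then show False using \<open>i \<noteq> j\<close> by simp
      qed
    qed
  qed (auto simp: finite_Mon)
  also have "... = (\<Sum>a\<le>t. card {\<mu>\<in>Mon n (t - a). P (\<mu> + Poly_Mapping.single n a)})"
    by (intro sum.cong refl card_image) (auto intro: inj_onI)
  finally show ?thesis .
qed

lemma card_Mon: "card (Mon (Suc d) t) = (t + d) choose d"
proof (induction d arbitrary: t)
  case 0
  have "Mon 0 s = (if s = 0 then {0} else {})" for s
    by (auto simp: Mon_def)
  then have "card {\<mu>\<in>Mon (Suc 0) t. True} = (\<Sum>a\<le>t. if t - a = 0 then 1 else 0)"
    unfolding card_Mon_Suc_filter by (intro sum.cong refl) auto
  also have "... = (\<Sum>a\<in>{t}. 1)" by (rule sum.mono_neutral_cong_right) auto
  finally show ?case by simp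
next
  case (Suc d)
  have "card {\<mu>\<in>Mon (Suc (Suc d)) t. True} = (\<Sum>a\<le>t. (t - a + d) choose d)"
    by (subst card_Mon_Suc_filter) (simp add: Suc)
  also have "... = (\<Sum>a\<le>t. (a + d) choose d)"
    by (rule sum.reindex_bij_witness[of _ "\<lambda>a. t - a" "\<lambda>a. t - a"]) auto
  also have "... = (\<Sum>a\<le>t. (d + a) choose a)"
    by (intro sum.cong refl) (metis add.commute add_diff_cancel_right' binomial_symmetric le_add2)
  also have "... = Suc (d + t) choose t" by (rule sum_choose_lower)
  also have "... = (t + Suc d) choose Suc d"
    using binomial_symmetric[of t "Suc (d + t)"] by (simp add: add_ac)
  finally show ?case by simp
qed

text \<open>
  Existence of the Hilbert polynomial of a monomial ideal \<open>U\<close>. The slices \<open>V\<^sub>a\<close> of \<open>U\<close>, at exponent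
  \<open>a\<close> of the last variable, are monomial ideals in one variable less; they increase with \<open>a\<close> and are
  constant from some \<open>A\<close> on. So the count is a finite sum of eventually polynomial functions and a
  summatory function of one.
\<close>

theorem evpoly_card_complement:
  assumes "upclosed n U"
  shows "evpoly (\<lambda>t. real (card {\<mu>\<in>Mon n t. \<mu> \<notin> U}))"
  using assms
proof (induction n arbitrary: U)
  case 0
  have "Mon 0 t = {}" if "t \<ge> 1" for t using that by (auto simp: Mon_def)
  then have "\<forall>t\<ge>1. poly 0 (real t) = real (card {\<mu>\<in>Mon 0 t. \<mu> \<notin> U})" by simp
  then show ?case unfolding evpoly_def eventually_sequentially by blast
next
  case (Suc n)
  define V where "V = (\<lambda>a. {\<mu>. pkeys \<mu> \<subseteq> {..<n} \<and> \<mu> + Poly_Mapping.single n a \<in> U})"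
  have up: "upclosed n (V a)" for a
    unfolding upclosed_def
  proof (intro ballI allI impI)
    fix \<mu> \<nu> :: "nat \<Rightarrow>\<^sub>0 nat" assume *: "\<mu> \<in> V a" "pkeys \<nu> \<subseteq> {..<n}"
    have "(\<mu> + Poly_Mapping.single n a) + \<nu> \<in> U"
      using Suc.prems * unfolding upclosed_def V_def by force
    then show "\<mu> + \<nu> \<in> V a" using * Poly_Mapping.keys_add[of \<mu> \<nu>] by (auto simp: V_def add_ac)
  qed
  have mono: "V a \<subseteq> V b" if "a \<le> b" for a b
  proof
    fix \<mu> assume *: "\<mu> \<in> V a"
    have "(\<mu> + Poly_Mapping.single n a) + Poly_Mapping.single n (b - a) \<in> U"
      using Suc.prems * unfolding upclosed_def V_def by force
    then show "\<mu> \<in> V b" using * that by (auto simp: V_def add.assoc simp flip: single_add)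
  qed
  \<comment> \<open>the increasing sequence of ideals is constant from some point on, by Dickson's lemma\<close>
  have "\<exists>A. \<forall>a\<ge>A. V a = V A"
  proof (rule ccontr)
    assume "\<not> ?thesis"
    then have "\<forall>A. \<exists>a\<ge>A. V a \<noteq> V A" by blast
    then have ex: "\<forall>A. \<exists>a\<ge>A. \<exists>\<mu>. \<mu> \<in> V a \<and> \<mu> \<notin> V A" using mono by blast
    then obtain nx \<mu> where nx: "\<And>A. nx A \<ge> A" "\<And>A. \<mu> A \<in> V (nx A)" "\<And>A. \<mu> A \<notin> V A" by metis
    define s where "s = (\<lambda>k. (nx ^^ k) 0)"
    have smono: "s i \<le> s j" if "i \<le> j" for i j
      using that by (induction rule: dec_induct) (use nx(1) in \<open>auto simp: s_def intro: order_trans\<close>)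
    have "pkeys (\<mu> (s k)) \<subseteq> {..<n}" for k using nx(2) by (auto simp: V_def)
    from dickson[of "\<lambda>k. \<mu> (s k)" n, OF this] obtain i j \<nu> where
      ij: "i < j" "pkeys \<nu> \<subseteq> {..<n}" "\<mu> (s j) = \<mu> (s i) + \<nu>" by blast
    have "\<mu> (s i) \<in> V (s (Suc i))" using nx(2)[of "s i"] by (simp add: s_def)
    then have "\<mu> (s i) \<in> V (s j)" using mono smono[of "Suc i" j] ij(1) by auto
    then have "\<mu> (s j) \<in> V (s j)" using up ij by (auto simp: upclosed_def)
    then show False using nx(3) by blast
  qed
  then obtain A where A: "\<And>a. a \<ge> A ==> V a = V A" by blast
  define c where "c = (\<lambda>a t. real (card {\<mu>\<in>Mon n t. \<mu> \<notin> V a}))"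
  have ev: "evpoly (c a)" for a unfolding c_def by (rule Suc.IH[OF up])
  have eq: "real (card {\<mu>\<in>Mon (Suc n) t. \<mu> \<notin> U}) = (\<Sum>a\<le>t. c a (t - a))" for t
    unfolding card_Mon_Suc_filter of_nat_sum c_def
    by (intro sum.cong refl arg_cong[where f = real] arg_cong[where f = card]) (auto simp: V_def Mon_def)
  have evs: "evpoly (\<lambda>t. \<Sum>a<m. c a (t - a))" for m
  proof (induction m)
    case 0
    show ?case unfolding evpoly_def by (intro exI[of _ 0]) simp
  next
    case (Suc m)
    then show ?case using evpoly_add[OF Suc evpoly_shift[OF ev[of m], of m]] by simp
  qed
  have "evpoly (\<lambda>t. (\<Sum>a<A. c a (t - a)) + (\<Sum>s\<le>t - A. c A s))"
    by (intro evpoly_add evs evpoly_shift[of "\<lambda>t. \<Sum>s\<le>t. c A s"] evpoly_sum_le ev)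
  then show ?case
  proof (rule evpoly_cong[where N = A])
    fix t assume t: "t \<ge> A"
    have "(\<Sum>a\<le>t. c a (t - a)) = (\<Sum>a<A. c a (t - a)) + (\<Sum>a\<in>{A..t}. c a (t - a))"
      using t by (subst sum.union_disjoint[symmetric]) (auto intro!: sum.cong)
    also have "(\<Sum>a\<in>{A..t}. c a (t - a)) = (\<Sum>a\<in>{A..t}. c A (t - a))"
    proof (rule sum.cong[OF refl])
      fix a assume "a \<in> {A..t}"
      then have "V a = V A" by (intro A) simp
      then show "c a (t - a) = c A (t - a)" by (simp only: c_def)
    qed
    also have "... = (\<Sum>s\<le>t - A. c A s)"
      by (rule sum.reindex_bij_witness[of _ "\<lambda>s. t - s" "\<lambda>a. t - a"]) (use t in auto)
    finally show "real (card {\<mu>\<in>Mon (Suc n) t. \<mu> \<notin> U}) = (\<Sum>a<A. c a (t - a)) + (\<Sum>s\<le>t - A. c A s)"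
      using eq by simp
  qed
qed

section \<open>Linear algebra of functions on a set\<close>

lemma (in vector_space) independent_familyI:
  assumes "finite I" "\<And>c. (\<Sum>i\<in>I. scale (c i) (g i)) = 0 ==> \<forall>i\<in>I. c i = 0"
  shows "inj_on g I" "independent (g ` I)"
proof -
  show inj: "inj_on g I"
  proof (rule inj_onI, rule ccontr)
    fix i j assume ij: "i \<in> I" "j \<in> I" "g i = g j" "i \<noteq> j"
    let ?c = "\<lambda>k. if k = i then 1 else if k = j then - 1 else (0 :: 'a)"
    have "(\<Sum>k\<in>I. scale (?c k) (g k)) = (\<Sum>k\<in>{i, j}. scale (?c k) (g k))"
      by (rule sum.mono_neutral_right) (use ij assms(1) in auto)
    also have "... = 0" using ij by simp
    finally have "?c i = 0" using assms(2)[of ?c] ij(1) by blast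
    then show False by simp
  qed
  show "independent (g ` I)"
    unfolding dependent_finite[OF finite_imageI[OF assms(1)]]
  proof
    assume "\<exists>u. (\<exists>v\<in>g ` I. u v \<noteq> 0) \<and> (\<Sum>v\<in>g ` I. scale (u v) v) = 0"
    then obtain u where u: "\<exists>v\<in>g ` I. u v \<noteq> 0" "(\<Sum>v\<in>g ` I. scale (u v) v) = 0" by blast
    have "(\<Sum>i\<in>I. scale (u (g i)) (g i)) = 0" using u(2) by (simp add: sum.reindex[OF inj])
    then show False using assms(2)[of "\<lambda>i. u (g i)"] u(1) by blast
  qed
qed

definition fscale :: "'a::field => ('b => 'a) => 'b => 'a" where
  "fscale c f = (\<lambda>x. c * f x)"

interpretation fv: vector_space fscale
  by unfold_locales (auto simp: fscale_def fun_eq_iff algebra_simps)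

lemma sum_fun_apply: "(\<Sum>i\<in>I. f i) x = (\<Sum>i\<in>I. f i x)"
  by (induction I rule: infinite_finite_induct) auto

definition indep_on :: "'b set => 'i set => ('i => 'b => 'a::field) => bool" where
  "indep_on X I g \<longleftrightarrow> (\<forall>c. (\<forall>x\<in>X. (\<Sum>i\<in>I. c i * g i x) = 0) --> (\<forall>i\<in>I. c i = 0))"

text \<open>
  Restricted to \<open>X\<close>, this is Steinitz exchange in the space of functions.
\<close>

lemma indep_on_card_le:
  fixes g :: "'i => 'b => 'a::field"
  assumes "finite I" "finite J" "indep_on X I g"
    "\<And>i. i \<in> I ==> \<exists>c. \<forall>x\<in>X. g i x = (\<Sum>j\<in>J. c j * h j x)"
  shows "card I \<le> card J"
proof -
  define R where "R = (\<lambda>(f :: 'b => 'a) x. if x \<in> X then f x else 0)"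
  have i: "inj_on (\<lambda>i. R (g i)) I" "fv.independent ((\<lambda>i. R (g i)) ` I)"
  proof -
    have *: "\<forall>i\<in>I. c i = 0" if "(\<Sum>i\<in>I. fscale (c i) (R (g i))) = 0" for c
    proof -
      have "(\<Sum>i\<in>I. c i * g i x) = 0" if "x \<in> X" for x
        using fun_cong[OF \<open>(\<Sum>i\<in>I. fscale (c i) (R (g i))) = 0\<close>, of x] that
        by (simp add: sum_fun_apply fscale_def R_def)
      then show ?thesis using assms(3) by (simp add: indep_on_def)
    qed
    show "inj_on (\<lambda>i. R (g i)) I" "fv.independent ((\<lambda>i. R (g i)) ` I)"
      using fv.independent_familyI[OF assms(1), of "\<lambda>i. R (g i)"] * by blast+
  qed
  have "R (g i) \<in> fv.span ((\<lambda>j. R (h j)) ` J)" if "i \<in> I" for i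
  proof -
    obtain c where c: "\<forall>x\<in>X. g i x = (\<Sum>j\<in>J. c j * h j x)" using assms(4) \<open>i \<in> I\<close> by blast
    have "R (g i) = (\<Sum>j\<in>J. fscale (c j) (R (h j)))"
      using c by (auto simp: fun_eq_iff sum_fun_apply fscale_def R_def)
    also have "... \<in> fv.span ((\<lambda>j. R (h j)) ` J)"
      by (intro fv.span_sum fv.span_scale fv.span_base) auto
    finally show ?thesis .
  qed
  then have "card ((\<lambda>i. R (g i)) ` I) \<le> card ((\<lambda>j. R (h j)) ` J)"
    using fv.independent_span_bound[OF finite_imageI[OF assms(2)] i(2)] by blast
  then show ?thesis
    using card_image[OF i(1)] card_image_le[OF assms(2), of "\<lambda>j. R (h j)"] by linarith
qed

lemma combination_trans:
  fixes m :: "'i => 'b => 'a::field"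
  assumes "\<forall>i\<in>A. \<exists>c. \<forall>x\<in>X. m i x = (\<Sum>j\<in>J. c j * h j x)"
  shows "\<exists>c. \<forall>x\<in>X. (\<Sum>i\<in>A. a i * m i x) = (\<Sum>j\<in>J. c j * h j x)"
proof -
  from bchoice[OF assms] obtain c where c: "\<forall>i\<in>A. \<forall>x\<in>X. m i x = (\<Sum>j\<in>J. c i j * h j x)" by (elim exE)
  have "(\<Sum>i\<in>A. a i * m i x) = (\<Sum>j\<in>J. (\<Sum>i\<in>A. a i * c i j) * h j x)" if x: "x \<in> X" for x
  proof -
    have "(\<Sum>i\<in>A. a i * m i x) = (\<Sum>i\<in>A. \<Sum>j\<in>J. a i * c i j * h j x)"
      by (intro sum.cong refl) (simp add: c x sum_distrib_left mult.assoc)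
    also have "... = (\<Sum>j\<in>J. \<Sum>i\<in>A. a i * c i j * h j x)" by (rule sum.swap)
    finally show ?thesis by (simp only: sum_distrib_right)
  qed
  then show ?thesis by (intro exI ballI)
qed

section \<open>Standard monomials and the Hilbert function\<close>

text \<open>
  The leading monomials of the forms that vanish on \<open>X\<close>, for the order of the type of monomials; the
  standard monomials are the others. They form a basis of the forms of degree \<open>t\<close> on \<open>X\<close>, so their
  number is the Hilbert function.
\<close>

definition LM :: "(nat => 'a::field) set => nat => nat => (nat \<Rightarrow>\<^sub>0 nat) set" where
  "LM X n t = {\<mu>\<in>Mon n t. \<exists>c. \<forall>x\<in>X. mon \<mu> x = (\<Sum>\<nu>\<in>{\<nu>\<in>Mon n t. \<nu> < \<mu>}. c \<nu> * mon \<nu> x)}"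

definition Std :: "(nat => 'a::field) set => nat => nat => (nat \<Rightarrow>\<^sub>0 nat) set" where
  "Std X n t = Mon n t - LM X n t"

definition hilb :: "(nat => 'a::field) set => nat => nat => nat" where
  "hilb X n t = card (Std X n t)"

lemma finite_Std: "finite (Std X n t)"
  by (simp add: Std_def finite_Mon)

lemma Std_indep: "indep_on X (Std X n t) mon"
  unfolding indep_on_def
proof (intro allI impI, rule ccontr)
  fix c assume eq: "\<forall>x\<in>X. (\<Sum>\<mu>\<in>Std X n t. c \<mu> * mon \<mu> x) = 0" and "\<not> (\<forall>\<mu>\<in>Std X n t. c \<mu> = 0)"
  define A where "A = {\<mu>\<in>Std X n t. c \<mu> \<noteq> 0}"
  have A: "finite A" "A \<noteq> {}"
    using finite_subset[OF _ finite_Std[of X n t], of A] \<open>\<not> _\<close> by (auto simp: A_def)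
  define \<mu> where "\<mu> = Max A"
  have \<mu>: "\<mu> \<in> A" "\<And>\<nu>. \<nu> \<in> A ==> \<nu> \<le> \<mu>" using A by (auto simp: \<mu>_def)
  define d where "d = (\<lambda>\<nu>. if \<nu> \<in> A then - c \<nu> / c \<mu> else 0)"
  have "mon \<mu> x = (\<Sum>\<nu>\<in>{\<nu>\<in>Mon n t. \<nu> < \<mu>}. d \<nu> * mon \<nu> x)" if "x \<in> X" for x
  proof -
    have "0 = (\<Sum>\<nu>\<in>Std X n t. c \<nu> * mon \<nu> x)" using eq that by simp
    also have "... = (\<Sum>\<nu>\<in>A. c \<nu> * mon \<nu> x)"
      by (rule sum.mono_neutral_right) (auto simp: A_def finite_Std)
    also have "... = c \<mu> * mon \<mu> x + (\<Sum>\<nu>\<in>A - {\<mu>}. c \<nu> * mon \<nu> x)"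
      by (rule sum.remove[OF A(1) \<mu>(1)])
    finally have "c \<mu> * mon \<mu> x = - (\<Sum>\<nu>\<in>A - {\<mu>}. c \<nu> * mon \<nu> x)"
      by (simp add: eq_neg_iff_add_eq_0)
    then have "mon \<mu> x = (\<Sum>\<nu>\<in>A - {\<mu>}. (- c \<nu> / c \<mu>) * mon \<nu> x)"
      using \<mu>(1) by (simp add: A_def field_simps sum_distrib_left sum_negf flip: sum_divide_distrib)
    also have "... = (\<Sum>\<nu>\<in>A - {\<mu>}. d \<nu> * mon \<nu> x)"
      by (intro sum.cong) (auto simp: d_def)
    also have "... = (\<Sum>\<nu>\<in>{\<nu>\<in>Mon n t. \<nu> < \<mu>}. d \<nu> * mon \<nu> x)"
    proof (rule sum.mono_neutral_left)
      show "A - {\<mu>} \<subseteq> {\<nu>\<in>Mon n t. \<nu> < \<mu>}" using \<mu>(2) by (force simp: A_def Std_def)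
    qed (auto simp: d_def finite_Mon)
    finally show ?thesis .
  qed
  then have "\<mu> \<in> LM X n t" using \<mu>(1) unfolding LM_def A_def Std_def by blast
  then show False using \<mu>(1) by (simp add: A_def Std_def)
qed

text \<open>
  Reduction modulo the forms that vanish on \<open>X\<close>; each step produces smaller monomials only.
\<close>

lemma mon_in_Std: "\<mu> \<in> Mon n t ==> \<exists>c. \<forall>x\<in>X. mon \<mu> x = (\<Sum>\<nu>\<in>Std X n t. c \<nu> * mon \<nu> x)"
proof (induction "card {\<nu>\<in>Mon n t. \<nu> < \<mu>}" arbitrary: \<mu> rule: less_induct)
  case (less \<mu>)
  show ?case
  proof (cases "\<mu> \<in> LM X n t")
    case True
    then obtain c where c: "\<forall>x\<in>X. mon \<mu> x = (\<Sum>\<nu>\<in>{\<nu>\<in>Mon n t. \<nu> < \<mu>}. c \<nu> * mon \<nu> x)"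
      by (auto simp: LM_def)
    have "\<forall>\<nu>\<in>{\<nu>\<in>Mon n t. \<nu> < \<mu>}. \<exists>c. \<forall>x\<in>X. mon \<nu> x = (\<Sum>\<kappa>\<in>Std X n t. c \<kappa> * mon \<kappa> x)"
    proof
      fix \<nu> assume \<nu>: "\<nu> \<in> {\<nu>\<in>Mon n t. \<nu> < \<mu>}"
      have "{\<kappa>\<in>Mon n t. \<kappa> < \<nu>} \<subset> {\<kappa>\<in>Mon n t. \<kappa> < \<mu>}" using \<nu> by auto
      then have "card {\<kappa>\<in>Mon n t. \<kappa> < \<nu>} < card {\<kappa>\<in>Mon n t. \<kappa> < \<mu>}"
        by (rule psubset_card_mono[rotated]) (simp add: finite_Mon)
      then show "\<exists>c. \<forall>x\<in>X. mon \<nu> x = (\<Sum>\<kappa>\<in>Std X n t. c \<kappa> * mon \<kappa> x)" by (rule less.hyps) (use \<nu> in simp)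
    qed
    from combination_trans[OF this, of c] show ?thesis using c by simp
  next
    case False
    then have b: "\<mu> \<in> Std X n t" using less.prems by (auto simp: Std_def)
    have "(\<Sum>\<nu>\<in>Std X n t. (if \<nu> = \<mu> then 1 else 0) * mon \<nu> x) = mon \<mu> x" for x :: "nat => 'a"
      using b finite_Std[of X n t] by (simp add: if_distrib[where f = "\<lambda>z. z * _"] sum.delta cong: if_cong)
    then have "\<forall>x\<in>X. mon \<mu> x = (\<Sum>\<nu>\<in>Std X n t. (if \<nu> = \<mu> then 1 else 0) * mon \<nu> x)" by metis
    then show ?thesis by (rule exI[of _ "\<lambda>\<nu>. if \<nu> = \<mu> then 1 else 0"])
  qed
qed

lemma hp_in_Std:
  assumes "hp UNIV n t f"
  shows "\<exists>c. \<forall>x\<in>X. f x = (\<Sum>\<nu>\<in>Std X n t. c \<nu> * mon \<nu> x)"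
proof -
  obtain a where a: "f = (\<lambda>x. \<Sum>\<mu>\<in>Mon n t. a \<mu> * mon \<mu> x)"
    using hp_normal_form[OF assms subfield_UNIV] by blast
  show ?thesis unfolding a by (rule combination_trans) (intro ballI mon_in_Std)
qed

lemma hilb_ge_card:
  assumes "finite I" "\<And>i. i \<in> I ==> hp UNIV n t (g i)" "indep_on X I g"
  shows "card I \<le> hilb X n t"
  unfolding hilb_def
  by (rule indep_on_card_le[OF assms(1) finite_Std assms(3)]) (rule hp_in_Std[OF assms(2)])

lemma hilb_le_card:
  assumes "finite J" "\<And>f. hp UNIV n t f ==> \<exists>c. \<forall>x\<in>X. f x = (\<Sum>j\<in>J. c j * h j x)"
  shows "hilb X n t \<le> card J"
  unfolding hilb_def
proof (rule indep_on_card_le[OF finite_Std assms(1) Std_indep])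
  fix \<mu> assume "\<mu> \<in> Std X n t"
  then have "hp UNIV n t (mon \<mu>)" by (intro hp_mon) (auto simp: Std_def)
  then show "\<exists>c. \<forall>x\<in>X. mon \<mu> x = (\<Sum>j\<in>J. c j * h j x)" by (rule assms(2))
qed

lemma LM_antimono: "X \<subseteq> Y ==> LM Y n t \<subseteq> LM X n t"
  unfolding LM_def by blast

lemma hilb_mono: "X \<subseteq> Y ==> hilb X n t \<le> hilb Y n t"
  unfolding hilb_def Std_def using LM_antimono[of X Y n t] finite_Mon[of n t] by (intro card_mono) auto

definition LMs :: "(nat => 'a::field) set => nat => (nat \<Rightarrow>\<^sub>0 nat) set" where
  "LMs X n = {\<mu>. \<mu> \<in> LM X n (mdeg \<mu>)}"

lemma Std_eq: "Std X n t = {\<mu>\<in>Mon n t. \<mu> \<notin> LMs X n}"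
  by (auto simp: Std_def LMs_def Mon_def)

text \<open>
  The order of monomials is compatible with multiplication.
\<close>

lemma upclosed_LMs: "upclosed n (LMs X n)"
  unfolding upclosed_def
proof (intro ballI allI impI)
  fix \<mu> \<nu> :: "nat \<Rightarrow>\<^sub>0 nat" assume \<mu>: "\<mu> \<in> LMs X n" and \<nu>: "pkeys \<nu> \<subseteq> {..<n}"
  let ?t = "mdeg \<mu>" and ?s = "mdeg \<nu>"
  have \<nu>': "\<nu> \<in> Mon n ?s" using \<nu> by (simp add: Mon_def)
  obtain c where \<mu>': "\<mu> \<in> Mon n ?t"
    and c: "\<forall>x\<in>X. mon \<mu> x = (\<Sum>\<kappa>\<in>{\<kappa>\<in>Mon n ?t. \<kappa> < \<mu>}. c \<kappa> * mon \<kappa> x)"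
    using \<mu> unfolding LMs_def LM_def by blast
  let ?A = "{\<kappa>\<in>Mon n ?t. \<kappa> < \<mu>}" and ?B = "{\<kappa>\<in>Mon n (?t + ?s). \<kappa> < \<mu> + \<nu>}"
  define d where "d = (\<lambda>\<kappa>. if \<kappa> \<in> (\<lambda>\<kappa>. \<kappa> + \<nu>) ` ?A then c (\<kappa> - \<nu>) else 0)"
  have "mon (\<mu> + \<nu>) x = (\<Sum>\<kappa>\<in>?B. d \<kappa> * mon \<kappa> x)" if "x \<in> X" for x
  proof -
    have "mon (\<mu> + \<nu>) x = (\<Sum>\<kappa>\<in>?A. c \<kappa> * mon (\<kappa> + \<nu>) x)"
      using c that by (simp add: mon_add sum_distrib_right mult.assoc)
    also have "... = (\<Sum>\<kappa>\<in>(\<lambda>\<kappa>. \<kappa> + \<nu>) ` ?A. d \<kappa> * mon \<kappa> x)"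
      by (subst sum.reindex) (auto simp: d_def intro!: sum.cong inj_onI)
    also have "... = (\<Sum>\<kappa>\<in>?B. d \<kappa> * mon \<kappa> x)"
    proof (rule sum.mono_neutral_left)
      show "(\<lambda>\<kappa>. \<kappa> + \<nu>) ` ?A \<subseteq> ?B"
        using Mon_add[OF _ \<nu>'] by (auto intro: add_strict_right_mono)
    qed (auto simp: finite_Mon d_def)
    finally show ?thesis .
  qed
  then show "\<mu> + \<nu> \<in> LMs X n"
    unfolding LMs_def LM_def using Mon_add[OF \<mu>' \<nu>'] by (auto simp: mdeg_add)
qed

theorem hilb_eventually_poly:
  "\<exists>p. eventually (\<lambda>t. poly p (real t) = real (hilb X n t)) sequentially"
  using evpoly_card_complement[OF upclosed_LMs[of n X]] unfolding evpoly_def hilb_def Std_eq .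

lemma LMs_antimono: "X \<subseteq> Y ==> LMs Y n \<subseteq> LMs X n"
  unfolding LMs_def using LM_antimono[of X Y] by blast

text \<open>
  Equal leading monomials force equal vanishing ideals: reduce \<open>f\<close> to standard monomials on the
  larger set, where independence on the smaller set makes all coefficients zero.
\<close>

lemma LMs_eq_vanishing:
  assumes "X \<subseteq> Y" "LMs X n = LMs Y n" "hp UNIV n t f" "\<forall>x\<in>X. f x = 0" "y \<in> Y"
  shows "f y = 0"
proof -
  have std: "Std X n t = Std Y n t" using assms(2) by (simp add: Std_eq)
  obtain c where c: "\<forall>x\<in>Y. f x = (\<Sum>\<nu>\<in>Std Y n t. c \<nu> * mon \<nu> x)"
    using hp_in_Std[OF assms(3)] by blast
  have "\<forall>x\<in>X. (\<Sum>\<nu>\<in>Std X n t. c \<nu> * mon \<nu> x) = 0"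
  proof
    fix x assume "x \<in> X"
    then have "f x = (\<Sum>\<nu>\<in>Std Y n t. c \<nu> * mon \<nu> x)" using c assms(1) by blast
    then show "(\<Sum>\<nu>\<in>Std X n t. c \<nu> * mon \<nu> x) = 0" using assms(4) \<open>x \<in> X\<close> std by simp
  qed
  then have "\<forall>\<nu>\<in>Std X n t. c \<nu> = 0" using Std_indep[of X n t] unfolding indep_on_def by blast
  then show ?thesis using c assms(5) std by auto
qed

text \<open>
  The descending chain condition for closed sets is obtained from Dickson's lemma.
\<close>

lemma LMs_chain_stabilises:
  fixes X :: "nat => (nat => 'a::field) set"
  assumes "\<And>i. X (Suc i) \<subseteq> X i"
  shows "\<exists>i. LMs (X (Suc i)) n = LMs (X i) n"
proof (rule ccontr)
  assume "\<nexists>i. LMs (X (Suc i)) n = LMs (X i) n"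
  then have "\<forall>i. \<exists>\<mu>. \<mu> \<in> LMs (X (Suc i)) n \<and> \<mu> \<notin> LMs (X i) n"
    using LMs_antimono[OF assms] by blast
  then obtain \<mu> where \<mu>: "\<And>i. \<mu> i \<in> LMs (X (Suc i)) n" "\<And>i. \<mu> i \<notin> LMs (X i) n" by metis
  have "pkeys (\<mu> k) \<subseteq> {..<n}" for k using \<mu>(1)[of k] by (auto simp: LMs_def LM_def Mon_def)
  from dickson[of \<mu> n, OF this] obtain i j \<nu> where ij: "i < j" "pkeys \<nu> \<subseteq> {..<n}" "\<mu> j = \<mu> i + \<nu>" by blast
  have "X j \<subseteq> X (Suc i)" using lift_Suc_antimono_le[of X, OF assms, of "Suc i" j] ij(1) by simp
  then have "\<mu> i \<in> LMs (X j) n" using LMs_antimono[of "X j" "X (Suc i)" n] \<mu>(1)[of i] by blast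
  then have "\<mu> i + \<nu> \<in> LMs (X j) n" using upclosed_LMs[of n "X j"] ij(2) unfolding upclosed_def by blast
  then have "\<mu> j \<in> LMs (X j) n" using ij(3) by simp
  then show False using \<mu>(2) by blast
qed

lemma poly_ev_nonneg_coeff:
  fixes q :: "real poly"
  assumes "eventually (\<lambda>t. poly q (real t) \<ge> 0) sequentially" "degree q \<le> d"
  shows "coeff q d \<ge> 0"
proof (rule ccontr)
  assume "\<not> ?thesis"
  then have neg: "coeff q d < 0" by simp
  then have deg: "degree q = d" using assms(2) le_degree[of q d] by force
  have "lead_coeff (- q) > 0" using neg deg by simp
  from poly_pinfty_gt_lc[OF this] obtain b where b: "\<forall>x\<ge>b. poly (- q) x \<ge> lead_coeff (- q)" by blast
  obtain N where N: "\<forall>t\<ge>N. poly q (real t) \<ge> 0" using assms(1) by (auto simp: eventually_sequentially)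
  define t where "t = max N (nat \<lceil>b\<rceil>)"
  have "real t \<ge> b" unfolding t_def by linarith
  then have "poly (- q) (real t) > 0" using b \<open>lead_coeff (- q) > 0\<close> by (meson less_le_trans)
  then show False using N[rule_format, of t] by (simp add: t_def)
qed

lemma pow_le_fact_choose: "t ^ d \<le> fact d * ((t + d) choose d)" for t d :: nat
proof (induction d)
  case (Suc d)
  have "t ^ Suc d \<le> (t + Suc d) * (fact d * ((t + d) choose d))"
    unfolding power_Suc by (intro mult_mono Suc) auto
  also have "... = fact d * (Suc (t + d) * ((t + d) choose d))" by (simp only: add_Suc_right ac_simps)
  also have "... = fact d * (Suc d * (Suc (t + d) choose Suc d))"
    by (simp only: Suc_times_binomial_eq mult.commute)
  also have "... = fact (Suc d) * ((t + Suc d) choose Suc d)" by (simp add: algebra_simps)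
  finally show ?case .
qed simp

text \<open>
  For Hilbert functions of finite modules over a polynomial ring in \<open>d + 1\<close> variables.
\<close>

lemma degree_le_of_growth:
  fixes p :: "real poly"
  assumes "eventually (\<lambda>t. poly p (real t) = real (h t)) sequentially"
    "\<And>t. real (h t) \<le> C * real ((t + d) choose d)" "C \<ge> 0"
  shows "degree p \<le> d"
proof (rule ccontr)
  assume "\<not> ?thesis"
  then have deg: "degree p > d" by simp
  define q where "q = smult C ([:real d, 1:] ^ d) - p"
  define u where "u = smult C ([:real d, 1:] ^ d)"
  have "degree u \<le> d"
    unfolding u_def by (rule order_trans[OF degree_smult_le]) (simp add: degree_power_eq)
  then have "degree u < degree p" using deg by simp
  then have qd: "degree q \<le> degree p" "coeff q (degree p) = - lead_coeff p"
    by (simp_all add: q_def coeff_eq_0 degree_diff_le flip: u_def)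
  have "eventually (\<lambda>t. poly q (real t) \<ge> 0) sequentially"
    using assms(1)
  proof eventually_elim
    case (elim t)
    have "((t + d) choose d) * 1 \<le> ((t + d) choose d) * fact d"
      by (intro mult_le_mono2 fact_ge_1)
    then have "(t + d) choose d \<le> (t + d) ^ d"
      using binomial_fact_pow[of "t + d" d] by linarith
    then have "real ((t + d) choose d) \<le> real ((t + d) ^ d)" by (rule of_nat_mono)
    then have "real ((t + d) choose d) \<le> (real t + real d) ^ d" by simp
    then have "C * real ((t + d) choose d) \<le> C * (real t + real d) ^ d" using assms(3) by (rule mult_left_mono)
    then show ?case using elim assms(2)[of t] by (simp add: q_def add.commute)
  qed
  from poly_ev_nonneg_coeff[OF this qd(1)] have "lead_coeff p \<le> 0" using qd(2) by simp
  moreover have "eventually (\<lambda>t. poly p (real t) \<ge> 0) sequentially" using assms(1) by eventually_elim simp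
  from poly_ev_nonneg_coeff[OF this order_refl] have "lead_coeff p \<ge> 0" .
  ultimately have "p = 0" by simp
  then show False using deg by simp
qed

text \<open>
  The lower bound for the degree: \<open>e\<close> shifted copies of a polynomial ring in \<open>d + 1\<close> variables
  contribute \<open>e / d!\<close> to the coefficient of \<open>t\<close> to the power \<open>d\<close>.
\<close>

lemma coeff_ge_of_growth:
  fixes p :: "real poly"
  assumes "eventually (\<lambda>t. poly p (real t) = real (h t)) sequentially" "degree p \<le> d"
    "\<And>t. t \<ge> e ==> (\<Sum>i<e. (t - i + d) choose d) \<le> h t"
  shows "real e \<le> fact d * coeff p d"
proof -
  define q where "q = smult (fact d) p - smult (real e) ([:- real e, 1:] ^ d)"
  have "degree (smult (real e) ([:- real e, 1:] ^ d)) \<le> d"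
    using degree_power_le[of "[:- real e, 1:]" d] by (simp add: degree_power_eq)
  then have qd: "degree q \<le> d" using assms(2) by (auto simp: q_def intro!: degree_diff_le)
  have "coeff ([:- real e, 1:] ^ d) d = 1"
    using lead_coeff_power[of "[:- real e, 1:]" d] by (simp add: degree_power_eq)
  then have qc: "coeff q d = fact d * coeff p d - real e" by (simp add: q_def)
  have "eventually (\<lambda>t. poly q (real t) \<ge> 0) sequentially"
    using assms(1) eventually_ge_at_top[of e]
  proof eventually_elim
    case (elim t)
    have "e * (t - e) ^ d = (\<Sum>i<e. (t - e) ^ d)" by simp
    also have "... \<le> (\<Sum>i<e. (t - i) ^ d)" by (intro sum_mono power_mono) auto
    also have "... \<le> (\<Sum>i<e. fact d * ((t - i + d) choose d))" by (intro sum_mono pow_le_fact_choose)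
    also have "... = fact d * (\<Sum>i<e. (t - i + d) choose d)" by (simp add: sum_distrib_left)
    also have "... \<le> fact d * h t" using assms(3)[OF elim(2)] by (rule mult_le_mono2)
    finally have "real (e * (t - e) ^ d) \<le> real (fact d * h t)" by (rule of_nat_mono)
    then show ?case using elim by (simp add: q_def of_nat_diff)
  qed
  from poly_ev_nonneg_coeff[OF this qd] qc show ?thesis by simp
qed

text \<open>
  If \<open>h\<close> is bounded by a difference \<open>h'(t) - h'(t - e)\<close>, then it grows with lower degree. The
  condition \<open>h \<ge> 1\<close> excludes the zero polynomial, whose degree counts as \<open>0\<close>.
\<close>

lemma degree_less_of_growth:
  fixes p p' :: "real poly"
  assumes "eventually (\<lambda>t. poly p (real t) = real (h t)) sequentially"
    "eventually (\<lambda>t. poly p' (real t) = real (h' t)) sequentially"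
    "\<And>t. t \<ge> e ==> h t + h' (t - e) \<le> h' t" "\<And>t. h t \<ge> 1"
  shows "degree p < degree p'"
proof (rule ccontr)
  assume not: "\<not> ?thesis"
  define s where "s = pcompose p' [:- real e, 1:]"
  define r where "r = p' - s"
  have degs: "degree s = degree p'" by (simp add: s_def degree_pcompose)
  have lcs: "lead_coeff s = lead_coeff p'" unfolding s_def by (subst lead_coeff_comp) auto
  have r0: "coeff r (degree p) = 0"
  proof (cases "degree p' = degree p")
    case True
    then show ?thesis using degs lcs by (simp add: r_def)
  next
    case False
    then show ?thesis using not degs by (simp add: r_def coeff_eq_0)
  qed
  have dr: "degree (r - p) \<le> degree p" using not degs by (auto simp: r_def intro!: degree_diff_le)
  have "eventually (\<lambda>t. poly (r - p) (real t) \<ge> 0) sequentially"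
  proof -
    obtain N where N: "\<forall>t\<ge>N. poly p (real t) = real (h t)" using assms(1) by (auto simp: eventually_sequentially)
    obtain N' where N': "\<forall>t\<ge>N'. poly p' (real t) = real (h' t)" using assms(2) by (auto simp: eventually_sequentially)
    have "poly (r - p) (real t) \<ge> 0" if "t \<ge> N + N' + e" for t
    proof -
      have 1: "poly p (real t) = real (h t)" "poly p' (real t) = real (h' t)" "poly p' (real (t - e)) = real (h' (t - e))"
        by (intro N[rule_format] N'[rule_format], use that in linarith)+
      have "poly s (real t) = poly p' (real (t - e))" using that by (simp add: s_def poly_pcompose of_nat_diff)
      moreover have "real (h t + h' (t - e)) \<le> real (h' t)" using assms(3)[of t] that by (intro of_nat_mono) simp
      ultimately show ?thesis using 1 by (simp add: r_def)
    qed
    then show ?thesis by (auto simp: eventually_sequentially)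
  qed
  from poly_ev_nonneg_coeff[OF this dr] r0 have "lead_coeff p \<le> 0" by simp
  moreover have "eventually (\<lambda>t. poly p (real t) \<ge> 0) sequentially" using assms(1) by eventually_elim simp
  from poly_ev_nonneg_coeff[OF this order_refl] have "lead_coeff p \<ge> 0" .
  ultimately have "p = 0" by simp
  then obtain N where "\<forall>t\<ge>N. h t = 0" using assms(1) by (auto simp: eventually_sequentially)
  then show False using assms(4)[of N] by simp
qed

lemma poly_ev_unique:
  fixes p q :: "real poly"
  assumes "eventually (\<lambda>t. poly p (real t) = f t) sequentially"
    "eventually (\<lambda>t. poly q (real t) = f t) sequentially"
  shows "p = q"
proof -
  obtain N where N: "\<forall>t\<ge>N. poly p (real t) = f t" using assms(1) by (auto simp: eventually_sequentially)
  obtain N' where N': "\<forall>t\<ge>N'. poly q (real t) = f t" using assms(2) by (auto simp: eventually_sequentially)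
  have "real ` {N + N'..} \<subseteq> {x. poly (p - q) x = 0}" using N N' by auto
  moreover have "infinite (real ` {N + N'..})"
    using finite_imageD[of real "{N + N'..}"] infinite_Ici by (auto simp: inj_on_def)
  ultimately have "infinite {x. poly (p - q) x = 0}" using finite_subset by blast
  then have "p - q = 0" using poly_roots_finite[of "p - q"] by argo
  then show ?thesis by simp
qed

section \<open>Elimination without division\<close>

text \<open>
  A substitute for the determinant in the Cayley-Hamilton argument: the matrix with entries
  \<open>\<delta>\<^sub>i\<^sub>j P\<^sub>i - Q\<^sub>i\<^sub>j\<close> kills the vector \<open>u\<close>, and Gaussian elimination without divisions yields a
  product of diagonal entries, up to smaller terms, that kills the entry \<open>u\<close> at \<open>i0\<close>. The predicates
  \<open>Mo\<close> and \<open>No\<close> stand for "main" and "negligible" elements of weight \<open>w\<close>, for instance monic polynomials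
  of degree \<open>w\<close> and polynomials of smaller degree, or elements outside and inside a prime ideal.
\<close>

lemma elimination:
  fixes Mo No :: "nat => ('x => 'a::comm_ring) => bool"
  assumes MM: "\<And>w P P'. Mo w P ==> Mo w P' ==> Mo (2 * w) (\<lambda>x. P x * P' x)"
    and MdN: "\<And>w P Q. Mo w P ==> No w Q ==> Mo w (\<lambda>x. P x - Q x)"
    and MN: "\<And>w P Q. Mo w P ==> No w Q ==> No (2 * w) (\<lambda>x. P x * Q x)"
    and NN: "\<And>w Q Q'. No w Q ==> No w Q' ==> No (2 * w) (\<lambda>x. Q x * Q' x)"
    and NaN: "\<And>w Q Q'. No w Q ==> No w Q' ==> No w (\<lambda>x. Q x + Q' x)"
  assumes "finite J" "i0 \<notin> J"
    "\<And>i. i \<in> insert i0 J ==> Mo w (P i)"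
    "\<And>i j. i \<in> insert i0 J ==> j \<in> insert i0 J ==> No w (Q i j)"
    "\<And>i x. i \<in> insert i0 J ==> x \<in> X ==> P i x * u i x = (\<Sum>j\<in>insert i0 J. Q i j x * u j x)"
  shows "\<exists>w' R. Mo w' R \<and> (\<forall>x\<in>X. R x * u i0 x = 0)"
  using assms(6-)
proof (induction J arbitrary: w P Q rule: finite_induct)
  case empty
  have "Mo w (\<lambda>x. P i0 x - Q i0 i0 x)" by (rule MdN) (use empty in auto)
  moreover have "\<forall>x\<in>X. (P i0 x - Q i0 i0 x) * u i0 x = 0"
    using empty(4)[of i0] by (simp add: left_diff_distrib)
  ultimately show ?case by blast
next
  case (insert e J)
  define Pe where "Pe = (\<lambda>x. P e x - Q e e x)"
  have Pe: "Mo w Pe" unfolding Pe_def by (rule MdN) (use insert.prems in auto)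
  have fin: "finite (insert i0 J)" "e \<notin> insert i0 J" using insert.hyps insert.prems(1) by auto
  have eq: "insert i0 (insert e J) = insert e (insert i0 J)" by auto
  have ue: "Pe x * u e x = (\<Sum>j\<in>insert i0 J. Q e j x * u j x)" if "x \<in> X" for x
  proof -
    have "P e x * u e x = (\<Sum>j\<in>insert e (insert i0 J). Q e j x * u j x)"
      using insert.prems(4)[of e x] that unfolding eq by simp
    also have "... = Q e e x * u e x + (\<Sum>j\<in>insert i0 J. Q e j x * u j x)"
      by (rule sum.insert[OF fin])
    finally show ?thesis by (simp add: Pe_def left_diff_distrib)
  qed
  define P' where "P' = (\<lambda>i x. Pe x * P i x)"
  define Q' where "Q' = (\<lambda>i j x. Pe x * Q i j x + Q i e x * Q e j x)"
  show ?case
  proof (rule insert.IH[of "2 * w" P' Q'])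
    show "i0 \<notin> J" using insert.prems(1) by auto
    show "Mo (2 * w) (P' i)" if "i \<in> insert i0 J" for i
      unfolding P'_def by (rule MM[OF Pe]) (use insert.prems(2) that in auto)
    show "No (2 * w) (Q' i j)" if "i \<in> insert i0 J" "j \<in> insert i0 J" for i j
      unfolding Q'_def by (intro NaN MN[OF Pe] NN) (use insert.prems(3) that in auto)
    show "P' i x * u i x = (\<Sum>j\<in>insert i0 J. Q' i j x * u j x)" if i: "i \<in> insert i0 J" "x \<in> X" for i x
    proof -
      have "P i x * u i x = (\<Sum>j\<in>insert e (insert i0 J). Q i j x * u j x)"
        using insert.prems(4)[of i x] i unfolding eq by simp
      also have "... = Q i e x * u e x + (\<Sum>j\<in>insert i0 J. Q i j x * u j x)"
        by (rule sum.insert[OF fin])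
      finally have "P' i x * u i x = Q i e x * (Pe x * u e x) + Pe x * (\<Sum>j\<in>insert i0 J. Q i j x * u j x)"
        by (simp add: P'_def algebra_simps)
      also have "... = (\<Sum>j\<in>insert i0 J. Q i e x * (Q e j x * u j x) + Pe x * (Q i j x * u j x))"
        unfolding ue[OF i(2)] sum_distrib_left sum.distrib ..
      also have "... = (\<Sum>j\<in>insert i0 J. Q' i j x * u j x)"
        by (intro sum.cong refl) (simp add: Q'_def algebra_simps)
      finally show ?thesis .
    qed
  qed
qed

section \<open>Cones and closed sets\<close>

text \<open>
  Two kinds of cones: with \<open>aff\<close>, cones over subsets of affine space, which do not meet the hyperplane
  at infinity where the last coordinate vanishes; otherwise cones over subsets of projective space. In
  both cases the closed sets are given by forms.
\<close>

definition pts :: "bool => nat => (nat => 'a::field) set" where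
  "pts aff n = {x \<in> vecs n. if aff then x (n - 1) \<noteq> 0 else \<exists>i. x i \<noteq> 0}"

definition zclosed :: "bool => 'a::field set => nat => (nat => 'a) set => bool" where
  "zclosed aff E n X \<longleftrightarrow> (\<exists>G. (\<forall>g\<in>G. \<exists>t. hp E n t g) \<and> X = {x \<in> pts aff n. \<forall>g\<in>G. g x = 0})"

definition cone :: "(nat => 'a::field) set => bool" where
  "cone X \<longleftrightarrow> (\<forall>x\<in>X. \<forall>a. a \<noteq> 0 --> (\<lambda>i. a * x i) \<in> X)"

lemma zclosed_subset_pts: "zclosed aff E n X ==> X \<subseteq> pts aff n"
  by (auto simp: zclosed_def)

lemma cone_pts: "cone (pts aff n)"
  by (auto simp: cone_def pts_def vecs_def)

lemma zclosed_cone: "zclosed aff E n X ==> cone X"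
proof -
  assume "zclosed aff E n X"
  then obtain G where G: "\<forall>g\<in>G. \<exists>t. hp E n t g" "X = {x \<in> pts aff n. \<forall>g\<in>G. g x = 0}"
    by (auto simp: zclosed_def)
  show "cone X"
    unfolding cone_def
  proof (intro ballI allI impI)
    fix x a assume x: "x \<in> X" and a: "a \<noteq> (0::'a)"
    have "(\<lambda>i. a * x i) \<in> pts aff n" using x a G(2) cone_pts[of aff n] unfolding cone_def by blast
    moreover have "g (\<lambda>i. a * x i) = 0" if g: "g \<in> G" for g
    proof -
      obtain t where t: "hp E n t g" using bspec[OF G(1) g] by (elim exE)
      have "g x = 0" using x g unfolding G(2) by simp
      then show ?thesis using hp_scale[OF t, of a x] by simp
    qed
    ultimately show "(\<lambda>i. a * x i) \<in> X" unfolding G(2) by simp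
  qed
qed

lemma zclosed_cut:
  assumes "zclosed aff E n X" "hp E n t g"
  shows "zclosed aff E n {x\<in>X. g x = 0}"
proof -
  obtain G where G: "\<forall>g\<in>G. \<exists>t. hp E n t g" "X = {x \<in> pts aff n. \<forall>g\<in>G. g x = 0}"
    using assms(1) by (auto simp: zclosed_def)
  show ?thesis unfolding zclosed_def
    by (rule exI[of _ "insert g G"]) (use G assms(2) in auto)
qed

section \<open>Finite projections\<close>

text \<open>
  The module generated by \<open>U\<close> over the forms in \<open>M\<^sub>0, \<dots>, M\<^bsub>r-1\<^esub>\<close>, in degree \<open>t\<close>; a pair \<open>(u, a)\<close> is
  a generator \<open>u\<close> of degree \<open>a\<close>.
\<close>

inductive fgs :: "'a::field set => nat => (nat => (nat => 'a) => 'a) =>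
    (((nat => 'a) => 'a) \<times> nat) set => nat => ((nat => 'a) => 'a) => bool" for E r M U where
  zero: "fgs E r M U t (\<lambda>_. 0)"
| gen: "(u, a) \<in> U ==> hp E r s b ==> t = s + a ==> fgs E r M U t (\<lambda>x. b (\<lambda>i. M i x) * u x)"
| add: "fgs E r M U t f ==> fgs E r M U t g ==> fgs E r M U t (\<lambda>x. f x + g x)"

text \<open>
  The forms on \<open>X\<close> are a finitely generated module over the forms in \<open>M\<^sub>0, \<dots>, M\<^bsub>r-1\<^esub>\<close>. For linear forms
  \<open>M\<^sub>i\<close> this is the finiteness of the map that they define.
\<close>

definition FG :: "'a::field set => nat => (nat => 'a) set => nat => (nat => (nat => 'a) => 'a) => bool" where
  "FG E n X r M \<longleftrightarrow> (\<exists>U. finite U \<and> (\<forall>(u, a)\<in>U. hp E n a u) \<and>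
     (\<forall>t f. hp E n t f --> (\<exists>g. fgs E r M U t g \<and> (\<forall>x\<in>X. f x = g x))))"

lemma fgs_sum: "(\<And>i. i \<in> I ==> fgs E r M U t (f i)) ==> fgs E r M U t (\<lambda>x. \<Sum>i\<in>I. f i x)"
  by (induction I rule: infinite_finite_induct) (auto intro: fgs.zero fgs.add)

lemma FG_id:
  assumes "1 \<in> E"
  shows "FG E n X n (\<lambda>i x. x i)"
  unfolding FG_def
proof (intro exI[of _ "{(\<lambda>_. 1, 0)}"] conjI allI impI)
  fix t f assume "hp E n t f"
  then have "fgs E n (\<lambda>i x. x i) {(\<lambda>_. 1, 0)} t (\<lambda>x. f (\<lambda>i. x i) * 1)"
    by (intro fgs.gen) auto
  then show "\<exists>g. fgs E n (\<lambda>i x. x i) {(\<lambda>_. 1, 0)} t g \<and> (\<forall>x\<in>X. f x = g x)"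
    by (intro exI[of _ f]) simp
qed (use assms in \<open>auto intro: hp.const\<close>)

lemma FG_subset:
  assumes "FG E n X r M" "Y \<subseteq> X"
  shows "FG E n Y r M"
proof -
  obtain U where U: "finite U" "\<forall>(u, a)\<in>U. hp E n a u"
    "\<forall>t f. hp E n t f --> (\<exists>g. fgs E r M U t g \<and> (\<forall>x\<in>X. f x = g x))"
    using assms(1) unfolding FG_def by (elim exE conjE)
  have "\<exists>g. fgs E r M U t g \<and> (\<forall>x\<in>Y. f x = g x)" if f: "hp E n t f" for t f
  proof -
    obtain g where "fgs E r M U t g" "\<forall>x\<in>X. f x = g x" using U(3)[rule_format, OF f] by (elim exE conjE)
    then show ?thesis using assms(2) by (intro exI[of _ g]) auto
  qed
  then show ?thesis unfolding FG_def using U by (intro exI[of _ U]) simp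
qed

text \<open>
  The projection from the point \<open>p\<close>, where \<open>p\<^sub>0 = 1\<close>, to the hyperplane \<open>y\<^sub>0 = 0\<close>. The remaining
  coordinates are renumbered from \<open>0\<close>; \<open>case_nat 0\<close> is the inclusion of the hyperplane.
\<close>

definition away :: "(nat => 'a::field) => (nat => 'a) => nat => 'a" where
  "away p y = (\<lambda>i. y (Suc i) - p (Suc i) * y 0)"

lemma away_plus: "p 0 = 1 ==> (\<lambda>i. (case i of 0 => 0 | Suc j => away p y j) + y 0 * p i) = y"
  by (auto simp: away_def fun_eq_iff algebra_simps split: nat.split)

lemma hp_case_subst:
  assumes "hp E (Suc r) t f"
  shows "hp E r t (\<lambda>y. f (case_nat 0 y))"
proof -
  have "hp E r t (\<lambda>y. f (\<lambda>i. (\<lambda>i y. case_nat 0 y i) i y))"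
  proof (rule hp_subst[OF assms])
    fix i assume "i < Suc r"
    then show "hp E r 1 (\<lambda>y. case_nat 0 y i)"
      by (cases i) (auto intro: hp.zero hp.var)
  qed
  then show ?thesis by simp
qed

text \<open>
  In the coordinates \<open>away p y\<close> and \<open>y\<^sub>0\<close>, a form is a polynomial in \<open>y\<^sub>0\<close> whose top coefficient is its
  value at the centre \<open>p\<close>.
\<close>

lemma expand_along:
  assumes "hp E (Suc r) t f" "0 \<in> E" "\<And>i. i < Suc r ==> p i \<in> E" "p 0 = 1"
  shows "\<exists>B. graded_coeffs E r t B \<and> (\<forall>z \<tau>. f (\<lambda>i. case_nat 0 z i + \<tau> * p i) = (\<Sum>l\<le>t. B l z * \<tau> ^ l))
    \<and> (\<forall>y. f y = (\<Sum>l\<le>t. B l (away p y) * y 0 ^ l)) \<and> (\<forall>z. B t z = f p)"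
proof -
  obtain A where A: "graded_coeffs E (Suc r) t A"
    "\<And>z \<tau>. f (\<lambda>i. z i + \<tau> * p i) = (\<Sum>l\<le>t. A l z * \<tau> ^ l)"
    using hp_taylor[OF assms(1,2), of p] assms(3) by blast
  define B where "B = (\<lambda>l y. A l (case_nat 0 y))"
  have gB: "graded_coeffs E r t B"
    unfolding graded_coeffs_def B_def
  proof (intro conjI allI impI)
    fix l assume "l \<le> t"
    then show "hp E r (t - l) (\<lambda>y. A l (case_nat 0 y))"
      using A(1) by (intro hp_case_subst) (simp add: graded_coeffs_def)
  qed (use A(1) in \<open>simp add: graded_coeffs_def\<close>)
  have *: "f (\<lambda>i. case_nat 0 z i + \<tau> * p i) = (\<Sum>l\<le>t. B l z * \<tau> ^ l)" for z \<tau>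
    using A(2)[of "case_nat 0 z"] by (simp add: B_def)
  have "f y = (\<Sum>l\<le>t. B l (away p y) * y 0 ^ l)" for y
    using *[of "away p y" "y 0"] away_plus[of p y] assms(4) by simp
  moreover have "B t z = f p" for z
  proof -
    have 1: "hp UNIV (Suc r) t f" by (rule hp_mono[OF assms(1)]) auto
    have 2: "graded_coeffs UNIV (Suc r) t A"
      unfolding graded_coeffs_def
    proof (intro conjI allI impI)
      fix l assume "l \<le> t"
      then have "hp E (Suc r) (t - l) (A l)" using A(1) by (simp add: graded_coeffs_def)
      then show "hp UNIV (Suc r) (t - l) (A l)" by (rule hp_mono) auto
    qed (use A(1) in \<open>simp add: graded_coeffs_def\<close>)
    show ?thesis unfolding B_def by (rule hp_taylor_lead[where b = p, OF 1 2 A(2)])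
  qed
  ultimately show ?thesis using gB * by blast
qed

text \<open>
  Division of the powers of \<open>\<tau>\<close> by a polynomial whose leading coefficient is the constant \<open>c\<close>. Passing
  from \<open>\<tau>\<close> to the power \<open>l\<close> to the next power shifts the coefficients and replaces \<open>\<tau>\<close> to the power
  \<open>e\<close> by lower powers.
\<close>

lemma power_reduction_family:
  fixes B :: "nat => (nat => 'a::field) => 'a"
  assumes E: "is_subfield E" and B: "graded_coeffs E r e B" "\<And>z. B e z = c" "c \<noteq> 0" "c \<in> E"
  obtains C where "\<And>l i. i < e ==> i \<le> l ==> hp E r (l - i) (C l i)" "\<And>l i. i < e ==> l < i ==> C l i = (\<lambda>_. 0)"
    "\<And>l. l < e ==> C l = (\<lambda>i _. if i = l then 1 else 0)"
    "\<And>l z \<tau>. (\<Sum>i\<le>e. B i z * \<tau> ^ i) = 0 ==> \<tau> ^ l = (\<Sum>i<e. C l i z * \<tau> ^ i)"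
proof (cases e)
  case 0
  then have False if "(\<Sum>i\<le>e. B i z * \<tau> ^ i) = 0" for z \<tau> using that B(2,3) by simp
  then show ?thesis using 0 by (intro that[of "\<lambda>_ _ _. 0"]) blast+
next
  case (Suc k)
  define b where "b = (\<lambda>i z. - (1 / c) * B i z)"
  have b: "hp E r (e - i) (b i)" if "i < e" for i
    unfolding b_def using B(1,4) that E by (intro hp_cmult) (auto simp: graded_coeffs_def subfieldD)
  define C where "C = rec_nat (\<lambda>i _. if i = 0 then 1 else 0)
    (\<lambda>_ D i z. (if i = 0 then 0 else D (i - 1) z) + (if i < e then D k z * b i z else 0))"
  have C: "C 0 = (\<lambda>i _. if i = 0 then 1 else 0)"
    "\<And>l. C (Suc l) = (\<lambda>i z. (if i = 0 then 0 else C l (i - 1) z) + (if i < e then C l k z * b i z else 0))"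
    unfolding C_def by simp_all
  have z: "C l i = (\<lambda>_. 0)" if "l < i" for l i
    using that by (induction l arbitrary: i) (auto simp: C fun_eq_iff Suc)
  have h: "hp E r (l - i) (C l i)" if "i < e" "i \<le> l" for l i
    using that
  proof (induction l arbitrary: i)
    case 0
    then show ?case using subfieldD(2)[OF E] by (simp add: C(1) hp.const)
  next
    case (Suc l)
    have 1: "hp E r (Suc l - i) (\<lambda>z. if i = 0 then 0 else C l (i - 1) z)"
      using Suc.IH[of "i - 1"] Suc.prems by (cases i) (auto intro: hp.zero)
    have 2: "hp E r (Suc l - i) (\<lambda>z. C l k z * b i z)"
    proof (cases "k \<le> l")
      case True
      then have "hp E r (l - k) (C l k)" using Suc.IH[of k] \<open>e = Suc k\<close> by simp
      from this b[OF Suc.prems(1)] show ?thesis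
        by (rule hp_multI) (use True Suc.prems \<open>e = Suc k\<close> in simp)
    next
      case False
      then show ?thesis using z[of l k] by (simp add: hp.zero)
    qed
    show ?case unfolding C(2) using hp.add[OF 1 2] Suc.prems by simp
  qed
  have d: "C l = (\<lambda>i _. if i = l then 1 else 0)" if "l < e" for l
    using that
  proof (induction l)
    case (Suc l)
    then have "C l k = (\<lambda>_. 0)" using z[of l k] \<open>e = Suc k\<close> by simp
    then show ?case using Suc by (auto simp: C(2) fun_eq_iff)
  qed (rule C(1))
  have r: "\<tau> ^ l = (\<Sum>i<e. C l i z * \<tau> ^ i)" if eq: "(\<Sum>i\<le>e. B i z * \<tau> ^ i) = 0" for l z \<tau>
  proof (induction l)
    case 0
    show ?case unfolding C(1) Suc sum.lessThan_Suc_shift by simp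
  next
    case (Suc l)
    have "(\<Sum>i<e. B i z * \<tau> ^ i) + c * \<tau> ^ e = 0"
      using eq B(2) by (simp add: lessThan_Suc_atMost[symmetric])
    then have te: "\<tau> ^ e = (\<Sum>i<e. b i z * \<tau> ^ i)" using B(3)
      by (simp add: b_def field_simps eq_neg_iff_add_eq_0 sum_divide_distrib[symmetric] sum_negf)
    have "\<tau> ^ Suc l = (\<Sum>i<Suc k. C l i z * \<tau> ^ Suc i)"
      unfolding power_Suc2[of \<tau> l] Suc.IH \<open>e = Suc k\<close> sum_distrib_right by (intro sum.cong refl) simp
    also have "... = (\<Sum>i<k. C l i z * \<tau> ^ Suc i) + C l k z * \<tau> ^ e" by (simp add: \<open>e = Suc k\<close>)
    also have "(\<Sum>i<k. C l i z * \<tau> ^ Suc i) = (\<Sum>i<e. (if i = 0 then 0 else C l (i - 1) z) * \<tau> ^ i)"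
      unfolding \<open>e = Suc k\<close> sum.lessThan_Suc_shift by simp
    also have "C l k z * \<tau> ^ e = (\<Sum>i<e. C l k z * b i z * \<tau> ^ i)"
      unfolding te by (simp add: sum_distrib_left mult.assoc)
    finally show ?case unfolding C(2) by (simp add: sum.distrib[symmetric] distrib_right)
  qed
  show ?thesis by (rule that[of C]) (rule h z d r; assumption)+
qed

text \<open>
  The relation \<open>f\<close> has the leading coefficient \<open>f(p) \<noteq> 0\<close> in \<open>M\<^sub>0\<close>, so the powers of \<open>M\<^sub>0\<close> below \<open>e\<close>
  generate all of them over the projected forms. Multiplied with the old generators they are the new
  ones.
\<close>

lemma projection_step:
  fixes f :: "(nat => 'a::field) => 'a"
  assumes E: "is_subfield E" and M: "\<And>i. i < Suc r ==> hp E n 1 (M i)" and FG: "FG E n X (Suc r) M"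
    and f: "hp E (Suc r) e f" "\<And>x. x \<in> X ==> f (\<lambda>i. M i x) = 0"
    and p: "p 0 = 1" "\<And>i. i < Suc r ==> p i \<in> E" "f p \<noteq> 0"
  shows "FG E n X r (\<lambda>i x. away p (\<lambda>j. M j x) i)"
proof -
  let ?M' = "\<lambda>i x. away p (\<lambda>j. M j x) i"
  have E01: "0 \<in> E" "1 \<in> E" using E by (auto simp: subfieldD)
  obtain B where B: "graded_coeffs E r e B" "\<And>y. f y = (\<Sum>l\<le>e. B l (away p y) * y 0 ^ l)" "\<And>z. B e z = f p"
    using expand_along[where p = p, OF f(1) E01(1) p(2,1)] by blast
  have fp: "f p \<in> E" by (rule hp_closed_value[OF f(1) E p(2)])
  obtain C where C: "\<And>l i. i < e ==> i \<le> l ==> hp E r (l - i) (C l i)" "\<And>l i. i < e ==> l < i ==> C l i = (\<lambda>_. 0)"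
    "\<And>l z \<tau>. (\<Sum>i\<le>e. B i z * \<tau> ^ i) = 0 ==> \<tau> ^ l = (\<Sum>i<e. C l i z * \<tau> ^ i)"
    by (rule power_reduction_family[OF E B(1,3) p(3) fp]) (rule that)
  \<comment> \<open>the powers of \<open>M\<^sub>0\<close> on \<open>X\<close>, with coefficients in the projected forms\<close>
  have red: "M 0 x ^ l = (\<Sum>i<e. C l i (\<lambda>i. ?M' i x) * M 0 x ^ i)" if "x \<in> X" for x l
    by (rule C(3)) (use B(2)[of "\<lambda>j. M j x"] f(2)[OF that] in simp)
  obtain U where U: "finite U" "\<And>u a. (u, a) \<in> U ==> hp E n a u"
    "\<And>t f. hp E n t f ==> \<exists>g. fgs E (Suc r) M U t g \<and> (\<forall>x\<in>X. f x = g x)"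
    using FG by (auto simp: FG_def)
  define U' where "U' = (\<lambda>((u, a), i). (\<lambda>x. M 0 x ^ i * u x, i + a)) ` (U \<times> {..<e})"
  have inU': "(\<lambda>x. M 0 x ^ i * u x, i + a) \<in> U'" if "(u, a) \<in> U" "i < e" for u a i
    unfolding U'_def using that by force
  have conv: "\<exists>g'. fgs E r ?M' U' t g' \<and> (\<forall>x\<in>X. g x = g' x)" if "fgs E (Suc r) M U t g" for t g
    using that
  proof (induction rule: fgs.induct)
    case (zero t)
    then show ?case using fgs.zero by blast
  next
    case (gen u a s b t)
    obtain D where D: "graded_coeffs E r s D" "\<And>y. b y = (\<Sum>l\<le>s. D l (away p y) * y 0 ^ l)"
      using expand_along[where p = p, OF gen(2) E01(1) p(2,1)] by blast
    define g' where "g' = (\<lambda>x. \<Sum>l\<le>s. \<Sum>i<e. (\<lambda>y. D l y * C l i y) (\<lambda>i. ?M' i x) * (M 0 x ^ i * u x))"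
    have "fgs E r ?M' U' t g'"
      unfolding g'_def
    proof (intro fgs_sum)
      fix l i assume li: "l \<in> {..s}" "i \<in> {..<e}"
      show "fgs E r ?M' U' t (\<lambda>x. (\<lambda>y. D l y * C l i y) (\<lambda>i. ?M' i x) * (M 0 x ^ i * u x))"
      proof (cases "i \<le> l")
        case True
        have "hp E r ((s - l) + (l - i)) (\<lambda>y. D l y * C l i y)"
          using D(1) C(1) li True by (intro hp.mult) (auto simp: graded_coeffs_def)
        moreover have "t = (s - l) + (l - i) + (i + a)" using li True gen(3) by auto
        moreover have "(\<lambda>x. M 0 x ^ i * u x, i + a) \<in> U'" using inU'[OF gen(1)] li by simp
        ultimately show ?thesis by (intro fgs.gen)
      next
        case False
        then have "C l i = (\<lambda>_. 0)" using C(2) li by auto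
        then show ?thesis by (simp add: fgs.zero)
      qed
    qed
    moreover have "b (\<lambda>i. M i x) * u x = g' x" if "x \<in> X" for x
    proof -
      have "b (\<lambda>i. M i x) = (\<Sum>l\<le>s. D l (\<lambda>i. ?M' i x) * M 0 x ^ l)" using D(2) by simp
      also have "... = (\<Sum>l\<le>s. D l (\<lambda>i. ?M' i x) * (\<Sum>i<e. C l i (\<lambda>i. ?M' i x) * M 0 x ^ i))"
        by (intro sum.cong refl arg_cong2[where f = "(*)"] red that)
      finally show ?thesis by (simp add: g'_def sum_distrib_left sum_distrib_right mult.assoc)
    qed
    ultimately show ?case by blast
  next
    case (add t f g)
    then obtain f' g' where "fgs E r ?M' U' t f'" "\<forall>x\<in>X. f x = f' x" "fgs E r ?M' U' t g'" "\<forall>x\<in>X. g x = g' x" by blast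
    then show ?case by (intro exI[of _ "\<lambda>x. f' x + g' x"]) (auto intro: fgs.add)
  qed
  show ?thesis
    unfolding FG_def
  proof (intro exI[of _ U'] conjI allI impI)
    show "finite U'" unfolding U'_def using U(1) by auto
    show "\<forall>(u, a)\<in>U'. hp E n a u"
      unfolding U'_def using M[of 0] U(2) E01 by (auto intro!: hp.mult hp_power1)
    fix t g assume "hp E n t g"
    then obtain g1 where g1: "fgs E (Suc r) M U t g1" "\<forall>x\<in>X. g x = g1 x" using U(3) by blast
    then show "\<exists>g'. fgs E r ?M' U' t g' \<and> (\<forall>x\<in>X. g x = g' x)" using conv[OF g1(1)] by auto
  qed
qed

section \<open>Lifting points along finite projections\<close>

text \<open>
  Points of the target that can be images of points of the cone.
\<close>

definition nz :: "bool => nat => (nat => 'a::field) => bool" where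
  "nz aff r y \<longleftrightarrow> (if aff then r > 0 \<and> y (r - 1) \<noteq> 0 else \<exists>i<r. y i \<noteq> 0)"

text \<open>
  Lying over: every point of the Zariski closure of the image, apart from the excluded ones, is the
  image of a point of \<open>X\<close>.
\<close>

definition lifts :: "bool => (nat => 'a::field) set => nat => (nat => (nat => 'a) => 'a) => bool" where
  "lifts aff X r M \<longleftrightarrow> (\<forall>y. nz aff r y -->
     (\<forall>f. pf UNIV r f --> (\<forall>x\<in>X. f (\<lambda>i. M i x) = 0) --> f y = 0) --> (\<exists>x\<in>X. \<forall>i<r. M i x = y i))"

lemma lifts_id:
  assumes "zclosed aff UNIV n X" "n > 0"
  shows "lifts aff X n (\<lambda>i x. x i)"
  unfolding lifts_def
proof (intro allI impI)
  fix y :: "nat => 'a" assume nz: "nz aff n y"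
    and van: "\<forall>f. pf UNIV n f --> (\<forall>x\<in>X. f (\<lambda>i. x i) = 0) --> f y = 0"
  obtain G where G: "\<forall>g\<in>G. \<exists>t. hp UNIV n t g" "X = {x \<in> pts aff n. \<forall>g\<in>G. g x = 0}"
    using assms(1) unfolding zclosed_def by (elim exE conjE)
  define y' where "y' = (\<lambda>i. if i < n then y i else 0)"
  have "y' \<in> pts aff n"
  proof (cases aff)
    case True
    then show ?thesis using nz assms(2) by (simp add: pts_def vecs_def nz_def y'_def)
  next
    case False
    then obtain i where "i < n" "y i \<noteq> 0" using nz by (auto simp: nz_def)
    then have "\<exists>i. y' i \<noteq> 0" by (intro exI[of _ i]) (simp add: y'_def)
    moreover have "y' \<in> vecs n" by (simp add: vecs_def y'_def)
    ultimately show ?thesis using False by (simp add: pts_def)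
  qed
  moreover have "g y' = 0" if g: "g \<in> G" for g
  proof -
    obtain t where t: "hp UNIV n t g" using bspec[OF G(1) g] by (elim exE)
    have "pf UNIV n g" by (rule pf_of_hp[OF t]) simp
    moreover have "\<forall>x\<in>X. g (\<lambda>i. x i) = 0" using g unfolding G(2) by simp
    ultimately have "g y = 0" using van by blast
    moreover have "g y' = g y" by (rule hp_cong[OF t]) (simp add: y'_def)
    ultimately show ?thesis by simp
  qed
  ultimately have "y' \<in> X" unfolding G(2) by simp
  then show "\<exists>x\<in>X. \<forall>i<n. x i = y i" by (intro bexI[of _ y']) (simp add: y'_def)
qed

lemma pf_expand:
  assumes "pf UNIV (Suc r) F" "p 0 = 1"
  shows "\<exists>N G. (\<forall>l. pf UNIV r (G l)) \<and>
    (\<forall>z \<tau>. F (\<lambda>i. case_nat 0 z i + \<tau> * p i) = (\<Sum>l\<le>N. G l z * \<tau> ^ l))"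
proof -
  obtain T c where c: "\<forall>t. hp UNIV (Suc r) t (c t)" "F = (\<lambda>x. \<Sum>t\<le>T. c t x)"
    using pf_decomp[OF assms(1)] by auto
  have "\<forall>t. \<exists>B. graded_coeffs UNIV r t B \<and>
      (\<forall>z \<tau>. c t (\<lambda>i. case_nat 0 z i + \<tau> * p i) = (\<Sum>l\<le>t. B l z * \<tau> ^ l))"
  proof
    fix t
    obtain B where "graded_coeffs UNIV r t B"
      "\<forall>z \<tau>. c t (\<lambda>i. case_nat 0 z i + \<tau> * p i) = (\<Sum>l\<le>t. B l z * \<tau> ^ l)"
      using expand_along[where p = p, OF c(1)[rule_format, of t] UNIV_I UNIV_I assms(2)] by (elim exE conjE)
    then show "\<exists>B. graded_coeffs UNIV r t B \<and>
      (\<forall>z \<tau>. c t (\<lambda>i. case_nat 0 z i + \<tau> * p i) = (\<Sum>l\<le>t. B l z * \<tau> ^ l))" by (intro exI[of _ B] conjI)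
  qed
  from choice[OF this] obtain B where B: "\<And>t. graded_coeffs UNIV r t (B t)"
    "\<And>t z \<tau>. c t (\<lambda>i. case_nat 0 z i + \<tau> * p i) = (\<Sum>l\<le>t. B t l z * \<tau> ^ l)" by blast
  define G where "G = (\<lambda>l z. \<Sum>t\<le>T. B t l z)"
  have pB: "pf UNIV r (B t l)" for t l
  proof (cases "l \<le> t")
    case True
    then have "hp UNIV r (t - l) (B t l)" using B(1)[of t] by (simp add: graded_coeffs_def)
    then show ?thesis by (rule pf_of_hp) simp
  next
    case False
    then have "B t l = (\<lambda>_. 0)" using B(1)[of t] by (simp add: graded_coeffs_def)
    then show ?thesis by (simp add: pf.const)
  qed
  have "pf UNIV r (G l)" for l
    unfolding G_def by (rule pf_sum) (use pB in auto)
  moreover have "F (\<lambda>i. case_nat 0 z i + \<tau> * p i) = (\<Sum>l\<le>T. G l z * \<tau> ^ l)" for z \<tau>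
  proof -
    have "(\<Sum>l\<le>t. B t l z * \<tau> ^ l) = (\<Sum>l\<le>T. B t l z * \<tau> ^ l)" if "t \<le> T" for t
      by (rule sum.mono_neutral_left) (use that B(1)[of t] in \<open>auto simp: graded_coeffs_def\<close>)
    then have "F (\<lambda>i. case_nat 0 z i + \<tau> * p i) = (\<Sum>t\<le>T. \<Sum>l\<le>T. B t l z * \<tau> ^ l)"
      unfolding c(2) B(2) by simp
    also have "... = (\<Sum>l\<le>T. \<Sum>t\<le>T. B t l z * \<tau> ^ l)" by (rule sum.swap)
    finally show ?thesis by (simp add: G_def sum_distrib_right)
  qed
  ultimately show ?thesis by blast
qed

lemma away_inverse: "p 0 = 1 ==> away p (\<lambda>i. case_nat 0 z i + s * p i) = z"
  by (auto simp: away_def fun_eq_iff)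

lemma pf_poly: "pf UNIV n f ==> pf UNIV n (\<lambda>x. poly Q (f x))"
proof (induction Q)
  case (pCons a Q)
  have "pf UNIV n (\<lambda>x. a + f x * poly Q (f x))"
    by (intro pf.add pf.const pf.mult pCons) simp
  then show ?case by simp
qed (simp add: pf.const)

text \<open>
  An ideal of polynomials in one variable is principal.
\<close>

lemma poly_ideal_common_root:
  fixes I :: "'a::alg_closed_field poly set"
  assumes add: "\<And>P Q. P \<in> I ==> Q \<in> I ==> P + Q \<in> I" and mult: "\<And>P Q. P \<in> I ==> Q * P \<in> I"
    and "P0 \<in> I" "P0 \<noteq> 0" and nc: "\<And>c. c \<noteq> 0 ==> [:c:] \<notin> I"
  shows "\<exists>s. \<forall>P\<in>I. poly P s = 0"
proof -
  obtain g where g: "g \<in> I \<and> g \<noteq> 0" "\<And>h. h \<in> I \<and> h \<noteq> 0 ==> degree g \<le> degree h"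
    using arg_min_nat_lemma[of "\<lambda>g. g \<in> I \<and> g \<noteq> 0" P0 degree] assms(3,4) by blast
  have "degree g > 0"
  proof (rule ccontr)
    assume "\<not> ?thesis"
    then obtain c where "g = [:c:]" using degree_eq_zeroE by auto
    then show False using g(1) nc[of c] by auto
  qed
  then obtain s where s: "poly g s = 0" using alg_closed_imp_poly_has_root by blast
  have "poly P s = 0" if "P \<in> I" for P
  proof -
    have "P mod g = P + (- (P div g)) * g" by (simp add: minus_div_mult_eq_mod[symmetric])
    also have "... \<in> I" by (intro add mult) (use that g(1) in auto)
    finally have "P mod g \<in> I" .
    have "P mod g = 0"
    proof (rule ccontr)
      assume nz: "P mod g \<noteq> 0"
      then have "degree g \<le> degree (P mod g)" using g(2) \<open>P mod g \<in> I\<close> by blast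
      moreover have "degree (P mod g) < degree g" using degree_mod_less'[OF conjunct2[OF g(1)] nz] .
      ultimately show False by simp
    qed
    then have "P = (P div g) * g" by (simp add: mod_eq_0_iff_dvd)
    then have "poly P s = poly (P div g) s * poly g s" by (metis poly_mult)
    then show ?thesis using s by simp
  qed
  then show ?thesis by blast
qed

text \<open>
  Let \<open>y\<close> lie in the closure of the projected image. The polynomials that vanish on the unprojected
  image, restricted to the line through \<open>y\<close> and the centre, form an ideal of polynomials in one
  variable. It contains the restriction of \<open>f\<close>, which is not zero. If it contained a nonzero constant \<open>c\<close>, then
  multiplication by the corresponding function would be \<open>c\<close> times the identity modulo functions that
  vanish at \<open>y\<close>, on the module spanned by the powers of \<open>M\<^sub>0\<close>; elimination would give a function that
  vanishes on the projected image but not at \<open>y\<close>. So there is a common root, and the corresponding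
  point of the line can be lifted.
\<close>

lemma lift_step:
  fixes f :: "(nat => 'a::alg_closed_field) => 'a"
  assumes inf: "infinite (UNIV :: 'a set)" and L: "lifts aff X (Suc r) M"
    and f: "hp UNIV (Suc r) e f" "\<And>x. x \<in> X ==> f (\<lambda>i. M i x) = 0"
    and p: "p 0 = 1" "f p \<noteq> 0" "aff ==> r > 0 \<and> p r = 0"
  shows "lifts aff X r (\<lambda>i x. away p (\<lambda>j. M j x) i)"
  unfolding lifts_def
proof (intro allI impI)
  fix y :: "nat => 'a" assume nz: "nz aff r y"
    and van: "\<forall>f. pf UNIV r f --> (\<forall>x\<in>X. f (\<lambda>i. away p (\<lambda>j. M j x) i) = 0) --> f y = 0"
  have van': "h y = 0" if "pf UNIV r h" "\<And>x. x \<in> X ==> h (away p (\<lambda>j. M j x)) = 0" for h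
    using van that by simp
  \<comment> \<open>the line through \<open>y\<close> and the centre\<close>
  define ys where "ys = (\<lambda>s i. case_nat 0 y i + s * p i)"
  define I where "I = {P. \<exists>F. pf UNIV (Suc r) F \<and> (\<forall>x\<in>X. F (\<lambda>i. M i x) = 0) \<and> (\<forall>s. poly P s = F (ys s))}"
  have lineI: "\<exists>P\<in>I. \<forall>s. poly P s = F (ys s)" if F: "pf UNIV (Suc r) F" "\<And>x. x \<in> X ==> F (\<lambda>i. M i x) = 0" for F
  proof -
    obtain P where "\<forall>s. poly P s = F (ys s)" using pf_line[OF F(1), of "case_nat 0 y" p] unfolding ys_def by (elim exE)
    then show ?thesis using F unfolding I_def by (intro bexI[of _ P]) auto
  qed
  obtain B where B: "graded_coeffs UNIV r e B" "\<And>y. f y = (\<Sum>l\<le>e. B l (away p y) * y 0 ^ l)" "\<And>z. B e z = f p"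
    using expand_along[where p = p, OF f(1) UNIV_I UNIV_I p(1)] by blast
  obtain P0 where P0: "coeff P0 e = f p" "\<forall>s. poly P0 s = f (ys s)"
    using hp_line[OF f(1), of p "case_nat 0 y"] unfolding ys_def by blast
  have "\<exists>s. \<forall>P\<in>I. poly P s = 0"
  proof (rule poly_ideal_common_root)
    fix P Q assume "P \<in> I" "Q \<in> I"
    then obtain F F' where F: "pf UNIV (Suc r) F" "\<forall>x\<in>X. F (\<lambda>i. M i x) = 0" "\<forall>s. poly P s = F (ys s)"
      and F': "pf UNIV (Suc r) F'" "\<forall>x\<in>X. F' (\<lambda>i. M i x) = 0" "\<forall>s. poly Q s = F' (ys s)"
      unfolding I_def by blast
    show "P + Q \<in> I" unfolding I_def
      by (intro CollectI exI[of _ "\<lambda>x. F x + F' x"]) (use F F' in \<open>auto intro: pf.add\<close>)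
  next
    fix P Q assume "P \<in> I"
    then obtain F where F: "pf UNIV (Suc r) F" "\<forall>x\<in>X. F (\<lambda>i. M i x) = 0" "\<forall>s. poly P s = F (ys s)"
      unfolding I_def by blast
    have ys0: "ys s 0 = s" for s by (simp add: ys_def p(1))
    show "Q * P \<in> I" unfolding I_def
      by (intro CollectI exI[of _ "\<lambda>x. poly Q (x 0) * F x"])
         (use F in \<open>auto intro!: pf.mult pf_poly pf.var simp: ys0\<close>)
  next
    show "P0 \<in> I" unfolding I_def
      by (intro CollectI exI[of _ f]) (use P0(2) f pf_of_hp[OF f(1)] in auto)
    show "P0 \<noteq> 0" using P0(1) p(2) by auto
  next
    fix c :: 'a assume c: "c \<noteq> 0"
    show "[:c:] \<notin> I"
    proof
      assume "[:c:] \<in> I"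
      then obtain F where F: "pf UNIV (Suc r) F" "\<forall>x\<in>X. F (\<lambda>i. M i x) = 0" "\<forall>s. c = F (ys s)"
        unfolding I_def by auto
      obtain N G where G: "\<And>l. pf UNIV r (G l)"
        "\<And>z \<tau>. F (\<lambda>i. case_nat 0 z i + \<tau> * p i) = (\<Sum>l\<le>N. G l z * \<tau> ^ l)"
        using pf_expand[where p = p, OF F(1) p(1)] by blast
      \<comment> \<open>\<open>F\<close> is constant on the line, so its expansion at \<open>y\<close> has a constant term only\<close>
      have G_y: "G l y = (if l = 0 then c else 0)" if "l \<le> N" for l
      proof -
        let ?p = "(\<Sum>l\<le>N. monom (G l y) l) - [:c:]"
        have "poly ?p s = 0" for s
          using F(3) G(2)[of y s] by (simp add: poly_sum poly_monom ys_def)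
        then have "infinite {s. poly ?p s = 0}" using inf by simp
        then have "?p = 0" using poly_roots_finite[of ?p] by argo
        then have "coeff ?p l = 0" by simp
        then show ?thesis using that by (cases l) (auto simp: coeff_sum)
      qed
      obtain C where C: "\<And>l i. i < e ==> i \<le> l ==> hp UNIV r (l - i) (C l i)" "\<And>l i. i < e ==> l < i ==> C l i = (\<lambda>_. 0)"
        "\<And>l. l < e ==> C l = (\<lambda>i _. if i = l then 1 else 0)"
        "\<And>l z \<tau>. (\<Sum>i\<le>e. B i z * \<tau> ^ i) = 0 ==> \<tau> ^ l = (\<Sum>i<e. C l i z * \<tau> ^ i)"
        by (rule power_reduction_family[OF subfield_UNIV B(1,3) p(2) UNIV_I]) (rule that)
      have pC: "pf UNIV r (C l i)" if "i < e" for l i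
      proof (cases "i \<le> l")
        case True
        show ?thesis by (rule pf_of_hp[OF C(1)[OF that True]]) simp
      next
        case False
        then show ?thesis using C(2)[OF that] by (simp add: pf.const)
      qed
      have red: "M 0 x ^ l = (\<Sum>i<e. C l i (away p (\<lambda>j. M j x)) * M 0 x ^ i)" if "x \<in> X" for x l
        by (rule C(4)) (use B(2)[of "\<lambda>j. M j x"] f(2)[OF that] in simp)
      \<comment> \<open>the matrix of multiplication by \<open>F\<close> on the powers of \<open>M\<^sub>0\<close>; at \<open>y\<close> it is \<open>c\<close> times the identity\<close>
      define c' where "c' = (\<lambda>i j z. \<Sum>l\<le>N. G l z * C (l + i) j z)"
      have pc': "pf UNIV r (c' i j)" if "j < e" for i j
        unfolding c'_def by (rule pf_sum) (use G(1) pC that in \<open>auto intro: pf.mult\<close>)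
      have c'y: "c' i j y = (if i = j then c else 0)" if "i < e" "j < e" for i j
      proof -
        have "c' i j y = (\<Sum>l\<le>N. if l = 0 then c * C i j y else 0)"
          unfolding c'_def by (intro sum.cong refl) (simp add: G_y)
        also have "... = c * C i j y" by simp
        finally show ?thesis using C(3)[OF that(1)] by simp
      qed
      have rel: "(\<Sum>j<e. c' i j (away p (\<lambda>j. M j x)) * M 0 x ^ j) = 0" if x: "x \<in> X" for i x
      proof -
        let ?z = "away p (\<lambda>j. M j x)"
        have "F (\<lambda>i. M i x) = (\<Sum>l\<le>N. G l ?z * M 0 x ^ l)"
          using G(2)[of ?z "M 0 x"] away_plus[of p "\<lambda>j. M j x", OF p(1)] by simp
        then have "0 = (\<Sum>l\<le>N. G l ?z * M 0 x ^ l) * M 0 x ^ i" using F(2) x by simp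
        also have "... = (\<Sum>l\<le>N. G l ?z * M 0 x ^ (l + i))" by (simp add: sum_distrib_right power_add mult.assoc)
        also have "... = (\<Sum>l\<le>N. G l ?z * (\<Sum>j<e. C (l + i) j ?z * M 0 x ^ j))"
          by (intro sum.cong refl arg_cong2[where f = "(*)"] red x)
        also have "... = (\<Sum>l\<le>N. \<Sum>j<e. G l ?z * C (l + i) j ?z * M 0 x ^ j)"
          by (simp add: sum_distrib_left mult.assoc)
        also have "... = (\<Sum>j<e. \<Sum>l\<le>N. G l ?z * C (l + i) j ?z * M 0 x ^ j)" by (rule sum.swap)
        finally show ?thesis by (simp add: c'_def sum_distrib_right)
      qed
      \<comment> \<open>functions of the projection that do not vanish, or vanish, at \<open>y\<close>\<close>
      define Mo where "Mo = (\<lambda>(w::nat) P. \<exists>a. pf UNIV r a \<and> a y \<noteq> 0 \<and> P = (\<lambda>x. a (away p (\<lambda>j. M j x))))"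
      define No where "No = (\<lambda>(w::nat) P. \<exists>a. pf UNIV r a \<and> a y = 0 \<and> P = (\<lambda>x. a (away p (\<lambda>j. M j x))))"
      have "\<exists>a. pf UNIV r a \<and> a y \<noteq> 0 \<and> (\<forall>x\<in>X. a (away p (\<lambda>j. M j x)) = 0)"
      proof (cases "e = 0")
        case True
        have "f (\<lambda>i. M i x) = f p" for x using B(2,3) True by simp
        then have "X = {}" using f(2) p(2) by auto
        then show ?thesis by (intro exI[of _ "\<lambda>_. 1"]) (auto intro: pf.const)
      next
        case False
        have ins: "insert 0 {1..<e} = {..<e}" using False by auto
        have "\<exists>w' R. Mo w' R \<and> (\<forall>x\<in>X. R x * M 0 x ^ 0 = 0)"
        proof (rule elimination[where J = "{1..<e}" and w = 0 and Mo = Mo and No = No and u = "\<lambda>i x. M 0 x ^ i" and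
              P = "\<lambda>i x. c" and Q = "\<lambda>i j x. (if i = j then c else 0) - c' i j (away p (\<lambda>j. M j x))"])
          fix w P P' assume "Mo w P" "Mo w P'"
          then obtain a b where "pf UNIV r a" "a y \<noteq> 0" "P = (\<lambda>x. a (away p (\<lambda>j. M j x)))"
            "pf UNIV r b" "b y \<noteq> 0" "P' = (\<lambda>x. b (away p (\<lambda>j. M j x)))" unfolding Mo_def by blast
          then show "Mo (2 * w) (\<lambda>x. P x * P' x)" unfolding Mo_def
            by (intro exI[of _ "\<lambda>y. a y * b y"]) (auto intro: pf.mult)
        next
          fix w P P' assume "Mo w P" "No w P'"
          then obtain a b where ab: "pf UNIV r a" "a y \<noteq> 0" "P = (\<lambda>x. a (away p (\<lambda>j. M j x)))"
            "pf UNIV r b" "b y = 0" "P' = (\<lambda>x. b (away p (\<lambda>j. M j x)))" unfolding Mo_def No_def by blast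
          then show "Mo w (\<lambda>x. P x - P' x)" unfolding Mo_def
            by (intro exI[of _ "\<lambda>y. a y - b y"]) (auto intro: pf_diff subfield_UNIV)
          show "No (2 * w) (\<lambda>x. P x * P' x)" using ab unfolding No_def
            by (intro exI[of _ "\<lambda>y. a y * b y"]) (auto intro: pf.mult)
        next
          fix w P P' assume "No w P" "No w P'"
          then obtain a b where ab: "pf UNIV r a" "a y = 0" "P = (\<lambda>x. a (away p (\<lambda>j. M j x)))"
            "pf UNIV r b" "b y = 0" "P' = (\<lambda>x. b (away p (\<lambda>j. M j x)))" unfolding No_def by blast
          then show "No w (\<lambda>x. P x + P' x)" unfolding No_def
            by (intro exI[of _ "\<lambda>y. a y + b y"]) (auto intro: pf.add)
          show "No (2 * w) (\<lambda>x. P x * P' x)" using ab unfolding No_def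
            by (intro exI[of _ "\<lambda>y. a y * b y"]) (auto intro: pf.mult)
        next
          fix i assume i: "i \<in> insert 0 {1..<e}"
          show "Mo 0 (\<lambda>x. c)" unfolding Mo_def
            by (intro exI[of _ "\<lambda>_. c"]) (use c in \<open>auto intro: pf.const\<close>)
          fix j assume j: "j \<in> insert 0 {1..<e}"
          have ij: "i < e" "j < e" using i j unfolding ins by auto
          have "pf UNIV r (\<lambda>y. (if i = j then c else 0) - c' i j y)"
            by (intro pf_diff subfield_UNIV pf.const pc' ij(2) UNIV_I)
          moreover have "(if i = j then c else 0) - c' i j y = 0" using c'y[OF ij] by simp
          ultimately show "No 0 (\<lambda>x. (if i = j then c else 0) - c' i j (away p (\<lambda>j. M j x)))"
            unfolding No_def by blast
        next
          fix i x assume i: "i \<in> insert 0 {1..<e}" and x: "x \<in> X"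
          let ?z = "away p (\<lambda>j. M j x)"
          have "(\<Sum>j<e. ((if i = j then c else 0) - c' i j ?z) * M 0 x ^ j) =
            (\<Sum>j<e. (if i = j then c * M 0 x ^ j else 0)) - (\<Sum>j<e. c' i j ?z * M 0 x ^ j)"
            unfolding sum_subtractf[symmetric] by (intro sum.cong refl) (simp add: left_diff_distrib)
          also have "... = c * M 0 x ^ i" using rel[OF x, of i] i unfolding ins by simp
          finally show "c * M 0 x ^ i = (\<Sum>j\<in>insert 0 {1..<e}. ((if i = j then c else 0) - c' i j ?z) * M 0 x ^ j)"
            unfolding ins by simp
        qed auto
        then obtain w' R where R: "Mo w' R" "\<forall>x\<in>X. R x * M 0 x ^ 0 = 0" by blast
        from R(1) obtain a where a: "pf UNIV r a" "a y \<noteq> 0" "R = (\<lambda>x. a (away p (\<lambda>j. M j x)))"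
          unfolding Mo_def by (elim exE conjE)
        have "\<forall>x\<in>X. a (away p (\<lambda>j. M j x)) = 0" using R(2) unfolding a(3) by simp
        then show ?thesis using a(1,2) by blast
      qed
      then obtain a where a: "pf UNIV r a" "a y \<noteq> 0" "\<forall>x\<in>X. a (away p (\<lambda>j. M j x)) = 0" by (elim exE conjE)
      have "a y = 0" by (rule van'[OF a(1)]) (use a(3) in blast)
      then show False using a(2) by simp
    qed
  qed
  then obtain s where s: "\<forall>P\<in>I. poly P s = 0" by blast
  have "F (ys s) = 0" if F: "pf UNIV (Suc r) F" "\<forall>x\<in>X. F (\<lambda>i. M i x) = 0" for F
  proof -
    obtain P where P: "P \<in> I" "\<forall>s. poly P s = F (ys s)" using lineI[OF F(1)] F(2) by blast
    then show ?thesis using s by metis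
  qed
  moreover have "nz aff (Suc r) (ys s)"
  proof (cases aff)
    case True
    then have "r > 0" "p r = 0" using p(3) by auto
    then have "ys s r = y (r - 1)" unfolding ys_def by (cases r) auto
    then show ?thesis using nz True by (simp add: nz_def)
  next
    case False
    then obtain i where i: "i < r" "y i \<noteq> 0" using nz by (auto simp: nz_def)
    have "ys s 0 = s" "ys s (Suc i) = y i + s * p (Suc i)" by (auto simp: ys_def p(1))
    then have "ys s 0 \<noteq> 0 \<or> ys s (Suc i) \<noteq> 0" using i(2) by auto
    then show ?thesis using False i(1) unfolding nz_def by auto
  qed
  ultimately obtain x where x: "x \<in> X" "\<forall>i<Suc r. M i x = ys s i"
    using L unfolding lifts_def by blast
  have "away p (\<lambda>j. M j x) i = y i" if "i < r" for i
  proof -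
    have "away p (\<lambda>j. M j x) i = away p (ys s) i" unfolding away_def using x(2) that by simp
    also have "... = y i" unfolding ys_def using away_inverse[of p y s] p(1) by simp
    finally show ?thesis .
  qed
  then show "\<exists>x\<in>X. \<forall>i<r. away p (\<lambda>j. M j x) i = y i" using x(1) by blast
qed

section \<open>Noether normalization by linear forms\<close>

text \<open>
  No nonzero form in the \<open>M\<^sub>i\<close> vanishes on \<open>X\<close>: the projection is dominant.
\<close>

definition alg_indep :: "'a::field set => (nat => 'a) set => nat => (nat => (nat => 'a) => 'a) => bool" where
  "alg_indep E X r M \<longleftrightarrow> (\<forall>t f. hp E r t f --> (\<forall>x\<in>X. f (\<lambda>i. M i x) = 0) --> (\<forall>y. f y = 0))"

lemma alg_indepD: "alg_indep E X r M ==> hp E r t f ==> (\<And>x. x \<in> X ==> f (\<lambda>i. M i x) = 0) ==> f y = 0"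
  unfolding alg_indep_def by blast

text \<open>
  The expansion in powers of \<open>y\<^sub>j\<close> has no constant term.
\<close>

lemma hp_divide_var:
  fixes f :: "(nat => 'a::field) => 'a"
  assumes E: "is_subfield E" and f: "hp E r t f" "t > 0" and j: "j < r"
    and van: "\<And>q. q j = 0 ==> f q = 0"
  shows "\<exists>g. hp E r (t - 1) g \<and> (\<forall>y. f y = y j * g y)"
proof -
  have E01: "0 \<in> E" "1 \<in> E" using E by (auto simp: subfieldD)
  define b where "b = (\<lambda>i. if i = j then 1 else (0::'a))"
  have bE: "b i \<in> E" for i using E01 by (simp add: b_def)
  obtain A where A: "graded_coeffs E r t A" "\<And>z \<tau>. f (\<lambda>i. z i + \<tau> * b i) = (\<Sum>l\<le>t. A l z * \<tau> ^ l)"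
    using hp_taylor[OF f(1) E01(1), of b] bE by blast
  define g where "g = (\<lambda>y. \<Sum>l<t. A (Suc l) (y(j := 0)) * y j ^ l)"
  have "hp E r (t - 1) g"
    unfolding g_def
  proof (rule hp_sum)
    fix l assume l: "l \<in> {..<t}"
    have "hp E r (t - Suc l) (A (Suc l))" using A(1) l by (simp add: graded_coeffs_def)
    then have "hp E r (t - Suc l) (\<lambda>y. A (Suc l) (\<lambda>i. (\<lambda>i y. if i = j then 0 else y i) i y))"
    proof (rule hp_subst)
      fix i assume "i < r"
      then show "hp E r 1 (\<lambda>y. if i = j then 0 else y i)"
        by (cases "i = j") (auto intro: hp.zero hp.var)
    qed
    moreover have "(\<lambda>i. (\<lambda>i y. if i = j then 0 else y i) i y) = y(j := 0)" for y :: "nat => 'a"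
      by (auto simp: fun_eq_iff)
    ultimately have "hp E r (t - Suc l) (\<lambda>y. A (Suc l) (y(j := 0)))" by simp
    moreover have "hp E r l (\<lambda>y. y j ^ l)" using hp_power1[OF hp_var1[OF j] E01(2)] .
    ultimately show "hp E r (t - 1) (\<lambda>y. A (Suc l) (y(j := 0)) * y j ^ l)"
      by (rule hp_multI) (use l in auto)
  qed
  moreover have "f y = y j * g y" for y
  proof -
    let ?z = "y(j := 0)"
    have zb: "(\<lambda>i. ?z i + s * b i) = y(j := s)" for s by (auto simp: b_def fun_eq_iff)
    have "f ?z = (\<Sum>l\<le>t. A l ?z * 0 ^ l)" using A(2)[of ?z 0] zb[of 0] by simp
    also have "... = A 0 ?z"
      by (subst sum.remove[of _ 0]) (auto intro!: sum.neutral simp: power_0_left)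
    finally have A0: "A 0 ?z = 0" using van[of ?z] by simp
    have "f y = (\<Sum>l\<le>t. A l ?z * y j ^ l)" using A(2)[of ?z "y j"] zb[of "y j"] by simp
    also have "... = A 0 ?z * y j ^ 0 + (\<Sum>l<t. A (Suc l) ?z * y j ^ Suc l)"
    proof -
      obtain s where s: "t = Suc s" using f(2) by (cases t) auto
      show ?thesis unfolding s by (simp only: sum.atMost_Suc_shift lessThan_Suc_atMost)
    qed
    also have "... = (\<Sum>l<t. A (Suc l) ?z * y j ^ Suc l)" by (simp add: A0)
    also have "... = y j * g y" by (simp add: g_def sum_distrib_left algebra_simps)
    finally show ?thesis .
  qed
  ultimately show ?thesis by blast
qed

text \<open>
  Make the first coordinate nonzero, scale it to \<open>1\<close>, and move the others into \<open>k\<close>. Coordinates from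
  \<open>s\<close> on are only scaled, which keeps the zeros among them.
\<close>

lemma normalized_point:
  fixes f :: "(nat => 'a::field) => 'a"
  assumes k: "1 \<in> k" "infinite k" and f: "hp UNIV r t f" "f q \<noteq> 0"
  shows "\<exists>p. f p \<noteq> 0 \<and> p 0 = 1 \<and> (\<forall>i<s. p i \<in> k) \<and> (\<forall>i\<ge>s. q i = 0 --> i > 0 --> p i = 0)"
proof -
  have "infinite (k - {0})" using k(2) by simp
  then obtain q1 where q1: "f q1 \<noteq> 0" "q1 0 \<in> k - {0}" "\<forall>i. i \<notin> {0} --> q1 i = q i"
    using hp_nonvanishing_in_set[OF f(1) _ f(2), of "k - {0}" "{0}"] by auto
  define q2 where "q2 = (\<lambda>i. inverse (q1 0) * q1 i)"
  have q2: "f q2 \<noteq> 0" "q2 0 = 1" using q1 hp_scale[OF f(1), of "inverse (q1 0)" q1] by (auto simp: q2_def)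
  obtain p where p: "f p \<noteq> 0" "\<forall>i\<in>{1..<s}. p i \<in> k" "\<forall>i. i \<notin> {1..<s} --> p i = q2 i"
    using hp_nonvanishing_in_set[OF f(1) _ q2(1), of k "{1..<s}"] k(2) by blast
  have p0: "p 0 = 1" using p(3) q2(2) by simp
  have "p i \<in> k" if "i < s" for i
    by (cases "i = 0") (use p0 k(1) p(2) that in auto)
  moreover have "p i = 0" if "i \<ge> s" "q i = 0" "i > 0" for i
    using p(3)[rule_format, of i] q1(3)[rule_format, of i] that by (simp add: q2_def)
  ultimately show ?thesis using p(1) p0 by blast
qed

text \<open>
  A centre for a projection. In the affine case it has to lie at infinity, so that the last coordinate
  is kept. There a vanishing form \<open>f\<close> of least degree is not identically zero, since otherwise it could
  be divided by the last coordinate, which has no zero on \<open>X\<close>.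
\<close>

lemma exists_center:
  fixes X :: "(nat => 'a::field) set"
  assumes k: "is_subfield k" "infinite k" and E: "is_subfield E"
    and X: "X \<noteq> {}" "X \<subseteq> pts aff n" "aff ==> r > 0 \<and> (\<forall>x\<in>X. M (r - 1) x = x (n - 1))"
    and ni: "\<not> alg_indep E X r M"
  obtains f e p where "hp E r e f" "\<And>x. x \<in> X ==> f (\<lambda>i. M i x) = 0" "p 0 = 1" "\<And>i. i < r ==> p i \<in> k"
    "f p \<noteq> 0" "r > 0" "aff ==> r \<ge> 2 \<and> p (r - 1) = 0"
proof -
  have k01: "0 \<in> k" "1 \<in> k" using k by (auto simp: subfieldD)
  define bad where "bad = (\<lambda>t. \<exists>f. hp E r t f \<and> (\<forall>x\<in>X. f (\<lambda>i. M i x) = 0) \<and> (\<exists>y. f y \<noteq> 0))"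
  have "\<exists>t. bad t" using ni unfolding alg_indep_def bad_def by blast
  \<comment> \<open>least degree of a nonzero form vanishing on the image\<close>
  define t where "t = (LEAST t. bad t)"
  have "bad t" unfolding t_def using \<open>\<exists>t. bad t\<close> by (rule LeastI_ex)
  have least: "\<not> bad s" if "s < t" for s using not_less_Least that unfolding t_def by blast
  obtain f y0 where f: "hp E r t f" "\<forall>x\<in>X. f (\<lambda>i. M i x) = 0" "f y0 \<noteq> 0"
    using \<open>bad t\<close> unfolding bad_def by blast
  have t0: "t > 0"
  proof (rule ccontr)
    assume "\<not> t > 0"
    then obtain c where "\<forall>y. f y = c" using hp_degree0[OF f(1) _ E] by auto
    then show False using X(1) f(2,3) by auto
  qed
  have r0: "r > 0" using hp_zero_pos[OF f(1) t0, of y0] f(3) by (cases r) auto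
  have "\<exists>q. f q \<noteq> 0 \<and> (aff --> q (r - 1) = 0)"
  proof (cases aff)
    case False
    then show ?thesis using f(3) by blast
  next
    case True
    show ?thesis
    proof (rule ccontr)
      assume "\<not> ?thesis"
      then have van: "\<And>q. q (r - 1) = 0 ==> f q = 0" by blast
      have r1: "r - 1 < r" using r0 by simp
      obtain g where g: "hp E r (t - 1) g" "\<And>y. f y = y (r - 1) * g y"
        using hp_divide_var[OF E f(1) t0 r1 van] by blast
      have "g (\<lambda>i. M i x) = 0" if x: "x \<in> X" for x
      proof -
        have "M (r - 1) x \<noteq> 0" using X(2,3) True x by (auto simp: pts_def)
        then show ?thesis using f(2) g(2)[of "\<lambda>i. M i x"] x by simp
      qed
      moreover have "g y0 \<noteq> 0" using g(2)[of y0] f(3) by auto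
      ultimately have "bad (t - 1)" unfolding bad_def using g(1) by blast
      then show False using least t0 by simp
    qed
  qed
  then obtain q where q: "f q \<noteq> 0" "aff ==> q (r - 1) = 0" by blast
  have r2: "r \<ge> 2" if aff
  proof (rule ccontr)
    assume "\<not> r \<ge> 2"
    then have "r = 1" using r0 by simp
    then show False using hp_zero_pos[OF f(1) t0, of q] q that by auto
  qed
  have fU: "hp UNIV r t f" by (rule hp_mono[OF f(1)]) auto
  define s where "s = (if aff then r - 1 else r)"
  obtain p where p: "f p \<noteq> 0" "p 0 = 1" "\<forall>i<s. p i \<in> k" "\<forall>i\<ge>s. q i = 0 --> i > 0 --> p i = 0"
    using normalized_point[OF k01(2) k(2) fU q(1)] by blast
  have pr: "p (r - 1) = 0" if aff using p(4) q(2) r2 that by (simp add: s_def)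
  have "p i \<in> k" if "i < r" for i
  proof (cases "i < s")
    case False
    then have "aff \<and> i = r - 1" using that by (auto simp: s_def split: if_splits)
    then show ?thesis using pr k01 by auto
  qed (use p(3) in blast)
  then show ?thesis using that[OF f(1) _ p(2) _ p(1) r0] f(2) r2 pr by blast
qed

lemma hp_away_subst:
  assumes "is_subfield E" "hp E r t f" "\<And>i. i < Suc r ==> p i \<in> E"
  shows "hp E (Suc r) t (\<lambda>y. f (away p y))"
proof -
  have "hp E (Suc r) t (\<lambda>y. f (\<lambda>i. (\<lambda>i y. away p y i) i y))"
  proof (rule hp_subst[OF assms(2)])
    fix i assume "i < r"
    then show "hp E (Suc r) 1 (\<lambda>y. away p y i)"
      unfolding away_def using assms(3)
      by (intro hp_diff[OF assms(1)] hp_cmult hp_var1) auto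
  qed
  then show ?thesis by simp
qed

text \<open>
  The outcome of a sequence of projections from \<open>r\<close> to \<open>d\<close> linear forms \<open>\<Lambda>\<^sub>i\<close> in the given forms \<open>M\<^sub>j\<close>:
  the map remains finite and becomes dominant, the last coordinate and lying over are preserved. The
  point \<open>y0\<close>, at which all \<open>\<Lambda>\<^sub>i\<close> vanish, is the centre of the first projection.
\<close>

definition noether_forms ::
    "'a::field set => 'a set => bool => nat => (nat => 'a) set => nat => (nat => (nat => 'a) => 'a) => nat => (nat => (nat => 'a) => 'a) => bool" where
  "noether_forms k E aff n X r M d \<Lambda> \<longleftrightarrow> d \<le> r \<and> (\<forall>i<d. hp k r 1 (\<Lambda> i)) \<and>
     FG E n X d (\<lambda>i x. \<Lambda> i (\<lambda>j. M j x)) \<and> alg_indep E X d (\<lambda>i x. \<Lambda> i (\<lambda>j. M j x)) \<and>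
     (aff --> d > 0 \<and> (\<forall>y. \<Lambda> (d - 1) y = y (r - 1))) \<and>
     (lifts aff X r M --> lifts aff X d (\<lambda>i x. \<Lambda> i (\<lambda>j. M j x))) \<and>
     (d < r --> (\<exists>y0. y0 0 = 1 \<and> (aff --> y0 (r - 1) = 0) \<and> (\<forall>i<d. \<Lambda> i y0 = 0)))"

lemma noether_normalization:
  fixes X :: "(nat => 'a::alg_closed_field) set"
  assumes k: "is_subfield k" "infinite k" and E: "is_subfield E" "k \<subseteq> E"
    and X: "X \<noteq> {}" "X \<subseteq> pts aff n"
    and "\<And>i. i < r ==> hp k n 1 (M i)" "FG E n X r M"
    and "aff ==> r > 0 \<and> (\<forall>x\<in>X. M (r - 1) x = x (n - 1))"
  shows "\<exists>d \<Lambda>. noether_forms k E aff n X r M d \<Lambda>"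
  using assms(7-)
proof (induction r arbitrary: M)
  case 0
  have "alg_indep E X 0 M"
  proof (rule ccontr)
    assume "\<not> ?thesis"
    then show False
      by (rule exists_center[OF k E(1) X, of 0 M, rotated]) (use 0(3) in auto)
  qed
  then show ?case unfolding noether_forms_def using 0 by (intro exI[of _ 0] exI[of _ "\<lambda>i y. y i"]) auto
next
  case (Suc r)
  show ?case
  proof (cases "alg_indep E X (Suc r) M")
    case True
    have "\<forall>i<Suc r. hp k (Suc r) 1 (\<lambda>y. y i)" by (auto intro: hp.var)
    then show ?thesis unfolding noether_forms_def
      using Suc.prems True by (intro exI[of _ "Suc r"] exI[of _ "\<lambda>i y. y i"]) simp
  next
    case False
    obtain f e p where f: "hp E (Suc r) e f" "\<And>x. x \<in> X ==> f (\<lambda>i. M i x) = 0"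
      and p: "p 0 = 1" "\<And>i. i < Suc r ==> p i \<in> k" "f p \<noteq> 0" "aff ==> Suc r \<ge> 2 \<and> p (Suc r - 1) = 0"
      by (rule exists_center[OF k E(1) X Suc.prems(3) False]) (simp, rule that)
    have p': "\<And>i. i < Suc r ==> p i \<in> E" using p(2) E(2) by blast
    have paff: "r > 0 \<and> p r = 0" if aff using p(4)[OF that] by auto
    define M' where "M' = (\<lambda>i x. away p (\<lambda>j. M j x) i)"
    have ME: "hp E n 1 (M i)" if "i < Suc r" for i using hp_mono[OF Suc.prems(1)[OF that] E(2) order_refl] .
    have FG': "FG E n X r M'"
      unfolding M'_def by (rule projection_step[OF E(1) ME Suc.prems(2) f p(1) p' p(3)])
    have M': "hp k n 1 (M' i)" if "i < r" for i
      unfolding M'_def away_def using that Suc.prems(1) p(2)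
      by (intro hp_diff[OF k(1)] hp_cmult) auto
    have aff': "r > 0 \<and> (\<forall>x\<in>X. M' (r - 1) x = x (n - 1))" if aff
      using paff[OF that] Suc.prems(3)[OF that] by (auto simp: M'_def away_def)
    have "\<exists>d \<Lambda>. noether_forms k E aff n X r M' d \<Lambda>" by (rule Suc.IH[OF M' FG' aff'])
    then obtain d \<Lambda> where IH: "d \<le> r" "\<forall>i<d. hp k r 1 (\<Lambda> i)" "FG E n X d (\<lambda>i x. \<Lambda> i (\<lambda>j. M' j x))"
      "alg_indep E X d (\<lambda>i x. \<Lambda> i (\<lambda>j. M' j x))" "aff --> d > 0 \<and> (\<forall>y. \<Lambda> (d - 1) y = y (r - 1))"
      "lifts aff X r M' --> lifts aff X d (\<lambda>i x. \<Lambda> i (\<lambda>j. M' j x))"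
      unfolding noether_forms_def by (elim exE conjE)
    define \<Lambda>' where "\<Lambda>' = (\<lambda>i y. \<Lambda> i (away p y))"
    have eq: "(\<lambda>i x. \<Lambda>' i (\<lambda>j. M j x)) = (\<lambda>i x. \<Lambda> i (\<lambda>j. M' j x))"
      by (simp add: \<Lambda>'_def M'_def)
    have 1: "\<forall>i<d. hp k (Suc r) 1 (\<Lambda>' i)"
      unfolding \<Lambda>'_def
    proof (intro allI impI)
      fix i assume "i < d"
      show "hp k (Suc r) 1 (\<lambda>y. \<Lambda> i (away p y))"
        by (rule hp_away_subst[OF k(1) IH(2)[rule_format, OF \<open>i < d\<close>]]) (rule p(2))
    qed
    have 2: "aff --> d > 0 \<and> (\<forall>y. \<Lambda>' (d - 1) y = y (Suc r - 1))"
    proof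
      assume aff
      then show "d > 0 \<and> (\<forall>y. \<Lambda>' (d - 1) y = y (Suc r - 1))"
        using IH(5) paff by (simp add: \<Lambda>'_def away_def)
    qed
    have 3: "lifts aff X (Suc r) M --> lifts aff X d (\<lambda>i x. \<Lambda>' i (\<lambda>j. M j x))"
    proof
      assume L: "lifts aff X (Suc r) M"
      have fU: "hp UNIV (Suc r) e f" by (rule hp_mono[OF f(1)]) auto
      have inf: "infinite (UNIV :: 'a set)" using k(2) finite_subset[of k UNIV] by auto
      have "lifts aff X r M'" unfolding M'_def by (rule lift_step[OF inf L fU f(2) p(1,3) paff])
      then show "lifts aff X d (\<lambda>i x. \<Lambda>' i (\<lambda>j. M j x))" unfolding eq using IH(6) by blast
    qed
    \<comment> \<open>the centre \<open>p\<close> is projected to zero\<close>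
    have 4: "\<exists>y0. y0 0 = 1 \<and> (aff --> y0 (Suc r - 1) = 0) \<and> (\<forall>i<d. \<Lambda>' i y0 = 0)"
    proof (intro exI[of _ p] conjI allI impI)
      fix i assume i: "i < d"
      have "away p p = (\<lambda>_. 0)" using p(1) by (simp add: away_def fun_eq_iff)
      moreover have "\<Lambda> i (\<lambda>_. 0) = 0" using hp_zero_pos[OF IH(2)[rule_format, OF i], of "\<lambda>_. 0"] by simp
      ultimately show "\<Lambda>' i p = 0" by (simp add: \<Lambda>'_def)
    qed (use p(1) paff in auto)
    show ?thesis unfolding noether_forms_def
      by (intro exI[of _ d] exI[of _ \<Lambda>']) (unfold eq, use 1 2 3[unfolded eq] 4 IH(1,3,4) in simp)
  qed
qed

section \<open>Growth of Hilbert functions under finite projections\<close>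

lemma fgs_monomials:
  fixes M :: "nat => (nat => 'a::field) => 'a"
  assumes "fgs E r M U t g" "is_subfield E" "finite U"
  shows "\<exists>c. \<forall>x. g x = (\<Sum>(v, \<alpha>)\<in>(SIGMA v:{v\<in>U. snd v \<le> t}. Mon r (t - snd v)). c (v, \<alpha>) * (mon \<alpha> (\<lambda>i. M i x) * fst v x))"
  using assms
proof (induction rule: fgs.induct)
  case (zero t)
  then show ?case by (intro exI[of _ "\<lambda>_. 0"]) simp
next
  case (gen u a s b t)
  obtain c where c: "b = (\<lambda>x. \<Sum>\<mu>\<in>Mon r s. c \<mu> * mon \<mu> x)"
    using hp_normal_form[OF gen(2,4)] by blast
  define c' where "c' = (\<lambda>(v, \<alpha>). if v = (u, a) then c \<alpha> else 0)"
  let ?S = "SIGMA v:{v\<in>U. snd v \<le> t}. Mon r (t - snd v)"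
  have fin: "finite ?S" using gen.prems(2) finite_Mon by (intro finite_SigmaI) auto
  have "b (\<lambda>i. M i x) * u x = (\<Sum>(v, \<alpha>)\<in>?S. c' (v, \<alpha>) * (mon \<alpha> (\<lambda>i. M i x) * fst v x))" for x
  proof -
    have "(\<Sum>(v, \<alpha>)\<in>?S. c' (v, \<alpha>) * (mon \<alpha> (\<lambda>i. M i x) * fst v x)) =
      (\<Sum>(v, \<alpha>)\<in>{(u, a)} \<times> Mon r s. c' (v, \<alpha>) * (mon \<alpha> (\<lambda>i. M i x) * fst v x))"
      by (rule sum.mono_neutral_right[OF fin]) (use gen(1,3) in \<open>auto simp: c'_def split: if_splits\<close>)
    also have "... = (\<Sum>\<alpha>\<in>Mon r s. c \<alpha> * (mon \<alpha> (\<lambda>i. M i x) * u x))"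
      by (simp add: sum.cartesian_product[symmetric] c'_def)
    finally show ?thesis by (simp add: c sum_distrib_right mult.assoc)
  qed
  then show ?case by (intro exI[of _ c'] allI)
next
  case (add t f g)
  obtain c where c: "\<forall>x. f x = (\<Sum>(v, \<alpha>)\<in>(SIGMA v:{v\<in>U. snd v \<le> t}. Mon r (t - snd v)). c (v, \<alpha>) * (mon \<alpha> (\<lambda>i. M i x) * fst v x))"
    using add.IH(1) add.prems by blast
  obtain d where d: "\<forall>x. g x = (\<Sum>(v, \<alpha>)\<in>(SIGMA v:{v\<in>U. snd v \<le> t}. Mon r (t - snd v)). d (v, \<alpha>) * (mon \<alpha> (\<lambda>i. M i x) * fst v x))"
    using add.IH(2) add.prems by blast
  show ?case
    by (intro exI[of _ "\<lambda>v. c v + d v"] allI)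
       (simp add: c[rule_format] d[rule_format] case_prod_unfold distrib_right sum.distrib)
qed

text \<open>
  The forms in \<open>d + 1\<close> variables of degree \<open>t - a\<close>, for the finitely many degrees \<open>a\<close> of generators,
  span the forms of degree \<open>t\<close> on \<open>X\<close>.
\<close>

lemma hilb_le_of_FG:
  fixes M :: "nat => (nat => 'a::field) => 'a"
  assumes FG: "FG E n X (Suc d) M" and E: "is_subfield E"
  shows "\<exists>C\<ge>0. \<forall>t. real (hilb X n t) \<le> C * real ((t + d) choose d)"
proof -
  obtain U where U: "finite U" "\<And>t f. hp E n t f ==> \<exists>g. fgs E (Suc d) M U t g \<and> (\<forall>x\<in>X. f x = g x)"
    using FG unfolding FG_def by blast
  have "hilb X n t \<le> card U * ((t + d) choose d)" for t
  proof -
    let ?S = "SIGMA v:{v\<in>U. snd v \<le> t}. Mon (Suc d) (t - snd v)"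
    let ?h = "\<lambda>(v, \<alpha>) x. mon \<alpha> (\<lambda>i. M i x) * fst v x"
    have fin: "finite ?S" using U(1) finite_Mon by (intro finite_SigmaI) auto
    have "hilb X n t \<le> card ?S"
    proof (rule hilb_le_card[OF fin, where h = ?h])
      fix f :: "(nat => 'a) => 'a" assume f: "hp UNIV n t f"
      obtain a where a: "f = (\<lambda>x. \<Sum>\<mu>\<in>Mon n t. a \<mu> * mon \<mu> x)"
        using hp_normal_form[OF f subfield_UNIV] by blast
      have "\<forall>\<mu>\<in>Mon n t. \<exists>c. \<forall>x\<in>X. mon \<mu> x = (\<Sum>j\<in>?S. c j * ?h j x)"
      proof
        fix \<mu> assume \<mu>: "\<mu> \<in> Mon n t"
        have "hp E n t (mon \<mu>)" by (rule hp_mon[OF \<mu> subfieldD(2)[OF E]])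
        then obtain g where g: "fgs E (Suc d) M U t g" "\<forall>x\<in>X. mon \<mu> x = g x" using U(2) by blast
        obtain c where "\<forall>x. g x = (\<Sum>(v, \<alpha>)\<in>?S. c (v, \<alpha>) * (mon \<alpha> (\<lambda>i. M i x) * fst v x))"
          using fgs_monomials[OF g(1) E U(1)] by blast
        then show "\<exists>c. \<forall>x\<in>X. mon \<mu> x = (\<Sum>j\<in>?S. c j * ?h j x)"
          using g(2) by (intro exI[of _ c]) (simp add: case_prod_unfold)
      qed
      from combination_trans[OF this, of a] show "\<exists>c. \<forall>x\<in>X. f x = (\<Sum>j\<in>?S. c j * ?h j x)" unfolding a .
    qed
    also have "card ?S = (\<Sum>v\<in>{v\<in>U. snd v \<le> t}. card (Mon (Suc d) (t - snd v)))"
      using U(1) finite_Mon by (intro card_SigmaI) auto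
    also have "... \<le> (\<Sum>v\<in>{v\<in>U. snd v \<le> t}. (t + d) choose d)"
      unfolding card_Mon by (intro sum_mono binomial_right_mono) auto
    also have "... \<le> card U * ((t + d) choose d)"
      using U(1) by (simp add: card_mono)
    finally show ?thesis .
  qed
  then have "real (hilb X n t) \<le> real (card U) * real ((t + d) choose d)" for t
    unfolding of_nat_mult[symmetric] by (rule of_nat_mono)
  then show ?thesis by (intro exI[of _ "real (card U)"]) auto
qed

section \<open>The degree of the Hilbert polynomial\<close>

definition hpoly :: "nat => (nat => 'a::field) set => real poly" where
  "hpoly n X = (THE p. eventually (\<lambda>t. poly p (real t) = real (hilb X n t)) sequentially)"

lemma hpoly_eventually: "eventually (\<lambda>t. poly (hpoly n X) (real t) = real (hilb X n t)) sequentially"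
proof -
  obtain p where p: "eventually (\<lambda>t. poly p (real t) = real (hilb X n t)) sequentially"
    using hilb_eventually_poly by blast
  show ?thesis unfolding hpoly_def
    by (rule theI[of _ p]) (use p poly_ev_unique[OF _ p] in blast)+
qed

text \<open>
  Forms over \<open>E\<close> that are linearly independent on \<open>X\<close> over \<open>E\<close> are independent over the whole field.
  The index sets are restricted to one type, large enough to index the products of monomials with powers of
  one more form.
\<close>

definition desc :: "'a::field set => nat => (nat => 'a) set => bool" where
  "desc E n X \<longleftrightarrow> (\<forall>t (I :: ((nat \<Rightarrow>\<^sub>0 nat) \<times> nat) set) g. finite I --> (\<forall>i\<in>I. hp E n t (g i)) -->
     (\<forall>c. (\<forall>i\<in>I. c i \<in> E) --> (\<forall>x\<in>X. (\<Sum>i\<in>I. c i * g i x) = 0) --> (\<forall>i\<in>I. c i = 0)) --> indep_on X I g)"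

lemma desc_UNIV: "desc UNIV n X"
  unfolding desc_def indep_on_def by simp

text \<open>
  If \<open>1, g, \<dots>\<close>, up to the power \<open>e - 1\<close>, are independent over the forms in \<open>M\<^sub>0, \<dots>, M\<^sub>d\<close>, then the
  products of these powers with monomials in the \<open>M\<^sub>i\<close> are independent on \<open>X\<close>, and there is one copy of
  a polynomial ring in \<open>d + 1\<close> variables for each power.
\<close>

lemma hilb_ge_powers:
  fixes M :: "nat => (nat => 'a::field) => 'a"
  assumes inf: "infinite (UNIV :: 'a set)" and E: "is_subfield E" and desc: "desc E n X"
    and M: "\<And>i. i < Suc d ==> hp E n 1 (M i)" and g: "hp E n 1 g"
    and nr: "\<And>t q. (\<And>i. i < e ==> i \<le> t ==> hp E (Suc d) (t - i) (q i)) ==> (\<And>i. i < e ==> t < i ==> q i = (\<lambda>_. 0)) ==>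
      (\<And>x. x \<in> X ==> (\<Sum>i<e. q i (\<lambda>j. M j x) * g x ^ i) = 0) ==> \<forall>i<e. \<forall>y. q i y = 0"
    and t: "t \<ge> e"
  shows "(\<Sum>i<e. (t - i + d) choose d) \<le> hilb X n t"
proof -
  have E1: "1 \<in> E" using E by (simp add: subfieldD)
  define S where "S = (SIGMA i:{..<e}. Mon (Suc d) (t - i))"
  define I where "I = (\<lambda>(i, \<alpha>). (\<alpha>, i)) ` S"
  define G where "G = (\<lambda>(\<alpha>, i) x. mon \<alpha> (\<lambda>j. M j x) * g x ^ i)"
  have finS: "finite S" unfolding S_def by (intro finite_SigmaI finite_Mon) auto
  have finI: "finite I" unfolding I_def using finS by simp
  have injS: "inj_on (\<lambda>(i, \<alpha>). (\<alpha>, i)) S" by (auto simp: inj_on_def)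
  have GE: "hp E n t (G j)" if jI: "j \<in> I" for j
  proof -
    obtain i \<alpha> where j: "j = (\<alpha>, i)" "i < e" "\<alpha> \<in> Mon (Suc d) (t - i)"
      using jI unfolding I_def S_def by auto
    have "hp E n (t - i) (\<lambda>x. mon \<alpha> (\<lambda>j. M j x))" by (rule hp_subst[OF hp_mon[OF j(3) E1]]) (rule M)
    moreover have "hp E n i (\<lambda>x. g x ^ i)" by (rule hp_power1[OF g E1])
    ultimately show ?thesis unfolding G_def j(1) prod.case by (rule hp_multI) (use j(2) t in auto)
  qed
  have sumI: "(\<Sum>j\<in>I. c j * G j x) = (\<Sum>i<e. (\<Sum>\<alpha>\<in>Mon (Suc d) (t - i). c (\<alpha>, i) * mon \<alpha> (\<lambda>j. M j x)) * g x ^ i)" for c x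
  proof -
    have "(\<Sum>j\<in>I. c j * G j x) = (\<Sum>(i, \<alpha>)\<in>S. c (\<alpha>, i) * G (\<alpha>, i) x)"
      unfolding I_def sum.reindex[OF injS] by (intro sum.cong) auto
    also have "... = (\<Sum>i<e. \<Sum>\<alpha>\<in>Mon (Suc d) (t - i). c (\<alpha>, i) * G (\<alpha>, i) x)"
      unfolding S_def by (rule sum.Sigma[symmetric]) (auto simp: finite_Mon)
    finally show ?thesis by (simp add: G_def sum_distrib_right mult.assoc)
  qed
  have "indep_on X I G"
  proof (rule desc[unfolded desc_def, rule_format, OF finI])
    show "hp E n t (G i)" if "i \<in> I" for i by (rule GE[OF that])
    fix c j assume cE: "\<And>i. i \<in> I ==> c i \<in> E" and rel: "\<And>x. x \<in> X ==> (\<Sum>i\<in>I. c i * G i x) = 0" and j: "j \<in> I"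
    define q where "q = (\<lambda>i y. \<Sum>\<alpha>\<in>Mon (Suc d) (t - i). c (\<alpha>, i) * mon \<alpha> y)"
    have inI: "(\<alpha>, i) \<in> I" if "i < e" "\<alpha> \<in> Mon (Suc d) (t - i)" for i \<alpha>
      unfolding I_def S_def using that by force
    have "\<forall>i<e. \<forall>y. q i y = 0"
    proof (rule nr)
      show "hp E (Suc d) (t - i) (q i)" if "i < e" for i
        unfolding q_def by (rule hp_of_normal_form[OF E]) (use cE inI[OF that] in blast)
      show "q i = (\<lambda>_. 0)" if "i < e" "t < i" for i using that t by simp
      show "(\<Sum>i<e. q i (\<lambda>j. M j x) * g x ^ i) = 0" if "x \<in> X" for x
        using rel that unfolding sumI q_def by blast
    qed
    moreover obtain i \<alpha> where ij: "j = (\<alpha>, i)" "i < e" "\<alpha> \<in> Mon (Suc d) (t - i)"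
      using j unfolding I_def S_def by auto
    ultimately have q0: "\<And>y. (\<Sum>\<alpha>\<in>Mon (Suc d) (t - i). c (\<alpha>, i) * mon \<alpha> y) = 0" unfolding q_def by blast
    have "(\<lambda>\<alpha>. c (\<alpha>, i)) \<alpha> = 0"
    proof (rule monomials_independent[where c = "\<lambda>\<alpha>. c (\<alpha>, i)" and A = "Mon (Suc d) (t - i)" and n = "Suc d"])
      show "pkeys \<mu> \<subseteq> {..<Suc d}" if "\<mu> \<in> Mon (Suc d) (t - i)" for \<mu> using that by (simp add: Mon_def)
    qed (use inf finite_Mon q0 ij(3) in auto)
    then show "c j = 0" using ij(1) by simp
  qed
  from hilb_ge_card[OF finI hp_mono[OF GE subset_UNIV order_refl] this]
  have "card I \<le> hilb X n t" by simp
  moreover have "card I = (\<Sum>i<e. (t - i + d) choose d)"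
  proof -
    have "card I = card S" unfolding I_def by (rule card_image[OF injS])
    also have "... = (\<Sum>i<e. card (Mon (Suc d) (t - i)))" unfolding S_def by (rule card_SigmaI) (auto simp: finite_Mon)
    finally show ?thesis by (simp add: card_Mon)
  qed
  ultimately show ?thesis by simp
qed

text \<open>
  Finiteness bounds the growth of the Hilbert function from above and dominance bounds it from below.
\<close>

lemma degree_hpoly:
  fixes M :: "nat => (nat => 'a::field) => 'a"
  assumes inf: "infinite (UNIV :: 'a set)" and E: "is_subfield E" and desc: "desc E n X"
    and M: "\<And>i. i < Suc d ==> hp E n 1 (M i)"
    and FG: "FG E n X (Suc d) M" and ai: "alg_indep E X (Suc d) M"
  shows "degree (hpoly n X) = d" "fact d * coeff (hpoly n X) d \<ge> 1"
proof -
  obtain C where C: "C \<ge> 0" "\<And>t. real (hilb X n t) \<le> C * real ((t + d) choose d)"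
    using hilb_le_of_FG[OF FG E] by blast
  have le: "degree (hpoly n X) \<le> d"
    by (rule degree_le_of_growth[OF hpoly_eventually C(2,1)])
  \<comment> \<open>the case of a single power, where independence is dominance\<close>
  have ge: "(\<Sum>i<1. (t - i + d) choose d) \<le> hilb X n t" if t: "t \<ge> 1" for t
  proof (rule hilb_ge_powers[OF inf E desc M M[of 0] _ t])
    fix s q assume q: "\<And>i. i < 1 ==> i \<le> s ==> hp E (Suc d) (s - i) (q i)"
      "\<And>x. x \<in> X ==> (\<Sum>i<1. q i (\<lambda>j. M j x) * M 0 x ^ i) = 0"
    have "hp E (Suc d) s (q 0)" using q(1)[of 0] by simp
    then have "q 0 y = 0" for y
      by (rule alg_indepD[OF ai]) (use q(2) in simp)
    then show "\<forall>i<1. \<forall>y. q i y = 0" by simp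
  qed auto
  have "real 1 \<le> fact d * coeff (hpoly n X) d"
    by (rule coeff_ge_of_growth[OF hpoly_eventually le ge])
  then show "fact d * coeff (hpoly n X) d \<ge> 1" by simp
  then have "coeff (hpoly n X) d \<noteq> 0" by auto
  then show "degree (hpoly n X) = d" using le le_degree[of "hpoly n X" d] by simp
qed

lemma degree_hpoly_mono:
  assumes "X \<subseteq> Y"
  shows "degree (hpoly n X) \<le> degree (hpoly n Y)"
proof (rule ccontr)
  let ?p = "hpoly n X" and ?q = "hpoly n Y"
  assume not: "\<not> ?thesis"
  have "eventually (\<lambda>t. poly (?q - ?p) (real t) \<ge> 0) sequentially"
    using hpoly_eventually[of n X] hpoly_eventually[of n Y]
  proof eventually_elim
    case (elim t)
    have "real (hilb X n t) \<le> real (hilb Y n t)" by (rule of_nat_mono[OF hilb_mono[OF assms]])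
    then show ?case using elim by simp
  qed
  moreover have "degree (?q - ?p) \<le> degree ?p" using not by (intro degree_diff_le) auto
  ultimately have "coeff (?q - ?p) (degree ?p) \<ge> 0" by (rule poly_ev_nonneg_coeff)
  then have "lead_coeff ?p \<le> 0" using not by (simp add: coeff_eq_0)
  moreover have "eventually (\<lambda>t. poly ?p (real t) \<ge> 0) sequentially"
    using hpoly_eventually[of n X] by eventually_elim simp
  from poly_ev_nonneg_coeff[OF this order_refl] have "lead_coeff ?p \<ge> 0" .
  ultimately have "?p = 0" by simp
  then show False using not by simp
qed

section \<open>Irreducible closed sets\<close>

lemma irreducible_prime:
  assumes irr: "irreducible_closed (zclosed aff E n) X" and f: "hp E n s f" and g: "hp E n t g"
    and fg: "\<And>x. x \<in> X ==> f x * g x = 0"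
  shows "(\<forall>x\<in>X. f x = 0) \<or> (\<forall>x\<in>X. g x = 0)"
proof -
  have X: "zclosed aff E n X" using irr by (simp add: irreducible_closed_def)
  have "X = {x\<in>X. f x = 0} \<union> {x\<in>X. g x = 0}" using fg by auto
  then have "X = {x\<in>X. f x = 0} \<or> X = {x\<in>X. g x = 0}"
    using irr zclosed_cut[OF X f] zclosed_cut[OF X g] unfolding irreducible_closed_def by blast
  then show ?thesis by blast
qed

lemma hilb_pos:
  assumes "X \<noteq> {}" "X \<subseteq> pts aff n"
  shows "hilb X n t \<ge> 1"
proof -
  obtain x where x: "x \<in> X" using assms(1) by blast
  obtain i where i: "x i \<noteq> 0" using x assms(2) by (auto simp: pts_def split: if_splits)
  have "x \<in> vecs n" using x assms(2) by (auto simp: pts_def)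
  then have "i < n" using i unfolding vecs_def by (metis (mono_tags, lifting) mem_Collect_eq not_le)
  have "card {()} \<le> hilb X n t"
  proof (rule hilb_ge_card[where g = "\<lambda>_ x. x i ^ t"])
    show "hp UNIV n t (\<lambda>x. x i ^ t)" by (rule hp_power1[OF hp_var1[OF \<open>i < n\<close>]]) simp
    show "indep_on X {()} (\<lambda>_ x. x i ^ t)"
      unfolding indep_on_def using x i by auto
  qed auto
  then show ?thesis by simp
qed

text \<open>
  A form \<open>f\<close> that vanishes on \<open>Z\<close> but not on the irreducible set \<open>Z'\<close> is not a zero divisor on \<open>Z'\<close>. So
  the forms of degree \<open>t - e\<close> on \<open>Z'\<close>, multiplied with \<open>f\<close>, are independent of standard monomials
  for \<open>Z\<close>.
\<close>

lemma irreducible_degree_less: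
  assumes irr: "irreducible_closed (zclosed aff UNIV n) Z" "irreducible_closed (zclosed aff UNIV n) Z'" and sub: "Z \<subset> Z'"
  shows "degree (hpoly n Z) < degree (hpoly n Z')"
proof -
  have Z: "zclosed aff UNIV n Z" "Z \<noteq> {}" using irr(1) by (auto simp: irreducible_closed_def)
  have Z': "zclosed aff UNIV n Z'" using irr(2) by (auto simp: irreducible_closed_def)
  obtain G where G: "\<forall>g\<in>G. \<exists>t. hp UNIV n t g" "Z = {x \<in> pts aff n. \<forall>g\<in>G. g x = 0}"
    using Z(1) unfolding zclosed_def by (elim exE conjE)
  obtain z where z: "z \<in> Z'" "z \<notin> Z" using sub by blast
  have "z \<in> pts aff n" using z(1) zclosed_subset_pts[OF Z'] by blast
  then obtain f where f: "f \<in> G" "f z \<noteq> 0" using z(2) unfolding G(2) by blast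
  obtain e where e: "hp UNIV n e f" using bspec[OF G(1) f(1)] by (elim exE)
  have f0: "f x = 0" if "x \<in> Z" for x using that f(1) unfolding G(2) by blast
  have "hilb Z n t + hilb Z' n (t - e) \<le> hilb Z' n t" if t: "t \<ge> e" for t
  proof -
    let ?I = "Std Z n t <+> Std Z' n (t - e)"
    \<comment> \<open>standard monomials for \<open>Z\<close>, and \<open>f\<close> times standard monomials for \<open>Z'\<close>\<close>
    let ?g = "case_sum mon (\<lambda>\<nu> x. f x * mon \<nu> x)"
    have "card ?I \<le> hilb Z' n t"
    proof (rule hilb_ge_card)
      show "finite ?I" by (simp add: finite_Std)
      show "hp UNIV n t (?g i)" if "i \<in> ?I" for i
      proof (cases i)
        case (Inl \<mu>)
        then show ?thesis using that by (auto intro!: hp_mon simp: Std_def)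
      next
        case (Inr \<nu>)
        then have "\<nu> \<in> Mon n (t - e)" using that by (auto simp: Std_def)
        from hp_multI[OF e hp_mon[OF this, of UNIV]] show ?thesis using Inr t by auto
      qed
      show "indep_on Z' ?I ?g"
        unfolding indep_on_def
      proof (intro allI impI)
        fix c assume c: "\<forall>x\<in>Z'. (\<Sum>i\<in>?I. c i * ?g i x) = 0"
        have c': "(\<Sum>\<mu>\<in>Std Z n t. c (Inl \<mu>) * mon \<mu> x) + f x * (\<Sum>\<nu>\<in>Std Z' n (t - e). c (Inr \<nu>) * mon \<nu> x) = 0" if "x \<in> Z'" for x
          using c that by (simp add: sum.Plus[OF finite_Std finite_Std] sum_distrib_left algebra_simps)
        have "\<forall>x\<in>Z. (\<Sum>\<mu>\<in>Std Z n t. c (Inl \<mu>) * mon \<mu> x) = 0"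
        proof
          fix x assume "x \<in> Z"
          then show "(\<Sum>\<mu>\<in>Std Z n t. c (Inl \<mu>) * mon \<mu> x) = 0" using c'[of x] f0[of x] sub by auto
        qed
        then have cl: "\<forall>\<mu>\<in>Std Z n t. c (Inl \<mu>) = 0"
          using Std_indep[of Z n t] unfolding indep_on_def by (elim allE[of _ "\<lambda>\<mu>. c (Inl \<mu>)"]) blast
        define h where "h = (\<lambda>x. \<Sum>\<nu>\<in>Std Z' n (t - e). c (Inr \<nu>) * mon \<nu> x)"
        have h: "hp UNIV n (t - e) h"
          unfolding h_def by (intro hp_sum hp_cmult hp_mon) (auto simp: Std_def)
        have "f x * h x = 0" if "x \<in> Z'" for x using c'[OF that] cl by (simp add: h_def)
        then have "(\<forall>x\<in>Z'. f x = 0) \<or> (\<forall>x\<in>Z'. h x = 0)" by (rule irreducible_prime[OF irr(2) e h])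
        then have "\<forall>x\<in>Z'. h x = 0" using z(1) f(2) by blast
        then have cr: "\<forall>\<nu>\<in>Std Z' n (t - e). c (Inr \<nu>) = 0"
          using Std_indep[of Z' n "t - e"] unfolding indep_on_def h_def by (elim allE[of _ "\<lambda>\<nu>. c (Inr \<nu>)"]) blast
        show "\<forall>i\<in>?I. c i = 0" using cl cr by auto
      qed
    qed
    then show ?thesis by (simp add: card_Plus finite_Std hilb_def)
  qed
  moreover have "hilb Z n t \<ge> 1" for t by (rule hilb_pos[OF Z(2) zclosed_subset_pts[OF Z(1)]])
  ultimately show ?thesis by (rule degree_less_of_growth[OF hpoly_eventually hpoly_eventually])
qed

lemma zclosed_chain_condition:
  fixes Z :: "nat => (nat => 'a::field) set"
  assumes "\<And>i. zclosed aff UNIV n (Z i)" "\<And>i. Z (Suc i) \<subset> Z i"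
  shows False
proof -
  obtain i where i: "LMs (Z (Suc i)) n = LMs (Z i) n"
    using LMs_chain_stabilises[of Z n] assms(2) by blast
  obtain G where G: "\<forall>g\<in>G. \<exists>t. hp UNIV n t g" "Z (Suc i) = {x \<in> pts aff n. \<forall>g\<in>G. g x = 0}"
    using assms(1)[of "Suc i"] unfolding zclosed_def by (elim exE conjE)
  obtain z where z: "z \<in> Z i" "z \<notin> Z (Suc i)" using assms(2)[of i] by blast
  have "z \<in> pts aff n" using z(1) zclosed_subset_pts[OF assms(1)[of i]] by blast
  then obtain f where f: "f \<in> G" "f z \<noteq> 0" using z(2) unfolding G(2) by blast
  obtain e where e: "hp UNIV n e f" using bspec[OF G(1) f(1)] by (elim exE)
  have "\<forall>x\<in>Z (Suc i). f x = 0" using f(1) unfolding G(2) by blast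
  then have "f z = 0" by (rule LMs_eq_vanishing[OF psubset_imp_subset[OF assms(2)] i e _ z(1)])
  then show False using f(2) by simp
qed

text \<open>
  Noetherian induction.
\<close>

lemma minimal_closed:
  assumes "Q X" "\<And>Z. Q Z ==> zclosed aff UNIV n Z"
  shows "\<exists>Z\<subseteq>X. Q Z \<and> (\<forall>Z'. Z' \<subset> Z --> \<not> Q Z')"
proof (rule ccontr)
  assume not: "\<not> ?thesis"
  have "\<exists>Z. \<forall>i. (Q (Z i) \<and> Z i \<subseteq> X) \<and> Z (Suc i) \<subset> Z i"
  proof (rule dependent_nat_choice)
    show "\<exists>Z. Q Z \<and> Z \<subseteq> X" using assms(1) by blast
    fix Z assume Z: "Q Z \<and> Z \<subseteq> X"
    have "\<exists>Z'. Z' \<subset> Z \<and> Q Z'"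
    proof (rule ccontr)
      assume "\<not> ?thesis"
      then have "\<forall>Z'. Z' \<subset> Z --> \<not> Q Z'" by simp
      then have "\<exists>Z\<subseteq>X. Q Z \<and> (\<forall>Z'. Z' \<subset> Z --> \<not> Q Z')" using Z by (intro exI[of _ Z]) simp
      with not show False by (rule notE)
    qed
    then obtain Z' where "Z' \<subset> Z" "Q Z'" by (elim exE conjE)
    then show "\<exists>Z'. (Q Z' \<and> Z' \<subseteq> X) \<and> Z' \<subset> Z" using Z by (intro exI[of _ Z']) auto
  qed
  then obtain Z where Z: "\<forall>i. (Q (Z i) \<and> Z i \<subseteq> X) \<and> Z (Suc i) \<subset> Z i" by (elim exE)
  show False by (rule zclosed_chain_condition[of aff n Z]) (use Z assms(2) in simp_all)
qed

text \<open>
  On the line through \<open>y0\<close> and \<open>y1\<close>, both forms are nonzero polynomials.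
\<close>

lemma hp_product_nonzero:
  fixes f :: "(nat => 'a::field) => 'a"
  assumes inf: "infinite (UNIV :: 'a set)" and f: "hp UNIV n s f" "f y0 \<noteq> 0" and g: "hp UNIV n t g" "g y1 \<noteq> 0"
  shows "\<exists>y. f y * g y \<noteq> 0"
proof -
  define b where "b = (\<lambda>i. y1 i - y0 i)"
  obtain P where P: "\<forall>s. poly P s = f (\<lambda>i. y0 i + s * b i)" using hp_line[OF f(1)] by blast
  obtain Q where Q: "\<forall>s. poly Q s = g (\<lambda>i. y0 i + s * b i)" using hp_line[OF g(1)] by blast
  have "poly P 0 \<noteq> 0" using P f(2) by simp
  moreover have "poly Q 1 \<noteq> 0" using Q g(2) by (simp add: b_def)
  ultimately have "P * Q \<noteq> 0" by auto
  then obtain s where "poly (P * Q) s \<noteq> 0" using poly_nonzero_in_set[of "P * Q" UNIV] inf by blast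
  then show ?thesis using P Q by auto
qed

text \<open>
  If \<open>Z\<close> were the union of two smaller sets, each would satisfy a nonzero relation, and the product of
  the two would be a relation on \<open>Z\<close>. This replaces the decomposition into irreducible components.
\<close>

lemma minimal_indep_irreducible:
  fixes Z :: "(nat => 'a::field) set"
  assumes inf: "infinite (UNIV :: 'a set)" and Z: "zclosed aff UNIV n Z" "alg_indep UNIV Z r L"
    and mini: "\<And>Z'. Z' \<subset> Z ==> zclosed aff UNIV n Z' ==> \<not> alg_indep UNIV Z' r L"
  shows "irreducible_closed (zclosed aff UNIV n) Z"
  unfolding irreducible_closed_def
proof (intro conjI allI impI)
  show "Z \<noteq> {}"
  proof
    assume "Z = {}"
    then have "(1::'a) = 0" using alg_indepD[OF Z(2) hp.const[of 1]] by auto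
    then show False by simp
  qed
  fix A B assume AB: "zclosed aff UNIV n A \<and> zclosed aff UNIV n B \<and> Z = A \<union> B"
  show "Z = A \<or> Z = B"
  proof (rule ccontr)
    assume "\<not> ?thesis"
    then have "A \<subset> Z" "B \<subset> Z" using AB by auto
    then have "\<not> alg_indep UNIV A r L" "\<not> alg_indep UNIV B r L" using mini AB by auto
    then obtain s f y0 t g y1 where f: "hp UNIV r s f" "\<forall>x\<in>A. f (\<lambda>i. L i x) = 0" "f y0 \<noteq> 0"
      and g: "hp UNIV r t g" "\<forall>x\<in>B. g (\<lambda>i. L i x) = 0" "g y1 \<noteq> 0"
      unfolding alg_indep_def by blast
    have "f y * g y = 0" for y
      by (rule alg_indepD[OF Z(2) hp.mult[OF f(1) g(1)]]) (use AB f(2) g(2) in auto)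
    then show False using hp_product_nonzero[OF inf f(1,3) g(1,3)] by blast
  qed
qed (rule Z(1))

lemma alg_indep_pf:
  fixes X :: "(nat => 'a::field) set"
  assumes inf: "infinite (UNIV :: 'a set)" and X: "cone X" and M: "\<And>i. i < r ==> hp UNIV n 1 (M i)"
    and ai: "alg_indep UNIV X r M" and f: "pf UNIV r f" "\<And>x. x \<in> X ==> f (\<lambda>i. M i x) = 0"
  shows "f y = 0"
proof -
  obtain T c where c: "\<And>t. hp UNIV r t (c t)" "f = (\<lambda>x. \<Sum>t\<le>T. c t x)"
    using pf_decomp[OF f(1)] by auto
  have "c t y = 0" if t: "t \<le> T" for t y
  proof (rule alg_indepD[OF ai c(1)])
    fix x assume x: "x \<in> X"
    have sc: "c t (\<lambda>i. M i (\<lambda>i. a * x i)) = a ^ t * c t (\<lambda>i. M i x)" for a t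
    proof -
      have "c t (\<lambda>i. M i (\<lambda>i. a * x i)) = c t (\<lambda>i. a * M i x)"
        by (rule hp_cong[OF c(1)]) (use hp_scale[OF M] in simp)
      then show ?thesis using hp_scale[OF c(1)] by simp
    qed
    show "c t (\<lambda>i. M i x) = 0"
    proof (rule homogeneous_components_vanish[where c = c and T = T])
      fix a :: 'a assume "a \<noteq> 0"
      then have "(\<lambda>i. a * x i) \<in> X" using X x by (simp add: cone_def)
      then have "(\<Sum>t\<le>T. c t (\<lambda>i. M i (\<lambda>i. a * x i))) = 0" using f(2) c(2) by simp
      then show "(\<Sum>t\<le>T. c t (\<lambda>i. a * M i x)) = 0"
        unfolding sc hp_scale[OF c(1)] .
    qed (use inf hp_scale[OF c(1)] t in auto)
  qed
  then show ?thesis unfolding c(2) by simp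
qed

text \<open>
  At a common zero of the \<open>M\<^sub>i\<close> every form of degree larger than the degrees of the generators
  vanishes, but a power of a nonzero coordinate does not.
\<close>

lemma FG_no_zero:
  fixes X :: "(nat => 'a::field) set"
  assumes X: "x \<in> X" "X \<subseteq> pts aff n" and FG: "FG E n X r M" and E: "1 \<in> E"
  shows "\<exists>i<r. M i x \<noteq> 0"
proof (rule ccontr)
  assume "\<not> ?thesis"
  then have M0: "\<And>i. i < r ==> M i x = 0" by blast
  obtain U where U: "finite U" "\<And>t f. hp E n t f ==> \<exists>g. fgs E r M U t g \<and> (\<forall>x\<in>X. f x = g x)"
    using FG unfolding FG_def by blast
  obtain i where i: "x i \<noteq> 0" using X by (auto simp: pts_def split: if_splits)
  have "x \<in> vecs n" using X by (auto simp: pts_def)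
  then have "i < n" using i unfolding vecs_def by (metis (mono_tags, lifting) mem_Collect_eq not_le)
  define t where "t = Suc (\<Sum>v\<in>U. snd v)"
  have zero: "g x = 0" if "fgs E r M U t' g" "t' = t" for t' g
    using that
  proof (induction rule: fgs.induct)
    case (gen u a s b t')
    have "snd (u, a) \<le> (\<Sum>v\<in>U. snd v)" using U(1) gen(1) by (intro member_le_sum) auto
    then have "s > 0" using gen by (simp add: t_def)
    have "b (\<lambda>i. M i x) = 0" by (rule hp_zero_pos[OF gen(2) \<open>s > 0\<close>]) (rule M0)
    then show ?case by simp
  qed auto
  have "hp E n t (\<lambda>x. x i ^ t)" by (rule hp_power1[OF hp_var1[OF \<open>i < n\<close>] E])
  from U(2)[OF this] obtain g where g: "fgs E r M U t g" "\<forall>x\<in>X. x i ^ t = g x" by blast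
  then have "x i ^ t = 0" using zero[OF g(1)] X(1) by simp
  then show False using i by simp
qed

section \<open>Krull dimension\<close>

text \<open>
  Induction on \<open>d\<close>: choose an irreducible subset of the same dimension and a finite dominant projection
  of it. The preimage \<open>W\<close> of the hyperplane where the first form vanishes projects onto that
  hyperplane, by lying over, so its dimension is smaller by one.
\<close>

lemma chain_exists:
  fixes X :: "(nat => 'a::alg_closed_field) set"
  assumes inf: "infinite (UNIV :: 'a set)" and n: "n > 0"
    and "zclosed aff UNIV n X" "X \<noteq> {}" "degree (hpoly n X) = d"
  shows "\<exists>Z. (\<forall>i\<le>d. irreducible_closed (zclosed aff UNIV n) (Z i) \<and> Z i \<subseteq> X) \<and> (\<forall>i<d. Z i \<subset> Z (Suc i))"
  using assms(3-)
proof (induction d arbitrary: X)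
  \<comment> \<open>both cases start from an irreducible subset of full dimension\<close>
  note nn = noether_normalization[OF subfield_UNIV inf subfield_UNIV order_refl, where n = n and r = n and M = "\<lambda>i x. x i"]
  have normal: "\<exists>d L. (\<forall>i<Suc d. hp UNIV n 1 (L i)) \<and> FG UNIV n X (Suc d) L \<and> alg_indep UNIV X (Suc d) L \<and>
      lifts aff X (Suc d) L \<and> degree (hpoly n X) = d" if X: "zclosed aff UNIV n X" "X \<noteq> {}" for X :: "(nat => 'a) set"
  proof -
    have sub: "X \<subseteq> pts aff n" by (rule zclosed_subset_pts[OF X(1)])
    obtain d \<Lambda> where L: "\<forall>i<d. hp UNIV n 1 (\<Lambda> i)" "FG UNIV n X d (\<lambda>i x. \<Lambda> i (\<lambda>j. x j))"
      "alg_indep UNIV X d (\<lambda>i x. \<Lambda> i (\<lambda>j. x j))" "lifts aff X n (\<lambda>i x. x i) --> lifts aff X d (\<lambda>i x. \<Lambda> i (\<lambda>j. x j))"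
    proof -
      have "FG UNIV n X n (\<lambda>i x. x i)" by (rule FG_id) simp
      then have "\<exists>d \<Lambda>. noether_forms UNIV UNIV aff n X n (\<lambda>i x. x i) d \<Lambda>"
        by (intro nn[OF X(2) sub]) (use n in \<open>auto intro: hp.var\<close>)
      then show ?thesis unfolding noether_forms_def by (elim exE conjE) (rule that)
    qed
    obtain x where "x \<in> X" using X(2) by blast
    from FG_no_zero[OF this sub L(2)] have "d > 0" by auto
    then obtain d' where d': "d = Suc d'" by (cases d) auto
    have L1: "\<And>i. i < Suc d' ==> hp UNIV n 1 (\<Lambda> i)" using L(1) d' by simp
    have "degree (hpoly n X) = d'"
      by (rule degree_hpoly(1)[OF inf subfield_UNIV desc_UNIV L1]) (use L(2,3) d' in simp_all)
    moreover have "lifts aff X (Suc d') \<Lambda>" using L(4) lifts_id[OF X(1) n] d' by simp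
    ultimately show ?thesis using L1 L(2,3) d' by (intro exI[of _ d'] exI[of _ \<Lambda>]) simp
  qed
  have irred: "\<exists>Z\<subseteq>X. irreducible_closed (zclosed aff UNIV n) Z \<and> degree (hpoly n Z) = degree (hpoly n X)"
    if X: "zclosed aff UNIV n X" "X \<noteq> {}" for X :: "(nat => 'a) set"
  proof -
    obtain d L where L: "\<forall>i<Suc d. hp UNIV n 1 (L i)" "FG UNIV n X (Suc d) L" "alg_indep UNIV X (Suc d) L" "degree (hpoly n X) = d"
      using normal[OF X] by (elim exE conjE)
    let ?Q = "\<lambda>Z. zclosed aff UNIV n Z \<and> alg_indep UNIV Z (Suc d) L"
    obtain Z where Z: "Z \<subseteq> X" "zclosed aff UNIV n Z" "alg_indep UNIV Z (Suc d) L" "\<And>Z'. Z' \<subset> Z ==> \<not> ?Q Z'"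
      using minimal_closed[of ?Q X aff n] X(1) L(3) by blast
    have "irreducible_closed (zclosed aff UNIV n) Z"
      by (rule minimal_indep_irreducible[OF inf Z(2,3)]) (use Z(4) in blast)
    moreover have "degree (hpoly n Z) = d"
      by (rule degree_hpoly(1)[OF inf subfield_UNIV desc_UNIV _ FG_subset[OF L(2) Z(1)] Z(3)]) (use L(1) in blast)
    ultimately show ?thesis using Z(1) L(4) by (intro exI[of _ Z]) simp
  qed
  {
    case 0
    obtain Z where "Z \<subseteq> X" "irreducible_closed (zclosed aff UNIV n) Z" using irred[OF 0(1,2)] by blast
    then show ?case by (intro exI[of _ "\<lambda>_. Z"]) auto
  next
    case (Suc d)
    obtain Z where Z: "Z \<subseteq> X" "irreducible_closed (zclosed aff UNIV n) Z" "degree (hpoly n Z) = Suc d"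
      using irred[OF Suc.prems(1,2)] Suc.prems(3) by auto
    have Zc: "zclosed aff UNIV n Z" "Z \<noteq> {}" using Z(2) by (auto simp: irreducible_closed_def)
    obtain d' L where "\<forall>i<Suc d'. hp UNIV n 1 (L i)" "FG UNIV n Z (Suc d') L" "alg_indep UNIV Z (Suc d') L"
      "lifts aff Z (Suc d') L" "degree (hpoly n Z) = d'"
      using normal[OF Zc] by (elim exE conjE)
    then have L: "\<And>i. i < Suc (Suc d) ==> hp UNIV n 1 (L i)" "FG UNIV n Z (Suc (Suc d)) L" "alg_indep UNIV Z (Suc (Suc d)) L"
      "lifts aff Z (Suc (Suc d)) L" using Z(3) by auto
    define W where "W = {z\<in>Z. L 0 z = 0}"
    have Wc: "zclosed aff UNIV n W" unfolding W_def by (rule zclosed_cut[OF Zc(1) L(1)]) simp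
    define L' where "L' = (\<lambda>i. L (Suc i))"
    \<comment> \<open>projecting from this centre omits the first form\<close>
    define p where "p = (\<lambda>i::nat. if i = 0 then 1 else (0::'a))"
    have "(\<lambda>i x. away p (\<lambda>j. L j x) i) = L'" by (simp add: away_def p_def L'_def fun_eq_iff)
    moreover have "FG UNIV n W (Suc d) (\<lambda>i x. away p (\<lambda>j. L j x) i)"
    proof (rule projection_step[OF subfield_UNIV L(1)])
      show "FG UNIV n W (Suc (Suc d)) L" by (rule FG_subset[OF L(2)]) (auto simp: W_def)
      show "hp UNIV (Suc (Suc d)) 1 (\<lambda>y. y 0)" by (rule hp_var1) simp
    qed (auto simp: W_def p_def)
    ultimately have FGW: "FG UNIV n W (Suc d) L'" by simp
    \<comment> \<open>points of the hyperplane have preimages in \<open>W\<close>\<close>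
    have key: "f y = 0" if f: "hp UNIV (Suc d) t f" "\<And>x. x \<in> W ==> f (\<lambda>i. L' i x) = 0" and nz: "nz aff (Suc d) y" for t f y
    proof -
      let ?y = "case_nat 0 y"
      have nz': "nz aff (Suc (Suc d)) ?y"
      proof (cases aff)
        case False
        then obtain i where "i < Suc d" "y i \<noteq> 0" using nz unfolding nz_def by auto
        then show ?thesis using False unfolding nz_def by (auto intro!: exI[of _ "Suc i"])
      qed (use nz in \<open>simp add: nz_def\<close>)
      have "g ?y = 0" if "pf UNIV (Suc (Suc d)) g" "\<forall>x\<in>Z. g (\<lambda>i. L i x) = 0" for g
        by (rule alg_indep_pf[OF inf zclosed_cone[OF Zc(1)] L(1) L(3) that(1)]) (use that(2) in auto)
      then obtain x where x: "x \<in> Z" "\<forall>i<Suc (Suc d). L i x = ?y i"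
        using L(4) nz' unfolding lifts_def by blast
      have "x \<in> W" using x by (auto simp: W_def)
      have "f y = f (\<lambda>i. L' i x)" by (rule hp_cong[OF f(1)]) (use x(2) in \<open>auto simp: L'_def\<close>)
      then show ?thesis using f(2)[OF \<open>x \<in> W\<close>] by simp
    qed
    have aiW: "alg_indep UNIV W (Suc d) L'"
      unfolding alg_indep_def
    proof (intro allI impI)
      fix t f y assume f: "hp UNIV (Suc d) t f" "\<forall>x\<in>W. f (\<lambda>i. L' i x) = 0"
      \<comment> \<open>the excluded points lie on two coordinate hyperplanes, each of which meets the line in one point\<close>
      obtain P where P: "\<forall>s. poly P s = f (\<lambda>i. y i + s * 1)" using hp_line[OF f(1), of "\<lambda>_. 1" y] by blast
      have "poly P s = 0" if s: "s \<noteq> - y d" "s \<noteq> - y 0" for s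
      proof -
        have "y d + s \<noteq> 0" "y 0 + s \<noteq> 0" using s by (auto simp: add_eq_0_iff)
        then have "nz aff (Suc d) (\<lambda>i. y i + s * 1)" unfolding nz_def by (cases aff) auto
        then show ?thesis using key[OF f(1)] f(2) P by simp
      qed
      then have "UNIV - {- y d, - y 0} \<subseteq> {s. poly P s = 0}" by auto
      moreover have "infinite (UNIV - {- y d, - y 0})" using inf by simp
      ultimately have "infinite {s. poly P s = 0}" using finite_subset by blast
      then have "P = 0" using poly_roots_finite[of P] by argo
      then show "f y = 0" using P[rule_format, of 0] by simp
    qed
    have L'1: "hp UNIV n 1 (L' i)" if "i < Suc d" for i unfolding L'_def by (rule L(1)) (use that in simp)
    have degW: "degree (hpoly n W) = d"
      by (rule degree_hpoly(1)[OF inf subfield_UNIV desc_UNIV L'1 FGW aiW])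
    have "W \<noteq> {}"
    proof
      assume "W = {}"
      then have "(1::'a) = 0" using alg_indepD[OF aiW hp.const[of 1]] by auto
      then show False by simp
    qed
    from Suc.IH[OF Wc this degW] obtain C where C: "\<forall>i\<le>d. irreducible_closed (zclosed aff UNIV n) (C i) \<and> C i \<subseteq> W"
      "\<forall>i<d. C i \<subset> C (Suc i)" by (elim exE conjE)
    have "W \<subset> Z"
    proof -
      have "\<exists>z\<in>Z. L 0 z \<noteq> 0"
      proof (rule ccontr)
        assume "\<not> ?thesis"
        then have "(\<lambda>_. 1) (0::nat) = (0::'a)"
          by (intro alg_indepD[OF L(3) hp_var1[of 0], where y = "\<lambda>_. 1"]) auto
        then show False by simp
      qed
      then show ?thesis by (auto simp: W_def)
    qed
    then have top: "C d \<subset> Z" using C(1) by blast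
    define C' where "C' = (\<lambda>i. if i = Suc d then Z else C i)"
    have C': "C' (Suc d) = Z" "\<And>i. i \<le> d ==> C' i = C i" by (simp_all add: C'_def)
    show ?case
    proof (intro exI[of _ C'] conjI allI impI)
      fix i assume i: "i \<le> Suc d"
      show "irreducible_closed (zclosed aff UNIV n) (C' i)"
      proof (cases "i = Suc d")
        case False
        then show ?thesis using i C'(2)[of i] C(1)[rule_format, of i] by simp
      qed (use C'(1) Z(2) in simp)
      show "C' i \<subseteq> X"
      proof (cases "i = Suc d")
        case False
        then have "C' i \<subseteq> W" using i C'(2)[of i] C(1)[rule_format, of i] by simp
        then show ?thesis using \<open>W \<subset> Z\<close> Z(1) by blast
      qed (use C'(1) Z(1) in simp)
    next
      fix i assume i: "i < Suc d"
      show "C' i \<subset> C' (Suc i)"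
      proof (cases "i = d")
        case True
        then show ?thesis using C' top by simp
      next
        case False
        then show ?thesis using i C'(2)[of i] C'(2)[of "Suc i"] C(2)[rule_format, of i] by simp
      qed
    qed
  }
qed

theorem krull_dim_eq_degree:
  fixes X :: "(nat => 'a::alg_closed_field) set"
  assumes inf: "infinite (UNIV :: 'a set)" and n: "n > 0" and X: "zclosed aff UNIV n X" "X \<noteq> {}"
  shows "krull_dim (zclosed aff UNIV n) X = degree (hpoly n X)"
  unfolding krull_dim_def
proof (rule cSup_eq_maximum)
  show "degree (hpoly n X) \<in> {m. \<exists>Z. (\<forall>i\<le>m. irreducible_closed (zclosed aff UNIV n) (Z i) \<and> Z i \<subseteq> X) \<and> (\<forall>i<m. Z i \<subset> Z (Suc i))}"
    using chain_exists[OF inf n X refl] by blast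
next
  fix m assume "m \<in> {m. \<exists>Z. (\<forall>i\<le>m. irreducible_closed (zclosed aff UNIV n) (Z i) \<and> Z i \<subseteq> X) \<and> (\<forall>i<m. Z i \<subset> Z (Suc i))}"
  then obtain Z where Z: "\<forall>i\<le>m. irreducible_closed (zclosed aff UNIV n) (Z i) \<and> Z i \<subseteq> X" "\<forall>i<m. Z i \<subset> Z (Suc i)" by blast
  have "i \<le> m ==> i \<le> degree (hpoly n (Z i))" for i
  proof (induction i)
    case (Suc i)
    have "degree (hpoly n (Z i)) < degree (hpoly n (Z (Suc i)))"
      by (rule irreducible_degree_less) (use Suc.prems Z in auto)
    then show ?case using Suc by simp
  qed simp
  from this[of m] have "m \<le> degree (hpoly n (Z m))" by simp
  also have "... \<le> degree (hpoly n X)" by (rule degree_hpoly_mono) (use Z(1) in blast)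
  finally show "m \<le> degree (hpoly n X)" .
qed

section \<open>Automorphisms of the algebraic closure\<close>

text \<open>
  Partial homomorphisms, as relations. They extend the identity of \<open>E\<close>, and the last clause makes them
  single-valued. The domain is a subring, which is a field if everything is algebraic over \<open>E\<close>.
\<close>

definition partial_hom :: "'a::field set => ('a \<times> 'a) set => bool" where
  "partial_hom E R \<longleftrightarrow> (\<forall>e\<in>E. (e, e) \<in> R) \<and>
     (\<forall>x y x' y'. (x, y) \<in> R --> (x', y') \<in> R --> (x + x', y + y') \<in> R \<and> (x * x', y * y') \<in> R) \<and>
     (\<forall>y. (0, y) \<in> R --> y = 0)"

text \<open>
  \<open>f'\<close> is the polynomial \<open>f\<close> with the homomorphism applied to its coefficients.
\<close>

definition polys_rel :: "('a::field \<times> 'a) set => 'a poly => 'a poly => bool" where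
  "polys_rel R f f' \<longleftrightarrow> (\<forall>i. (coeff f i, coeff f' i) \<in> R)"

lemma partial_homD:
  assumes "partial_hom E R" "is_subfield E"
  shows "e \<in> E ==> (e, e) \<in> R" "(x, y) \<in> R ==> (x', y') \<in> R ==> (x + x', y + y') \<in> R"
    "(x, y) \<in> R ==> (x', y') \<in> R ==> (x * x', y * y') \<in> R" "(0, y) \<in> R ==> y = 0"
    "(x, y) \<in> R ==> (x', y') \<in> R ==> (x - x', y - y') \<in> R" "(x, y) \<in> R ==> (x, y') \<in> R ==> y = y'"
    "(0, 0) \<in> R" "(1, 1) \<in> R"
proof -
  show 1: "e \<in> E ==> (e, e) \<in> R" for e using assms(1) unfolding partial_hom_def by blast
  show 2: "(x, y) \<in> R ==> (x', y') \<in> R ==> (x + x', y + y') \<in> R" for x y x' y'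
    using assms(1) unfolding partial_hom_def by blast
  show 3: "(x, y) \<in> R ==> (x', y') \<in> R ==> (x * x', y * y') \<in> R" for x y x' y'
    using assms(1) unfolding partial_hom_def by blast
  show 4: "(0, y) \<in> R ==> y = 0" for y using assms(1) unfolding partial_hom_def by blast
  have m1: "(- 1, - 1) \<in> R" by (rule 1) (simp add: subfieldD assms(2))
  show 5: "(x, y) \<in> R ==> (x', y') \<in> R ==> (x - x', y - y') \<in> R" for x y x' y'
    using 2[OF _ 3[OF m1], of x y x' y'] by simp
  show "(x, y) \<in> R ==> (x, y') \<in> R ==> y = y'" using 5[of x y x y'] 4[of "y - y'"] by simp
  show "(0, 0) \<in> R" "(1, 1) \<in> R" by (rule 1, simp add: subfieldD assms(2))+
qed

lemma partial_hom_sum: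
  assumes "partial_hom E R" "is_subfield E"
  shows "(\<And>i. i \<in> I ==> (f i, g i) \<in> R) ==> (\<Sum>i\<in>I. f i, \<Sum>i\<in>I. g i) \<in> R"
  by (induction I rule: infinite_finite_induct) (auto intro: partial_homD[OF assms])

lemma partial_hom_power:
  assumes "partial_hom E R" "is_subfield E"
  shows "(x, y) \<in> R ==> (x ^ n, y ^ n) \<in> R"
  by (induction n) (auto intro: partial_homD[OF assms])

lemma partial_hom_poly:
  assumes "partial_hom E R" "is_subfield E" "p \<in> polys_over E" "(x, y) \<in> R"
  shows "(poly p x, poly p y) \<in> R"
proof -
  have "(coeff p i, coeff p i) \<in> R" for i
    using assms(3) partial_homD(1)[OF assms(1,2)] by (simp add: polys_over_def)
  then show ?thesis unfolding poly_altdef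
    by (intro partial_hom_sum[OF assms(1,2)] partial_homD(3)[OF assms(1,2)] partial_hom_power[OF assms(1,2) assms(4)])
qed

lemma algebraic_min_poly:
  assumes "algebraic_over E x"
  obtains p where "p \<in> polys_over E" "p \<noteq> 0" "poly p x = 0"
    "\<And>q. q \<in> polys_over E ==> q \<noteq> 0 ==> poly q x = 0 ==> degree p \<le> degree q"
proof -
  obtain p0 where "p0 \<in> polys_over E \<and> p0 \<noteq> 0 \<and> poly p0 x = 0" using assms by (auto simp: algebraic_over_def)
  from arg_min_nat_lemma[of "\<lambda>p. p \<in> polys_over E \<and> p \<noteq> 0 \<and> poly p x = 0", OF this, of degree] that
  show ?thesis by blast
qed

text \<open>
  The minimal polynomial of \<open>x\<close> has a nonzero constant term, so the inverse of \<open>x\<close> is a polynomial in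
  \<open>x\<close>.
\<close>

lemma partial_hom_inverse:
  assumes R: "partial_hom E R" and E: "is_subfield E" and alg: "algebraic_over E x" and xy: "(x, y) \<in> R" "x \<noteq> 0"
  shows "(inverse x, inverse y) \<in> R" "y \<noteq> 0"
proof -
  obtain p where p: "p \<in> polys_over E" "p \<noteq> 0" "poly p x = 0"
    "\<And>q. q \<in> polys_over E ==> q \<noteq> 0 ==> poly q x = 0 ==> degree p \<le> degree q"
    using algebraic_min_poly[OF alg] by blast
  obtain c q where pc: "p = pCons c q" by (cases p)
  have "c = coeff p 0" "\<And>i. coeff q i = coeff p (Suc i)" by (simp_all add: pc)
  then have cE: "c \<in> E" and qE: "q \<in> polys_over E" using p(1) by (auto simp: polys_over_def)
  have "c \<noteq> 0"
  proof
    assume "c = 0"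
    then have "poly q x = 0" "q \<noteq> 0" using p(2,3) xy(2) pc by auto
    then have "degree p \<le> degree q" using p(4) qE by blast
    then show False using pc \<open>q \<noteq> 0\<close> by simp
  qed
  define z where "z = - inverse c * poly q x"
  have "c + x * poly q x = 0" using p(3) pc by simp
  then have "x * poly q x = - c" by (simp add: eq_neg_iff_add_eq_0 add.commute)
  moreover have "x * z = - inverse c * (x * poly q x)" by (simp add: z_def)
  ultimately have "x * z = 1" using \<open>c \<noteq> 0\<close> by simp
  then have z: "inverse x = z" using xy(2) by (simp add: field_simps)
  have "(- inverse c, - inverse c) \<in> R" by (rule partial_homD(1)[OF R E]) (simp add: cE subfieldD[OF E])
  then have "(z, - inverse c * poly q y) \<in> R"
    unfolding z_def by (intro partial_homD(3)[OF R E] partial_hom_poly[OF R E qE xy(1)])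
  then obtain w where w: "(inverse x, w) \<in> R" using z by auto
  have "(x * inverse x, y * w) \<in> R" by (rule partial_homD(3)[OF R E xy(1) w])
  then have "(1, y * w) \<in> R" using xy(2) by simp
  then have "y * w = 1" using partial_homD(6)[OF R E _ partial_homD(8)[OF R E]] by blast
  then have "y \<noteq> 0" "inverse y = w" by (auto simp: inverse_unique)
  then show "(inverse x, inverse y) \<in> R" "y \<noteq> 0" using w by auto
qed

lemma polys_rel_closed:
  assumes R: "partial_hom E R" and E: "is_subfield E"
  shows "polys_rel R f f' ==> polys_rel R g g' ==> polys_rel R (f + g) (f' + g')"
    "polys_rel R f f' ==> polys_rel R g g' ==> polys_rel R (f - g) (f' - g')"
    "polys_rel R f f' ==> polys_rel R g g' ==> polys_rel R (f * g) (f' * g')"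
    "(c, c') \<in> R ==> polys_rel R (monom c n) (monom c' n)"
    "polys_rel R 0 g' ==> g' = 0"
  by (auto simp: polys_rel_def coeff_mult poly_eq_iff intro!: partial_homD[OF R E] partial_hom_sum[OF R E]
      dest: partial_homD(4)[OF R E])

lemma poly_altdef_le: "degree (p :: 'a::field poly) \<le> n ==> poly p x = (\<Sum>i\<le>n. coeff p i * x ^ i)"
  unfolding poly_altdef by (rule sum.mono_neutral_left) (auto simp: coeff_eq_0)

text \<open>
  Division with remainder by a monic polynomial, carried out for both polynomials in parallel.
\<close>

lemma polys_rel_division:
  assumes R: "partial_hom E R" and E: "is_subfield E" and p: "polys_rel R p p'" "lead_coeff p = 1"
    and f: "polys_rel R f f'"
  shows "\<exists>h h' r r'. polys_rel R h h' \<and> polys_rel R r r' \<and> f = p * h + r \<and> f' = p' * h' + r' \<and> (r = 0 \<or> degree r < degree p)"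
proof -
  have "\<forall>i\<ge>N. coeff f i = 0 ==> polys_rel R f f' ==> \<exists>h h' r r'. polys_rel R h h' \<and> polys_rel R r r' \<and>
      f = p * h + r \<and> f' = p' * h' + r' \<and> (r = 0 \<or> degree r < degree p)" for N f f'
  proof (induction N arbitrary: f f')
    case 0
    then have "f = 0" by (intro poly_eqI) auto
    then have "f' = 0" using polys_rel_closed(5)[OF R E] 0 by blast
    have "polys_rel R 0 0" using partial_homD(7)[OF R E] by (simp add: polys_rel_def)
    then show ?case using \<open>f = 0\<close> \<open>f' = 0\<close> by (intro exI[of _ 0]) simp
  next
    case (Suc N)
    show ?case
    proof (cases "N < degree p")
      case True
      have "degree f \<le> N" using Suc.prems(1) by (intro degree_le) auto
      moreover have "polys_rel R 0 0" using partial_homD(7)[OF R E] by (simp add: polys_rel_def)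
      ultimately show ?thesis using Suc.prems(2) True
        by (intro exI[of _ 0] exI[of _ f] exI[of _ f'] conjI) auto
    next
      case False
      define c where "c = coeff f N"
      define c' where "c' = coeff f' N"
      have cc': "polys_rel R (monom c (N - degree p)) (monom c' (N - degree p))"
        by (rule polys_rel_closed(4)[OF R E]) (use Suc.prems(2) in \<open>simp add: c_def c'_def polys_rel_def\<close>)
      define g where "g = f - monom c (N - degree p) * p"
      define g' where "g' = f' - monom c' (N - degree p) * p'"
      have gg': "polys_rel R g g'"
        unfolding g_def g'_def by (intro polys_rel_closed(2,3)[OF R E] Suc.prems(2) cc' p(1))
      have "coeff g i = 0" if i: "i \<ge> N" for i
      proof (cases "i = N")
        case True
        then show ?thesis using False p(2) by (simp add: g_def coeff_monom_mult c_def)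
      next
        case neq: False
        then have "i > N" using i by simp
        then have "coeff p (i - (N - degree p)) = 0" using False by (intro coeff_eq_0) linarith
        then show ?thesis using Suc.prems(1) \<open>i > N\<close> by (simp add: g_def coeff_monom_mult)
      qed
      then obtain h h' r r' where IH: "polys_rel R h h'" "polys_rel R r r'" "g = p * h + r" "g' = p' * h' + r'" "r = 0 \<or> degree r < degree p"
        using Suc.IH[OF _ gg'] by blast
      show ?thesis
      proof (intro exI conjI)
        show "polys_rel R (monom c (N - degree p) + h) (monom c' (N - degree p) + h')"
          by (intro polys_rel_closed(1)[OF R E] cc' IH(1))
        show "f = p * (monom c (N - degree p) + h) + r" using IH(3) by (simp add: g_def algebra_simps)
        show "f' = p' * (monom c' (N - degree p) + h') + r'" using IH(4) by (simp add: g'_def algebra_simps)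
      qed (use IH in auto)
    qed
  qed
  from this[of "Suc (degree f)" f f'] f show ?thesis by (auto simp: coeff_eq_0)
qed

text \<open>
  The extension is well defined since \<open>f(a) = 0\<close> implies that the minimal polynomial \<open>p\<close> divides \<open>f\<close>, and
  then \<open>p'\<close> divides \<open>f'\<close>.
\<close>

lemma partial_hom_extend:
  fixes a :: "'a::field"
  assumes R: "partial_hom E R" and E: "is_subfield E"
    and p: "polys_rel R p p'" "lead_coeff p = 1" "poly p a = 0" "poly p' a' = 0"
    and mini: "\<And>q q'. polys_rel R q q' ==> q \<noteq> 0 ==> poly q a = 0 ==> degree p \<le> degree q"
  shows "\<exists>R'. partial_hom E R' \<and> R \<subseteq> R' \<and> (a, a') \<in> R'"
proof -
  define R' where "R' = {(poly f a, poly f' a') | f f'. polys_rel R f f'}"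
  have key: "poly f' a' = 0" if f: "polys_rel R f f'" "poly f a = 0" for f f'
  proof -
    obtain h h' r r' where hr: "polys_rel R h h'" "polys_rel R r r'" "f = p * h + r" "f' = p' * h' + r'" "r = 0 \<or> degree r < degree p"
      using polys_rel_division[OF R E p(1,2) f(1)] by blast
    have "poly r a = 0" using f(2) hr(3) p(3) by simp
    then have "r = 0" using mini[OF hr(2)] hr(5) by fastforce
    then have "r' = 0" using polys_rel_closed(5)[OF R E] hr(2) by blast
    then show ?thesis using hr(4) p(4) by simp
  qed
  have sub: "R \<subseteq> R'"
  proof
    fix z assume "z \<in> R"
    obtain x y where z: "z = (x, y)" by (cases z)
    have "polys_rel R (monom x 0) (monom y 0)" by (rule polys_rel_closed(4)[OF R E]) (use \<open>z \<in> R\<close> z in simp)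
    then show "z \<in> R'" unfolding R'_def z using poly_monom[of x 0 a] poly_monom[of y 0 a'] by force
  qed
  have "polys_rel R (monom 1 1) (monom 1 1)" by (rule polys_rel_closed(4)[OF R E partial_homD(8)[OF R E]])
  then have aa': "(a, a') \<in> R'" unfolding R'_def using poly_monom[of 1 1 a] poly_monom[of 1 1 a'] by force
  have "partial_hom E R'"
    unfolding partial_hom_def
  proof (intro conjI allI impI ballI)
    show "(e, e) \<in> R'" if "e \<in> E" for e using sub partial_homD(1)[OF R E that] by blast
    fix x y x' y' assume "(x, y) \<in> R'" "(x', y') \<in> R'"
    then obtain f f' g g' where fg: "polys_rel R f f'" "x = poly f a" "y = poly f' a'" "polys_rel R g g'" "x' = poly g a" "y' = poly g' a'"
      unfolding R'_def by blast
    show "(x + x', y + y') \<in> R'" unfolding R'_def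
      by (intro CollectI exI[of _ "f + g"] exI[of _ "f' + g'"] conjI polys_rel_closed(1)[OF R E]) (use fg in auto)
    show "(x * x', y * y') \<in> R'" unfolding R'_def
      by (intro CollectI exI[of _ "f * g"] exI[of _ "f' * g'"] conjI polys_rel_closed(3)[OF R E]) (use fg in auto)
  next
    fix y assume "(0, y) \<in> R'"
    then obtain f f' where "polys_rel R f f'" "0 = poly f a" "y = poly f' a'" unfolding R'_def by blast
    then show "y = 0" using key by metis
  qed
  then show ?thesis using sub aa' by blast
qed

lemma partial_hom_min_poly:
  fixes a :: "'a::alg_closed_field"
  assumes R: "partial_hom E R" and E: "is_subfield E" and alg: "\<And>x. algebraic_over E x"
  shows "\<exists>R' a'. partial_hom E R' \<and> R \<subseteq> R' \<and> (a, a') \<in> R'"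
proof -
  define Q where "Q = (\<lambda>p. \<exists>p'. polys_rel R p p' \<and> p \<noteq> 0 \<and> poly p a = 0)"
  have "\<exists>p. Q p"
  proof -
    obtain p where "p \<in> polys_over E" "p \<noteq> 0" "poly p a = 0" using alg[of a] by (auto simp: algebraic_over_def)
    moreover from this have "polys_rel R p p" using partial_homD(1)[OF R E] by (auto simp: polys_rel_def polys_over_def)
    ultimately show ?thesis unfolding Q_def by blast
  qed
  then obtain p where p: "Q p" "\<And>q. Q q ==> degree p \<le> degree q" using arg_min_nat_lemma[of Q _ degree] by blast
  then obtain p' where p': "polys_rel R p p'" "p \<noteq> 0" "poly p a = 0" unfolding Q_def by blast
  define c where "c = lead_coeff p"
  define c' where "c' = coeff p' (degree p)"
  have c: "c \<noteq> 0" "(c, c') \<in> R" using p'(1,2) by (auto simp: c_def c'_def polys_rel_def)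
  define s where "s = smult (inverse c) p"
  define s' where "s' = smult (inverse c') p'"
  have inv: "(inverse c, inverse c') \<in> R" "c' \<noteq> 0" by (rule partial_hom_inverse[OF R E alg c(2,1)])+
  have s: "polys_rel R s s'"
    using p'(1) inv(1) by (auto simp: polys_rel_def s_def s'_def intro: partial_homD(3)[OF R E])
  have s1: "lead_coeff s = 1" "poly s a = 0" "degree s = degree p"
    using c(1) p'(3) by (auto simp: s_def c_def)
  have "coeff s' (degree p) = 1" using inv(2) by (simp add: s'_def c'_def)
  then have "degree s' \<ge> degree p" by (intro le_degree) simp
  have "degree p > 0"
  proof (rule ccontr)
    assume "\<not> ?thesis"
    then obtain d where "p = [:d:]" using degree_eq_zeroE by auto
    then show False using p'(2,3) by auto
  qed
  then obtain a' where a': "poly s' a' = 0"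
    using alg_closed_imp_poly_has_root[of s'] \<open>degree s' \<ge> degree p\<close> by auto
  have m: "degree s \<le> degree q" if "polys_rel R q q'" "q \<noteq> 0" "poly q a = 0" for q q'
    using p(2)[of q] that s1(3) unfolding Q_def by auto
  have "\<exists>R'. partial_hom E R' \<and> R \<subseteq> R' \<and> (a, a') \<in> R'"
    by (rule partial_hom_extend[OF R E s s1(1,2) a']) (rule m)
  then show ?thesis by blast
qed

lemma partial_hom_Union:
  assumes C: "C \<noteq> {}" "\<And>R. R \<in> C ==> partial_hom E R" "\<And>R S. R \<in> C ==> S \<in> C ==> R \<subseteq> S \<or> S \<subseteq> R" and E: "is_subfield E"
  shows "partial_hom E (\<Union>C)"
  unfolding partial_hom_def
proof (intro conjI allI impI ballI)
  fix e assume "e \<in> E"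
  then show "(e, e) \<in> \<Union>C" using C(1,2) partial_homD(1)[OF _ E] by blast
next
  fix x y x' y' assume "(x, y) \<in> \<Union>C" "(x', y') \<in> \<Union>C"
  then obtain R where R: "R \<in> C" "(x, y) \<in> R" "(x', y') \<in> R" using C(3) by blast
  show "(x + x', y + y') \<in> \<Union>C" "(x * x', y * y') \<in> \<Union>C"
    using partial_homD(2,3)[OF C(2)[OF R(1)] E R(2,3)] R(1) by blast+
next
  fix y assume "(0, y) \<in> \<Union>C"
  then show "y = 0" using partial_homD(4)[OF C(2) E] by blast
qed

definition field_aut :: "'a::field set => ('a => 'a) => bool" where
  "field_aut E \<sigma> \<longleftrightarrow> (\<forall>x y. \<sigma> (x + y) = \<sigma> x + \<sigma> y) \<and> (\<forall>x y. \<sigma> (x * y) = \<sigma> x * \<sigma> y) \<and>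
     (\<forall>e\<in>E. \<sigma> e = e) \<and> bij \<sigma>"

lemma field_autD:
  assumes "field_aut E \<sigma>" "is_subfield E"
  shows "\<sigma> (x + y) = \<sigma> x + \<sigma> y" "\<sigma> (x * y) = \<sigma> x * \<sigma> y" "e \<in> E ==> \<sigma> e = e" "\<sigma> 0 = 0" "\<sigma> 1 = 1"
    "\<sigma> x = 0 \<longleftrightarrow> x = 0" "\<exists>y. \<sigma> y = x" "\<sigma> (\<Sum>i\<in>I. f i) = (\<Sum>i\<in>I. \<sigma> (f i))"
proof -
  show add: "\<sigma> (x + y) = \<sigma> x + \<sigma> y" and "\<sigma> (x * y) = \<sigma> x * \<sigma> y" and *: "\<And>e. e \<in> E ==> \<sigma> e = e" for x y
    using assms(1) by (auto simp: field_aut_def)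
  show 0: "\<sigma> 0 = 0" "\<sigma> 1 = 1" by (rule *, simp add: subfieldD assms(2))+
  have "bij \<sigma>" using assms(1) by (simp add: field_aut_def)
  then have "inj \<sigma>" "surj \<sigma>" by (auto simp: bij_def)
  show "\<sigma> x = 0 \<longleftrightarrow> x = 0" using injD[OF \<open>inj \<sigma>\<close>, of x 0] 0 by auto
  show "\<exists>y. \<sigma> y = x" using surjD[OF \<open>surj \<sigma>\<close>, of x] by metis
  show "\<sigma> (\<Sum>i\<in>I. f i) = (\<Sum>i\<in>I. \<sigma> (f i))"
    by (induction I rule: infinite_finite_induct) (auto simp: 0 add)
qed

text \<open>
  A maximal extension is total. It is injective as a homomorphism of fields, and surjective because it
  permutes the finitely many roots of each polynomial over \<open>E\<close>.
\<close>

lemma field_aut_extend: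
  fixes R :: "('a::alg_closed_field \<times> 'a) set"
  assumes R: "partial_hom E R" and E: "is_subfield E" and alg: "\<And>x::'a. algebraic_over E x"
  shows "\<exists>\<sigma>. field_aut E \<sigma> \<and> (\<forall>(x, y)\<in>R. \<sigma> x = y)"
proof -
  let ?A = "{S. partial_hom E S \<and> R \<subseteq> S}"
  have "\<exists>M\<in>?A. \<forall>X\<in>?A. M \<subseteq> X --> X = M"
  proof (rule subset_Zorn_nonempty)
    show "?A \<noteq> {}" using R by blast
    fix C assume C: "C \<noteq> {}" "subset.chain ?A C"
    have "partial_hom E (\<Union>C)"
      by (rule partial_hom_Union[OF C(1) _ _ E]) (use C(2) in \<open>auto simp: subset_chain_def\<close>)
    moreover obtain S where S: "S \<in> C" using C(1) by blast
    then have "R \<subseteq> S" using C(2) by (auto simp: subset_chain_def)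
    then have "R \<subseteq> \<Union>C" using S by blast
    ultimately show "\<Union>C \<in> ?A" by simp
  qed
  then obtain M where M0: "M \<in> ?A" "\<forall>X\<in>?A. M \<subseteq> X --> X = M" by (elim bexE)
  then have M: "partial_hom E M" "R \<subseteq> M" "\<And>X. partial_hom E X ==> R \<subseteq> X ==> M \<subseteq> X ==> X = M" by simp_all
  have total: "\<exists>y. (x, y) \<in> M" for x
  proof -
    obtain R' y where R': "partial_hom E R'" "M \<subseteq> R'" "(x, y) \<in> R'"
      using partial_hom_min_poly[OF M(1) E alg] by blast
    then have "R' = M" using M(2,3) by blast
    then show ?thesis using R'(3) by blast
  qed
  define \<sigma> where "\<sigma> = (\<lambda>x. SOME y. (x, y) \<in> M)"
  have \<sigma>: "(x, \<sigma> x) \<in> M" for x unfolding \<sigma>_def by (rule someI_ex[OF total])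
  have uniq: "\<sigma> x = y" if "(x, y) \<in> M" for x y by (rule partial_homD(6)[OF M(1) E \<sigma> that])
  have add: "\<sigma> (x + y) = \<sigma> x + \<sigma> y" for x y by (rule uniq[OF partial_homD(2)[OF M(1) E \<sigma> \<sigma>]])
  have mult: "\<sigma> (x * y) = \<sigma> x * \<sigma> y" for x y by (rule uniq[OF partial_homD(3)[OF M(1) E \<sigma> \<sigma>]])
  have fixE: "\<sigma> e = e" if "e \<in> E" for e by (rule uniq[OF partial_homD(1)[OF M(1) E that]])
  have diff: "\<sigma> (x - y) = \<sigma> x - \<sigma> y" for x y by (rule uniq[OF partial_homD(5)[OF M(1) E \<sigma> \<sigma>]])
  have inj: "inj \<sigma>"
  proof (rule injI, rule ccontr)
    fix x y assume "\<sigma> x = \<sigma> y" "x \<noteq> y"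
    then have "x - y \<noteq> 0" "\<sigma> (x - y) = 0" by (simp_all add: diff)
    then show False using partial_hom_inverse(2)[OF M(1) E alg \<sigma>, of "x - y"] by simp
  qed
  have "surj \<sigma>"
    unfolding surj_def
  proof
    fix y
    obtain p where p: "p \<in> polys_over E" "p \<noteq> 0" "poly p y = 0" using alg[of y] by (auto simp: algebraic_over_def)
    let ?S = "{x. poly p x = 0}"
    have "\<sigma> ` ?S \<subseteq> ?S"
    proof
      fix z assume "z \<in> \<sigma> ` ?S"
      then obtain x where x: "poly p x = 0" "z = \<sigma> x" by blast
      have "(poly p x, poly p (\<sigma> x)) \<in> M" by (rule partial_hom_poly[OF M(1) E p(1) \<sigma>])
      then show "z \<in> ?S" using x partial_homD(4)[OF M(1) E] by simp
    qed
    then have "\<sigma> ` ?S = ?S" using endo_inj_surj[OF poly_roots_finite[OF p(2)]] inj inj_on_subset by blast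
    then show "\<exists>x. y = \<sigma> x" using p(3) by blast
  qed
  then have "field_aut E \<sigma>" unfolding field_aut_def using add mult fixE inj \<open>surj \<sigma>\<close> by (auto simp: bij_def)
  moreover have "\<forall>(x, y)\<in>R. \<sigma> x = y" using uniq M(2) by auto
  ultimately show ?thesis by blast
qed

text \<open>
  Over a perfect field the minimal polynomial \<open>p\<close> is separable: otherwise its derivative vanishes, so it
  is a polynomial in the \<open>P\<close>-th power of the variable, where \<open>P\<close> is the characteristic, and the polynomial
  with the \<open>P\<close>-th roots of its coefficients has a smaller degree and vanishes at \<open>a\<close> as well. So \<open>a\<close> is a
  simple root, and there is another one.
\<close>

lemma conjugate_root_exists:
  fixes a :: "'a::alg_closed_field"
  assumes E: "is_subfield E" and perf: "\<And>x. CHAR('a) > 0 ==> x ^ CHAR('a) \<in> E ==> x \<in> E" and a: "a \<notin> E"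
    and p: "p \<in> polys_over E" "lead_coeff p = 1" "poly p a = 0"
    "\<And>q. q \<in> polys_over E ==> q \<noteq> 0 ==> poly q a = 0 ==> degree p \<le> degree q"
  shows "\<exists>b. b \<noteq> a \<and> poly p b = 0"
proof -
  have p0: "p \<noteq> 0" using p(2) by auto
  have deg1: "degree p > 0"
  proof (rule ccontr)
    assume "\<not> ?thesis"
    then obtain d where "p = [:d:]" using degree_eq_zeroE by auto
    then show False using p0 p(3) by auto
  qed
  have deg2: "degree p \<noteq> 1"
  proof
    assume 1: "degree p = 1"
    then have "poly p a = coeff p 0 + a" using p(2) by (simp add: poly_altdef)
    then have "a = - coeff p 0" using p(3) by (simp add: eq_neg_iff_add_eq_0 add.commute)
    then show False using a p(1) subfieldD(7)[OF E] by (auto simp: polys_over_def)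
  qed
  have "pderiv p \<noteq> 0"
  proof
    assume d0: "pderiv p = 0"
    have co: "of_nat i * coeff p i = 0" if "i > 0" for i
      using arg_cong[OF d0, of "\<lambda>q. coeff q (i - 1)"] that by (simp add: coeff_pderiv)
    have "of_nat (degree p) = (0::'a)" using co[of "degree p"] p(2) deg1 by simp
    then have ch: "CHAR('a) > 0" using deg1 unfolding CHAR_pos_iff by blast
    define P where "P = CHAR('a)"
    have prime: "prime P" unfolding P_def by (rule prime_CHAR_semidom[OF ch])
    then have P: "P > 1" by (rule prime_gt_1_nat)
    \<comment> \<open>only exponents divisible by the characteristic occur\<close>
    have supp: "P dvd i" if "coeff p i \<noteq> 0" for i
    proof (cases "i = 0")
      case False
      then have "of_nat i = (0::'a)" using co[of i] that by auto
      then show ?thesis unfolding P_def by (simp add: of_nat_eq_0_iff_char_dvd)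
    qed simp
    obtain rt where rt: "\<And>x::'a. rt x ^ P = x" using nth_root_exists[of P] P by (metis less_trans zero_less_one)
    define N where "N = degree p div P"
    have dN: "degree p = P * N" using supp[of "degree p"] p0 by (simp add: N_def)
    \<comment> \<open>its \<open>P\<close>-th power has the same value at \<open>a\<close> as \<open>p\<close>\<close>
    define q where "q = (\<Sum>j\<le>N. monom (rt (coeff p (P * j))) j)"
    have cq: "coeff q j = (if j \<le> N then rt (coeff p (P * j)) else 0)" for j by (simp add: q_def coeff_sum)
    have "rt (coeff p i) \<in> E" for i
      by (rule perf[OF ch]) (use rt[of "coeff p i"] p(1) in \<open>simp add: P_def polys_over_def\<close>)
    then have qE: "q \<in> polys_over E" by (auto simp: polys_over_def cq subfieldD[OF E])
    have "poly p a = (\<Sum>i\<in>(\<lambda>j. P * j) ` {..N}. coeff p i * a ^ i)"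
      unfolding poly_altdef
    proof (rule sum.mono_neutral_right)
      show "(\<lambda>j. P * j) ` {..N} \<subseteq> {..degree p}" using dN by auto
      show "\<forall>i\<in>{..degree p} - (\<lambda>j. P * j) ` {..N}. coeff p i * a ^ i = 0"
      proof
        fix i assume i: "i \<in> {..degree p} - (\<lambda>j. P * j) ` {..N}"
        have "\<not> P dvd i"
        proof
          assume "P dvd i"
          then obtain j where "i = P * j" by blast
          then show False using i dN P by auto
        qed
        then show "coeff p i * a ^ i = 0" using supp by auto
      qed
    qed auto
    also have "... = (\<Sum>j\<le>N. coeff p (P * j) * a ^ (P * j))"
      by (subst sum.reindex) (use P in \<open>auto simp: inj_on_def\<close>)
    also have "... = (\<Sum>j\<le>N. (rt (coeff p (P * j)) * a ^ j) ^ P)"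
      by (intro sum.cong refl) (simp add: power_mult_distrib rt mult.commute flip: power_mult)
    also have "... = (\<Sum>j\<le>N. rt (coeff p (P * j)) * a ^ j) ^ P"
      by (rule freshmans_dream_sum[symmetric]) (use prime in \<open>simp_all add: P_def\<close>)
    also have "... = poly q a ^ P" by (simp add: q_def poly_sum poly_monom)
    finally have "poly q a = 0" using p(3) by simp
    moreover have "coeff q N \<noteq> 0"
    proof
      assume "coeff q N = 0"
      then have "rt (coeff p (degree p)) = 0" by (simp add: cq dN)
      then show False using rt[of "coeff p (degree p)"] p(2) P by (simp add: power_0_left)
    qed
    then have "q \<noteq> 0" by auto
    ultimately have "degree p \<le> degree q" using p(4)[OF qE] by blast
    moreover have "degree q \<le> N" by (rule degree_le) (simp add: cq)
    ultimately have le: "P * N \<le> N" using dN by linarith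
    have "N > 0" using dN deg1 by (cases N) auto
    then have "1 * N < P * N" using P by (intro mult_strict_right_mono) auto
    then show False using le by simp
  qed
  moreover have "pderiv p \<in> polys_over E"
  proof -
    have "of_nat n \<in> E" for n by (induction n) (auto simp: subfieldD[OF E])
    then show ?thesis using p(1) by (auto simp: polys_over_def coeff_pderiv intro!: subfieldD(5)[OF E] simp del: of_nat_Suc)
  qed
  moreover have "degree (pderiv p) < degree p"
  proof (rule degree_lessI)
    show "pderiv p \<noteq> 0 \<or> degree p > 0" using deg1 by simp
    show "\<forall>k\<ge>degree p. coeff (pderiv p) k = 0" by (auto simp: coeff_pderiv coeff_eq_0)
  qed
  ultimately have d: "poly (pderiv p) a \<noteq> 0" using p(4)[of "pderiv p"] by auto
  obtain q where q: "p = [:- a, 1:] * q" using p(3) by (auto simp: poly_eq_0_iff_dvd)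
  have "pderiv p = q + [:- a, 1:] * pderiv q" unfolding q by (simp only: pderiv_mult) (simp add: pderiv_pCons)
  then have "poly q a \<noteq> 0" using d by simp
  have "q \<noteq> 0" using p0 q by auto
  then have "degree p = 1 + degree q" unfolding q by (subst degree_mult_eq) auto
  then have "degree q > 0" using deg1 deg2 by simp
  then obtain b where "poly q b = 0" using alg_closed_imp_poly_has_root by blast
  then show ?thesis using \<open>poly q a \<noteq> 0\<close> q by (intro exI[of _ b]) auto
qed

lemma field_aut_moving:
  fixes a :: "'a::alg_closed_field"
  assumes E: "is_subfield E" and perf: "\<And>x. CHAR('a) > 0 ==> x ^ CHAR('a) \<in> E ==> x \<in> E"
    and alg: "\<And>x::'a. algebraic_over E x" and a: "a \<notin> E"
  shows "\<exists>\<sigma>. field_aut E \<sigma> \<and> \<sigma> a \<noteq> a"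
proof -
  let ?R = "Id_on E"
  have R: "partial_hom E ?R" using E by (auto simp: partial_hom_def Id_on_iff subfieldD)
  obtain p0 where p0: "p0 \<in> polys_over E" "p0 \<noteq> 0" "poly p0 a = 0"
    "\<And>q. q \<in> polys_over E ==> q \<noteq> 0 ==> poly q a = 0 ==> degree p0 \<le> degree q"
    using algebraic_min_poly[OF alg[of a]] by blast
  define p where "p = smult (inverse (lead_coeff p0)) p0"
  have p: "p \<in> polys_over E" "lead_coeff p = 1" "poly p a = 0" "degree p = degree p0"
    using p0 by (auto simp: p_def polys_over_def intro!: subfieldD(5,6)[OF E])
  have mini: "\<And>q. q \<in> polys_over E ==> q \<noteq> 0 ==> poly q a = 0 ==> degree p \<le> degree q" using p0(4) p(4) by simp
  obtain b where b: "b \<noteq> a" "poly p b = 0" using conjugate_root_exists[OF E perf a p(1-3) mini] by blast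
  have pr: "polys_rel ?R p p" using p(1) by (auto simp: polys_rel_def polys_over_def)
  obtain R' where R': "partial_hom E R'" "(a, b) \<in> R'"
    using partial_hom_extend[OF R E pr p(2,3) b(2)] mini by (auto simp: polys_rel_def polys_over_def Id_on_iff)
  obtain \<sigma> where "field_aut E \<sigma>" "\<forall>(x, y)\<in>R'. \<sigma> x = y" using field_aut_extend[OF R'(1) E alg] by blast
  then show ?thesis using R'(2) b(1) by (intro exI[of _ \<sigma>]) auto
qed

section \<open>Galois descent\<close>

lemma hp_field_aut:
  assumes "hp E n t f" "field_aut E \<sigma>" "is_subfield E"
  shows "f (\<lambda>i. \<sigma> (x i)) = \<sigma> (f x)"
  using assms(1) by (induction rule: hp.induct) (auto simp: field_autD[OF assms(2,3)])

text \<open>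
  Artin's argument. In a relation of minimal length with one coefficient \<open>1\<close>, some coefficient is not
  in \<open>E\<close> and is moved by an automorphism; the difference of the relation and its conjugate is shorter.
\<close>

lemma descent:
  fixes X :: "(nat => 'a::field) set"
  assumes E: "is_subfield E" and mov: "\<And>a. a \<notin> E ==> \<exists>\<sigma>. field_aut E \<sigma> \<and> \<sigma> a \<noteq> a"
    and stable: "\<And>\<sigma> x. field_aut E \<sigma> ==> x \<in> X ==> \<exists>x'\<in>X. x = (\<lambda>i. \<sigma> (x' i))"
  shows "desc E n X"
  unfolding desc_def
proof (intro allI impI)
  fix t and I :: "((nat \<Rightarrow>\<^sub>0 nat) \<times> nat) set" and g
  assume I: "finite I" and g: "\<forall>i\<in>I. hp E n t (g i)"
    and ind: "\<forall>c. (\<forall>i\<in>I. c i \<in> E) --> (\<forall>x\<in>X. (\<Sum>i\<in>I. c i * g i x) = 0) --> (\<forall>i\<in>I. c i = 0)"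
  define bad where "bad = (\<lambda>c. (\<forall>x\<in>X. (\<Sum>i\<in>I. c i * g i x) = 0) \<and> (\<exists>i\<in>I. c i \<noteq> 0))"
  show "indep_on X I g"
  proof (rule ccontr)
    assume "\<not> ?thesis"
    then obtain c0 where "bad c0" unfolding indep_on_def bad_def by blast
    then obtain c where c: "bad c" "\<And>c'. bad c' ==> card {i\<in>I. c i \<noteq> 0} \<le> card {i\<in>I. c' i \<noteq> 0}"
      using arg_min_nat_lemma[of bad c0 "\<lambda>c. card {i\<in>I. c i \<noteq> 0}"] by blast
    obtain i0 where i0: "i0 \<in> I" "c i0 \<noteq> 0" using c(1) by (auto simp: bad_def)
    define d where "d = (\<lambda>i. c i / c i0)"
    have drel: "(\<Sum>i\<in>I. d i * g i x) = 0" if "x \<in> X" for x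
    proof -
      have "(\<Sum>i\<in>I. d i * g i x) = (\<Sum>i\<in>I. c i * g i x) / c i0"
        by (simp add: d_def sum_divide_distrib)
      then show ?thesis using c(1) that by (simp add: bad_def)
    qed
    have d0: "d i0 = 1" using i0 by (simp add: d_def)
    have "\<not> (\<forall>i\<in>I. d i \<in> E)"
    proof
      assume "\<forall>i\<in>I. d i \<in> E"
      then have "\<forall>i\<in>I. d i = 0" using ind drel by blast
      then show False using i0(1) d0 by simp
    qed
    then obtain i1 where i1: "i1 \<in> I" "d i1 \<notin> E" by blast
    obtain \<sigma> where \<sigma>: "field_aut E \<sigma>" "\<sigma> (d i1) \<noteq> d i1" using mov[OF i1(2)] by blast
    note aut = field_autD[OF \<sigma>(1) E]
    define d' where "d' = (\<lambda>i. d i - \<sigma> (d i))"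
    have "(\<Sum>i\<in>I. d' i * g i x) = 0" if x: "x \<in> X" for x
    proof -
      obtain x' where x': "x' \<in> X" "x = (\<lambda>i. \<sigma> (x' i))" using stable[OF \<sigma>(1) x] by blast
      have "(\<Sum>i\<in>I. \<sigma> (d i) * g i x) = (\<Sum>i\<in>I. \<sigma> (d i * g i x'))"
        unfolding x'(2) by (intro sum.cong refl) (simp add: aut hp_field_aut[OF g[rule_format] \<sigma>(1) E])
      also have "... = \<sigma> (\<Sum>i\<in>I. d i * g i x')" by (simp add: aut)
      also have "... = 0" using drel[OF x'(1)] aut by simp
      finally show ?thesis using drel[OF x] by (simp add: d'_def left_diff_distrib sum_subtractf)
    qed
    moreover have "d' i1 \<noteq> 0" using \<sigma>(2) by (simp add: d'_def)
    ultimately have "bad d'" unfolding bad_def using i1(1) by blast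
    then have "card {i\<in>I. c i \<noteq> 0} \<le> card {i\<in>I. d' i \<noteq> 0}" by (rule c(2))
    moreover have "{i\<in>I. d' i \<noteq> 0} \<subset> {i\<in>I. c i \<noteq> 0}"
    proof -
      have "d' i0 = 0" using d0 aut by (simp add: d'_def)
      moreover have "d' i = 0" if "c i = 0" for i using that aut by (simp add: d'_def d_def)
      ultimately show ?thesis using i0 by auto
    qed
    then have "card {i\<in>I. d' i \<noteq> 0} < card {i\<in>I. c i \<noteq> 0}" using I by (intro psubset_card_mono) auto
    ultimately show False by simp
  qed
qed

text \<open>
  Automorphisms permute the zeros of polynomials over the fixed field.
\<close>

lemma zclosed_aut_stable:
  assumes X: "zclosed aff K n X" and K: "is_subfield K" and KE: "K \<subseteq> E" and E: "is_subfield E" and \<sigma>: "field_aut E \<sigma>" and x: "x \<in> X"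
  shows "\<exists>x'\<in>X. x = (\<lambda>i. \<sigma> (x' i))"
proof -
  note aut = field_autD[OF \<sigma> E]
  have \<sigma>K: "field_aut K \<sigma>" using \<sigma> KE by (auto simp: field_aut_def)
  obtain G where G: "\<forall>g\<in>G. \<exists>t. hp K n t g" "X = {x \<in> pts aff n. \<forall>g\<in>G. g x = 0}"
    using X unfolding zclosed_def by (elim exE conjE)
  obtain x' where x': "\<And>i. \<sigma> (x' i) = x i" using choice[of "\<lambda>i y. \<sigma> y = x i"] aut(7) by blast
  have z: "x' i = 0 \<longleftrightarrow> x i = 0" for i using aut(6)[of "x' i"] x'[of i] by simp
  have xp: "x \<in> pts aff n" "\<forall>g\<in>G. g x = 0" using x unfolding G(2) by auto
  have "x' \<in> pts aff n" using xp(1) z unfolding pts_def vecs_def by auto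
  moreover have "g x' = 0" if gG: "g \<in> G" for g
  proof -
    obtain t where t: "hp K n t g" using bspec[OF G(1) gG] by (elim exE)
    have "\<sigma> (g x') = g (\<lambda>i. \<sigma> (x' i))" by (rule hp_field_aut[OF t \<sigma>K K, symmetric])
    also have "... = 0" using xp(2) gG x' by simp
    finally show ?thesis using aut(6) by simp
  qed
  ultimately have "x' \<in> X" unfolding G(2) by blast
  then show ?thesis using x' by (intro bexI[of _ x']) auto
qed

section \<open>The perfect closure of the ground field\<close>

text \<open>
  The characteristic exponent.
\<close>

definition frob :: "'a::field itself => nat" where
  "frob _ = (if CHAR('a) = 0 then 1 else CHAR('a))"

definition perfect_closure :: "'a::field set => 'a set" where
  "perfect_closure K = {x. \<exists>j. x ^ (frob TYPE('a) ^ j) \<in> K}"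

lemma frob_add: "(x + y) ^ (frob TYPE('a) ^ j) = x ^ (frob TYPE('a) ^ j) + (y::'a::field) ^ (frob TYPE('a) ^ j)"
proof (cases "CHAR('a) = 0")
  case False
  then have "prime CHAR('a)" using prime_CHAR_semidom[where ?'a = 'a] by simp
  then show ?thesis using False by (simp add: frob_def freshmans_dream')
qed (simp add: frob_def)

lemma frob_power_mono:
  assumes "is_subfield K" "x ^ (frob TYPE('a) ^ i) \<in> K" "i \<le> j"
  shows "(x::'a::field) ^ (frob TYPE('a) ^ j) \<in> K"
proof -
  have "x ^ (frob TYPE('a) ^ j) = (x ^ (frob TYPE('a) ^ i)) ^ (frob TYPE('a) ^ (j - i))"
    using assms(3) by (simp flip: power_mult power_add)
  then show ?thesis using subfieldD(9)[OF assms(1,2)] by simp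
qed

lemma perfect_closure_subfield:
  fixes K :: "'a::field set"
  assumes K: "is_subfield K"
  shows "is_subfield (perfect_closure K)"
proof -
  let ?q = "frob TYPE('a)"
  have common: "\<exists>j. x ^ (?q ^ j) \<in> K \<and> y ^ (?q ^ j) \<in> K" if xy: "x \<in> perfect_closure K" "y \<in> perfect_closure K" for x y
  proof -
    obtain i j where ij: "x ^ (?q ^ i) \<in> K" "y ^ (?q ^ j) \<in> K" using xy unfolding perfect_closure_def by blast
    have "x ^ (?q ^ max i j) \<in> K" "y ^ (?q ^ max i j) \<in> K"
      by (rule frob_power_mono[OF K ij(1)], simp, rule frob_power_mono[OF K ij(2)], simp)
    then show ?thesis by blast
  qed
  have q0: "?q > 0" by (simp add: frob_def)
  have "1 \<in> perfect_closure K" "0 \<in> perfect_closure K"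
    unfolding perfect_closure_def using subfieldD(1,2)[OF K] q0 by (auto simp: power_0_left)
  moreover have m1: "- 1 \<in> perfect_closure K"
    unfolding perfect_closure_def using subfieldD(7)[OF K subfieldD(2)[OF K]] by (auto intro: exI[of _ 0])
  moreover have add: "x + y \<in> perfect_closure K" and mul: "x * y \<in> perfect_closure K"
    if xy: "x \<in> perfect_closure K" "y \<in> perfect_closure K" for x y
  proof -
    obtain j where j: "x ^ (?q ^ j) \<in> K" "y ^ (?q ^ j) \<in> K" using common[OF xy] by blast
    have "(x + y) ^ (?q ^ j) \<in> K" unfolding frob_add by (rule subfieldD(3)[OF K j])
    then show "x + y \<in> perfect_closure K" unfolding perfect_closure_def by blast
    have "(x * y) ^ (?q ^ j) \<in> K" unfolding power_mult_distrib by (rule subfieldD(5)[OF K j])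
    then show "x * y \<in> perfect_closure K" unfolding perfect_closure_def by blast
  qed
  moreover have "x - y \<in> perfect_closure K" if "x \<in> perfect_closure K" "y \<in> perfect_closure K" for x y
    using add[OF that(1) mul[OF m1 that(2)]] by simp
  moreover have "inverse x \<in> perfect_closure K" if "x \<in> perfect_closure K" for x
    using that subfieldD(6)[OF K] unfolding perfect_closure_def by (auto simp: power_inverse)
  ultimately show ?thesis unfolding is_subfield_def by simp
qed

lemma perfect_closure_perfect:
  fixes x :: "'a::field"
  assumes "CHAR('a) > 0" "x ^ CHAR('a) \<in> perfect_closure K"
  shows "x \<in> perfect_closure K"
proof -
  obtain j where "(x ^ CHAR('a)) ^ (frob TYPE('a) ^ j) \<in> K" using assms(2) unfolding perfect_closure_def by blast
  then have "x ^ (frob TYPE('a) ^ Suc j) \<in> K" using assms(1) by (simp add: frob_def flip: power_mult)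
  then show ?thesis unfolding perfect_closure_def by blast
qed

lemma subset_perfect_closure: "K \<subseteq> perfect_closure K"
  unfolding perfect_closure_def by (auto intro: exI[of _ 0])

text \<open>
  Taking powers of the characteristic exponent is additive, so it acts on the coefficients.
\<close>

lemma hp_frob_power:
  fixes K :: "'a::field set"
  assumes f: "hp (perfect_closure K) n t f" and K: "is_subfield K"
  shows "\<exists>j. hp K n (frob TYPE('a) ^ j * t) (\<lambda>x. f x ^ (frob TYPE('a) ^ j))"
proof -
  let ?q = "frob TYPE('a)"
  have K1: "1 \<in> K" using K by (simp add: subfieldD)
  have up: "hp K n (?q ^ j * t) (\<lambda>x. f x ^ (?q ^ j))" if h: "hp K n (?q ^ i * t) (\<lambda>x. f x ^ (?q ^ i))" "i \<le> j" for i j t and f :: "(nat => 'a) => 'a"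
  proof -
    have "hp K n (?q ^ (j - i) * (?q ^ i * t)) (\<lambda>x. (f x ^ (?q ^ i)) ^ (?q ^ (j - i)))"
      by (rule hp_power[OF h(1) K1])
    moreover have "?q ^ (j - i) * (?q ^ i * t) = ?q ^ j * t" using h(2) by (simp flip: power_add mult.assoc)
    moreover have "(f x ^ (?q ^ i)) ^ (?q ^ (j - i)) = f x ^ (?q ^ j)" for x using h(2) by (simp flip: power_mult power_add)
    ultimately show ?thesis by simp
  qed
  have q0: "?q > 0" by (simp add: frob_def)
  show ?thesis using f
  proof (induction rule: hp.induct)
    case (zero t)
    have "hp K n (?q ^ 0 * t) (\<lambda>x. 0 ^ (?q ^ 0))" by (simp add: hp.zero)
    then show ?case by blast
  next
    case (const c)
    then obtain j where "c ^ (?q ^ j) \<in> K" unfolding perfect_closure_def by blast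
    then show ?case by (intro exI[of _ j]) (simp add: hp.const)
  next
    case (var i)
    have "hp K n (?q ^ 0 * Suc 0) (\<lambda>x. x i ^ (?q ^ 0))" using hp.var[OF var] by simp
    then show ?case by blast
  next
    case (add t f g)
    then obtain i j where ij: "hp K n (?q ^ i * t) (\<lambda>x. f x ^ (?q ^ i))" "hp K n (?q ^ j * t) (\<lambda>x. g x ^ (?q ^ j))" by blast
    have "hp K n (?q ^ max i j * t) (\<lambda>x. f x ^ (?q ^ max i j) + g x ^ (?q ^ max i j))"
      by (intro hp.add up[OF ij(1)] up[OF ij(2)]) auto
    then show ?case by (intro exI[of _ "max i j"]) (simp add: frob_add)
  next
    case (mult s f t g)
    then obtain i j where ij: "hp K n (?q ^ i * s) (\<lambda>x. f x ^ (?q ^ i))" "hp K n (?q ^ j * t) (\<lambda>x. g x ^ (?q ^ j))" by blast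
    have "hp K n (?q ^ max i j * s + ?q ^ max i j * t) (\<lambda>x. f x ^ (?q ^ max i j) * g x ^ (?q ^ max i j))"
      by (intro hp.mult up[OF ij(1)] up[OF ij(2)]) auto
    then show ?case by (intro exI[of _ "max i j"]) (simp add: power_mult_distrib distrib_left)
  qed
qed

definition prime_on :: "'a::field set => nat => (nat => 'a) set => bool" where
  "prime_on E n X \<longleftrightarrow> (\<forall>s t f g. hp E n s f --> hp E n t g --> (\<forall>x\<in>X. f x * g x = 0) -->
     (\<forall>x\<in>X. f x = 0) \<or> (\<forall>x\<in>X. g x = 0))"

text \<open>
  Suitable powers of \<open>f\<close> and \<open>g\<close> have coefficients in \<open>K\<close> and vanish at the same points.
\<close>

lemma prime_on_perfect_closure:
  assumes irr: "irreducible_closed (zclosed aff K n) X" and K: "is_subfield K"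
  shows "prime_on (perfect_closure K) n X"
  unfolding prime_on_def
proof (intro allI impI)
  fix s t f g assume fg: "hp (perfect_closure K) n s f" "hp (perfect_closure K) n t g" "\<forall>x\<in>X. f x * g x = 0"
  let ?q = "frob TYPE('a)"
  have q0: "?q > 0" by (simp add: frob_def)
  obtain i where i: "hp K n (?q ^ i * s) (\<lambda>x. f x ^ (?q ^ i))" using hp_frob_power[OF fg(1) K] by blast
  obtain j where j: "hp K n (?q ^ j * t) (\<lambda>x. g x ^ (?q ^ j))" using hp_frob_power[OF fg(2) K] by blast
  have "f x ^ (?q ^ i) * g x ^ (?q ^ j) = 0" if "x \<in> X" for x
    using bspec[OF fg(3) that] q0 by auto
  from irreducible_prime[OF irr i j this] show "(\<forall>x\<in>X. f x = 0) \<or> (\<forall>x\<in>X. g x = 0)" using q0 by auto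
qed

section \<open>Integral relations\<close>

text \<open>
  One coefficient for each generator. Generators of degree larger than \<open>t\<close> get the coefficient zero.
\<close>

lemma fgs_normal_form:
  fixes M :: "nat => (nat => 'a::field) => 'a"
  assumes "fgs E r M U t f" "finite U"
  shows "\<exists>b. (\<forall>v\<in>U. (snd v \<le> t --> hp E r (t - snd v) (b v)) \<and> (t < snd v --> b v = (\<lambda>_. 0))) \<and>
    (\<forall>x. f x = (\<Sum>v\<in>U. b v (\<lambda>i. M i x) * fst v x))"
  using assms
proof (induction rule: fgs.induct)
  case (zero t)
  then show ?case by (intro exI[of _ "\<lambda>_ _. 0"]) (auto intro: hp.zero)
next
  case (gen u a s b t)
  define c where "c = (\<lambda>v. if v = (u, a) then b else (\<lambda>_. 0))"
  have "(\<Sum>v\<in>U. c v (\<lambda>i. M i x) * fst v x) = b (\<lambda>i. M i x) * u x" for x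
  proof -
    have "(\<Sum>v\<in>U. c v (\<lambda>i. M i x) * fst v x) = (\<Sum>v\<in>{(u, a)}. c v (\<lambda>i. M i x) * fst v x)"
      by (rule sum.mono_neutral_right[OF gen.prems]) (use gen(1) in \<open>auto simp: c_def\<close>)
    then show ?thesis by (simp add: c_def)
  qed
  moreover have "\<forall>v\<in>U. (snd v \<le> t --> hp E r (t - snd v) (c v)) \<and> (t < snd v --> c v = (\<lambda>_. 0))"
    using gen(2,3) by (auto simp: c_def intro: hp.zero)
  ultimately show ?case by (intro exI[of _ c]) simp
next
  case (add t f g)
  obtain b where b: "\<forall>v\<in>U. (snd v \<le> t --> hp E r (t - snd v) (b v)) \<and> (t < snd v --> b v = (\<lambda>_. 0))"
    "\<forall>x. f x = (\<Sum>v\<in>U. b v (\<lambda>i. M i x) * fst v x)" using add.IH(1)[OF add.prems] by (elim exE conjE)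
  obtain c where c: "\<forall>v\<in>U. (snd v \<le> t --> hp E r (t - snd v) (c v)) \<and> (t < snd v --> c v = (\<lambda>_. 0))"
    "\<forall>x. g x = (\<Sum>v\<in>U. c v (\<lambda>i. M i x) * fst v x)" using add.IH(2)[OF add.prems] by (elim exE conjE)
  show ?case
  proof (intro exI[of _ "\<lambda>v y. b v y + c v y"] conjI ballI allI impI)
    fix v assume v: "v \<in> U"
    show "hp E r (t - snd v) (\<lambda>y. b v y + c v y)" if "snd v \<le> t" using b(1) c(1) v that by (auto intro: hp.add)
    show "(\<lambda>y. b v y + c v y) = (\<lambda>_. 0)" if "t < snd v" using b(1) c(1) v that by simp
  qed (simp add: b(2) c(2) distrib_right sum.distrib)
qed

text \<open>
  Polynomials in \<open>g\<close> of degree at most \<open>w\<close>, with coefficients in the ring of the \<open>L\<^sub>j\<close> and the constant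
  \<open>e\<close> as coefficient of the \<open>w\<close>-th power: monic for \<open>e = 1\<close>, of smaller degree for \<open>e = 0\<close>.
\<close>

definition spolys where
  "spolys E r L g w e Q \<longleftrightarrow> (\<exists>c. (\<forall>i. pf E r (c i)) \<and> (\<forall>i>w. c i = (\<lambda>_. 0)) \<and> c w = (\<lambda>_. e) \<and>
     Q = (\<lambda>x. \<Sum>i\<le>w. c i (\<lambda>j. L j x) * g x ^ i))"

lemma spolys_mult:
  assumes E: "is_subfield E" and Q: "spolys E r L g w e Q" "spolys E r L g w e' Q'"
  shows "spolys E r L g (2 * w) (e * e') (\<lambda>x. Q x * Q' x)"
proof -
  have E0: "0 \<in> E" using E by (simp add: subfieldD)
  obtain c where c: "\<And>i. pf E r (c i)" "\<And>i. i > w ==> c i = (\<lambda>_. 0)" "c w = (\<lambda>_. e)"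
    "Q = (\<lambda>x. \<Sum>i\<le>w. c i (\<lambda>j. L j x) * g x ^ i)" using Q(1) unfolding spolys_def by auto
  obtain c' where c': "\<And>i. pf E r (c' i)" "\<And>i. i > w ==> c' i = (\<lambda>_. 0)" "c' w = (\<lambda>_. e')"
    "Q' = (\<lambda>x. \<Sum>i\<le>w. c' i (\<lambda>j. L j x) * g x ^ i)" using Q(2) unfolding spolys_def by auto
  define d where "d = (\<lambda>k y. \<Sum>i\<le>k. c i y * c' (k - i) y)"
  have "pf E r (d k)" for k unfolding d_def by (intro pf_sum E0 pf.mult c(1) c'(1))
  moreover have "d k = (\<lambda>_. 0)" if "k > 2 * w" for k
  proof -
    have "c i y * c' (k - i) y = 0" for i y
      by (cases "i > w") (use c(2) c'(2)[of "k - i"] that in auto)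
    then show ?thesis unfolding d_def by (simp del: mult_eq_0_iff)
  qed
  moreover have "d (2 * w) = (\<lambda>_. e * e')"
  proof
    fix y
    have "d (2 * w) y = (\<Sum>i\<in>{w}. c i y * c' (2 * w - i) y)"
      unfolding d_def
    proof (rule sum.mono_neutral_right)
      show "\<forall>i\<in>{..2 * w} - {w}. c i y * c' (2 * w - i) y = 0"
      proof
        fix i assume "i \<in> {..2 * w} - {w}"
        then have "i > w \<or> 2 * w - i > w" by auto
        then show "c i y * c' (2 * w - i) y = 0" using c(2)[of i] c'(2)[of "2 * w - i"] by auto
      qed
    qed auto
    also have "... = e * e'" using c(3) c'(3) by (simp add: mult_2)
    finally show "d (2 * w) y = e * e'" .
  qed
  moreover have "(\<lambda>x. Q x * Q' x) = (\<lambda>x. \<Sum>k\<le>2 * w. d k (\<lambda>j. L j x) * g x ^ k)"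
    using polynomial_product[of w "\<lambda>i. c i (\<lambda>j. L j _)" w "\<lambda>i. c' i (\<lambda>j. L j _)" "g _"] c(2) c'(2)
    by (simp add: c(4) c'(4) d_def mult_2)
  ultimately show ?thesis unfolding spolys_def by (intro exI[of _ d]) simp
qed

lemma spolys_linear:
  assumes E: "is_subfield E" and Q: "spolys E r L g w e Q" "spolys E r L g w e' Q'"
  shows "spolys E r L g w (e + e') (\<lambda>x. Q x + Q' x)" "spolys E r L g w (e - e') (\<lambda>x. Q x - Q' x)"
proof -
  obtain c where c: "\<And>i. pf E r (c i)" "\<And>i. i > w ==> c i = (\<lambda>_. 0)" "c w = (\<lambda>_. e)"
    "Q = (\<lambda>x. \<Sum>i\<le>w. c i (\<lambda>j. L j x) * g x ^ i)" using Q(1) unfolding spolys_def by auto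
  obtain c' where c': "\<And>i. pf E r (c' i)" "\<And>i. i > w ==> c' i = (\<lambda>_. 0)" "c' w = (\<lambda>_. e')"
    "Q' = (\<lambda>x. \<Sum>i\<le>w. c' i (\<lambda>j. L j x) * g x ^ i)" using Q(2) unfolding spolys_def by auto
  show "spolys E r L g w (e + e') (\<lambda>x. Q x + Q' x)" unfolding spolys_def
    by (intro exI[of _ "\<lambda>i y. c i y + c' i y"] conjI allI impI pf.add c(1) c'(1))
       (simp_all add: c(2-4) c'(2-4) distrib_right sum.distrib)
  show "spolys E r L g w (e - e') (\<lambda>x. Q x - Q' x)" unfolding spolys_def
    by (intro exI[of _ "\<lambda>i y. c i y - c' i y"] conjI allI impI pf_diff[OF E] c(1) c'(1))
       (simp_all add: c(2-4) c'(2-4) left_diff_distrib sum_subtractf)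
qed

text \<open>
  Multiplication by \<open>g\<close> on a finite module satisfies a monic relation (Cayley-Hamilton). The relation
  kills a generator that does not vanish on \<open>X\<close>, and irreducibility removes this factor. As \<open>X\<close> is a
  cone, the relation can be replaced by one of its homogeneous components.
\<close>

lemma monic_relation:
  fixes L :: "nat => (nat => 'a::field) => 'a"
  assumes inf: "infinite (UNIV :: 'a set)" and E: "is_subfield E" and X: "X \<noteq> {}" "cone X" and pr: "prime_on E n X"
    and L: "\<And>i. i < r ==> hp E n 1 (L i)" and FG: "FG E n X r L" and g: "hp E n 1 g"
  shows "\<exists>w F. (\<forall>i\<le>w. hp E r (w - i) (F i)) \<and> F w = (\<lambda>_. 1) \<and> (\<forall>x\<in>X. (\<Sum>i\<le>w. F i (\<lambda>j. L j x) * g x ^ i) = 0)"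
proof -
  have E01: "0 \<in> E" "1 \<in> E" using E by (auto simp: subfieldD)
  obtain U where U: "finite U" "\<And>u a. (u, a) \<in> U ==> hp E n a u"
    "\<And>t f. hp E n t f ==> \<exists>g. fgs E r L U t g \<and> (\<forall>x\<in>X. f x = g x)"
    using FG unfolding FG_def by blast
  have nf: "\<exists>b. (\<forall>v\<in>U. pf E r (b v)) \<and> (\<forall>x\<in>X. f x = (\<Sum>v\<in>U. b v (\<lambda>i. L i x) * fst v x))" if f: "hp E n t f" for t f
  proof -
    obtain h where h: "fgs E r L U t h" "\<forall>x\<in>X. f x = h x" using U(3)[OF f] by (elim exE conjE)
    obtain b where b: "\<forall>v\<in>U. (snd v \<le> t --> hp E r (t - snd v) (b v)) \<and> (t < snd v --> b v = (\<lambda>_. 0))"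
      "\<forall>x. h x = (\<Sum>v\<in>U. b v (\<lambda>i. L i x) * fst v x)" using fgs_normal_form[OF h(1) U(1)] by (elim exE conjE)
    have "pf E r (b v)" if v: "v \<in> U" for v
    proof (cases "snd v \<le> t")
      case True
      then have "hp E r (t - snd v) (b v)" using b(1) v by blast
      then show ?thesis by (rule pf_of_hp[OF _ E01(1)])
    next
      case False
      then have "b v = (\<lambda>_. 0)" using b(1) v by simp
      then show ?thesis using E01 by (simp add: pf.const)
    qed
    then show ?thesis using h(2) b(2) by (intro exI[of _ b]) simp
  qed
  \<comment> \<open>otherwise \<open>1\<close> would vanish on \<open>X\<close>\<close>
  have "\<exists>v\<in>U. \<exists>x\<in>X. fst v x \<noteq> 0"
  proof (rule ccontr)
    assume not: "\<not> ?thesis"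
    obtain b where b: "\<forall>x\<in>X. 1 = (\<Sum>v\<in>U. b v (\<lambda>i. L i x) * fst v x)" using nf[OF hp.const[OF E01(2)]] by blast
    obtain x where x: "x \<in> X" using X(1) by blast
    have "(\<Sum>v\<in>U. b v (\<lambda>i. L i x) * fst v x) = 0" using not x by (intro sum.neutral) auto
    then show False using b x by simp
  qed
  then obtain v0 where v0: "v0 \<in> U" "\<exists>x\<in>X. fst v0 x \<noteq> 0" by blast
  have gu: "hp E n (1 + snd v) (\<lambda>x. g x * fst v x)" if "v \<in> U" for v
    using hp.mult[OF g U(2), of "fst v" "snd v"] that by simp
  have "\<forall>v\<in>U. \<exists>b. (\<forall>v'\<in>U. pf E r (b v')) \<and> (\<forall>x\<in>X. g x * fst v x = (\<Sum>v'\<in>U. b v' (\<lambda>i. L i x) * fst v' x))"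
    using nf[OF gu] by blast
  from bchoice[OF this] obtain b where b: "\<forall>v\<in>U. (\<forall>v'\<in>U. pf E r (b v v')) \<and>
      (\<forall>x\<in>X. g x * fst v x = (\<Sum>v'\<in>U. b v v' (\<lambda>i. L i x) * fst v' x))" by (elim exE)
  have ins: "insert v0 (U - {v0}) = U" using v0(1) by auto
  have "\<exists>w R. spolys E r L g w 1 R \<and> (\<forall>x\<in>X. R x * fst v0 x = 0)"
  proof (rule elimination[where J = "U - {v0}" and w = 1 and Mo = "\<lambda>w. spolys E r L g w 1" and No = "\<lambda>w. spolys E r L g w 0"
        and u = fst and P = "\<lambda>v. g" and Q = "\<lambda>v v' x. b v v' (\<lambda>i. L i x)"])
    show "spolys E r L g (2 * w) 1 (\<lambda>x. P x * P' x)" if "spolys E r L g w 1 P" "spolys E r L g w 1 P'" for w P P'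
      using spolys_mult[OF E that] by simp
    show "spolys E r L g w 1 (\<lambda>x. P x - Q x)" if "spolys E r L g w 1 P" "spolys E r L g w 0 Q" for w P Q
      using spolys_linear(2)[OF E that] by simp
    show "spolys E r L g (2 * w) 0 (\<lambda>x. P x * Q x)" if "spolys E r L g w 1 P" "spolys E r L g w 0 Q" for w P Q
      using spolys_mult[OF E that] by simp
    show "spolys E r L g (2 * w) 0 (\<lambda>x. P x * Q x)" if "spolys E r L g w 0 P" "spolys E r L g w 0 Q" for w P Q
      using spolys_mult[OF E that] by simp
    show "spolys E r L g w 0 (\<lambda>x. P x + Q x)" if "spolys E r L g w 0 P" "spolys E r L g w 0 Q" for w P Q
      using spolys_linear(1)[OF E that] by simp
    show "spolys E r L g 1 1 g" unfolding spolys_def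
      by (intro exI[of _ "\<lambda>i _. if i = 1 then 1 else 0"]) (auto intro: pf.const E01)
    show "spolys E r L g 1 0 (\<lambda>x. b v v' (\<lambda>i. L i x))" if "v \<in> insert v0 (U - {v0})" "v' \<in> insert v0 (U - {v0})" for v v'
      unfolding spolys_def
    proof (intro exI[of _ "\<lambda>i. if i = 0 then b v v' else (\<lambda>_. 0)"] conjI allI impI)
      fix i show "pf E r (if i = 0 then b v v' else (\<lambda>_. 0))"
        using b that unfolding ins by (auto intro: pf.const E01)
    qed auto
    show "g x * fst v x = (\<Sum>v'\<in>insert v0 (U - {v0}). b v v' (\<lambda>i. L i x) * fst v' x)" if "v \<in> insert v0 (U - {v0})" "x \<in> X" for v x
      using b that unfolding ins by blast
  qed (use U(1) in auto)
  then obtain w R where R: "spolys E r L g w 1 R" "\<forall>x\<in>X. R x * fst v0 x = 0" by (elim exE conjE)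
  obtain c where c0: "\<forall>i. pf E r (c i)" and c2: "c w = (\<lambda>_. 1)" and c3: "R = (\<lambda>x. \<Sum>i\<le>w. c i (\<lambda>j. L j x) * g x ^ i)"
    using R(1) unfolding spolys_def by (elim exE conjE)
  note c = c0[rule_format] c2 c3
  have "\<forall>i. \<exists>T C. (\<forall>t. hp E r t (C t)) \<and> (\<forall>t>T. C t = (\<lambda>_. 0)) \<and> c i = (\<lambda>x. \<Sum>t\<le>T. C t x)"
    by (intro allI pf_decomp[OF c(1) E01(1)])
  from choice[OF this] obtain T where "\<forall>i. \<exists>C. (\<forall>t. hp E r t (C t)) \<and> (\<forall>t>T i. C t = (\<lambda>_. 0)) \<and> c i = (\<lambda>x. \<Sum>t\<le>T i. C t x)"
    by (elim exE)
  from choice[OF this] obtain C where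
    C0: "\<forall>i. (\<forall>t. hp E r t (C i t)) \<and> (\<forall>t>T i. C i t = (\<lambda>_. 0)) \<and> c i = (\<lambda>x. \<Sum>t\<le>T i. C i t x)" by (elim exE)
  have C: "\<And>i t. hp E r t (C i t)" "\<And>i t. t > T i ==> C i t = (\<lambda>_. 0)"
    using C0 by simp_all
  have C3: "c i = (\<lambda>x. \<Sum>t\<le>T i. C i t x)" for i using C0 by blast
  \<comment> \<open>homogeneous components of the coefficients; that of the top one is \<open>1\<close> in degree \<open>0\<close>\<close>
  define D where "D = (\<lambda>i t. if i = w then (if t = 0 then (\<lambda>_. 1) else (\<lambda>_. 0)) else C i t)"
  define N where "N = (\<Sum>i\<le>w. T i)"
  have D: "hp E r t (D i t)" for i t using C(1) E01 by (auto simp: D_def intro: hp.zero hp.const)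
  have cD: "c i y = (\<Sum>t\<le>N'. D i t y)" if "i \<le> w" "N' \<ge> N" for i N' y
  proof (cases "i = w")
    case True
    have "(\<Sum>t\<le>N'. D i t y) = (\<Sum>t\<in>{0}. D i t y)" by (rule sum.mono_neutral_right) (auto simp: D_def True)
    then show ?thesis using True c(2) by (simp add: D_def)
  next
    case False
    have "T i \<le> N" unfolding N_def using that(1) by (intro member_le_sum) auto
    then have "(\<Sum>t\<le>T i. D i t y) = (\<Sum>t\<le>N'. D i t y)"
      using that(2) C(2) False by (intro sum.mono_neutral_left) (auto simp: D_def)
    then show ?thesis using False fun_cong[OF C3[of i], of y] by (simp add: D_def)
  qed
  \<comment> \<open>the component of degree \<open>k\<close> of the relation, where \<open>g\<close> has degree \<open>1\<close>; the monic term lies in degree \<open>w\<close>\<close>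
  define \<Phi> where "\<Phi> = (\<lambda>k x. \<Sum>i\<le>w. (if i \<le> k then D i (k - i) (\<lambda>j. L j x) else 0) * g x ^ i)"
  have Phi: "hp E n k (\<Phi> k)" for k
    unfolding \<Phi>_def
  proof (rule hp_sum)
    fix i assume "i \<in> {..w}"
    show "hp E n k (\<lambda>x. (if i \<le> k then D i (k - i) (\<lambda>j. L j x) else 0) * g x ^ i)"
    proof (cases "i \<le> k")
      case True
      have "hp E n (k - i) (\<lambda>x. D i (k - i) (\<lambda>j. L j x))" by (rule hp_subst[OF D]) (rule L)
      from hp_multI[OF this hp_power1[OF g E01(2), of i]] True show ?thesis by auto
    qed (simp add: hp.zero)
  qed
  have RPhi: "R x = (\<Sum>k\<le>w + N. \<Phi> k x)" for x
  proof -
    have "(\<Sum>k\<le>w + N. \<Phi> k x) = (\<Sum>i\<le>w. \<Sum>k\<le>w + N. (if i \<le> k then D i (k - i) (\<lambda>j. L j x) else 0) * g x ^ i)"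
      unfolding \<Phi>_def by (rule sum.swap)
    also have "... = (\<Sum>i\<le>w. (\<Sum>t\<le>w + N - i. D i t (\<lambda>j. L j x)) * g x ^ i)"
    proof (rule sum.cong[OF refl])
      fix i assume i: "i \<in> {..w}"
      have "(\<Sum>k\<le>w + N. if i \<le> k then D i (k - i) (\<lambda>j. L j x) else 0) = (\<Sum>k\<in>{i..w + N}. D i (k - i) (\<lambda>j. L j x))"
        by (rule sum.mono_neutral_cong_right) auto
      also have "... = (\<Sum>t\<le>w + N - i. D i t (\<lambda>j. L j x))"
        by (rule sum.reindex_bij_witness[of _ "\<lambda>t. t + i" "\<lambda>k. k - i"]) (use i in auto)
      finally show "(\<Sum>k\<le>w + N. (if i \<le> k then D i (k - i) (\<lambda>j. L j x) else 0) * g x ^ i) = (\<Sum>t\<le>w + N - i. D i t (\<lambda>j. L j x)) * g x ^ i"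
        by (simp only: sum_distrib_right[symmetric])
    qed
    also have "... = (\<Sum>i\<le>w. c i (\<lambda>j. L j x) * g x ^ i)"
      by (intro sum.cong refl arg_cong2[where f = "(*)"] cD[symmetric]) auto
    finally show ?thesis by (simp add: c(3))
  qed
  have v0h: "hp E n (snd v0) (fst v0)" using U(2)[of "fst v0" "snd v0"] v0(1) by simp
  have prod0: "\<Phi> w x * fst v0 x = 0" if x: "x \<in> X" for x
  proof (cases "fst v0 x = 0")
    case False
    have "\<Phi> w x = 0"
    proof (rule homogeneous_components_vanish[where c = \<Phi> and T = "w + N"])
      show "\<Phi> t (\<lambda>i. a * x i) = a ^ t * \<Phi> t x" for t x a by (rule hp_scale[OF Phi])
      fix a :: 'a assume a: "a \<noteq> 0"
      have "(\<lambda>i. a * x i) \<in> X" using X(2) x a by (simp add: cone_def)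
      then have "R (\<lambda>i. a * x i) * fst v0 (\<lambda>i. a * x i) = 0" using R(2) by blast
      moreover have "fst v0 (\<lambda>i. a * x i) \<noteq> 0" using hp_scale[OF v0h, of a x] a False by simp
      ultimately show "(\<Sum>t\<le>w + N. \<Phi> t (\<lambda>i. a * x i)) = 0" using RPhi by simp
    qed (use inf in auto)
    then show ?thesis by simp
  qed simp
  have "(\<forall>x\<in>X. \<Phi> w x = 0) \<or> (\<forall>x\<in>X. fst v0 x = 0)"
    by (rule pr[unfolded prime_on_def, rule_format, OF Phi v0h]) (rule prod0)
  then have "\<forall>x\<in>X. \<Phi> w x = 0" using v0(2) by blast
  moreover have "\<Phi> w x = (\<Sum>i\<le>w. D i (w - i) (\<lambda>j. L j x) * g x ^ i)" for x
    unfolding \<Phi>_def by (intro sum.cong) auto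
  moreover have "D w (w - w) = (\<lambda>_. 1)" by (simp add: D_def)
  ultimately show ?thesis
    by (intro exI[of _ w] exI[of _ "\<lambda>i. D i (w - i)"]) (simp add: D)
qed

section \<open>Polynomials with forms as coefficients, and Gauss's lemma\<close>

text \<open>
  Polynomials in one further variable, homogeneous of total degree \<open>T\<close> if that variable has degree \<open>1\<close>,
  as functions of the first \<open>r\<close> variables.
\<close>

definition gpoly :: "'a::field set => nat => nat => ((nat => 'a) => 'a poly) => bool" where
  "gpoly E r T P \<longleftrightarrow> (\<forall>i. (i \<le> T --> hp E r (T - i) (\<lambda>y. coeff (P y) i)) \<and> (T < i --> (\<forall>y. coeff (P y) i = 0)))"

lemma gpolyD: "gpoly E r T P ==> i \<le> T ==> hp E r (T - i) (\<lambda>y. coeff (P y) i)"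
  "gpoly E r T P ==> T < i ==> coeff (P y) i = 0"
  unfolding gpoly_def by blast+

lemma gpoly_zero: "gpoly E r T (\<lambda>_. 0)"
  unfolding gpoly_def by (auto intro: hp.zero)

lemma gpoly_add: "gpoly E r T P ==> gpoly E r T Q ==> gpoly E r T (\<lambda>y. P y + Q y)"
  unfolding gpoly_def by (auto intro: hp.add)

lemma gpoly_diff: "is_subfield E ==> gpoly E r T P ==> gpoly E r T Q ==> gpoly E r T (\<lambda>y. P y - Q y)"
  unfolding gpoly_def by (auto intro: hp_diff)

lemma gpoly_monom_mult:
  assumes c: "hp E r a c" and P: "gpoly E r T P" and S: "S = a + k + T"
  shows "gpoly E r S (\<lambda>y. monom (c y) k * P y)"
  unfolding gpoly_def
proof (intro allI conjI impI)
  fix i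
  { assume i: "i \<le> S"
    show "hp E r (S - i) (\<lambda>y. coeff (monom (c y) k * P y) i)"
    proof (cases "k \<le> i \<and> i - k \<le> T")
      case True
      have "hp E r (S - i) (\<lambda>y. c y * coeff (P y) (i - k))"
        by (rule hp_multI[OF c gpolyD(1)[OF P]]) (use True S in auto)
      then show ?thesis using True by (simp add: coeff_monom_mult)
    next
      case False
      have "(\<lambda>y. coeff (monom (c y) k * P y) i) = (\<lambda>_. 0)"
      proof
        fix y show "coeff (monom (c y) k * P y) i = 0"
          using False gpolyD(2)[OF P, of "i - k" y] by (auto simp: coeff_monom_mult)
      qed
      then show ?thesis by (simp add: hp.zero)
    qed }
  fix y assume "S < i"
  then show "coeff (monom (c y) k * P y) i = 0" using S gpolyD(2)[OF P, of "i - k" y] by (simp add: coeff_monom_mult)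
qed

lemma gpoly_smult:
  assumes "hp E r a c" "gpoly E r T P" "S = a + T"
  shows "gpoly E r S (\<lambda>y. smult (c y) (P y))"
  using gpoly_monom_mult[OF assms(1,2), of S 0] assms(3) by (simp add: monom_0)

text \<open>
  Division with remainder, after multiplication with a power of the leading coefficient of \<open>Q\<close>.
\<close>

lemma pseudo_division:
  fixes Q :: "(nat => 'a::field) => 'a poly"
  assumes E: "is_subfield E" and Q: "gpoly E r t Q" "\<And>y. degree (Q y) \<le> e" "e \<le> t"
  shows "gpoly E r T F ==> (\<And>y i. i \<ge> w ==> coeff (F y) i = 0) ==>
    \<exists>j H R. gpoly E r (T + j * (t - e) - t) H \<and> gpoly E r (T + j * (t - e)) R \<and> (\<forall>y i. i \<ge> e --> coeff (R y) i = 0) \<and>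
      (\<forall>y. smult (coeff (Q y) e ^ j) (F y) = Q y * H y + R y)"
proof (induction w arbitrary: F T)
  case 0
  then have "F y = 0" for y by (intro poly_eqI) simp
  then show ?case by (intro exI[of _ 0] exI[of _ "\<lambda>_. 0"]) (simp add: gpoly_zero)
next
  case (Suc w)
  show ?case
  proof (cases "w < e \<or> T < w")
    case True
    then show ?thesis
    proof
      assume "T < w"
      have "coeff (F y) i = 0" if "i \<ge> w" for y i
        using gpolyD(2)[OF Suc.prems(1), of i y] that \<open>T < w\<close> by simp
      then show ?thesis by (rule Suc.IH[OF Suc.prems(1)])
    next
      assume "w < e"
      then have "\<forall>y i. i \<ge> e --> coeff (F y) i = 0" using Suc.prems(2) by simp
      then show ?thesis
        by (intro exI[of _ 0] exI[of _ "\<lambda>_. 0"] exI[of _ F]) (use Suc.prems(1) in \<open>simp add: gpoly_zero\<close>)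
    qed
  next
    case False
    then have we: "e \<le> w" "w \<le> T" by auto
    define v where "v = (\<lambda>y. coeff (Q y) e)"
    define a where "a = (\<lambda>y. coeff (F y) w)"
    have v: "hp E r (t - e) v" unfolding v_def by (rule gpolyD(1)[OF Q(1,3)])
    have a: "hp E r (T - w) a" unfolding a_def by (rule gpolyD(1)[OF Suc.prems(1) we(2)])
    define F' where "F' = (\<lambda>y. smult (v y) (F y) - monom (a y) (w - e) * Q y)"
    have F': "gpoly E r (T + (t - e)) F'"
      unfolding F'_def
    proof (rule gpoly_diff[OF E])
      show "gpoly E r (T + (t - e)) (\<lambda>y. smult (v y) (F y))" by (rule gpoly_smult[OF v Suc.prems(1)]) simp
      show "gpoly E r (T + (t - e)) (\<lambda>y. monom (a y) (w - e) * Q y)"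
        by (rule gpoly_monom_mult[OF a Q(1)]) (use we Q(3) in auto)
    qed
    have F'0: "coeff (F' y) i = 0" if i: "i \<ge> w" for y i
    proof (cases "i = w")
      case True
      then show ?thesis using we by (simp add: F'_def coeff_monom_mult v_def a_def)
    next
      case False
      then have "coeff (Q y) (i - (w - e)) = 0" using i we Q(2)[of y] by (intro coeff_eq_0) linarith
      then show ?thesis using Suc.prems(2)[of i y] False i by (simp add: F'_def coeff_monom_mult)
    qed
    have "\<exists>j H R. gpoly E r (T + (t - e) + j * (t - e) - t) H \<and> gpoly E r (T + (t - e) + j * (t - e)) R \<and>
      (\<forall>y i. i \<ge> e --> coeff (R y) i = 0) \<and> (\<forall>y. smult (coeff (Q y) e ^ j) (F' y) = Q y * H y + R y)"
      by (rule Suc.IH[OF F']) (rule F'0)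
    then obtain j H R where IH: "gpoly E r (T + (t - e) + j * (t - e) - t) H" "gpoly E r (T + (t - e) + j * (t - e)) R"
      "\<forall>y i. i \<ge> e --> coeff (R y) i = 0" "\<forall>y. smult (coeff (Q y) e ^ j) (F' y) = Q y * H y + R y"
      by (elim exE conjE)
    define H' where "H' = (\<lambda>y. H y + monom (v y ^ j * a y) (w - e))"
    have vj: "hp E r (j * (t - e)) (\<lambda>y. v y ^ j)" by (rule hp_power[OF v subfieldD(2)[OF E]])
    have "gpoly E r 0 (\<lambda>_. 1 :: 'a poly)" unfolding gpoly_def by (auto intro: hp.const subfieldD(2)[OF E])
    moreover have "T + (t - e) + j * (t - e) - t = (j * (t - e) + (T - w)) + (w - e) + 0"
      using we Q(3) by linarith
    ultimately have "gpoly E r (T + (t - e) + j * (t - e) - t) (\<lambda>y. monom (v y ^ j * a y) (w - e) * 1)"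
      by (rule gpoly_monom_mult[OF hp.mult[OF vj a]])
    then have "gpoly E r (T + (t - e) + j * (t - e) - t) (\<lambda>y. monom (v y ^ j * a y) (w - e))" by simp
    then have H': "gpoly E r (T + Suc j * (t - e) - t) H'"
      unfolding H'_def using gpoly_add[OF IH(1), of "\<lambda>y. monom (v y ^ j * a y) (w - e)"] by (simp add: add.assoc)
    have "smult (v y ^ Suc j) (F y) = Q y * H' y + R y" for y
    proof -
      have "smult (v y ^ Suc j) (F y) = smult (v y ^ j) (F' y) + smult (v y ^ j) (monom (a y) (w - e) * Q y)"
        unfolding F'_def by (simp add: smult_diff_right mult.commute)
      also have "... = Q y * H y + R y + monom (v y ^ j * a y) (w - e) * Q y"
        using IH(4) by (simp add: v_def smult_monom flip: mult_smult_left)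
      finally show ?thesis by (simp add: H'_def algebra_simps)
    qed
    then show ?thesis using H' IH(2,3)
      by (intro exI[of _ "Suc j"] exI[of _ H'] exI[of _ R]) (simp add: add_ac v_def)
  qed
qed

lemma prime_elem_linear: "prime_elem [:- \<alpha>, 1:: 'a::field:]"
  by (rule prime_elemI) (auto simp: poly_eq_0_iff_dvd[symmetric])

lemma smult_left_cancel: "a \<noteq> 0 ==> smult a p = smult a q ==> p = q" for a :: "'b::idom"
  by (simp add: poly_eq_iff)

text \<open>
  Gauss's lemma for polynomials over a polynomial ring in one variable. The constant \<open>c\<close> is a product
  of linear factors, which are prime, and each of them divides \<open>Q\<close> or \<open>H\<close>.
\<close>

lemma lead_coeff_dvd_coeff:
  fixes Q F H :: "'a::alg_closed_field poly poly"
  assumes "smult c F = Q * H" "lead_coeff F = 1" "c \<noteq> 0"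
  shows "lead_coeff Q dvd coeff Q i"
  using assms
proof (induction "degree c" arbitrary: c Q H rule: less_induct)
  case less
  have lc: "c = lead_coeff Q * lead_coeff H"
    using arg_cong[OF less.prems(1), of lead_coeff] less.prems(2,3) by (simp add: lead_coeff_mult lead_coeff_smult)
  show ?case
  proof (cases "degree c = 0")
    case True
    then have "is_unit c" using less.prems(3) by (simp add: is_unit_iff_degree)
    then have "is_unit (lead_coeff Q)" unfolding lc by (simp add: is_unit_mult_iff)
    then show ?thesis by (rule unit_imp_dvd)
  next
    case False
    then obtain \<alpha> where "poly c \<alpha> = 0" using alg_closed_imp_poly_has_root by blast
    define \<pi> where "\<pi> = [:- \<alpha>, 1:]"
    have pe: "prime_elem [:\<pi>:]" unfolding \<pi>_def by (intro lift_prime_elem_poly prime_elem_linear)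
    have pi0: "\<pi> \<noteq> 0" "degree \<pi> = 1" by (auto simp: \<pi>_def)
    obtain c1 where c1: "c = \<pi> * c1" using \<open>poly c \<alpha> = 0\<close> by (auto simp: poly_eq_0_iff_dvd \<pi>_def)
    have c10: "c1 \<noteq> 0" using c1 less.prems(3) by auto
    then have deg: "degree c1 < degree c" unfolding c1 using pi0 by (subst degree_mult_eq) auto
    have "[:\<pi>:] dvd Q * H" unfolding less.prems(1)[symmetric] c1 by (simp add: const_poly_dvd_iff)
    then have "[:\<pi>:] dvd Q \<or> [:\<pi>:] dvd H" using pe by (simp add: prime_elem_dvd_mult_iff)
    then show ?thesis
    proof
      assume "[:\<pi>:] dvd Q"
      then obtain Q1 where Q1: "Q = smult \<pi> Q1" by (auto elim!: dvdE)
      have "smult \<pi> (smult c1 F) = smult \<pi> (Q1 * H)" using less.prems(1) by (simp add: c1 Q1)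
      then have "smult c1 F = Q1 * H" by (rule smult_left_cancel[OF pi0(1)])
      from less.hyps[OF deg this less.prems(2) c10] show ?thesis by (simp add: Q1 lead_coeff_smult mult_dvd_mono)
    next
      assume "[:\<pi>:] dvd H"
      then obtain H1 where H1: "H = smult \<pi> H1" by (auto elim!: dvdE)
      have "smult \<pi> (smult c1 F) = smult \<pi> (Q * H1)" using less.prems(1) by (simp add: c1 H1)
      then have "smult c1 F = Q * H1" by (rule smult_left_cancel[OF pi0(1)])
      from less.hyps[OF deg this less.prems(2) c10] show ?thesis .
    qed
  qed
qed

section \<open>Relations of small degree\<close>

lemma expand_gpoly:
  assumes "hp E (Suc r) t f" "0 \<in> E" "\<And>i. i < Suc r ==> p i \<in> E" "p 0 = 1"
  shows "\<exists>P. gpoly E r t P \<and> (\<forall>z \<tau>. f (\<lambda>i. case_nat 0 z i + \<tau> * p i) = poly (P z) \<tau>) \<and> (\<forall>z. coeff (P z) t = f p)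
    \<and> (\<forall>z. degree (P z) \<le> t)"
proof -
  have "\<exists>B. graded_coeffs E r t B \<and> (\<forall>z \<tau>. f (\<lambda>i. case_nat 0 z i + \<tau> * p i) = (\<Sum>l\<le>t. B l z * \<tau> ^ l))
    \<and> (\<forall>y. f y = (\<Sum>l\<le>t. B l (away p y) * y 0 ^ l)) \<and> (\<forall>z. B t z = f p)"
    by (rule expand_along[where p = p, OF assms])
  then obtain B where B: "graded_coeffs E r t B" "\<forall>z \<tau>. f (\<lambda>i. case_nat 0 z i + \<tau> * p i) = (\<Sum>l\<le>t. B l z * \<tau> ^ l)"
    "\<forall>z. B t z = f p" by (elim exE conjE)
  define P where "P = (\<lambda>z. \<Sum>l\<le>t. monom (B l z) l)"
  have co: "coeff (P z) i = (if i \<le> t then B i z else 0)" for z i by (simp add: P_def coeff_sum)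
  have "gpoly E r t P" using B(1) by (simp add: gpoly_def co graded_coeffs_def)
  moreover have "degree (P z) \<le> t" for z by (rule degree_le) (simp add: co)
  moreover have "poly (P z) \<tau> = (\<Sum>l\<le>t. B l z * \<tau> ^ l)" for z \<tau> by (simp add: P_def poly_sum poly_monom)
  ultimately show ?thesis using B(2,3) by (intro exI[of _ P]) (simp add: co)
qed

lemma hp_of_gpoly:
  assumes E: "is_subfield E" and P: "gpoly E r t P" "\<And>z. degree (P z) \<le> t" and p: "\<And>i. i < Suc r ==> p i \<in> E"
  shows "hp E (Suc r) t (\<lambda>y. poly (P (away p y)) (y 0))"
proof -
  have "hp E (Suc r) t (\<lambda>y. \<Sum>l\<le>t. coeff (P (away p y)) l * y 0 ^ l)"
  proof (rule hp_sum)
    fix l assume l: "l \<in> {..t}"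
    have "hp E r (t - l) (\<lambda>z. coeff (P z) l)" using gpolyD(1)[OF P(1)] l by simp
    from hp_away_subst[OF E this p] have "hp E (Suc r) (t - l) (\<lambda>y. coeff (P (away p y)) l)" by simp
    moreover have "hp E (Suc r) l (\<lambda>y. y 0 ^ l)" by (rule hp_power1[OF hp_var1 subfieldD(2)[OF E]]) simp
    ultimately show "hp E (Suc r) t (\<lambda>y. coeff (P (away p y)) l * y 0 ^ l)" by (rule hp_multI) (use l in auto)
  qed
  moreover have "poly (P (away p y)) (y 0) = (\<Sum>l\<le>t. coeff (P (away p y)) l * y 0 ^ l)" for y
    by (rule poly_altdef_le[OF P(2)])
  ultimately show ?thesis by simp
qed

lemma poly_eqI_infinite:
  fixes p q :: "'a::field poly"
  assumes "infinite (UNIV :: 'a set)" "\<And>x. poly p x = poly q x"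
  shows "p = q"
proof -
  have "{x. poly (p - q) x = 0} = UNIV" using assms(2) by simp
  then have "p - q = 0" using poly_roots_finite[of "p - q"] assms(1) by fastforce
  then show ?thesis by simp
qed

text \<open>
  The ring of forms is integrally closed, in the shape that is needed: a divisor \<open>Q\<close> of a multiple of
  the monic polynomial \<open>F\<close> becomes monic after division by its leading coefficient \<open>v\<close>. On every line in the
  direction of a point \<open>p\<close> with \<open>v(p) \<noteq> 0\<close> this is Gauss's lemma in one variable. As \<open>v\<close> has
  the constant leading coefficient \<open>v(p)\<close> in this direction, division by it has a remainder with
  form coefficients, and the remainder vanishes on each line.
\<close>

lemma divide_leading_coefficient:
  fixes Q :: "(nat => 'a::alg_closed_field) => 'a poly"
  assumes inf: "infinite E" and E: "is_subfield E" and Q: "gpoly E (Suc d) t Q" "\<And>y. degree (Q y) \<le> e" "e \<le> t"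
    and v0: "\<exists>y. coeff (Q y) e \<noteq> 0"
    and F: "gpoly E (Suc d) T F" "\<And>y. degree (F y) = w" "\<And>y. coeff (F y) w = 1" and H: "gpoly E (Suc d) S H"
    and eq: "\<And>y. smult (coeff (Q y) e ^ j) (F y) = Q y * H y"
  shows "\<exists>W. \<forall>i\<le>e. hp E (Suc d) (e - i) (W i) \<and> (\<forall>y. coeff (Q y) i = coeff (Q y) e * W i y)"
proof -
  have infU: "infinite (UNIV :: 'a set)" using inf finite_subset[of E UNIV] by auto
  have E0: "0 \<in> E" using E by (simp add: subfieldD)
  define \<delta> where "\<delta> = t - e"
  define v where "v = (\<lambda>y. coeff (Q y) e)"
  have v: "hp E (Suc d) \<delta> v" unfolding v_def \<delta>_def by (rule gpolyD(1)[OF Q(1,3)])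
  obtain q0 where "v q0 \<noteq> 0" using v0 by (auto simp: v_def)
  then obtain p where p: "v p \<noteq> 0" "p 0 = 1" "\<And>i. i < Suc d ==> p i \<in> E"
    using normalized_point[OF subfieldD(2)[OF E] inf hp_mono[OF v subset_UNIV order_refl], of q0 "Suc d"] by blast
  define c where "c = v p"
  have cE: "c \<in> E" unfolding c_def by (rule hp_closed_value[OF v E p(3)])
  have ex: "\<exists>P. gpoly E d s P \<and> (\<forall>z \<tau>. f (\<lambda>i. case_nat 0 z i + \<tau> * p i) = poly (P z) \<tau>) \<and> (\<forall>z. coeff (P z) s = f p)
    \<and> (\<forall>z. degree (P z) \<le> s)" if f: "hp E (Suc d) s f" for s f
    by (rule expand_gpoly[where p = p, OF f E0 p(3) p(2)])
  obtain V where V: "gpoly E d \<delta> V" "\<And>z \<tau>. v (\<lambda>i. case_nat 0 z i + \<tau> * p i) = poly (V z) \<tau>" "\<And>z. coeff (V z) \<delta> = c" "\<And>z. degree (V z) \<le> \<delta>"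
    using ex[OF v] unfolding c_def by blast
  have c0: "c \<noteq> 0" using p(1) by (simp add: c_def)
  have degV: "degree (V z) = \<delta>" for z using V(3,4)[of z] c0 le_degree[of "V z" \<delta>] by simp
  have V0: "V z \<noteq> 0" for z using V(3)[of z] c0 by auto
  have line: "\<exists>P. \<forall>\<tau>. poly P \<tau> = coeff (A (\<lambda>i. case_nat 0 z i + \<tau> * p i)) i" if A: "gpoly E (Suc d) s A" for A s z i
  proof (cases "i \<le> s")
    case True
    from hp_mono[OF gpolyD(1)[OF A True] subset_UNIV order_refl]
    have "hp UNIV (Suc d) (s - i) (\<lambda>y. coeff (A y) i)" .
    from hp_line[OF this, of p "case_nat 0 z"] show ?thesis by blast
  next
    case False
    then show ?thesis using gpolyD(2)[OF A] by (intro exI[of _ 0]) simp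
  qed
  have dvd: "V z dvd Pi" if i: "i \<le> e" and Pi: "\<And>\<tau>. poly Pi \<tau> = coeff (Q (\<lambda>i. case_nat 0 z i + \<tau> * p i)) i" for z i Pi
  proof -
    define y where "y = (\<lambda>\<tau> i. case_nat 0 z i + \<tau> * p i)"
    have "\<forall>i. \<exists>P. \<forall>\<tau>. poly P \<tau> = coeff (Q (y \<tau>)) i" unfolding y_def using line[OF Q(1)] by blast
    from choice[OF this] obtain PQ where PQ: "\<forall>i \<tau>. poly (PQ i) \<tau> = coeff (Q (y \<tau>)) i" by (elim exE) blast
    have "\<forall>i. \<exists>P. \<forall>\<tau>. poly P \<tau> = coeff (F (y \<tau>)) i" unfolding y_def using line[OF F(1)] by blast
    from choice[OF this] obtain PF where PF: "\<forall>i \<tau>. poly (PF i) \<tau> = coeff (F (y \<tau>)) i" by (elim exE) blast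
    have "\<forall>i. \<exists>P. \<forall>\<tau>. poly P \<tau> = coeff (H (y \<tau>)) i" unfolding y_def using line[OF H] by blast
    from choice[OF this] obtain PH where PH: "\<forall>i \<tau>. poly (PH i) \<tau> = coeff (H (y \<tau>)) i" by (elim exE) blast
    \<comment> \<open>\<open>Q\<close>, \<open>F\<close> and \<open>H\<close> on the line, as polynomials over the ring of polynomials in the parameter\<close>
    define QQ where "QQ = (\<Sum>i\<le>t. monom (PQ i) i)"
    define FF where "FF = (\<Sum>i\<le>T. monom (PF i) i)"
    define HH where "HH = (\<Sum>i\<le>S. monom (PH i) i)"
    have cQ: "poly (coeff QQ i) \<tau> = coeff (Q (y \<tau>)) i" for i \<tau>
      using PQ gpolyD(2)[OF Q(1), of i "y \<tau>"] by (auto simp: QQ_def coeff_sum)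
    have cF: "poly (coeff FF i) \<tau> = coeff (F (y \<tau>)) i" for i \<tau>
      using PF gpolyD(2)[OF F(1), of i "y \<tau>"] by (auto simp: FF_def coeff_sum)
    have cH: "poly (coeff HH i) \<tau> = coeff (H (y \<tau>)) i" for i \<tau>
      using PH gpolyD(2)[OF H, of i "y \<tau>"] by (auto simp: HH_def coeff_sum)
    have ce: "coeff QQ e = V z"
      by (rule poly_eqI_infinite[OF infU]) (simp add: cQ V(2)[symmetric] v_def y_def)
    have "coeff QQ k = 0" if "k > e" for k
    proof (rule poly_eqI_infinite[OF infU])
      fix \<tau>
      have "coeff (Q (y \<tau>)) k = 0" by (rule coeff_eq_0) (rule le_less_trans[OF Q(2) that])
      then show "poly (coeff QQ k) \<tau> = poly 0 \<tau>" by (simp add: cQ)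
    qed
    then have "degree QQ \<le> e" by (intro degree_le) auto
    then have dQ: "degree QQ = e" using le_degree[of QQ e] ce V0 by simp
    have Fw: "coeff FF w = 1" by (rule poly_eqI_infinite[OF infU]) (simp add: cF F(3))
    have "coeff FF k = 0" if "k > w" for k
      by (rule poly_eqI_infinite[OF infU]) (use F(2) that in \<open>simp add: cF coeff_eq_0\<close>)
    then have "degree FF \<le> w" by (intro degree_le) auto
    then have dF: "lead_coeff FF = 1" using le_degree[of FF w] Fw by simp
    have "smult (V z ^ j) FF = QQ * HH"
    proof (rule poly_eqI, rule poly_eqI_infinite[OF infU])
      fix k \<tau>
      have "poly (coeff (QQ * HH) k) \<tau> = coeff (Q (y \<tau>) * H (y \<tau>)) k"
        by (simp add: coeff_mult poly_sum cQ cH)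
      also have "... = coeff (Q (y \<tau>)) e ^ j * coeff (F (y \<tau>)) k" by (simp flip: eq)
      also have "... = poly (coeff (smult (V z ^ j) FF) k) \<tau>"
        using V(2)[of z \<tau>] by (simp add: cF v_def y_def)
      finally show "poly (coeff (smult (V z ^ j) FF) k) \<tau> = poly (coeff (QQ * HH) k) \<tau>" by simp
    qed
    from lead_coeff_dvd_coeff[OF this dF, of i] have "V z dvd coeff QQ i" using V0 dQ ce by simp
    moreover have "coeff QQ i = Pi" by (rule poly_eqI_infinite[OF infU]) (simp add: cQ Pi y_def)
    ultimately show ?thesis by simp
  qed
  have "\<exists>W. hp E (Suc d) (e - i) W \<and> (\<forall>y. coeff (Q y) i = v y * W y)" if i: "i \<le> e" for i
  proof -
    have it: "i \<le> t" using i Q(3) by simp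
    obtain P where P: "gpoly E d (t - i) P" "\<And>z \<tau>. coeff (Q (\<lambda>i. case_nat 0 z i + \<tau> * p i)) i = poly (P z) \<tau>" "\<And>z. degree (P z) \<le> t - i"
      using ex[OF gpolyD(1)[OF Q(1) it]] by blast
    obtain j' H' R' where D: "gpoly E d (t - i + j' * (\<delta> - \<delta>) - \<delta>) H'" "gpoly E d (t - i + j' * (\<delta> - \<delta>)) R'"
      "\<forall>y i. i \<ge> \<delta> --> coeff (R' y) i = 0" "\<forall>y. smult (coeff (V y) \<delta> ^ j') (P y) = V y * H' y + R' y"
    proof -
      have "\<exists>j H R. gpoly E d (t - i + j * (\<delta> - \<delta>) - \<delta>) H \<and> gpoly E d (t - i + j * (\<delta> - \<delta>)) R \<and> (\<forall>y i. i \<ge> \<delta> --> coeff (R y) i = 0) \<and>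
          (\<forall>y. smult (coeff (V y) \<delta> ^ j) (P y) = V y * H y + R y)"
        by (rule pseudo_division[OF E V(1,4) order_refl P(1), where w = "Suc (t - i)"]) (rule gpolyD(2)[OF P(1)], simp)
      then show ?thesis by (elim exE conjE) (rule that)
    qed
    \<comment> \<open>on each line \<open>v\<close> divides, so the remainder of smaller degree vanishes\<close>
    have R0: "R' z = 0" for z
    proof (rule ccontr)
      assume nz: "R' z \<noteq> 0"
      have "V z dvd P z" by (rule dvd[OF i]) (rule P(2)[symmetric])
      then have "V z dvd smult (c ^ j') (P z) - V z * H' z" by (intro dvd_diff dvd_smult) auto
      then have "V z dvd R' z" using D(4)[rule_format, of z] V(3)[of z] by simp
      then have "degree (V z) \<le> degree (R' z)" using nz by (rule dvd_imp_degree_le)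
      moreover have "coeff (R' z) (degree (R' z)) \<noteq> 0" using nz by simp
      then have "degree (R' z) < \<delta>" using D(3) not_le by blast
      ultimately show False using degV by simp
    qed
    define k where "k = inverse (c ^ j')"
    have kE: "k \<in> E" unfolding k_def using cE E by (simp add: subfieldD)
    have PV: "P z = V z * smult k (H' z)" for z
    proof -
      have "smult (c ^ j') (P z) = V z * H' z" using D(4)[rule_format, of z] V(3)[of z] R0 by simp
      then have "smult k (smult (c ^ j') (P z)) = V z * smult k (H' z)" by simp
      then show ?thesis using c0 by (simp add: k_def)
    qed
    define H'' where "H'' = (\<lambda>z. smult k (H' z))"
    have ei: "t - i - \<delta> = e - i" using Q(3) i by (simp add: \<delta>_def)
    have "gpoly E d (e - i) H'" using D(1) ei by simp
    then have gH'': "gpoly E d (e - i) H''" unfolding H''_def by (rule gpoly_smult[OF hp.const[OF kE]]) simp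
    have dH'': "degree (H'' z) \<le> e - i" for z by (rule degree_le) (use gpolyD(2)[OF gH''] in blast)
    define W where "W = (\<lambda>y. poly (H'' (away p y)) (y 0))"
    have "hp E (Suc d) (e - i) W" unfolding W_def by (rule hp_of_gpoly[OF E gH'' dH'' p(3)])
    moreover have "coeff (Q y) i = v y * W y" for y
    proof -
      have y: "(\<lambda>i. case_nat 0 (away p y) i + y 0 * p i) = y" using away_plus[of p y] p(2) by simp
      have "coeff (Q y) i = poly (P (away p y)) (y 0)" using P(2)[of "away p y" "y 0"] y by simp
      also have "... = poly (V (away p y)) (y 0) * W y" unfolding PV by (simp add: W_def H''_def)
      also have "poly (V (away p y)) (y 0) = v y" using V(2)[of "away p y" "y 0"] y by simp
      finally show ?thesis .
    qed
    ultimately show ?thesis by blast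
  qed
  then have "\<forall>i. \<exists>W. i \<le> e --> hp E (Suc d) (e - i) W \<and> (\<forall>y. coeff (Q y) i = v y * W y)" by blast
  from choice[OF this] show ?thesis unfolding v_def by blast
qed

text \<open>
  Every linear form satisfies a monic relation of degree at most \<open>deg X\<close> over the ring of the \<open>L\<^sub>j\<close>. A
  relation of this degree exists by comparison of Hilbert functions; one of least degree divides, up to
  a power of its leading coefficient, a monic relation, hence is a multiple of a monic one by Gauss's lemma.
\<close>

theorem integral_relation_degree_le:
  fixes L :: "nat => (nat => 'a::alg_closed_field) => 'a"
  assumes inf: "infinite E" and E: "is_subfield E" and X: "X \<noteq> {}" "cone X" and pr: "prime_on E n X" and desc: "desc E n X"
    and L: "\<And>i. i < Suc d ==> hp E n 1 (L i)" and FG: "FG E n X (Suc d) L" and ai: "alg_indep E X (Suc d) L"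
    and g: "hp E n 1 g"
  shows "\<exists>e w. real e \<le> fact d * coeff (hpoly n X) d \<and> (\<forall>i<e. hp E (Suc d) (e - i) (w i)) \<and>
    (\<forall>x\<in>X. g x ^ e + (\<Sum>i<e. w i (\<lambda>j. L j x) * g x ^ i) = 0)"
proof -
  have infU: "infinite (UNIV :: 'a set)" using inf finite_subset[of E UNIV] by auto
  let ?L = "\<lambda>x j. L j x"
  \<comment> \<open>a nontrivial relation for \<open>g\<close> of degree \<open>e\<close> over the ring of the \<open>L\<^sub>j\<close>\<close>
  define rel where "rel = (\<lambda>e. \<exists>t Q. gpoly E (Suc d) t Q \<and> (\<forall>y. degree (Q y) \<le> e) \<and> (\<exists>y. coeff (Q y) e \<noteq> 0) \<and>
    (\<forall>x\<in>X. poly (Q (?L x)) (g x) = 0))"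
  have relI: "\<exists>i<e. rel i" if Q: "gpoly E (Suc d) t Q" "\<And>y i. i \<ge> e ==> coeff (Q y) i = 0" "\<exists>y. Q y \<noteq> 0"
    "\<forall>x\<in>X. poly (Q (?L x)) (g x) = 0" for e t Q
  proof -
    obtain y0 where "Q y0 \<noteq> 0" using Q(3) by blast
    define A where "A = {i. \<exists>y. coeff (Q y) i \<noteq> 0}"
    have "A \<subseteq> {..<e}" using Q(2) by (auto simp: A_def) (metis not_le)
    then have finA: "finite A" using finite_subset by blast
    have "A \<noteq> {}" using \<open>Q y0 \<noteq> 0\<close> leading_coeff_neq_0 unfolding A_def by blast
    define i where "i = Max A"
    have i: "i \<in> A" "\<And>k. k \<in> A ==> k \<le> i" unfolding i_def using finA \<open>A \<noteq> {}\<close> by auto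
    have "degree (Q y) \<le> i" for y
    proof (rule degree_le, intro allI impI, rule ccontr)
      fix k assume "i < k" "coeff (Q y) k \<noteq> 0"
      then have "k \<in> A" by (auto simp: A_def)
      then show False using i(2) \<open>i < k\<close> by fastforce
    qed
    then have "rel i" unfolding rel_def using Q(1,4) i(1) by (intro exI[of _ t] exI[of _ Q]) (auto simp: A_def)
    moreover have "i < e" using i(1) \<open>A \<subseteq> {..<e}\<close> by auto
    ultimately show ?thesis by blast
  qed
  define D where "D = fact d * coeff (hpoly n X) d"
  have degp: "degree (hpoly n X) = d" by (rule degree_hpoly(1)[OF infU E desc L FG ai])
  have "\<exists>e. rel e \<and> real e \<le> D"
  proof (rule ccontr)
    assume not: "\<not> ?thesis"
    define e0 where "e0 = Suc (nat \<lfloor>D\<rfloor>)"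
    have e0: "real e0 > D" unfolding e0_def by linarith
    have small: "real i \<le> D" if "i < e0" "D \<ge> 0" for i using that unfolding e0_def by linarith
    have "(\<Sum>i<e0. (t - i + d) choose d) \<le> hilb X n t" if t: "t \<ge> e0" for t
    proof (rule hilb_ge_powers[OF infU E desc L g _ t])
      fix s q assume q: "\<And>i. i < e0 ==> i \<le> s ==> hp E (Suc d) (s - i) (q i)" "\<And>i. i < e0 ==> s < i ==> q i = (\<lambda>_. 0)"
        "\<And>x. x \<in> X ==> (\<Sum>i<e0. q i (\<lambda>j. L j x) * g x ^ i) = 0"
      define Q where "Q = (\<lambda>y. \<Sum>i<e0. monom (q i y) i)"
      have co: "coeff (Q y) i = (if i < e0 then q i y else 0)" for y i by (simp add: Q_def coeff_sum)
      have gQ: "gpoly E (Suc d) s Q" unfolding gpoly_def co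
      proof (intro allI conjI impI)
        fix i assume "i \<le> s"
        then show "hp E (Suc d) (s - i) (\<lambda>y. if i < e0 then q i y else 0)"
          using q(1)[of i] by (cases "i < e0") (auto intro: hp.zero)
      qed (use q(2) in auto)
      have Q0: "\<forall>x\<in>X. poly (Q (?L x)) (g x) = 0" using q(3) by (simp add: Q_def poly_sum poly_monom)
      show "\<forall>i<e0. \<forall>y. q i y = 0"
      proof (rule ccontr)
        assume "\<not> ?thesis"
        then obtain i y where "i < e0" "q i y \<noteq> 0" by blast
        then have "coeff (Q y) i \<noteq> 0" by (simp add: co)
        then have "\<exists>y. Q y \<noteq> 0" by (intro exI[of _ y]) auto
        then obtain k where k: "k < e0" "rel k" using relI[OF gQ _ _ Q0, of e0] co by auto
        have "\<not> real k \<le> D" using not k(2) by blast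
        then have "D < 0" using small[OF k(1)] by linarith
        moreover have "eventually (\<lambda>t. poly (hpoly n X) (real t) \<ge> 0) sequentially"
          using hpoly_eventually[of n X] by eventually_elim simp
        then have "coeff (hpoly n X) d \<ge> 0" by (rule poly_ev_nonneg_coeff) (simp add: degp)
        then have "D \<ge> 0" by (simp add: D_def)
        ultimately show False by simp
      qed
    qed
    from coeff_ge_of_growth[OF hpoly_eventually _ this] have "real e0 \<le> D" using degp by (simp add: D_def)
    then show False using e0 by simp
  qed
  then obtain e1 where e1: "rel e1" "real e1 \<le> D" by blast
  define e where "e = (LEAST e. rel e)"
  have "rel e" unfolding e_def by (rule LeastI[of rel, OF e1(1)])
  have "e \<le> e1" unfolding e_def by (rule Least_le[of rel, OF e1(1)])
  then have eD: "real e \<le> D" using e1(2) by linarith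
  have least: "\<not> rel i" if "i < e" for i using that not_less_Least unfolding e_def by blast
  obtain t Q where Q: "gpoly E (Suc d) t Q" "\<And>y. degree (Q y) \<le> e" "\<exists>y. coeff (Q y) e \<noteq> 0" "\<forall>x\<in>X. poly (Q (?L x)) (g x) = 0"
    using \<open>rel e\<close> unfolding rel_def by blast
  have et: "e \<le> t" using gpolyD(2)[OF Q(1)] Q(3) not_le by blast
  obtain w F0 where F0: "\<forall>i\<le>w. hp E (Suc d) (w - i) (F0 i)" "F0 w = (\<lambda>_. 1)" "\<forall>x\<in>X. (\<Sum>i\<le>w. F0 i (\<lambda>j. L j x) * g x ^ i) = 0"
    using monic_relation[OF infU E X pr L FG g] by blast
  define F where "F = (\<lambda>y. \<Sum>i\<le>w. monom (F0 i y) i)"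
  have coF: "coeff (F y) i = (if i \<le> w then F0 i y else 0)" for y i by (simp add: F_def coeff_sum)
  have gF: "gpoly E (Suc d) w F" unfolding gpoly_def coF using F0(1) by simp
  have dF: "degree (F y) = w" for y
  proof (rule antisym)
    show "degree (F y) \<le> w" by (rule degree_le) (simp add: coF)
    show "w \<le> degree (F y)" by (rule le_degree) (simp add: coF F0(2))
  qed
  have F1: "coeff (F y) w = 1" for y by (simp add: coF F0(2))
  have FX: "\<forall>x\<in>X. poly (F (?L x)) (g x) = 0" using F0(3) by (simp add: F_def poly_sum poly_monom)
  obtain j H R where HR: "gpoly E (Suc d) (w + j * (t - e) - t) H" "gpoly E (Suc d) (w + j * (t - e)) R" "\<forall>y i. i \<ge> e --> coeff (R y) i = 0"
    "\<forall>y. smult (coeff (Q y) e ^ j) (F y) = Q y * H y + R y"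
  proof -
    have "\<exists>j H R. gpoly E (Suc d) (w + j * (t - e) - t) H \<and> gpoly E (Suc d) (w + j * (t - e)) R \<and> (\<forall>y i. i \<ge> e --> coeff (R y) i = 0) \<and>
      (\<forall>y. smult (coeff (Q y) e ^ j) (F y) = Q y * H y + R y)"
      by (rule pseudo_division[OF E Q(1,2) et gF, where w = "Suc w"]) (simp add: coF)
    then show ?thesis by (elim exE conjE) (rule that)
  qed
  \<comment> \<open>a nonzero remainder would be a relation of degree less than \<open>e\<close>\<close>
  have "R y = 0" for y
  proof (rule ccontr)
    assume "R y \<noteq> 0"
    have "\<forall>x\<in>X. poly (R (?L x)) (g x) = 0"
    proof
      fix x assume x: "x \<in> X"
      have "poly (smult (coeff (Q (?L x)) e ^ j) (F (?L x))) (g x) = poly (Q (?L x) * H (?L x) + R (?L x)) (g x)"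
        using HR(4) by simp
      then show "poly (R (?L x)) (g x) = 0" using FX Q(4) x by simp
    qed
    then have "\<exists>i<e. rel i" using relI[OF HR(2)] HR(3) \<open>R y \<noteq> 0\<close> by blast
    then show False using least by blast
  qed
  then have FQH: "smult (coeff (Q y) e ^ j) (F y) = Q y * H y" for y using HR(4) by simp
  obtain W where W: "\<forall>i\<le>e. hp E (Suc d) (e - i) (W i) \<and> (\<forall>y. coeff (Q y) i = coeff (Q y) e * W i y)"
    using divide_leading_coefficient[OF inf E Q(1,2) et Q(3) gF dF F1 HR(1) FQH] by blast
  define v where "v = (\<lambda>y. coeff (Q y) e)"
  have v: "hp E (Suc d) (t - e) v" unfolding v_def by (rule gpolyD(1)[OF Q(1) et])
  define G where "G = (\<lambda>x. g x ^ e + (\<Sum>i<e. W i (?L x) * g x ^ i))"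
  have G: "hp E n e G"
    unfolding G_def
  proof (intro hp.add hp_sum)
    show "hp E n e (\<lambda>x. g x ^ e)" by (rule hp_power1[OF g subfieldD(2)[OF E]])
    fix i assume i: "i \<in> {..<e}"
    have "hp E n (e - i) (\<lambda>x. W i (\<lambda>j. L j x))" by (rule hp_subst[of E "Suc d"]) (use W i L in auto)
    from hp_multI[OF this hp_power1[OF g subfieldD(2)[OF E], of i]] show "hp E n e (\<lambda>x. W i (?L x) * g x ^ i)" using i by auto
  qed
  have vL: "hp E n (t - e) (\<lambda>x. v (?L x))" by (rule hp_subst[OF v]) (rule L)
  \<comment> \<open>the least relation is \<open>v\<close> times the monic one, and \<open>v\<close> does not vanish on \<open>X\<close>\<close>
  have prod: "v (?L x) * G x = 0" if x: "x \<in> X" for x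
  proof -
    have "v (?L x) * G x = v (?L x) * g x ^ e + (\<Sum>i<e. v (?L x) * (W i (?L x) * g x ^ i))"
      unfolding G_def distrib_left sum_distrib_left ..
    also have "(\<Sum>i<e. v (?L x) * (W i (?L x) * g x ^ i)) = (\<Sum>i<e. coeff (Q (?L x)) i * g x ^ i)"
    proof (rule sum.cong[OF refl])
      fix i assume "i \<in> {..<e}"
      then have "coeff (Q (?L x)) i = v (?L x) * W i (?L x)" using W[rule_format, of i] by (simp add: v_def)
      then show "v (?L x) * (W i (?L x) * g x ^ i) = coeff (Q (?L x)) i * g x ^ i" by (simp only: mult.assoc)
    qed
    also have "v (?L x) * g x ^ e + (\<Sum>i<e. coeff (Q (?L x)) i * g x ^ i) = poly (Q (?L x)) (g x)"
      using poly_altdef_le[OF Q(2), of "?L x" "g x"] by (simp only: v_def lessThan_Suc_atMost[symmetric] sum.lessThan_Suc add.commute)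
    finally show ?thesis using Q(4) x by simp
  qed
  have "(\<forall>x\<in>X. v (?L x) = 0) \<or> (\<forall>x\<in>X. G x = 0)"
    by (rule pr[unfolded prime_on_def, rule_format, OF vL G]) (rule prod)
  moreover have "\<not> (\<forall>x\<in>X. v (?L x) = 0)"
  proof
    assume v0: "\<forall>x\<in>X. v (?L x) = 0"
    have "v y = 0" for y by (rule alg_indepD[OF ai v]) (rule bspec[OF v0])
    then show False using Q(3) by (simp add: v_def)
  qed
  ultimately have "\<forall>x\<in>X. G x = 0" by blast
  then show ?thesis using W eD unfolding G_def D_def by (intro exI[of _ e] exI[of _ W]) simp
qed

section \<open>Small projections\<close>

text \<open>
  The set \<open>I\<close> stands for the integers, or the polynomials in \<open>T\<close>, and \<open>sz\<close> for the absolute value at the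
  infinite place. The last condition supplies the sets of \<open>e + 1\<close> small elements from which the
  coordinates of the centres are taken.
\<close>

definition sized :: "'a::field set => 'a set => ('a => real) => bool" where
  "sized k I sz \<longleftrightarrow> I \<subseteq> k \<and> 0 \<in> I \<and> 1 \<in> I \<and> sz 0 \<le> 1 \<and> sz 1 \<le> 1 \<and>
     (\<forall>x\<in>I. sz x \<ge> 0) \<and>
     (\<forall>x\<in>I. \<forall>y\<in>I. x - y \<in> I \<and> x * y \<in> I \<and> sz (x - y) \<le> sz x + sz y \<and> sz (x * y) \<le> sz x * sz y) \<and>
     (\<forall>e::nat. \<exists>S\<subseteq>I. card S = Suc e \<and> (\<forall>s\<in>S. sz s \<le> max 1 (real e)))"

text \<open>
  If the projection were not dominant, one more projection would be possible, and the Hilbert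
  polynomial would have a smaller degree.
\<close>

lemma FG_alg_indep:
  fixes X :: "(nat => 'a::field) set"
  assumes k: "is_subfield k" "infinite k" and E: "is_subfield E" "k \<subseteq> E"
    and X: "X \<noteq> {}" "X \<subseteq> pts aff n"
    and M: "\<And>i. i < Suc d ==> hp E n 1 (M i)" and FG: "FG E n X (Suc d) M"
    and aff: "aff ==> \<forall>x\<in>X. M d x = x (n - 1)" and deg: "degree (hpoly n X) = d"
  shows "alg_indep E X (Suc d) M"
proof (rule ccontr)
  assume ni: "\<not> ?thesis"
  have aff': "Suc d > 0 \<and> (\<forall>x\<in>X. M (Suc d - 1) x = x (n - 1))" if aff using aff[OF that] by simp
  obtain f e p where f: "hp E (Suc d) e f" "\<And>x. x \<in> X ==> f (\<lambda>i. M i x) = 0"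
    and p: "p 0 = 1" "\<And>i. i < Suc d ==> p i \<in> k" "f p \<noteq> 0"
    by (rule exists_center[OF k E(1) X aff' ni]) (simp, rule that)
  have p': "\<And>i. i < Suc d ==> p i \<in> E" using p(2) E(2) by blast
  have FG': "FG E n X d (\<lambda>i x. away p (\<lambda>j. M j x) i)"
    by (rule projection_step[OF E(1) M FG f p(1) p' p(3)])
  show False
  proof (cases d)
    case 0
    obtain x where "x \<in> X" using X(1) by blast
    from FG_no_zero[OF this X(2) FG'[unfolded 0] subfieldD(2)[OF E(1)]] show False by simp
  next
    case (Suc d')
    obtain C where C: "C \<ge> 0" "\<And>t. real (hilb X n t) \<le> C * real ((t + d') choose d')"
      using hilb_le_of_FG[OF FG'[unfolded Suc] E(1)] by blast
    have "degree (hpoly n X) \<le> d'" by (rule degree_le_of_growth[OF hpoly_eventually C(2,1)])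
    then show False using deg Suc by simp
  qed
qed

text \<open>
  A linear form \<open>g\<close> that separates finitely many points of a fibre takes as many values on them, all of
  which are roots of the same polynomial of degree at most \<open>deg X\<close>.
\<close>

lemma fibre_bound:
  fixes X :: "(nat => 'a::alg_closed_field) set"
  assumes k: "infinite k" "k \<subseteq> E" and E: "is_subfield E"
    and X: "X \<noteq> {}" "cone X" "X \<subseteq> pts aff n" and pr: "prime_on E n X" and desc: "desc E n X"
    and L: "\<And>i. i < Suc d ==> hp E n 1 (L i)" and FG: "FG E n X (Suc d) L" and ai: "alg_indep E X (Suc d) L"
  shows "finite {x\<in>X. \<forall>i<Suc d. L i x = y i}" "real (card {x\<in>X. \<forall>i<Suc d. L i x = y i}) \<le> fact d * coeff (hpoly n X) d"
proof -
  let ?D = "fact d * coeff (hpoly n X) d"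
  let ?F = "{x\<in>X. \<forall>i<Suc d. L i x = y i}"
  have infE: "infinite E" using k finite_subset by blast
  have bound: "real (card T) \<le> ?D" if T: "finite T" "T \<subseteq> ?F" for T
  proof -
    \<comment> \<open>its zeros are the \<open>\<tau>\<close> for which the two points are not separated\<close>
    define P where "P = (\<lambda>(x :: nat => 'a, x' :: nat => 'a). \<Sum>j<n. monom (x j - x' j) j)"
    define S where "S = {(x, x'). x \<in> T \<and> x' \<in> T \<and> x \<noteq> x'}"
    have "S \<subseteq> T \<times> T" by (auto simp: S_def)
    then have finS: "finite S" using T(1) finite_subset by blast
    have Pnz: "P z \<noteq> 0" if zS: "z \<in> S" for z
    proof -
      obtain x x' where z: "z = (x, x')" "x \<in> T" "x' \<in> T" "x \<noteq> x'" using zS by (auto simp: S_def)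
      have "x \<in> vecs n" "x' \<in> vecs n" using z T(2) X(3) by (auto simp: pts_def)
      moreover obtain j where "x j \<noteq> x' j" using z(4) by auto
      ultimately have "j < n" "coeff (P z) j \<noteq> 0" by (auto simp: P_def z(1) coeff_sum vecs_def not_le[symmetric])
      then show ?thesis by auto
    qed
    have "(\<Prod>z\<in>S. P z) \<noteq> 0" using Pnz finS by simp
    then obtain \<tau> where \<tau>: "\<tau> \<in> k" "poly (\<Prod>z\<in>S. P z) \<tau> \<noteq> 0" using poly_nonzero_in_set k(1) by blast
    \<comment> \<open>a linear form with coefficients \<open>1, \<tau>, \<dots>\<close> that separates the points of \<open>T\<close>\<close>
    define g where "g = (\<lambda>x. \<Sum>j<n. \<tau> ^ j * x j)"
    have "\<tau> \<in> E" using \<tau>(1) k(2) by blast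
    then have g: "hp E n 1 g" unfolding g_def by (intro hp_sum hp_cmult hp_var1 subfieldD(9)[OF E]) auto
    have inj: "inj_on g T"
    proof (rule inj_onI, rule ccontr)
      fix x x' assume xx: "x \<in> T" "x' \<in> T" "g x = g x'" "x \<noteq> x'"
      have zS: "(x, x') \<in> S" using xx by (simp add: S_def)
      have "poly (P (x, x')) \<tau> = g x - g x'"
        by (simp add: P_def g_def poly_sum poly_monom algebra_simps sum_subtractf)
      then have "poly (P (x, x')) \<tau> = 0" using xx(3) by simp
      then have "poly (\<Prod>z\<in>S. P z) \<tau> = 0" using finS zS by (auto simp: poly_prod)
      then show False using \<tau>(2) by simp
    qed
    obtain e w where ew: "real e \<le> ?D" "\<forall>i<e. hp E (Suc d) (e - i) (w i)"
      "\<forall>x\<in>X. g x ^ e + (\<Sum>i<e. w i (\<lambda>j. L j x) * g x ^ i) = 0"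
      using integral_relation_degree_le[OF infE E X(1,2) pr desc L FG ai g] by blast
    define p where "p = monom 1 e + (\<Sum>i<e. monom (w i y) i)"
    have "coeff p e = 1" by (simp add: p_def coeff_sum)
    then have p0: "p \<noteq> 0" by auto
    have "degree p \<le> e" by (rule degree_le) (simp add: p_def coeff_sum)
    have "g ` T \<subseteq> {s. poly p s = 0}"
    proof
      fix s assume "s \<in> g ` T"
      then obtain x where x: "x \<in> T" "s = g x" by blast
      have xF: "x \<in> X" "\<forall>i<Suc d. L i x = y i" using x(1) T(2) by auto
      have "w i y = w i (\<lambda>j. L j x)" if "i < e" for i
        by (rule hp_cong[OF ew(2)[rule_format, OF that]]) (use xF(2) in simp)
      then have "poly p s = g x ^ e + (\<Sum>i<e. w i (\<lambda>j. L j x) * g x ^ i)"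
        by (simp add: p_def poly_sum poly_monom x(2))
      then show "s \<in> {s. poly p s = 0}" using ew(3) xF(1) by simp
    qed
    then have "card (g ` T) \<le> card {s. poly p s = 0}" by (intro card_mono poly_roots_finite p0)
    also have "... \<le> degree p" by (rule card_poly_roots_bound[OF p0])
    finally have "card T \<le> e" using card_image[OF inj] \<open>degree p \<le> e\<close> by simp
    then show ?thesis using ew(1) by linarith
  qed
  show fin: "finite ?F"
  proof (rule ccontr)
    assume "infinite ?F"
    from infinite_arbitrarily_large[OF this, of "Suc (nat \<lfloor>?D\<rfloor>)"]
    obtain T where T: "finite T" "card T = Suc (nat \<lfloor>?D\<rfloor>)" "T \<subseteq> ?F" by (elim exE conjE)
    have "real (card T) > ?D" unfolding T(2) by linarith
    then show False using bound[OF T(1,3)] by simp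
  qed
  show "real (card ?F) \<le> ?D" by (rule bound[OF fin order_refl])
qed

definition linfun :: "nat => (nat => nat => 'a::field) => nat => (nat => 'a) => 'a" where
  "linfun n A i x = (\<Sum>j<n. A i j * x j)"

lemma hp_linfun: "(\<And>j. j < n ==> A i j \<in> E) ==> hp E n 1 (linfun n A i)"
proof -
  assume A: "\<And>j. j < n ==> A i j \<in> E"
  have "hp E n 1 (\<lambda>x. \<Sum>j<n. A i j * x j)" using A by (intro hp_sum hp_cmult hp_var1) auto
  then show ?thesis unfolding linfun_def[abs_def] .
qed

lemma linfun_delta:
  assumes "\<And>j. j < n ==> A i j = (if j = l then 1 else 0)" "l < n"
  shows "linfun n A i x = x l"
proof -
  have "linfun n A i x = (\<Sum>j<n. if j = l then x j else 0)"
    unfolding linfun_def by (intro sum.cong refl) (simp add: assms(1))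
  then show ?thesis using assms(2) by simp
qed

text \<open>
  The heart of the height bound. As long as \<open>r > d\<close>, the image of \<open>X\<close> in projective \<open>r\<close>-space satisfies a
  relation \<open>f\<close> of degree \<open>e \<le> D\<close>, namely the monic relation of the first coordinate over a Noether
  normalization \<open>\<Lambda>\<close>. It is nonzero at the point \<open>y0\<close> where all \<open>\<Lambda>\<^sub>i\<close> vanish and the first coordinate
  is \<open>1\<close>. Hence there is a centre with coordinates in a set of \<open>e + 1\<close> small elements.
\<close>

lemma small_projection_step:
  fixes X :: "(nat => 'a::alg_closed_field) set"
  assumes k: "is_subfield k" "infinite k" and E: "is_subfield E" "k \<subseteq> E" and sz: "sized k I sz"
    and X: "X \<noteq> {}" "cone X" "X \<subseteq> pts aff n" and pr: "prime_on E n X" and desc: "desc E n X" and n: "n > 0"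
    and d: "d = degree (hpoly n X)" and D: "D = fact d * coeff (hpoly n X) d" "D \<ge> 1"
    and r: "r > d"
    and A: "\<And>i j. i < Suc r ==> j < n ==> A i j \<in> I \<and> sz (A i j) \<le> B" and FG: "FG E n X (Suc r) (linfun n A)"
    and aff: "aff ==> (\<forall>j<n. A r j = (if j = n - 1 then 1 else 0)) \<and> (\<forall>i<r. A i (n - 1) = 0)"
  shows "\<exists>A'. (\<forall>i<r. \<forall>j<n. A' i j \<in> I \<and> sz (A' i j) \<le> 2 * D * B) \<and> FG E n X r (linfun n A') \<and>
    (aff --> (\<forall>j<n. A' (r - 1) j = (if j = n - 1 then 1 else 0)) \<and> (\<forall>i<r - 1. A' i (n - 1) = 0))"
proof -
  let ?M = "linfun n A"
  have infU: "infinite (UNIV :: 'a set)" using k(2) finite_subset[of k UNIV] by auto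
  have infE: "infinite E" using k(2) E(2) finite_subset by blast
  have Ik: "I \<subseteq> k" using sz by (simp add: sized_def)
  have Ak: "A i j \<in> k" if "i < Suc r" "j < n" for i j using A[OF that] Ik by blast
  have Mk: "hp k n 1 (?M i)" if "i < Suc r" for i by (rule hp_linfun) (rule Ak[OF that])
  have ME: "hp E n 1 (?M i)" if "i < Suc r" for i by (rule hp_mono[OF Mk[OF that] E(2) order_refl])
  have aff': "Suc r > 0 \<and> (\<forall>x\<in>X. ?M (Suc r - 1) x = x (n - 1))" if aff
    using linfun_delta[of n A r "n - 1"] aff[OF that] n by simp
  have "\<exists>d' \<Lambda>. noether_forms k E aff n X (Suc r) ?M d' \<Lambda>"
    by (rule noether_normalization[OF k E X(1,3) Mk FG aff'])
  then obtain d' \<Lambda> where N: "\<forall>i<d'. hp k (Suc r) 1 (\<Lambda> i)" "FG E n X d' (\<lambda>i x. \<Lambda> i (\<lambda>j. ?M j x))"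
    "alg_indep E X d' (\<lambda>i x. \<Lambda> i (\<lambda>j. ?M j x))"
    "d' < Suc r --> (\<exists>y0. y0 0 = 1 \<and> (aff --> y0 (Suc r - 1) = 0) \<and> (\<forall>i<d'. \<Lambda> i y0 = 0))"
    unfolding noether_forms_def by (elim exE conjE)
  define L where "L = (\<lambda>i x. \<Lambda> i (\<lambda>j. ?M j x))"
  obtain x0 where "x0 \<in> X" using X(1) by blast
  from FG_no_zero[OF this X(3) N(2) subfieldD(2)[OF E(1)]] have "d' > 0" by auto
  then obtain d1 where d1: "d' = Suc d1" by (cases d') auto
  have Lam: "hp E (Suc r) 1 (\<Lambda> i)" if "i < Suc d1" for i
    by (rule hp_mono[of k "Suc r"]) (use N(1) that d1 E(2) in auto)
  have L: "hp E n 1 (L i)" if "i < Suc d1" for i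
    unfolding L_def by (rule hp_subst[OF Lam[OF that]]) (rule ME)
  have FGL: "FG E n X (Suc d1) L" and aiL: "alg_indep E X (Suc d1) L" using N(2,3) d1 by (simp_all add: L_def)
  have "degree (hpoly n X) = d1" by (rule degree_hpoly(1)[OF infU E(1) desc L FGL aiL])
  then have dd: "d1 = d" using d by simp
  obtain y0 where y0: "y0 0 = 1" "aff ==> y0 r = 0" "\<forall>i<Suc d. \<Lambda> i y0 = 0"
    using N(4) d1 dd r by auto
  have M0: "hp E n 1 (?M 0)" by (rule ME) simp
  obtain e w where ew: "real e \<le> fact d1 * coeff (hpoly n X) d1" "\<forall>i<e. hp E (Suc d1) (e - i) (w i)"
    "\<forall>x\<in>X. ?M 0 x ^ e + (\<Sum>i<e. w i (\<lambda>j. L j x) * ?M 0 x ^ i) = 0"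
    using integral_relation_degree_le[OF infE E(1) X(1,2) pr desc L FGL aiL M0] by blast
  have eD: "real e \<le> D" using ew(1) dd D(1) by simp
  define f where "f = (\<lambda>y. y 0 ^ e + (\<Sum>i<e. w i (\<lambda>j. \<Lambda> j y) * y 0 ^ i))"
  have f: "hp E (Suc r) e f"
    unfolding f_def
  proof (intro hp.add hp_sum)
    have v: "hp E (Suc r) 1 (\<lambda>y. y 0)" by (rule hp_var1) simp
    show "hp E (Suc r) e (\<lambda>y. y 0 ^ e)" by (rule hp_power1[OF v subfieldD(2)[OF E(1)]])
    fix i assume i: "i \<in> {..<e}"
    have "hp E (Suc r) (e - i) (\<lambda>y. w i (\<lambda>j. \<Lambda> j y))" by (rule hp_subst[of E "Suc d1"]) (use ew(2) i Lam in auto)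
    from hp_multI[OF this hp_power1[OF v subfieldD(2)[OF E(1)], of i]] show "hp E (Suc r) e (\<lambda>y. w i (\<lambda>j. \<Lambda> j y) * y 0 ^ i)" using i by auto
  qed
  have fX: "f (\<lambda>i. ?M i x) = 0" if "x \<in> X" for x using ew(3) that by (simp add: f_def L_def)
  have "f y0 \<noteq> 0"
  proof -
    have "w i (\<lambda>j. \<Lambda> j y0) = 0" if i: "i < e" for i
    proof -
      have wi: "hp E (Suc d1) (e - i) (w i)" using ew(2) i by blast
      show ?thesis by (rule hp_zero_pos[OF wi]) (use i y0(3) dd in auto)
    qed
    then show ?thesis using y0(1) by (simp add: f_def)
  qed
  obtain S where S: "S \<subseteq> I" "card S = Suc e" "\<forall>s\<in>S. sz s \<le> max 1 (real e)" using sz unfolding sized_def by blast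
  \<comment> \<open>the first coordinate stays \<open>1\<close>; in the affine case the last one stays \<open>0\<close>\<close>
  define J where "J = {1..<(if aff then r else Suc r)}"
  obtain p where p: "f p \<noteq> 0" "\<forall>i\<in>J. p i \<in> S" "\<forall>i. i \<notin> J --> p i = y0 i"
    using hp_nonvanishing_in_set[OF hp_mono[OF f subset_UNIV order_refl], of S y0 J] S(2) \<open>f y0 \<noteq> 0\<close> unfolding J_def by auto
  have p0: "p 0 = 1" using p(3) y0(1) by (simp add: J_def)
  have pr0: "p r = 0" if aff using p(3) y0(2) that by (simp add: J_def)
  have szD: "\<forall>x\<in>I. sz x \<ge> 0" "sz 0 \<le> 1" "sz 1 \<le> 1" "0 \<in> I" "1 \<in> I"
    "\<And>x y. x \<in> I ==> y \<in> I ==> x - y \<in> I \<and> x * y \<in> I \<and> sz (x - y) \<le> sz x + sz y \<and> sz (x * y) \<le> sz x * sz y"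
    using sz unfolding sized_def by auto
  have pI: "p i \<in> I \<and> sz (p i) \<le> D" if "i < Suc r" for i
  proof (cases "i \<in> J")
    case True
    then have "p i \<in> S" using p(2) by blast
    then show ?thesis using S(1,3) eD D(2) by fastforce
  next
    case False
    then have "i = 0 \<or> aff \<and> i = r" using that by (auto simp: J_def split: if_splits)
    then show ?thesis using p0 pr0 szD D(2) by auto
  qed
  define A' where "A' = (\<lambda>i j. A (Suc i) j - p (Suc i) * A 0 j)"
  have eq: "linfun n A' = (\<lambda>i x. away p (\<lambda>j. ?M j x) i)"
    by (simp add: fun_eq_iff linfun_def away_def A'_def left_diff_distrib sum_subtractf sum_distrib_left mult.assoc)
  have pE: "p i \<in> E" if "i < Suc r" for i using pI[OF that] Ik E(2) by blast
  have "FG E n X r (linfun n A')"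
    unfolding eq by (rule projection_step[OF E(1) ME FG f fX p0 pE p(1)])
  moreover have "A' i j \<in> I \<and> sz (A' i j) \<le> 2 * D * B" if ij: "i < r" "j < n" for i j
  proof -
    have a: "A (Suc i) j \<in> I" "sz (A (Suc i) j) \<le> B" "A 0 j \<in> I" "sz (A 0 j) \<le> B" "p (Suc i) \<in> I" "sz (p (Suc i)) \<le> D"
      using A[of "Suc i" j] A[of 0 j] pI[of "Suc i"] ij by auto
    have "sz (A 0 j) \<ge> 0" using szD(1) a(3) by blast
    then have B0: "B \<ge> 0" using a(4) by linarith
    have pa: "p (Suc i) * A 0 j \<in> I" "sz (p (Suc i) * A 0 j) \<le> sz (p (Suc i)) * sz (A 0 j)" using szD(6)[OF a(5,3)] by auto
    have "sz (p (Suc i)) * sz (A 0 j) \<le> D * B" by (rule mult_mono) (use a \<open>sz (A 0 j) \<ge> 0\<close> D(2) in auto)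
    then have 1: "sz (A' i j) \<le> B + D * B" unfolding A'_def using szD(6)[OF a(1) pa(1)] pa(2) a(2) by linarith
    have "1 * B \<le> D * B" by (rule mult_right_mono[OF D(2) B0])
    then have "sz (A' i j) \<le> 2 * D * B" using 1 by linarith
    then show ?thesis using szD(6)[OF a(1) pa(1)] unfolding A'_def by blast
  qed
  moreover have "(\<forall>j<n. A' (r - 1) j = (if j = n - 1 then 1 else 0)) \<and> (\<forall>i<r - 1. A' i (n - 1) = 0)" if aff
  proof -
    have "r > 0" using r by simp
    then have "A' (r - 1) j = A r j" for j using pr0[OF that] by (simp add: A'_def)
    moreover have "A' i (n - 1) = 0" if "i < r - 1" for i using aff[OF \<open>aff\<close>] that \<open>r > 0\<close> by (simp add: A'_def)
    ultimately show ?thesis using aff[OF that] by simp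
  qed
  ultimately show ?thesis by (intro exI[of _ A']) blast
qed

text \<open>
  Projecting \<open>n - 1 - d\<close> times, starting from the coordinate functions.
\<close>

theorem small_normalization:
  fixes X :: "(nat => 'a::alg_closed_field) set"
  assumes k: "is_subfield k" "infinite k" and E: "is_subfield E" "k \<subseteq> E" and sz: "sized k I sz"
    and X: "X \<noteq> {}" "cone X" "X \<subseteq> pts aff n" and pr: "prime_on E n X" and desc: "desc E n X" and n: "n > 0"
    and d: "d = degree (hpoly n X)" and D: "D = fact d * coeff (hpoly n X) d"
  shows "\<exists>A. (\<forall>i\<le>d. \<forall>j<n. A i j \<in> I \<and> sz (A i j) \<le> (2 * D) ^ (n - 1 - d)) \<and> FG E n X (Suc d) (linfun n A) \<and>
    alg_indep E X (Suc d) (linfun n A) \<and>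
    (aff --> (\<forall>j<n. A d j = (if j = n - 1 then 1 else 0)) \<and> (\<forall>i<d. A i (n - 1) = 0))"
proof -
  have infU: "infinite (UNIV :: 'a set)" using k(2) finite_subset[of k UNIV] by auto
  have E1: "1 \<in> E" and Ik: "I \<subseteq> k" using subfieldD(2)[OF E(1)] sz by (auto simp: sized_def)
  have szD: "sz 0 \<le> 1" "sz 1 \<le> 1" "0 \<in> I" "1 \<in> I" using sz unfolding sized_def by auto
  define A0 where "A0 = (\<lambda>i j::nat. if j = i then 1 else (0::'a))"
  have A0: "linfun n A0 i x = x i" if "i < n" for i x
    by (rule linfun_delta) (use that in \<open>auto simp: A0_def\<close>)
  have FGid: "FG E n X n (\<lambda>i x. x i)" by (rule FG_id[OF E1])
  have one: "d < n \<and> D \<ge> 1"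
  proof -
    have "\<exists>d \<Lambda>. noether_forms k E aff n X n (\<lambda>i x. x i) d \<Lambda>"
      by (rule noether_normalization[OF k E X(1,3) _ FGid]) (use n in \<open>auto intro: hp.var\<close>)
    then obtain d' \<Lambda> where N: "d' \<le> n" "\<forall>i<d'. hp k n 1 (\<Lambda> i)" "FG E n X d' (\<lambda>i x. \<Lambda> i (\<lambda>j. x j))"
      "alg_indep E X d' (\<lambda>i x. \<Lambda> i (\<lambda>j. x j))" unfolding noether_forms_def by (elim exE conjE)
    obtain x0 where "x0 \<in> X" using X(1) by blast
    from FG_no_zero[OF this X(3) N(3) E1] have "d' > 0" by auto
    then obtain d1 where d1: "d' = Suc d1" by (cases d') auto
    have Lam: "hp E n 1 (\<Lambda> i)" if "i < Suc d1" for i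
      by (rule hp_mono[of k n]) (use N(2) that d1 E(2) in auto)
    have "FG E n X (Suc d1) \<Lambda>" "alg_indep E X (Suc d1) \<Lambda>" using N(3,4) d1 by simp_all
    from degree_hpoly[OF infU E(1) desc Lam this] show ?thesis using d D N(1) d1 by simp
  qed
  have "s \<le> n - Suc d ==> \<exists>A. (\<forall>i<n - s. \<forall>j<n. A i j \<in> I \<and> sz (A i j) \<le> (2 * D) ^ s) \<and> FG E n X (n - s) (linfun n A) \<and>
    (aff --> (\<forall>j<n. A (n - s - 1) j = (if j = n - 1 then 1 else 0)) \<and> (\<forall>i<n - s - 1. A i (n - 1) = 0))" for s
  proof (induction s)
    case 0
    have "FG E n X n (linfun n A0)"
    proof -
      obtain U where U: "finite U" "\<forall>(u, a)\<in>U. hp E n a u"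
        "\<forall>t f. hp E n t f --> (\<exists>g. fgs E n (\<lambda>i x. x i) U t g \<and> (\<forall>x\<in>X. f x = g x))"
        using FGid unfolding FG_def by (elim exE conjE)
      have "fgs E n (linfun n A0) U t g" if "fgs E n (\<lambda>i x. x i) U t g" for t g
        using that
      proof (induction rule: fgs.induct)
        case (gen u a s b t)
        have "b (\<lambda>i. linfun n A0 i x) = b (\<lambda>i. x i)" for x by (rule hp_cong[OF gen(2)]) (simp add: A0)
        then have "(\<lambda>x. b (\<lambda>i. x i) * u x) = (\<lambda>x. b (\<lambda>i. linfun n A0 i x) * u x)" by simp
        then show ?case using fgs.gen[OF gen, of "linfun n A0"] by simp
      qed (auto intro: fgs.intros)
      then show ?thesis unfolding FG_def using U by (intro exI[of _ U]) blast
    qed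
    then show ?case using szD n by (intro exI[of _ A0]) (auto simp: A0_def)
  next
    case (Suc s)
    define r where "r = n - Suc s"
    have r: "n - s = Suc r" "n - Suc s = r" "r > d" using Suc.prems one by (auto simp: r_def)
    have "s \<le> n - Suc d" using Suc.prems by simp
    from Suc.IH[OF this] obtain A where A: "\<forall>i<Suc r. \<forall>j<n. A i j \<in> I \<and> sz (A i j) \<le> (2 * D) ^ s" "FG E n X (Suc r) (linfun n A)"
      "aff --> (\<forall>j<n. A r j = (if j = n - 1 then 1 else 0)) \<and> (\<forall>i<r. A i (n - 1) = 0)"
      unfolding r(1) by auto
    have "\<exists>A'. (\<forall>i<r. \<forall>j<n. A' i j \<in> I \<and> sz (A' i j) \<le> 2 * D * (2 * D) ^ s) \<and> FG E n X r (linfun n A') \<and>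
      (aff --> (\<forall>j<n. A' (r - 1) j = (if j = n - 1 then 1 else 0)) \<and> (\<forall>i<r - 1. A' i (n - 1) = 0))"
      by (rule small_projection_step[OF k E sz X pr desc n d D _ r(3) _ A(2)]) (use one A(1,3) in blast)+
    then show ?case unfolding r(2) by simp
  qed
  from this[of "n - Suc d"] one obtain A where A: "\<forall>i<Suc d. \<forall>j<n. A i j \<in> I \<and> sz (A i j) \<le> (2 * D) ^ (n - Suc d)"
    "FG E n X (Suc d) (linfun n A)" "aff --> (\<forall>j<n. A d j = (if j = n - 1 then 1 else 0)) \<and> (\<forall>i<d. A i (n - 1) = 0)"
    by auto
  have AE: "hp E n 1 (linfun n A i)" if "i < Suc d" for i
    by (rule hp_linfun) (use A(1) that Ik E(2) in blast)
  have affd: "\<forall>x\<in>X. linfun n A d x = x (n - 1)" if aff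
    using linfun_delta[of n A d "n - 1"] A(3) that n by simp
  have "alg_indep E X (Suc d) (linfun n A)"
    by (rule FG_alg_indep[OF k E X(1,3) AE A(2) affd d[symmetric]])
  then show ?thesis using A by (intro exI[of _ A]) (simp add: less_Suc_eq_le)
qed

lemma fgs_mono: "fgs E r M U t f ==> E \<subseteq> E' ==> fgs E' r M U t f"
  by (induction rule: fgs.induct) (auto intro: fgs.intros hp_mono)

lemma fgs_cmult: "fgs E r M U t f ==> c \<in> E ==> fgs E r M U t (\<lambda>x. c * f x)"
proof (induction rule: fgs.induct)
  case (gen u a s b t)
  from fgs.gen[OF gen(1) hp_cmult[OF gen(2,4)] gen(3), of M] show ?case by (simp add: mult.assoc)
qed (auto intro: fgs.intros simp: distrib_left)

lemma FG_UNIV: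
  fixes X :: "(nat => 'a::field) set"
  assumes FG: "FG E n X r M" and E: "is_subfield E"
  shows "FG UNIV n X r M"
proof -
  obtain U where U: "finite U" "\<forall>(u, a)\<in>U. hp E n a u"
    "\<forall>t f. hp E n t f --> (\<exists>g. fgs E r M U t g \<and> (\<forall>x\<in>X. f x = g x))"
    using FG unfolding FG_def by (elim exE conjE)
  show ?thesis
    unfolding FG_def
  proof (intro exI[of _ U] conjI allI impI)
    show "\<forall>(u, a)\<in>U. hp UNIV n a u" using U(2) hp_mono[OF _ subset_UNIV order_refl] by blast
    fix t f assume f: "hp (UNIV :: 'a set) n t f"
    obtain a where a: "f = (\<lambda>x. \<Sum>\<mu>\<in>Mon n t. a \<mu> * mon \<mu> x)"
      using hp_normal_form[OF f subfield_UNIV] by blast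
    have "\<forall>\<mu>\<in>Mon n t. \<exists>g. fgs E r M U t g \<and> (\<forall>x\<in>X. mon \<mu> x = g x)"
      using U(3) hp_mon[OF _ subfieldD(2)[OF E]] by blast
    from bchoice[OF this] obtain g where g: "\<forall>\<mu>\<in>Mon n t. fgs E r M U t (g \<mu>) \<and> (\<forall>x\<in>X. mon \<mu> x = g \<mu> x)" by (elim exE)
    show "\<exists>h. fgs UNIV r M U t h \<and> (\<forall>x\<in>X. f x = h x)"
    proof (intro exI[of _ "\<lambda>x. \<Sum>\<mu>\<in>Mon n t. a \<mu> * g \<mu> x"] conjI ballI)
      show "fgs UNIV r M U t (\<lambda>x. \<Sum>\<mu>\<in>Mon n t. a \<mu> * g \<mu> x)"
        by (intro fgs_sum fgs_cmult UNIV_I) (use g fgs_mono in blast)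
      fix x assume x: "x \<in> X"
      show "f x = (\<Sum>\<mu>\<in>Mon n t. a \<mu> * g \<mu> x)" unfolding a by (intro sum.cong refl) (use g x in simp)
    qed
  qed (use U(1) in simp)
qed

section \<open>Forms as polynomials and as functions\<close>

lemma mp_eval_superset:
  assumes "finite A" "pkeys f \<subseteq> A"
  shows "mp_eval f x = (\<Sum>\<mu>\<in>A. plookup f \<mu> * mon \<mu> x)"
  unfolding mp_eval_def mon_def[symmetric]
  by (rule sum.mono_neutral_left) (use assms in \<open>auto simp: in_keys_iff\<close>)

lemma forms_iff: "f \<in> forms S n d \<longleftrightarrow> (\<forall>\<mu>. plookup f \<mu> \<in> S) \<and> pkeys f \<subseteq> Mon n d"
  by (auto simp: forms_def mpols_def Mon_def mdeg_def)

lemma mp_eval_form: "f \<in> forms S n d ==> mp_eval f x = (\<Sum>\<mu>\<in>Mon n d. plookup f \<mu> * mon \<mu> x)"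
  by (intro mp_eval_superset finite_Mon) (simp add: forms_iff)

lemma poly_mapping_of_fun:
  fixes c :: "'i => 'a::comm_monoid_add"
  assumes "finite A"
  shows "plookup (\<Sum>\<mu>\<in>A. Poly_Mapping.single \<mu> (c \<mu>)) \<nu> = (if \<nu> \<in> A then c \<nu> else 0)"
  using assms by (simp add: lookup_sum lookup_single when_def)

lemma form_of_fun:
  assumes "\<And>\<mu>. c \<mu> \<in> S" "0 \<in> S"
  shows "(\<Sum>\<mu>\<in>Mon n d. Poly_Mapping.single \<mu> (c \<mu>)) \<in> forms S n d"
  using assms by (auto simp: forms_iff poly_mapping_of_fun finite_Mon in_keys_iff split: if_splits)

lemma hp_of_form: "f \<in> forms E n t ==> is_subfield E ==> hp E n t (mp_eval f)"
proof -
  assume f: "f \<in> forms E n t" and E: "is_subfield E"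
  have "mp_eval f = (\<lambda>x. \<Sum>\<mu>\<in>Mon n t. plookup f \<mu> * mon \<mu> x)" using mp_eval_form[OF f] by (simp add: fun_eq_iff)
  then show ?thesis using hp_of_normal_form[OF E, of n t "plookup f"] f by (simp add: forms_iff)
qed

lemma form_of_hp: "hp E n t g ==> is_subfield E ==> \<exists>f\<in>forms E n t. mp_eval f = g"
proof -
  assume g: "hp E n t g" and E: "is_subfield E"
  obtain c where c: "\<forall>\<mu>. c \<mu> \<in> E" "g = (\<lambda>x. \<Sum>\<mu>\<in>Mon n t. c \<mu> * mon \<mu> x)"
    using hp_normal_form[OF g E] by blast
  let ?f = "\<Sum>\<mu>\<in>Mon n t. Poly_Mapping.single \<mu> (c \<mu>)"
  have f: "?f \<in> forms E n t" by (rule form_of_fun) (use c(1) E in \<open>auto simp: subfieldD\<close>)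
  have "mp_eval ?f x = g x" for x
    unfolding mp_eval_form[OF f] c(2) by (intro sum.cong refl) (simp add: poly_mapping_of_fun finite_Mon)
  then show ?thesis using f by (intro bexI[OF _ f]) (simp add: fun_eq_iff)
qed

lemma lookup_mp_scale: "plookup (mp_scale a f) \<mu> = a * plookup f \<mu>"
  unfolding mp_scale_def by (simp add: map.rep_eq when_def flip: mult_map_scale_conv_mult)

lemma mp_eval_add: "mp_eval (f + h :: 'a::field mpol) x = mp_eval f x + mp_eval h x"
proof -
  have "finite (pkeys f \<union> pkeys h)" by simp
  note sup = mp_eval_superset[OF this]
  show ?thesis using Poly_Mapping.keys_add[of f h]
    by (simp add: sup lookup_add sum.distrib distrib_right)
qed

lemma mp_eval_scale: "mp_eval (mp_scale a f :: 'a::field mpol) x = a * mp_eval f x"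
proof -
  have "pkeys (mp_scale a f) \<subseteq> pkeys f" by (auto simp: in_keys_iff lookup_mp_scale)
  then show ?thesis
    by (simp add: mp_eval_superset[OF finite_keys] mp_eval_superset[OF finite_keys order_refl, of f x] lookup_mp_scale sum_distrib_left mult.assoc)
qed

text \<open>
  The vanishing forms have a basis consisting of one form for each leading monomial, which is that
  monomial minus its reduction to standard ones.
\<close>

lemma hilbert_function_eq_hilb:
  fixes V :: "'a::field ppoint set"
  shows "hilbert_function m V t = hilb (\<Union>V) (Suc m) t"
proof -
  let ?n = "Suc m" and ?X = "\<Union>V"
  let ?M = "Mon ?n t" and ?S = "Std ?X ?n t"
  let ?s = "\<lambda>\<mu>. Poly_Mapping.single \<mu> (1 :: 'a)"
  have SM: "?S \<subseteq> ?M" by (auto simp: Std_def)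
  have expand: "f = (\<Sum>\<mu>\<in>?M. mp_scale (plookup f \<mu>) (?s \<mu>))" if "f \<in> forms UNIV ?n t" for f :: "'a mpol"
  proof (rule poly_mapping_eqI)
    fix \<nu>
    show "plookup f \<nu> = plookup (\<Sum>\<mu>\<in>?M. mp_scale (plookup f \<mu>) (?s \<mu>)) \<nu>"
      using that finite_Mon[of ?n t]
      by (auto simp: lookup_sum lookup_mp_scale lookup_single when_def forms_iff not_in_keys_iff_lookup_eq_zero if_distrib[of "(*) _"] cong: if_cong)
  qed
  have dim_forms: "mp.dim (forms UNIV ?n t :: 'a mpol set) = card ?M"
  proof -
    have *: "\<forall>\<mu>\<in>?M. c \<mu> = 0" if eq: "(\<Sum>\<mu>\<in>?M. mp_scale (c \<mu>) (?s \<mu>)) = 0" for c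
    proof
      fix \<nu> assume "\<nu> \<in> ?M"
      moreover have "plookup (\<Sum>\<mu>\<in>?M. mp_scale (c \<mu>) (?s \<mu>)) \<nu> = 0" unfolding eq by simp
      ultimately show "c \<nu> = 0" using finite_Mon[of ?n t]
        by (simp add: lookup_sum lookup_mp_scale lookup_single when_def if_distrib[of "(*) _"] cong: if_cong)
    qed
    note ind = mp.independent_familyI[where g = ?s, OF finite_Mon *]
    have "?s ` ?M \<subseteq> forms UNIV ?n t" by (auto simp: forms_iff)
    moreover have "forms UNIV ?n t \<subseteq> mp.span (?s ` ?M)"
    proof
      fix f :: "'a mpol" assume f: "f \<in> forms UNIV ?n t"
      show "f \<in> mp.span (?s ` ?M)"
        by (subst expand[OF f], intro mp.span_sum mp.span_scale mp.span_base imageI)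
    qed
    ultimately show ?thesis using mp.basis_card_eq_dim[of "?s ` ?M" "forms UNIV ?n t"] ind card_image[OF ind(1)] by simp
  qed
  have "\<forall>\<mu>\<in>?M - ?S. \<exists>c. \<forall>x\<in>?X. mon \<mu> x = (\<Sum>\<nu>\<in>?S. c \<nu> * mon \<nu> x)" using mon_in_Std by blast
  from bchoice[OF this] obtain C where C: "\<forall>\<mu>\<in>?M - ?S. \<forall>x\<in>?X. mon \<mu> x = (\<Sum>\<nu>\<in>?S. C \<mu> \<nu> * mon \<nu> x)" by (elim exE)
  \<comment> \<open>the forms \<open>g\<^sub>\<mu>\<close> are the basis of the vanishing forms\<close>
  define g where "g = (\<lambda>\<mu>. ?s \<mu> - (\<Sum>\<nu>\<in>?S. Poly_Mapping.single \<nu> (C \<mu> \<nu>)))"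
  have lg: "plookup (g \<mu>) \<nu> = (if \<nu> = \<mu> then 1 else 0) - (if \<nu> \<in> ?S then C \<mu> \<nu> else 0)" for \<mu> \<nu>
    by (auto simp: g_def lookup_minus poly_mapping_of_fun finite_Std lookup_single when_def)
  have vf: "f \<in> vanishing_forms m V t \<longleftrightarrow> f \<in> forms UNIV ?n t \<and> (\<forall>x\<in>?X. mp_eval f x = 0)" for f
    by (auto simp: vanishing_forms_def)
  have sub: "mp.subspace (vanishing_forms m V t)"
  proof (rule mp.subspaceI)
    show "0 \<in> vanishing_forms m V t" by (simp add: vf forms_iff mp_eval_def)
  next
    fix f h :: "'a mpol" assume fh: "f \<in> vanishing_forms m V t" "h \<in> vanishing_forms m V t"
    have s: "f + h \<in> forms UNIV ?n t" using fh Poly_Mapping.keys_add[of f h] by (auto simp: vf forms_iff)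
    then show "f + h \<in> vanishing_forms m V t" using fh by (simp add: vf mp_eval_add)
  next
    fix a and f :: "'a mpol" assume f: "f \<in> vanishing_forms m V t"
    have s: "mp_scale a f \<in> forms UNIV ?n t" using f by (auto simp: vf forms_iff in_keys_iff lookup_mp_scale)
    then show "mp_scale a f \<in> vanishing_forms m V t" using f by (simp add: vf mp_eval_scale)
  qed
  have gv: "g \<mu> \<in> vanishing_forms m V t" if \<mu>: "\<mu> \<in> ?M - ?S" for \<mu>
  proof -
    have gf: "g \<mu> \<in> forms UNIV ?n t" using \<mu> SM by (auto simp: forms_iff in_keys_iff lg split: if_splits)
    have "mp_eval (g \<mu>) x = 0" if "x \<in> ?X" for x
    proof -
      have "mp_eval (g \<mu>) x = (\<Sum>\<nu>\<in>?M. (if \<nu> = \<mu> then mon \<nu> x else 0) - (if \<nu> \<in> ?S then C \<mu> \<nu> * mon \<nu> x else 0))"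
        unfolding mp_eval_form[OF gf] lg by (intro sum.cong refl) (simp add: left_diff_distrib)
      also have "... = mon \<mu> x - (\<Sum>\<nu>\<in>?M \<inter> ?S. C \<mu> \<nu> * mon \<nu> x)"
        using \<mu> finite_Mon[of ?n t] by (simp add: sum_subtractf sum.inter_restrict)
      also have "?M \<inter> ?S = ?S" using SM by blast
      also have "mon \<mu> x - (\<Sum>\<nu>\<in>?S. C \<mu> \<nu> * mon \<nu> x) = 0" using bspec[OF bspec[OF C \<mu>] that] by simp
      finally show ?thesis .
    qed
    then show ?thesis using gf by (simp add: vf)
  qed
  have fin: "finite (?M - ?S)" using finite_Mon[of ?n t] by simp
  have lsum: "plookup (\<Sum>\<mu>\<in>?M - ?S. mp_scale (c \<mu>) (g \<mu>)) \<nu> = c \<nu>" if \<nu>: "\<nu> \<in> ?M - ?S" for c \<nu>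
  proof -
    have "plookup (\<Sum>\<mu>\<in>?M - ?S. mp_scale (c \<mu>) (g \<mu>)) \<nu> = (\<Sum>\<mu>\<in>?M - ?S. if \<nu> = \<mu> then c \<mu> else 0)"
      unfolding lookup_sum lookup_mp_scale lg by (intro sum.cong refl) (use \<nu> in simp)
    then show ?thesis using \<nu> fin by simp
  qed
  have dim_van: "mp.dim (vanishing_forms m V t) = card (?M - ?S)"
  proof -
    have *: "\<forall>\<mu>\<in>?M - ?S. c \<mu> = 0" if eq: "(\<Sum>\<mu>\<in>?M - ?S. mp_scale (c \<mu>) (g \<mu>)) = 0" for c
      using lsum[of _ c] unfolding eq by simp
    note ind = mp.independent_familyI[where g = g, OF fin *]
    have "vanishing_forms m V t \<subseteq> mp.span (g ` (?M - ?S))"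
    proof
      fix f assume f: "f \<in> vanishing_forms m V t"
      define f' where "f' = (\<Sum>\<mu>\<in>?M - ?S. mp_scale (plookup f \<mu>) (g \<mu>))"
      have "f' \<in> vanishing_forms m V t" unfolding f'_def
        by (intro mp.subspace_sum mp.subspace_scale sub gv)
      then have d: "f - f' \<in> vanishing_forms m V t" by (intro mp.subspace_diff sub f)
      then have df: "f - f' \<in> forms UNIV ?n t" and d0: "\<And>x. x \<in> ?X ==> mp_eval (f - f') x = 0" unfolding vf by blast+
      have z: "plookup (f - f') \<nu> = 0" if "\<nu> \<in> ?M - ?S" for \<nu>
        using lsum[OF that, of "plookup f"] by (simp add: lookup_minus f'_def)
      have "(\<Sum>\<nu>\<in>?S. plookup (f - f') \<nu> * mon \<nu> x) = 0" if "x \<in> ?X" for x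
      proof -
        have "(\<Sum>\<nu>\<in>?S. plookup (f - f') \<nu> * mon \<nu> x) = (\<Sum>\<nu>\<in>?M. plookup (f - f') \<nu> * mon \<nu> x)"
          by (rule sum.mono_neutral_left) (use SM z finite_Mon in auto)
        then show ?thesis using d0[OF that] mp_eval_form[OF df] by simp
      qed
      then have zS: "\<forall>\<nu>\<in>?S. plookup (f - f') \<nu> = 0" using Std_indep[of ?X ?n t] unfolding indep_on_def by blast
      have "plookup (f - f') \<nu> = 0" for \<nu>
        using zS z df by (cases "\<nu> \<in> ?M") (auto simp: forms_iff in_keys_iff)
      then have "f - f' = 0" by (intro poly_mapping_eqI) simp
      then have "f = f'" by simp
      also have "f' \<in> mp.span (g ` (?M - ?S))" unfolding f'_def by (intro mp.span_sum mp.span_scale mp.span_base imageI)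
      finally show "f \<in> mp.span (g ` (?M - ?S))" .
    qed
    moreover have "g ` (?M - ?S) \<subseteq> vanishing_forms m V t" using gv by blast
    ultimately show ?thesis using mp.basis_card_eq_dim[of "g ` (?M - ?S)" "vanishing_forms m V t"] ind card_image[OF ind(1)] by simp
  qed
  have "card (?M - ?S) = card ?M - card ?S" by (rule card_Diff_subset[OF finite_Std SM])
  moreover have "card ?S \<le> card ?M" by (rule card_mono[OF finite_Mon SM])
  ultimately show ?thesis unfolding hilbert_function_def dim_forms dim_van hilb_def by simp
qed

section \<open>Cones over projective and affine algebraic sets\<close>

text \<open>
  Passage to cones: the closed sets of a space correspond to those of a cone over it, by taking
  preimages under the quotient map \<open>\<phi>\<close>. Irreducibility and Krull dimension are transported.
\<close>

locale closed_correspondence =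
  fixes \<phi> :: "'y => 'x" and S :: "'y set" and c1 :: "'x set => bool" and c2 :: "'y set => bool"
  assumes pull: "c1 V ==> V \<subseteq> \<phi> ` S \<and> c2 {y \<in> S. \<phi> y \<in> V}"
    and push: "c2 Y ==> c1 (\<phi> ` Y) \<and> Y = {y \<in> S. \<phi> y \<in> \<phi> ` Y}"
begin

abbreviation "pre V \<equiv> {y \<in> S. \<phi> y \<in> V}"

lemma image_pre: "c1 V ==> \<phi> ` pre V = V"
  using pull by blast

lemma irreducible_pre: "irreducible_closed c1 V ==> irreducible_closed c2 (pre V)"
  unfolding irreducible_closed_def
proof (elim conjE, intro conjI allI impI)
  assume V: "c1 V" "V \<noteq> {}" "\<forall>A B. c1 A \<and> c1 B \<and> V = A \<union> B --> V = A \<or> V = B"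
  show "c2 (pre V)" using pull V(1) by blast
  show "pre V \<noteq> {}" using V image_pre[OF V(1)] by blast
  fix A B assume AB: "c2 A \<and> c2 B \<and> pre V = A \<union> B"
  have "V = \<phi> ` pre V" using image_pre[OF V(1)] by simp
  also have "... = \<phi> ` A \<union> \<phi> ` B" using AB by (simp add: image_Un)
  finally have "V = \<phi> ` A \<union> \<phi> ` B" .
  then have "V = \<phi> ` A \<or> V = \<phi> ` B" using V(3) push[of A] push[of B] AB by simp
  then show "pre V = A \<or> pre V = B" using push AB by metis
qed

lemma irreducible_image: "irreducible_closed c2 Y ==> irreducible_closed c1 (\<phi> ` Y)"
  unfolding irreducible_closed_def
proof (elim conjE, intro conjI allI impI)
  assume Y: "c2 Y" "Y \<noteq> {}" "\<forall>A B. c2 A \<and> c2 B \<and> Y = A \<union> B --> Y = A \<or> Y = B"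
  show "c1 (\<phi> ` Y)" using push Y(1) by blast
  show "\<phi> ` Y \<noteq> {}" using Y by simp
  fix A B assume AB: "c1 A \<and> c1 B \<and> \<phi> ` Y = A \<union> B"
  have "Y = pre (\<phi> ` Y)" using push[OF Y(1)] by (rule conjunct2)
  also have "... = pre A \<union> pre B" using AB by auto
  finally have "Y = pre A \<union> pre B" .
  then have "Y = pre A \<or> Y = pre B" using Y(3) pull[of A] pull[of B] AB by simp
  then show "\<phi> ` Y = A \<or> \<phi> ` Y = B" using image_pre AB by metis
qed

lemma krull_dim_pre:
  assumes V: "c1 V"
  shows "krull_dim c1 V = krull_dim c2 (pre V)"
proof -
  have "(\<exists>Z. (\<forall>i\<le>n. irreducible_closed c1 (Z i) \<and> Z i \<subseteq> V) \<and> (\<forall>i<n. Z i \<subset> Z (Suc i))) \<longleftrightarrow>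
    (\<exists>Z. (\<forall>i\<le>n. irreducible_closed c2 (Z i) \<and> Z i \<subseteq> pre V) \<and> (\<forall>i<n. Z i \<subset> Z (Suc i)))" for n
  proof
    assume "\<exists>Z. (\<forall>i\<le>n. irreducible_closed c1 (Z i) \<and> Z i \<subseteq> V) \<and> (\<forall>i<n. Z i \<subset> Z (Suc i))"
    then obtain Z where Z: "\<forall>i\<le>n. irreducible_closed c1 (Z i) \<and> Z i \<subseteq> V" "\<forall>i<n. Z i \<subset> Z (Suc i)" by (elim exE conjE)
    have "pre (Z i) \<subset> pre (Z (Suc i))" if "i < n" for i
    proof -
      have "c1 (Z i)" "c1 (Z (Suc i))" using Z(1) that by (auto simp: irreducible_closed_def)
      then have "\<phi> ` pre (Z i) = Z i" "\<phi> ` pre (Z (Suc i)) = Z (Suc i)" by (simp_all add: image_pre)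
      moreover have "Z i \<subset> Z (Suc i)" using Z(2) that by blast
      ultimately have "pre (Z i) \<noteq> pre (Z (Suc i))" by (metis less_irrefl)
      then show ?thesis using \<open>Z i \<subset> Z (Suc i)\<close> by blast
    qed
    moreover have "irreducible_closed c2 (pre (Z i)) \<and> pre (Z i) \<subseteq> pre V" if "i \<le> n" for i
      using irreducible_pre Z(1) that by blast
    ultimately show "\<exists>Z. (\<forall>i\<le>n. irreducible_closed c2 (Z i) \<and> Z i \<subseteq> pre V) \<and> (\<forall>i<n. Z i \<subset> Z (Suc i))"
      by (intro exI[of _ "\<lambda>i. pre (Z i)"]) blast
  next
    assume "\<exists>Z. (\<forall>i\<le>n. irreducible_closed c2 (Z i) \<and> Z i \<subseteq> pre V) \<and> (\<forall>i<n. Z i \<subset> Z (Suc i))"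
    then obtain Z where Z: "\<forall>i\<le>n. irreducible_closed c2 (Z i) \<and> Z i \<subseteq> pre V" "\<forall>i<n. Z i \<subset> Z (Suc i)" by (elim exE conjE)
    have "\<phi> ` Z i \<subset> \<phi> ` Z (Suc i)" if "i < n" for i
    proof -
      have "c2 (Z i)" "c2 (Z (Suc i))" using Z(1) that by (auto simp: irreducible_closed_def)
      then have "pre (\<phi> ` Z i) = Z i" "pre (\<phi> ` Z (Suc i)) = Z (Suc i)" using push by blast+
      moreover have "Z i \<subset> Z (Suc i)" using Z(2) that by blast
      ultimately have "\<phi> ` Z i \<noteq> \<phi> ` Z (Suc i)" by (metis less_irrefl)
      then show ?thesis using \<open>Z i \<subset> Z (Suc i)\<close> by blast
    qed
    moreover have "irreducible_closed c1 (\<phi> ` Z i) \<and> \<phi> ` Z i \<subseteq> V" if "i \<le> n" for i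
      using irreducible_image Z(1) that by blast
    ultimately show "\<exists>Z. (\<forall>i\<le>n. irreducible_closed c1 (Z i) \<and> Z i \<subseteq> V) \<and> (\<forall>i<n. Z i \<subset> Z (Suc i))"
      by (intro exI[of _ "\<lambda>i. \<phi> ` Z i"]) blast
  qed
  then show ?thesis by (simp add: krull_dim_def)
qed

end

lemma ppt_self: "x \<in> ppt x"
  by (auto simp: ppt_def intro: exI[of _ 1])

lemma ppt_eq: "y \<in> ppt x ==> ppt y = ppt x"
proof -
  assume "y \<in> ppt x"
  then obtain a where a: "a \<noteq> 0" "y = (\<lambda>i. a * x i)" by (auto simp: ppt_def)
  have "(\<lambda>i. b * y i) \<in> ppt x" if "b \<noteq> 0" for b
    using a that by (auto simp: ppt_def intro!: exI[of _ "b * a"])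
  moreover have "(\<lambda>i. b * x i) \<in> ppt y" if "b \<noteq> 0" for b
    using a that by (auto simp: ppt_def intro!: exI[of _ "b / a"])
  ultimately show ?thesis by (auto simp: ppt_def)
qed

lemma proj_space_eq: "proj_space m = ppt ` pts False (Suc m)"
  by (simp add: proj_space_def pts_def)

lemma ppt_in_cone: "cone X ==> x \<in> X ==> ppt x \<subseteq> X"
  by (auto simp: cone_def ppt_def)

lemma proj_correspondence:
  fixes K :: "'a::field set"
  assumes K: "is_subfield K"
  shows "closed_correspondence ppt (pts False (Suc m)) (proj_closed K m) (zclosed False K (Suc m))"
proof
  fix V :: "'a ppoint set" assume "proj_closed K m V"
  then obtain G where G: "G \<subseteq> (\<Union>d. forms K (Suc m) d)" "V = {P \<in> proj_space m. \<forall>x\<in>P. \<forall>g\<in>G. mp_eval g x = 0}"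
    unfolding proj_closed_def by blast
  have gh: "\<exists>t. hp K (Suc m) t (mp_eval g)" if "g \<in> G" for g using hp_of_form[OF _ K] G(1) that by blast
  have "{y \<in> pts False (Suc m). ppt y \<in> V} = {y \<in> pts False (Suc m). \<forall>g\<in>mp_eval ` G. g y = 0}"
  proof (intro Collect_cong conj_cong refl iffI)
    fix y assume "ppt y \<in> V"
    then show "\<forall>g\<in>mp_eval ` G. g y = 0" using ppt_self[of y] G(2) by auto
  next
    fix y assume y: "y \<in> pts False (Suc m)" "\<forall>g\<in>mp_eval ` G. g y = 0"
    have "mp_eval g x = 0" if x: "x \<in> ppt y" and g: "g \<in> G" for x g
    proof -
      obtain a where "x = (\<lambda>i. a * y i)" using x by (auto simp: ppt_def)
      moreover obtain t where "hp K (Suc m) t (mp_eval g)" using gh[OF g] by blast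
      ultimately show ?thesis using hp_scale[of K "Suc m" t "mp_eval g" a y] y(2) g by simp
    qed
    then show "ppt y \<in> V" using y(1) by (simp add: G(2) proj_space_eq)
  qed
  then have "zclosed False K (Suc m) {y \<in> pts False (Suc m). ppt y \<in> V}"
    unfolding zclosed_def using gh by (intro exI[of _ "mp_eval ` G"]) blast
  then show "V \<subseteq> ppt ` pts False (Suc m) \<and> zclosed False K (Suc m) {y \<in> pts False (Suc m). ppt y \<in> V}"
    using G(2) by (auto simp: proj_space_eq)
next
  fix Y :: "(nat => 'a) set" assume Y: "zclosed False K (Suc m) Y"
  then obtain G where G: "\<forall>g\<in>G. \<exists>t. hp K (Suc m) t g" "Y = {x \<in> pts False (Suc m). \<forall>g\<in>G. g x = 0}"
    unfolding zclosed_def by (elim exE conjE)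
  note cY = zclosed_cone[OF Y] and sY = zclosed_subset_pts[OF Y]
  have 1: "Y = {y \<in> pts False (Suc m). ppt y \<in> ppt ` Y}"
  proof (intro set_eqI iffI)
    fix y assume "y \<in> {y \<in> pts False (Suc m). ppt y \<in> ppt ` Y}"
    then obtain x where "x \<in> Y" "ppt y = ppt x" by auto
    then show "y \<in> Y" using ppt_in_cone[OF cY] ppt_self[of y] by auto
  qed (use sY in auto)
  define F where "F = {f \<in> (\<Union>d. forms K (Suc m) d). mp_eval f \<in> G}"
  have "ppt ` Y = {P \<in> proj_space m. \<forall>x\<in>P. \<forall>f\<in>F. mp_eval f x = 0}"
  proof (intro set_eqI iffI)
    fix P assume "P \<in> ppt ` Y"
    then obtain y where y: "y \<in> Y" "P = ppt y" by blast
    then have "P \<subseteq> Y" using ppt_in_cone[OF cY] by blast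
    then show "P \<in> {P \<in> proj_space m. \<forall>x\<in>P. \<forall>f\<in>F. mp_eval f x = 0}" using y sY G(2) by (auto simp: proj_space_eq F_def)
  next
    fix P assume P: "P \<in> {P \<in> proj_space m. \<forall>x\<in>P. \<forall>f\<in>F. mp_eval f x = 0}"
    then obtain y where y: "y \<in> pts False (Suc m)" "P = ppt y" by (auto simp: proj_space_eq)
    have "g y = 0" if g: "g \<in> G" for g
    proof -
      obtain t where "hp K (Suc m) t g" using G(1) g by blast
      from form_of_hp[OF this K] obtain f where "f \<in> forms K (Suc m) t" "mp_eval f = g" by blast
      then have "f \<in> F" using g by (auto simp: F_def)
      then show ?thesis using P y(2) ppt_self[of y] \<open>mp_eval f = g\<close> by auto
    qed
    then show "P \<in> ppt ` Y" using y G(2) by simp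
  qed
  then have "proj_closed K m (ppt ` Y)" unfolding proj_closed_def by (intro exI[of _ F]) (auto simp: F_def)
  then show "proj_closed K m (ppt ` Y) \<and> Y = {y \<in> pts False (Suc m). ppt y \<in> ppt ` Y}" using 1 by simp
qed

lemma Union_eq_pre: "V \<subseteq> proj_space m ==> \<Union>V = {y \<in> pts False (Suc m). ppt y \<in> V}"
proof (intro set_eqI iffI)
  fix y assume V: "V \<subseteq> proj_space m" and "y \<in> \<Union>V"
  then obtain P where P: "P \<in> V" "y \<in> P" by blast
  then obtain x where x: "x \<in> pts False (Suc m)" "P = ppt x" using V by (auto simp: proj_space_eq)
  then have "y \<in> pts False (Suc m)" using P ppt_in_cone[OF cone_pts] by blast
  moreover have "ppt y = P" using P(2) x(2) ppt_eq by blast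
  ultimately show "y \<in> {y \<in> pts False (Suc m). ppt y \<in> V}" using P(1) by simp
qed (use ppt_self in blast)

lemma proj_closed_cone:
  assumes "is_subfield K" "proj_closed K m V"
  shows "zclosed False K (Suc m) (\<Union>V)"
  using closed_correspondence.pull[OF proj_correspondence[OF assms(1)] assms(2)] Union_eq_pre[of V m]
  by (simp add: proj_space_eq)

lemma proj_dim_degree:
  fixes V :: "'a::alg_closed_field ppoint set"
  assumes inf: "infinite (UNIV :: 'a set)" and V: "proj_closed UNIV m V" "V \<noteq> {}"
  shows "proj_dim m V = degree (hpoly (Suc m) (\<Union>V))"
    "proj_degree m V = fact (degree (hpoly (Suc m) (\<Union>V))) * coeff (hpoly (Suc m) (\<Union>V)) (degree (hpoly (Suc m) (\<Union>V)))"
proof -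
  interpret closed_correspondence ppt "pts False (Suc m)" "proj_closed UNIV m" "zclosed False UNIV (Suc m) :: (nat => 'a) set => bool"
    by (rule proj_correspondence[OF subfield_UNIV])
  have sub: "V \<subseteq> proj_space m" using pull[OF V(1)] by (simp add: proj_space_eq)
  have "\<Union>V \<noteq> {}"
  proof -
    obtain P where "P \<in> V" using V(2) by blast
    moreover from this obtain x where "P = ppt x" using sub unfolding proj_space_eq by blast
    ultimately show ?thesis using ppt_self[of x] by blast
  qed
  from krull_dim_eq_degree[OF inf _ proj_closed_cone[OF subfield_UNIV V(1)] this]
  show d: "proj_dim m V = degree (hpoly (Suc m) (\<Union>V))"
    unfolding proj_dim_def krull_dim_pre[OF V(1)] Union_eq_pre[OF sub, symmetric] by simp
  show "proj_degree m V = fact (degree (hpoly (Suc m) (\<Union>V))) * coeff (hpoly (Suc m) (\<Union>V)) (degree (hpoly (Suc m) (\<Union>V)))"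
    unfolding proj_degree_def d hilbert_poly_def hpoly_def hilbert_function_eq_hilb ..
qed

lemma mp_eval_single: "mp_eval (Poly_Mapping.single \<mu> c :: 'a::field mpol) x = c * mon \<mu> x"
  by (cases "c = 0") (auto simp: mp_eval_def mon_def)

lemma mp_eval_sum: "mp_eval (\<Sum>i\<in>I. f i :: 'a::field mpol) x = (\<Sum>i\<in>I. mp_eval (f i) x)"
  by (induction I rule: infinite_finite_induct) (auto simp: mp_eval_add, simp_all add: mp_eval_def)

text \<open>
  The point of affine space below a point of the cone that is not at infinity.
\<close>

definition dehom :: "nat => (nat => 'a::field) => nat => 'a" where
  "dehom m x = (\<lambda>i. if i < m then x i / x m else 0)"

lemma dehom_upd: "z \<in> vecs m ==> dehom m (z(m := 1)) = z"
  by (auto simp: dehom_def vecs_def fun_eq_iff)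

lemma dehom_vecs: "dehom m x \<in> vecs m"
  by (simp add: dehom_def vecs_def)

lemma upd_pts: "z \<in> vecs m ==> z(m := 1) \<in> pts True (Suc m)"
  by (auto simp: pts_def vecs_def)

lemma pts_eq_scaled: "x \<in> pts True (Suc m) ==> x = (\<lambda>i. x m * ((dehom m x)(m := 1)) i)"
  by (auto simp: pts_def vecs_def dehom_def fun_eq_iff)

lemma mon_cong: "\<mu> \<in> Mon n t ==> (\<And>i. i < n ==> x i = y i) ==> mon \<mu> x = mon \<mu> y"
  unfolding mon_def by (intro prod.cong refl) (auto simp: Mon_def)

lemma homogenize:
  assumes f: "f \<in> mpols K m" and K: "is_subfield (K :: 'a::field set)"
  shows "\<exists>t F. hp K (Suc m) t F \<and> (\<forall>x. x m \<noteq> 0 --> F x = x m ^ t * mp_eval f (dehom m x))"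
proof -
  define t where "t = (\<Sum>\<mu>\<in>pkeys f. mdeg \<mu>)"
  have t: "mdeg \<mu> \<le> t" if "\<mu> \<in> pkeys f" for \<mu>
    unfolding t_def by (rule member_le_sum[OF that]) auto
  have M: "\<mu> \<in> Mon m (mdeg \<mu>)" if "\<mu> \<in> pkeys f" for \<mu> using f that by (auto simp: mpols_def Mon_def)
  have K1: "1 \<in> K" using K by (simp add: subfieldD)
  define F where "F = (\<lambda>x. \<Sum>\<mu>\<in>pkeys f. plookup f \<mu> * (mon \<mu> x * x m ^ (t - mdeg \<mu>)))"
  have "hp K (Suc m) t F"
    unfolding F_def
  proof (intro hp_sum hp_cmult)
    fix \<mu> assume \<mu>: "\<mu> \<in> pkeys f"
    have "hp K (Suc m) (mdeg \<mu>) (mon \<mu>)" by (rule hp_mono[OF hp_mon[OF M[OF \<mu>] K1]]) auto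
    moreover have "hp K (Suc m) (t - mdeg \<mu>) (\<lambda>x. x m ^ (t - mdeg \<mu>))"
      by (rule hp_power1[OF hp_var1 K1]) simp
    ultimately show "hp K (Suc m) t (\<lambda>x. mon \<mu> x * x m ^ (t - mdeg \<mu>))"
      by (rule hp_multI) (use t[OF \<mu>] in simp)
    show "plookup f \<mu> \<in> K" using f by (simp add: mpols_def)
  qed
  moreover have "F x = x m ^ t * mp_eval f (dehom m x)" if "x m \<noteq> 0" for x
  proof -
    have "plookup f \<mu> * (mon \<mu> x * x m ^ (t - mdeg \<mu>)) = x m ^ t * (plookup f \<mu> * mon \<mu> (dehom m x))" if \<mu>: "\<mu> \<in> pkeys f" for \<mu>
    proof -
      have "mon \<mu> x = mon \<mu> (\<lambda>i. x m * dehom m x i)"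
        by (rule mon_cong[OF M[OF \<mu>]]) (use \<open>x m \<noteq> 0\<close> in \<open>simp add: dehom_def\<close>)
      also have "... = x m ^ mdeg \<mu> * mon \<mu> (dehom m x)"
        by (rule hp_scale[OF hp_mon[OF M[OF \<mu>] K1]])
      finally show ?thesis using t[OF \<mu>] by (simp add: algebra_simps flip: power_add)
    qed
    then show ?thesis
      unfolding F_def mp_eval_superset[OF finite_keys order_refl, of f] sum_distrib_left by (intro sum.cong refl)
  qed
  ultimately show ?thesis by blast
qed

lemma dehomogenize:
  assumes g: "hp K (Suc m) t g" and K: "is_subfield (K :: 'a::field set)"
  shows "\<exists>f\<in>mpols K m. \<forall>z. mp_eval f z = g (z(m := 1))"
proof -
  obtain c where c: "\<forall>\<mu>. c \<mu> \<in> K" "g = (\<lambda>x. \<Sum>\<mu>\<in>Mon (Suc m) t. c \<mu> * mon \<mu> x)"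
    using hp_normal_form[OF g K] by blast
  define r where "r = (\<lambda>\<mu> :: nat \<Rightarrow>\<^sub>0 nat. \<mu> - Poly_Mapping.single m (plookup \<mu> m))"
  have lr: "plookup (r \<mu>) i = (if i = m then 0 else plookup \<mu> i)" for \<mu> i
    by (simp add: r_def lookup_minus lookup_single when_def)
  have rk: "pkeys (r \<mu>) \<subseteq> {..<m}" if "\<mu> \<in> Mon (Suc m) t" for \<mu>
  proof
    fix i assume "i \<in> pkeys (r \<mu>)"
    then have "i \<noteq> m" "i \<in> pkeys \<mu>" by (auto simp: in_keys_iff lr split: if_splits)
    then show "i \<in> {..<m}" using that by (auto simp: Mon_def less_Suc_eq)
  qed
  have mr: "mon \<mu> (z(m := 1)) = mon (r \<mu>) z" for \<mu> and z :: "nat => 'a"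
  proof -
    have "\<mu> = r \<mu> + Poly_Mapping.single m (plookup \<mu> m)"
      by (intro poly_mapping_eqI) (simp add: lookup_add lr lookup_single when_def)
    then have "mon \<mu> (z(m := 1)) = mon (r \<mu>) (z(m := 1)) * 1"
      by (metis fun_upd_same mon_add mon_single power_one)
    also have "mon (r \<mu>) (z(m := 1)) = mon (r \<mu>) z"
      unfolding mon_def by (intro prod.cong refl) (auto simp: in_keys_iff lr)
    finally show ?thesis unfolding mult_1_right .
  qed
  let ?f = "\<Sum>\<mu>\<in>Mon (Suc m) t. Poly_Mapping.single (r \<mu>) (c \<mu>)"
  have "plookup ?f \<nu> \<in> K" for \<nu>
  proof -
    have "(\<Sum>\<mu>\<in>A. if r \<mu> = \<nu> then c \<mu> else 0) \<in> K" for A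
      by (induction A rule: infinite_finite_induct) (use c(1) subfieldD(1,3)[OF K] in auto)
    then show ?thesis by (simp add: lookup_sum lookup_single when_def)
  qed
  moreover have "pkeys \<nu> \<subseteq> {..<m}" if "\<nu> \<in> pkeys ?f" for \<nu>
  proof -
    have "(\<Sum>\<mu>\<in>Mon (Suc m) t. plookup (Poly_Mapping.single (r \<mu>) (c \<mu>)) \<nu>) \<noteq> 0"
      using that by (simp add: in_keys_iff lookup_sum)
    then obtain \<mu> where "\<mu> \<in> Mon (Suc m) t" "plookup (Poly_Mapping.single (r \<mu>) (c \<mu>)) \<nu> \<noteq> 0"
      by (rule sum.not_neutral_contains_not_neutral)
    then show ?thesis using rk by (auto simp: lookup_single when_def split: if_splits)
  qed
  ultimately have "?f \<in> mpols K m" by (simp add: mpols_def)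
  moreover have "mp_eval ?f z = g (z(m := 1))" for z
    by (simp add: mp_eval_sum mp_eval_single c(2) mr)
  ultimately show ?thesis by blast
qed

lemma affine_correspondence:
  fixes K :: "'a::field set"
  assumes K: "is_subfield K"
  shows "closed_correspondence (dehom m) (pts True (Suc m)) (affine_closed K m) (zclosed True K (Suc m))"
proof
  fix V :: "(nat => 'a) set" assume "affine_closed K m V"
  then obtain G where G: "G \<subseteq> mpols K m" "V = {x \<in> vecs m. \<forall>g\<in>G. mp_eval g x = 0}"
    unfolding affine_closed_def by blast
  have "\<forall>g\<in>G. \<exists>F. (\<exists>t. hp K (Suc m) t F) \<and> (\<forall>x\<in>pts True (Suc m). F x = 0 \<longleftrightarrow> mp_eval g (dehom m x) = 0)"
  proof
    fix g assume "g \<in> G"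
    then obtain t F where F: "hp K (Suc m) t F" "\<forall>x. x m \<noteq> 0 --> F x = x m ^ t * mp_eval g (dehom m x)"
      using homogenize[OF _ K] G(1) by blast
    have "F x = 0 \<longleftrightarrow> mp_eval g (dehom m x) = 0" if "x \<in> pts True (Suc m)" for x
    proof -
      have "x m \<noteq> 0" using that by (simp add: pts_def)
      then show ?thesis using F(2) by simp
    qed
    then show "\<exists>F. (\<exists>t. hp K (Suc m) t F) \<and> (\<forall>x\<in>pts True (Suc m). F x = 0 \<longleftrightarrow> mp_eval g (dehom m x) = 0)"
      using F(1) by blast
  qed
  from bchoice[OF this] obtain H where H: "\<forall>g\<in>G. (\<exists>t. hp K (Suc m) t (H g)) \<and>
    (\<forall>x\<in>pts True (Suc m). H g x = 0 \<longleftrightarrow> mp_eval g (dehom m x) = 0)" by (elim exE)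
  have "{y \<in> pts True (Suc m). dehom m y \<in> V} = {y \<in> pts True (Suc m). \<forall>g\<in>H ` G. g y = 0}"
    unfolding G(2) using H dehom_vecs by auto
  then have "zclosed True K (Suc m) {y \<in> pts True (Suc m). dehom m y \<in> V}"
    unfolding zclosed_def using H by (intro exI[of _ "H ` G"]) blast
  moreover have "V \<subseteq> dehom m ` pts True (Suc m)"
  proof
    fix z assume "z \<in> V"
    then have "z \<in> vecs m" using G(2) by simp
    from dehom_upd[OF this, symmetric] upd_pts[OF this] show "z \<in> dehom m ` pts True (Suc m)" by (rule image_eqI)
  qed
  ultimately show "V \<subseteq> dehom m ` pts True (Suc m) \<and> zclosed True K (Suc m) {y \<in> pts True (Suc m). dehom m y \<in> V}" by simp
next
  fix Y :: "(nat => 'a) set" assume Y: "zclosed True K (Suc m) Y"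
  then obtain G where G: "\<forall>g\<in>G. \<exists>t. hp K (Suc m) t g" "Y = {x \<in> pts True (Suc m). \<forall>g\<in>G. g x = 0}"
    unfolding zclosed_def by (elim exE conjE)
  have GY: "g x = 0 \<longleftrightarrow> g ((dehom m x)(m := 1)) = 0" if gx: "g \<in> G" "x \<in> pts True (Suc m)" for g x
  proof -
    obtain t where t: "hp K (Suc m) t g" using bspec[OF G(1) gx(1)] by (elim exE)
    have "g x = g (\<lambda>i. x m * ((dehom m x)(m := 1)) i)" by (rule arg_cong[OF pts_eq_scaled[OF gx(2)]])
    also have "... = x m ^ t * g ((dehom m x)(m := 1))" by (rule hp_scale[OF t])
    finally have "g x = x m ^ t * g ((dehom m x)(m := 1))" .
    moreover have "x m \<noteq> 0" using gx(2) by (simp add: pts_def)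
    ultimately show ?thesis by (simp del: fun_upd_apply)
  qed
  have im: "dehom m ` Y = {z \<in> vecs m. \<forall>g\<in>G. g (z(m := 1)) = 0}"
  proof (intro set_eqI iffI)
    fix z assume z: "z \<in> {z \<in> vecs m. \<forall>g\<in>G. g (z(m := 1)) = 0}"
    then have "z(m := 1) \<in> Y" "dehom m (z(m := 1)) = z" using G(2) upd_pts dehom_upd by auto
    then show "z \<in> dehom m ` Y" by (metis imageI)
  qed (use GY G(2) dehom_vecs in auto)
  define F where "F = {f \<in> mpols K m. \<exists>g\<in>G. \<forall>z. mp_eval f z = g (z(m := 1))}"
  have "dehom m ` Y = {z \<in> vecs m. \<forall>f\<in>F. mp_eval f z = 0}"
    unfolding im
  proof (intro Collect_cong conj_cong refl iffI ballI)
    fix z g assume z: "\<forall>f\<in>F. mp_eval f z = 0" and g: "g \<in> G"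
    obtain t where "hp K (Suc m) t g" using bspec[OF G(1) g] by (elim exE)
    from dehomogenize[OF this K] obtain f where "f \<in> mpols K m" "\<forall>z. mp_eval f z = g (z(m := 1))" by blast
    then show "g (z(m := 1)) = 0" using z g by (force simp: F_def)
  qed (auto simp: F_def)
  then have "affine_closed K m (dehom m ` Y)" unfolding affine_closed_def by (intro exI[of _ F]) (auto simp: F_def)
  moreover have "Y = {y \<in> pts True (Suc m). dehom m y \<in> dehom m ` Y}"
    unfolding im by (subst (1) G(2)) (use GY dehom_vecs in auto)
  ultimately show "affine_closed K m (dehom m ` Y) \<and> Y = {y \<in> pts True (Suc m). dehom m y \<in> dehom m ` Y}" by simp
qed

text \<open>
  Leading monomials depend on the vanishing forms only. So the cone over an affine variety has the same
  Hilbert function as the cone over its projective closure.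
\<close>

lemma hilb_cong_vanishing:
  assumes "\<And>f. hp UNIV n t f ==> (\<forall>x\<in>X. f x = 0) \<longleftrightarrow> (\<forall>x\<in>Y. f x = 0)"
  shows "hilb X n t = hilb Y n t"
proof -
  have "(\<forall>x\<in>X. mon \<mu> x = (\<Sum>\<nu>\<in>{\<nu>\<in>Mon n t. \<nu> < \<mu>}. c \<nu> * mon \<nu> x)) \<longleftrightarrow>
      (\<forall>x\<in>Y. mon \<mu> x = (\<Sum>\<nu>\<in>{\<nu>\<in>Mon n t. \<nu> < \<mu>}. c \<nu> * mon \<nu> x))" if "\<mu> \<in> Mon n t" for \<mu> and c :: "_ => 'a"
  proof -
    have "hp UNIV n t (\<lambda>x. mon \<mu> x - (\<Sum>\<nu>\<in>{\<nu>\<in>Mon n t. \<nu> < \<mu>}. c \<nu> * mon \<nu> x))"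
      by (intro hp_diff subfield_UNIV hp_sum hp_cmult hp_mon UNIV_I) (use that in auto)
    from assms[OF this] show ?thesis by simp
  qed
  then have "LM X n t = LM Y n t" unfolding LM_def by blast
  then show ?thesis by (simp add: hilb_def Std_def)
qed

lemma proj_closure_eq:
  fixes Z :: "(nat => 'a::field) set"
  assumes "Z \<subseteq> vecs m"
  shows "proj_closure m Z = {P \<in> proj_space m. \<forall>x\<in>P. \<forall>g\<in>{f \<in> (\<Union>d. forms UNIV (Suc m) d). \<forall>z\<in>Z. mp_eval f (z(m := 1)) = 0}. mp_eval g x = 0}"
    (is "_ = ?W")
proof
  let ?G = "{f \<in> (\<Union>d. forms UNIV (Suc m) d). \<forall>z\<in>Z. mp_eval f (z(m := 1)) = 0}"
  have "proj_closed UNIV m ?W" unfolding proj_closed_def by (intro exI[of _ ?G]) auto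
  moreover have "ppt (z(m := 1)) \<in> ?W" if z: "z \<in> Z" for z
  proof -
    have "z(m := 1) \<in> pts False (Suc m)" using upd_pts[of z m] z assms by (auto simp: pts_def)
    moreover have "mp_eval g x = 0" if x: "x \<in> ppt (z(m := 1))" and g: "g \<in> ?G" for x g
    proof -
      obtain a where a: "x = (\<lambda>i. a * (z(m := 1)) i)" using x by (auto simp: ppt_def)
      obtain d where "g \<in> forms UNIV (Suc m) d" using g by blast
      from hp_scale[OF hp_of_form[OF this subfield_UNIV], of a "z(m := 1)"]
      show ?thesis using a g z by simp
    qed
    ultimately show ?thesis by (simp add: proj_space_eq)
  qed
  ultimately show "proj_closure m Z \<subseteq> ?W" unfolding proj_closure_def by blast
  show "?W \<subseteq> proj_closure m Z"
    unfolding proj_closure_def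
  proof (intro Inter_greatest)
    fix W assume "W \<in> {W. proj_closed UNIV m W \<and> (\<forall>z\<in>Z. ppt (z(m := 1)) \<in> W)}"
    then obtain G where G: "G \<subseteq> (\<Union>d. forms UNIV (Suc m) d)" "W = {P \<in> proj_space m. \<forall>x\<in>P. \<forall>g\<in>G. mp_eval g x = 0}"
      and W: "\<forall>z\<in>Z. ppt (z(m := 1)) \<in> W" unfolding proj_closed_def by blast
    have GG: "G \<subseteq> ?G"
    proof
      fix g assume g: "g \<in> G"
      have "mp_eval g (z(m := 1)) = 0" if z: "z \<in> Z" for z
      proof -
        have "\<forall>x\<in>ppt (z(m := 1)). \<forall>g\<in>G. mp_eval g x = 0" using bspec[OF W z] unfolding G(2) by simp
        then show ?thesis using ppt_self[of "z(m := 1)"] g by blast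
      qed
      then show "g \<in> ?G" using g G(1) by blast
    qed
    show "?W \<subseteq> W"
    proof
      fix P assume P: "P \<in> ?W"
      note P' = P[unfolded mem_Collect_eq]
      have P1: "P \<in> proj_space m" using P' by (rule conjunct1)
      have P2: "\<forall>x\<in>P. \<forall>g\<in>?G. mp_eval g x = 0" using P' by (rule conjunct2)
      have P3: "\<forall>x\<in>P. \<forall>g\<in>G. mp_eval g x = 0"
      proof (intro ballI)
        fix x g assume "x \<in> P" "g \<in> G"
        then show "mp_eval g x = 0" using bspec[OF bspec[OF P2] subsetD[OF GG]] by blast
      qed
      show "P \<in> W" unfolding G(2) by (intro CollectI conjI P1 P3)
    qed
  qed
qed

lemma affine_dim_degree:
  fixes Z :: "(nat => 'a::alg_closed_field) set" and m :: nat
  defines "X \<equiv> {y \<in> pts True (Suc m). dehom m y \<in> Z}" 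
  assumes inf: "infinite (UNIV :: 'a set)" and Z: "affine_closed UNIV m Z" "Z \<noteq> {}"
  shows "affine_dim m Z = degree (hpoly (Suc m) X)"
    "affine_degree m Z = fact (degree (hpoly (Suc m) X)) * coeff (hpoly (Suc m) X) (degree (hpoly (Suc m) X))"
proof -
  interpret closed_correspondence "dehom m" "pts True (Suc m)" "affine_closed UNIV m" "zclosed True UNIV (Suc m) :: (nat => 'a) set => bool"
    by (rule affine_correspondence[OF subfield_UNIV])
  have Xc: "zclosed True UNIV (Suc m) X" using pull[OF Z(1)] by (simp add: X_def)
  have Zv: "Z \<subseteq> vecs m" using Z(1) by (auto simp: affine_closed_def)
  have lift: "z(m := 1) \<in> X" if "z \<in> Z" for z
    using that Zv upd_pts[of z m] dehom_upd[of z m] by (auto simp: X_def)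
  have "X \<noteq> {}" using Z(2) lift by blast
  from krull_dim_eq_degree[OF inf _ Xc this]
  show "affine_dim m Z = degree (hpoly (Suc m) X)"
    unfolding affine_dim_def krull_dim_pre[OF Z(1)] X_def by simp
  let ?W = "proj_closure m Z"
  let ?G = "{f \<in> (\<Union>d. forms UNIV (Suc m) d). \<forall>z\<in>Z. mp_eval f (z(m := 1)) = 0}"
  note W = proj_closure_eq[OF Zv]
  have Wc: "proj_closed UNIV m ?W" unfolding W proj_closed_def by (intro exI[of _ ?G]) auto
  have WZ: "ppt (z(m := 1)) \<in> ?W" if "z \<in> Z" for z unfolding proj_closure_def using that by blast
  have hil: "hilb (\<Union>?W) (Suc m) t = hilb X (Suc m) t" for t
  proof (rule hilb_cong_vanishing)
    fix f assume f: "hp (UNIV :: 'a set) (Suc m) t f"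
    obtain p where p: "p \<in> forms UNIV (Suc m) t" "mp_eval p = f" using form_of_hp[OF f subfield_UNIV] by blast
    show "(\<forall>x\<in>\<Union>?W. f x = 0) \<longleftrightarrow> (\<forall>x\<in>X. f x = 0)"
    proof
      assume v: "\<forall>x\<in>\<Union>?W. f x = 0"
      show "\<forall>x\<in>X. f x = 0"
      proof
        fix x assume x: "x \<in> X"
        have "(dehom m x)(m := 1) \<in> \<Union>?W" using WZ x ppt_self by (fastforce simp: X_def)
        then have "f ((dehom m x)(m := 1)) = 0" using v by blast
        moreover have "f x = f (\<lambda>i. x m * ((dehom m x)(m := 1)) i)"
          by (rule arg_cong[OF pts_eq_scaled]) (use x in \<open>simp add: X_def\<close>)
        ultimately show "f x = 0" unfolding hp_scale[OF f] by (simp del: fun_upd_apply)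
      qed
    next
      assume "\<forall>x\<in>X. f x = 0"
      then have "p \<in> ?G" using p lift by blast
      then show "\<forall>x\<in>\<Union>?W. f x = 0" unfolding W using p(2) by blast
    qed
  qed
  then have hp: "hpoly (Suc m) (\<Union>?W) = hpoly (Suc m) X" by (simp add: hpoly_def)
  have "?W \<noteq> {}" using WZ Z(2) by blast
  from proj_dim_degree(2)[OF inf Wc this]
  show "affine_degree m Z = fact (degree (hpoly (Suc m) X)) * coeff (hpoly (Suc m) X) (degree (hpoly (Suc m) X))"
    unfolding affine_degree_def hp .
qed

section \<open>Finite morphisms\<close>

text \<open>
  If the same generator occurs for several indices, its coefficients have to be added up; hence the
  condition on partial sums.
\<close>

lemma finite_over_family:
  assumes I: "finite I" and g: "\<And>i. i \<in> I ==> g i \<in> A"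
    and ex: "\<And>f. f \<in> A ==> \<exists>b. (\<forall>J\<subseteq>I. (\<lambda>y. \<Sum>i\<in>J. b i y) \<in> B) \<and> (\<forall>x\<in>X. f x = (\<Sum>i\<in>I. b i (\<phi> x) * g i x))"
  shows "finite_over X \<phi> B A"
  unfolding finite_over_def
proof (intro exI[of _ "g ` I"] conjI ballI)
  fix f assume "f \<in> A"
  then obtain b where b: "\<forall>J\<subseteq>I. (\<lambda>y. \<Sum>i\<in>J. b i y) \<in> B" "\<forall>x\<in>X. f x = (\<Sum>i\<in>I. b i (\<phi> x) * g i x)"
    using ex by blast
  define c where "c = (\<lambda>h y. \<Sum>i\<in>{i\<in>I. g i = h}. b i y)"
  have "f x = (\<Sum>h\<in>g ` I. c h (\<phi> x) * h x)" if "x \<in> X" for x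
  proof -
    have "f x = (\<Sum>i\<in>I. b i (\<phi> x) * g i x)" using b(2) that by blast
    also have "... = (\<Sum>h\<in>g ` I. \<Sum>i\<in>{i\<in>I. g i = h}. b i (\<phi> x) * g i x)" by (rule sum.image_gen[OF I])
    also have "... = (\<Sum>h\<in>g ` I. c h (\<phi> x) * h x)"
      unfolding c_def sum_distrib_right by (intro sum.cong refl) simp
    finally show ?thesis .
  qed
  moreover have "c h \<in> B" for h unfolding c_def by (rule b(1)[rule_format]) blast
  ultimately show "\<exists>b. (\<forall>g\<in>g ` I. b g \<in> B) \<and> (\<forall>x\<in>X. f x = (\<Sum>h\<in>g ` I. b h (\<phi> x) * h x))"
    by (intro exI[of _ c] conjI ballI)
qed (use I g in auto)

text \<open>
  On the open set where \<open>M\<^sub>i\<close> does not vanish, dividing the generators by powers of \<open>M\<^sub>i\<close> makes all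
  coefficients homogeneous of the same degree \<open>t\<close>.
\<close>

lemma FG_coefficients:
  fixes X :: "(nat => 'a::field) set"
  assumes FG: "FG UNIV n X r M" and i: "i < r"
  shows "\<exists>U. finite U \<and> (\<forall>v\<in>U. hp UNIV n (snd v) (fst v)) \<and>
    (\<forall>t f. hp UNIV n t f --> (\<exists>b. (\<forall>v\<in>U. hp UNIV r t (b v)) \<and>
      (\<forall>x\<in>X. M i x \<noteq> 0 --> f x = (\<Sum>v\<in>U. b v (\<lambda>j. M j x) * (fst v x / M i x ^ snd v)))))"
proof -
  obtain U where U: "finite U" "\<forall>(u, a)\<in>U. hp UNIV n a u"
    "\<forall>t f. hp UNIV n t f --> (\<exists>g. fgs UNIV r M U t g \<and> (\<forall>x\<in>X. f x = g x))"
    using FG unfolding FG_def by (elim exE conjE)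
  show ?thesis
  proof (intro exI[of _ U] conjI allI impI)
    show "\<forall>v\<in>U. hp UNIV n (snd v) (fst v)" using U(2) by auto
    fix t f assume "hp (UNIV :: 'a set) n t f"
    from U(3)[rule_format, OF this] obtain g where g: "fgs UNIV r M U t g" "\<forall>x\<in>X. f x = g x" by (elim exE conjE)
    obtain b where b: "\<forall>v\<in>U. (snd v \<le> t --> hp UNIV r (t - snd v) (b v)) \<and> (t < snd v --> b v = (\<lambda>_. 0))"
      "\<forall>x. g x = (\<Sum>v\<in>U. b v (\<lambda>i. M i x) * fst v x)"
      using fgs_normal_form[OF g(1) U(1)] by (elim exE conjE)
    have "hp UNIV r t (\<lambda>y. b v y * y i ^ snd v)" if v: "v \<in> U" for v
    proof (cases "snd v \<le> t")
      case True
      then have "hp UNIV r (t - snd v) (b v)" using b(1) v by blast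
      from this hp_power1[OF hp_var1[OF i] UNIV_I] show ?thesis by (rule hp_multI) (use True in simp)
    next
      case False
      then have "b v = (\<lambda>_. 0)" using b(1) v by simp
      then show ?thesis by (simp add: hp.zero)
    qed
    moreover have "f x = (\<Sum>v\<in>U. (b v (\<lambda>j. M j x) * M i x ^ snd v) * (fst v x / M i x ^ snd v))" if "x \<in> X" "M i x \<noteq> 0" for x
      using g(2) b(2) that by simp
    ultimately show "\<exists>b. (\<forall>v\<in>U. hp UNIV r t (b v)) \<and>
      (\<forall>x\<in>X. M i x \<noteq> 0 --> f x = (\<Sum>v\<in>U. b v (\<lambda>j. M j x) * (fst v x / M i x ^ snd v)))"
      by (intro exI[of _ "\<lambda>v y. b v y * y i ^ snd v"] conjI ballI impI)
  qed (rule U(1))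
qed

definition lin_form :: "nat => (nat => 'a::field) => 'a mpol" where
  "lin_form n a = (\<Sum>j<n. Poly_Mapping.single (Poly_Mapping.single j 1) (a j))"

lemma mp_eval_lin_form: "mp_eval (lin_form n a) x = (\<Sum>j<n. a j * x j)"
  by (simp add: lin_form_def mp_eval_sum mp_eval_single)

lemma lookup_lin_form: "plookup (lin_form n a) \<mu> = (\<Sum>j<n. if Poly_Mapping.single j 1 = \<mu> then a j else 0)"
  by (simp add: lin_form_def lookup_sum lookup_single when_def)

lemma single_one_eq_iff: "Poly_Mapping.single i (1::nat) = Poly_Mapping.single j 1 \<longleftrightarrow> i = j"
  by (metis lookup_single_eq lookup_single_not_eq zero_neq_one)

lemma lin_coeff_lin_form: "j < n ==> lin_coeff (lin_form n a) j = a j"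
  unfolding lin_coeff_def lookup_lin_form unfolding single_one_eq_iff by simp

lemma lin_form_in_forms:
  assumes "\<And>j. j < n ==> a j \<in> E" "0 \<in> E"
  shows "lin_form n a \<in> forms E n 1"
proof -
  have dich: "plookup (lin_form n a) \<mu> = 0 \<or> (\<exists>j<n. \<mu> = Poly_Mapping.single j 1 \<and> plookup (lin_form n a) \<mu> = a j)" for \<mu>
  proof (cases "\<exists>j<n. \<mu> = Poly_Mapping.single j 1")
    case True
    then show ?thesis using lin_coeff_lin_form[of _ n a] by (auto simp: lin_coeff_def)
  next
    case False
    then have "plookup (lin_form n a) \<mu> = 0" unfolding lookup_lin_form by (intro sum.neutral) auto
    then show ?thesis ..
  qed
  show ?thesis
    unfolding forms_iff
  proof (intro conjI allI subsetI)
    fix \<mu>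
    show "plookup (lin_form n a) \<mu> \<in> E" using dich[of \<mu>] assms by auto
  next
    fix \<mu> assume "\<mu> \<in> pkeys (lin_form n a)"
    then obtain j where "j < n" "\<mu> = Poly_Mapping.single j 1" using dich[of \<mu>] unfolding in_keys_iff by blast
    then show "\<mu> \<in> Mon n 1" using single_in_Mon by blast
  qed
qed

section \<open>Normalization of projective and affine varieties\<close>

text \<open>
  Here the perfect closure of \<open>K\<close> enters, as the field of coefficients of all relations.
\<close>

lemma normalization_over_base:
  fixes X :: "(nat => 'a::alg_closed_field) set"
  assumes k: "is_subfield k" "infinite k" and K: "is_subfield K" "k \<subseteq> K" and alg: "\<And>x::'a. algebraic_over k x"
    and sz: "sized k I sz" and irr: "irreducible_closed (zclosed aff K n) X" and n: "n > 0"
    and d: "d = degree (hpoly n X)" and D: "D = fact d * coeff (hpoly n X) d"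
  shows "\<exists>A. (\<forall>i\<le>d. \<forall>j<n. A i j \<in> I \<and> sz (A i j) \<le> (2 * D) ^ (n - 1 - d)) \<and> FG UNIV n X (Suc d) (linfun n A) \<and>
    (aff --> (\<forall>j<n. A d j = (if j = n - 1 then 1 else 0)) \<and> (\<forall>i<d. A i (n - 1) = 0)) \<and>
    (\<forall>y. finite {x\<in>X. \<forall>i<Suc d. linfun n A i x = y i} \<and> real (card {x\<in>X. \<forall>i<Suc d. linfun n A i x = y i}) \<le> D) \<and> D \<ge> 1"
proof -
  define E where "E = perfect_closure K"
  have KE: "K \<subseteq> E" unfolding E_def by (rule subset_perfect_closure)
  have E: "is_subfield E" unfolding E_def by (rule perfect_closure_subfield[OF K(1)])
  have kE: "k \<subseteq> E" using K(2) KE by blast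
  have infU: "infinite (UNIV :: 'a set)" using k(2) finite_subset[of k UNIV] by auto
  have XK: "zclosed aff K n X" and Xne: "X \<noteq> {}" using irr by (simp_all add: irreducible_closed_def)
  note X = Xne zclosed_cone[OF XK] zclosed_subset_pts[OF XK]
  have pr: "prime_on E n X" unfolding E_def by (rule prime_on_perfect_closure[OF irr K(1)])
  have algE: "algebraic_over E x" for x :: 'a
    using alg[of x] kE unfolding algebraic_over_def polys_over_def by blast
  have desc: "desc E n X"
  proof (rule descent[OF E])
    fix a :: 'a assume a: "a \<notin> E"
    have "x \<in> E" if "CHAR('a) > 0" "x ^ CHAR('a) \<in> E" for x :: 'a
      using that unfolding E_def by (rule perfect_closure_perfect)
    from field_aut_moving[OF E this algE a] show "\<exists>\<sigma>. field_aut E \<sigma> \<and> \<sigma> a \<noteq> a" .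
  next
    fix \<sigma> x assume "field_aut E \<sigma>" "x \<in> X"
    then show "\<exists>x'\<in>X. x = (\<lambda>i. \<sigma> (x' i))" by (rule zclosed_aut_stable[OF XK K(1) KE E])
  qed
  obtain A where A: "\<forall>i\<le>d. \<forall>j<n. A i j \<in> I \<and> sz (A i j) \<le> (2 * D) ^ (n - 1 - d)" "FG E n X (Suc d) (linfun n A)"
    "alg_indep E X (Suc d) (linfun n A)"
    "aff --> (\<forall>j<n. A d j = (if j = n - 1 then 1 else 0)) \<and> (\<forall>i<d. A i (n - 1) = 0)"
    using small_normalization[OF k E kE sz X pr desc n d D] by (elim exE conjE)
  have Ik: "I \<subseteq> k" using sz by (simp add: sized_def)
  have L: "hp E n 1 (linfun n A i)" if "i < Suc d" for i
    by (rule hp_linfun) (use A(1) that kE Ik less_Suc_eq_le in blast)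
  note fib = fibre_bound[OF k(2) kE E X pr desc L A(2,3)]
  have "D \<ge> 1" unfolding D by (rule degree_hpoly(2)[OF infU E desc L A(2,3)])
  with A FG_UNIV[OF A(2) E] fib show ?thesis unfolding D by (intro exI[of _ A] conjI allI) auto
qed

lemma height_bound:
  fixes D :: real
  assumes "h \<le> max 1 s" "s \<le> (2 * D) ^ (m - d)" "D \<ge> 1"
  shows "h \<le> real (2 ^ m) * D ^ (m - d)"
proof -
  have "(1::real) \<le> (2 * D) ^ (m - d)" using assms(3) by (intro one_le_power) simp
  then have "h \<le> (2 * D) ^ (m - d)" using assms(1,2) by simp
  also have "... = 2 ^ (m - d) * D ^ (m - d)" by (rule power_mult_distrib)
  also have "... \<le> 2 ^ m * D ^ (m - d)" using assms(3) by (intro mult_right_mono power_increasing) auto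
  finally show ?thesis by simp
qed

lemma lin_form_height:
  assumes sz: "sized k I sz" and h: "\<And>x. x \<in> I ==> h x \<le> max 1 (sz x)" and D: "D \<ge> 1"
    and A: "\<forall>j<n. a j \<in> I \<and> sz (a j) \<le> (2 * D) ^ (m - d)"
  shows "lin_form n a \<in> forms k n 1 \<and> (\<forall>j<n. h (lin_coeff (lin_form n a) j) \<le> real (2 ^ m) * D ^ (m - d))"
proof (intro conjI allI impI)
  show "lin_form n a \<in> forms k n 1" by (rule lin_form_in_forms) (use sz A in \<open>auto simp: sized_def\<close>)
  fix j assume j: "j < n"
  show "h (lin_coeff (lin_form n a) j) \<le> real (2 ^ m) * D ^ (m - d)"
    unfolding lin_coeff_lin_form[OF j] by (rule height_bound[OF h _ D]) (use A j in blast)+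
qed

lemma card_bound_image:
  assumes "T \<subseteq> g ` S" "finite S \<and> real (card S) \<le> D"
  shows "finite T \<and> real (card T) \<le> D"
proof -
  have f: "finite (g ` S)" and c: "card (g ` S) \<le> card S" using assms(2) card_image_le by auto
  show ?thesis using finite_subset[OF assms(1) f] card_mono[OF f assms(1)] c assms(2) by linarith
qed

lemma poly_map_lin_form:
  "poly_map r (\<lambda>i. lin_form n (A i)) x = (\<lambda>i. if i < r then linfun n A i x else 0)"
  by (simp add: fun_eq_iff poly_map_def mp_eval_lin_form linfun_def)

lemma linfun_scale: "linfun n A i (\<lambda>j. a * x j) = a * linfun n A i x"
  by (simp add: linfun_def sum_distrib_left algebra_simps)

lemma proj_map_lin_form:
  "proj_map r (\<lambda>i. lin_form n (A i)) (ppt x) = ppt (poly_map (Suc r) (\<lambda>i. lin_form n (A i)) x)"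
proof -
  let ?f = "poly_map (Suc r) (\<lambda>i. lin_form n (A i))"
  have "ppt (?f x') = ppt (?f x)" if x': "x' \<in> ppt x" for x'
  proof -
    obtain a where a: "a \<noteq> 0" "x' = (\<lambda>j. a * x j)" using x' by (auto simp: ppt_def)
    have "?f x' = (\<lambda>i. a * ?f x i)" by (auto simp: poly_map_lin_form a(2) linfun_scale)
    then have "?f x' \<in> ppt (?f x)" using a(1) by (auto simp: ppt_def)
    then show ?thesis by (rule ppt_eq)
  qed
  then show ?thesis unfolding proj_map_def using ppt_self[of x] by blast
qed

lemma mp_eval_var: "mp_eval (mp_var i) x = (x i :: 'a::field)"
  unfolding mp_var_def mp_eval_single by simp

text \<open>
  Forms of degree \<open>t\<close>, divided by the \<open>t\<close>-th power of the \<open>i\<close>-th linear form, are the local functions on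
  the source and on the target.
\<close>

lemma proj_finite_map_of_FG:
  fixes V :: "'a::field ppoint set"
  assumes V: "\<Union>V \<subseteq> pts False (Suc m)" and FG: "FG UNIV (Suc m) (\<Union>V) (Suc d) (linfun (Suc m) A)"
  shows "proj_finite_map m d V (\<lambda>i. lin_form (Suc m) (A i))"
proof -
  let ?n = "Suc m" and ?L = "\<lambda>i. lin_form (Suc m) (A i)"
  have ev: "mp_eval (?L i) = linfun ?n A i" for i
    by (simp add: fun_eq_iff mp_eval_lin_form linfun_def)
  have Lf: "?L i \<in> forms UNIV ?n 1" for i by (rule lin_form_in_forms) auto
  have loc: "finite_over {x \<in> \<Union>V. mp_eval (?L i) x \<noteq> 0} (poly_map (Suc d) ?L)
      (local_functions d 1 (mp_var i)) (local_functions m 1 (?L i))" if i: "i \<le> d" for i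
  proof -
    have i': "i < Suc d" using i by simp
    obtain U where U: "finite U" "\<forall>v\<in>U. hp UNIV ?n (snd v) (fst v)"
      "\<forall>t f. hp UNIV ?n t f --> (\<exists>b. (\<forall>v\<in>U. hp UNIV (Suc d) t (b v)) \<and>
        (\<forall>x\<in>\<Union>V. linfun ?n A i x \<noteq> 0 --> f x = (\<Sum>v\<in>U. b v (\<lambda>j. linfun ?n A j x) * (fst v x / linfun ?n A i x ^ snd v))))"
      using FG_coefficients[OF FG i'] by (elim exE conjE)
    show ?thesis
    proof (rule finite_over_family[OF U(1), where g = "\<lambda>v x. fst v x / linfun ?n A i x ^ snd v"])
      fix v assume "v \<in> U"
      from form_of_hp[OF bspec[OF U(2) this] subfield_UNIV]
      obtain f where f: "f \<in> forms UNIV ?n (snd v)" "mp_eval f = fst v" by (elim bexE)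
      show "(\<lambda>x. fst v x / linfun ?n A i x ^ snd v) \<in> local_functions m 1 (?L i)"
        unfolding local_functions_def ev by (intro CollectI exI[of _ f] exI[of _ "snd v"]) (simp add: f)
    next
      fix F assume "F \<in> local_functions m 1 (?L i)"
      then obtain f t where F: "F = (\<lambda>x. mp_eval f x / linfun ?n A i x ^ t)" "f \<in> forms UNIV ?n t"
        unfolding local_functions_def ev by auto
      obtain b where b: "\<forall>v\<in>U. hp UNIV (Suc d) t (b v)"
        "\<forall>x\<in>\<Union>V. linfun ?n A i x \<noteq> 0 --> mp_eval f x = (\<Sum>v\<in>U. b v (\<lambda>j. linfun ?n A j x) * (fst v x / linfun ?n A i x ^ snd v))"
        using U(3)[rule_format, OF hp_of_form[OF F(2) subfield_UNIV]] by (elim exE conjE)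
      have B: "(\<lambda>y. \<Sum>v\<in>J. b v y / y i ^ t) \<in> local_functions d 1 (mp_var i)" if J: "J \<subseteq> U" for J
      proof -
        have "hp UNIV (Suc d) t (\<lambda>y. \<Sum>v\<in>J. b v y)" by (rule hp_sum) (use b(1) J in blast)
        from form_of_hp[OF this subfield_UNIV] obtain h where h: "h \<in> forms UNIV (Suc d) t" "mp_eval h = (\<lambda>y. \<Sum>v\<in>J. b v y)" by (elim bexE)
        show ?thesis unfolding local_functions_def
          by (intro CollectI exI[of _ h] exI[of _ t]) (simp add: h mp_eval_var sum_divide_distrib)
      qed
      have eq: "F x = (\<Sum>v\<in>U. b v (poly_map (Suc d) ?L x) / poly_map (Suc d) ?L x i ^ t * (fst v x / linfun ?n A i x ^ snd v))"
        if x: "x \<in> {x \<in> \<Union>V. mp_eval (?L i) x \<noteq> 0}" for x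
      proof -
        have x': "x \<in> \<Union>V" "linfun ?n A i x \<noteq> 0" using x unfolding ev by blast+
        have bv: "b v (\<lambda>j. linfun ?n A j x) = b v (poly_map (Suc d) ?L x)" if "v \<in> U" for v
          by (rule hp_cong[OF bspec[OF b(1) that]]) (simp add: poly_map_lin_form)
        have "F x = (\<Sum>v\<in>U. b v (\<lambda>j. linfun ?n A j x) * (fst v x / linfun ?n A i x ^ snd v)) / linfun ?n A i x ^ t"
          unfolding F(1) using bspec[OF b(2) x'(1)] x'(2) by simp
        also have "... = (\<Sum>v\<in>U. b v (poly_map (Suc d) ?L x) / poly_map (Suc d) ?L x i ^ t * (fst v x / linfun ?n A i x ^ snd v))"
          unfolding sum_divide_distrib by (intro sum.cong refl) (use i' in \<open>simp add: bv poly_map_lin_form[of "Suc d" "Suc m" A x, THEN fun_cong, of i]\<close>)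
        finally show ?thesis .
      qed
      show "\<exists>b. (\<forall>J\<subseteq>U. (\<lambda>y. \<Sum>i\<in>J. b i y) \<in> local_functions d 1 (mp_var i)) \<and>
        (\<forall>x\<in>{x \<in> \<Union>V. mp_eval (?L i) x \<noteq> 0}. F x = (\<Sum>v\<in>U. b v (poly_map (Suc d) ?L x) * (fst v x / linfun ?n A i x ^ snd v)))"
        by (intro exI[of _ "\<lambda>v y. b v y / y i ^ t"] conjI allI impI ballI B eq)
    qed
  qed
  have nz: "\<exists>i\<le>d. mp_eval (?L i) x \<noteq> 0" if "P \<in> V" "x \<in> P" for P x
  proof -
    have "x \<in> \<Union>V" using that by blast
    from FG_no_zero[OF this V FG UNIV_I] show ?thesis unfolding ev by (simp add: less_Suc_eq_le)
  qed
  show ?thesis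
    unfolding proj_finite_map_def
  proof (intro exI[of _ 1] conjI)
    show "\<forall>P\<in>V. \<forall>x\<in>P. \<exists>i\<le>d. mp_eval (?L i) x \<noteq> 0" using nz by blast
  qed (use Lf loc in simp_all)
qed

theorem proj_normalization:
  fixes V :: "'a::alg_closed_field ppoint set"
  assumes k: "is_subfield k" "infinite k" and K: "is_subfield K" "k \<subseteq> K" and alg: "\<And>x::'a. algebraic_over k x"
    and sz: "sized k I sz" "\<And>x. x \<in> I ==> h x \<le> max 1 (sz x)" and V: "proj_variety K m V"
  shows "\<exists>L. (\<forall>i\<le>proj_dim m V. L i \<in> forms k (Suc m) 1 \<and>
      (\<forall>j\<le>m. h (lin_coeff (L i) j) \<le> real (2 ^ m) * proj_degree m V ^ (m - proj_dim m V))) \<and>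
    proj_finite_map m (proj_dim m V) V L \<and>
    (\<forall>Q\<in>proj_space (proj_dim m V). finite {P \<in> V. proj_map (proj_dim m V) L P = Q} \<and>
       real (card {P \<in> V. proj_map (proj_dim m V) L P = Q}) \<le> proj_degree m V)"
proof -
  interpret closed_correspondence ppt "pts False (Suc m)" "proj_closed K m" "zclosed False K (Suc m) :: (nat => 'a) set => bool"
    by (rule proj_correspondence[OF K(1)])
  have infU: "infinite (UNIV :: 'a set)" using k(2) finite_subset[of k UNIV] by auto
  have Vc: "proj_closed K m V" and Vne: "V \<noteq> {}" using V by (simp_all add: proj_variety_def irreducible_closed_def)
  have Vs: "V \<subseteq> proj_space m" using Vc by (auto simp: proj_closed_def)
  have "forms K (Suc m) t \<subseteq> forms UNIV (Suc m) t" for t by (auto simp: forms_iff)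
  then have sub: "(\<Union>t. forms K (Suc m) t) \<subseteq> (\<Union>t. forms UNIV (Suc m) t)" by (rule UN_mono[OF order_refl])
  have VU: "proj_closed UNIV m V"
    using Vc unfolding proj_closed_def by (elim exE conjE) (intro exI conjI subset_trans[OF _ sub])
  let ?X = "\<Union>V"
  have irr: "irreducible_closed (zclosed False K (Suc m)) ?X"
    using irreducible_pre V unfolding proj_variety_def Union_eq_pre[OF Vs] by blast
  define d D where dD: "d = proj_dim m V" "D = proj_degree m V"
  note dd = proj_dim_degree[OF infU VU Vne]
  have d': "d = degree (hpoly (Suc m) ?X)" using dD(1) dd(1) by simp
  have D': "D = fact d * coeff (hpoly (Suc m) ?X) d" unfolding dD(2) dd(2) d' ..
  obtain A where A: "\<forall>i\<le>d. \<forall>j<Suc m. A i j \<in> I \<and> sz (A i j) \<le> (2 * D) ^ (Suc m - 1 - d)" "FG UNIV (Suc m) ?X (Suc d) (linfun (Suc m) A)"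
    "\<forall>y. finite {x\<in>?X. \<forall>i<Suc d. linfun (Suc m) A i x = y i} \<and> real (card {x\<in>?X. \<forall>i<Suc d. linfun (Suc m) A i x = y i}) \<le> D" "D \<ge> 1"
    using normalization_over_base[OF k K alg sz(1) irr _ d' D'] by auto
  let ?L = "\<lambda>i. lin_form (Suc m) (A i)"
  have Xp: "?X \<subseteq> pts False (Suc m)" unfolding Union_eq_pre[OF Vs] by blast
  have fib: "finite {P \<in> V. proj_map d ?L P = Q} \<and> real (card {P \<in> V. proj_map d ?L P = Q}) \<le> D" if Q: "Q \<in> proj_space d" for Q
  proof -
    obtain y where y: "Q = ppt y" using Q by (auto simp: proj_space_def)
    let ?S = "{x\<in>?X. \<forall>i<Suc d. linfun (Suc m) A i x = y i}"
    have sub: "{P \<in> V. proj_map d ?L P = Q} \<subseteq> ppt ` ?S"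
    proof
      fix P assume "P \<in> {P \<in> V. proj_map d ?L P = Q}"
      then have P: "P \<in> V" "proj_map d ?L P = Q" by blast+
      obtain x where x: "P = ppt x" using P(1) Vs by (auto simp: proj_space_eq)
      have "ppt (poly_map (Suc d) ?L x) = ppt y" using P(2) unfolding x proj_map_lin_form y .
      then have "y \<in> ppt (poly_map (Suc d) ?L x)" using ppt_self[of y] by simp
      then obtain a where a: "a \<noteq> 0" "y = (\<lambda>i. a * poly_map (Suc d) ?L x i)" by (auto simp: ppt_def)
      let ?x = "\<lambda>j. a * x j"
      have xP: "?x \<in> P" unfolding x using a(1) by (auto simp: ppt_def)
      have "?x \<in> ?S" using P(1) xP by (auto simp: a(2) poly_map_lin_form linfun_scale)
      then have "ppt ?x \<in> ppt ` ?S" by (rule imageI)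
      moreover have "P = ppt ?x" using ppt_eq[of ?x x] xP unfolding x by simp
      ultimately show "P \<in> ppt ` ?S" by simp
    qed
    show ?thesis by (rule card_bound_image[OF sub]) (rule A(3)[rule_format])
  qed
  have ht: "?L i \<in> forms k (Suc m) 1 \<and> (\<forall>j<Suc m. h (lin_coeff (?L i) j) \<le> real (2 ^ m) * D ^ (m - d))" if "i \<le> d" for i
    by (rule lin_form_height[OF sz A(4)]) (use A(1) that in simp_all)
  show ?thesis
    unfolding dD[symmetric]
  proof (intro exI[of _ ?L] conjI proj_finite_map_of_FG[OF Xp A(2)] ballI allI impI)
    show "h (lin_coeff (?L i) j) \<le> real (2 ^ m) * D ^ (m - d)" if "i \<le> d" "j \<le> m" for i j
      using ht[OF that(1)] that(2) by (simp add: less_Suc_eq_le)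
  qed (use ht fib in blast)+
qed

lemma linfun_affine:
  assumes A: "\<And>j. j < Suc m ==> A d j = (if j = m then 1 else 0)" "\<And>i. i < d ==> A i m = 0" and i: "i < Suc d"
  shows "linfun (Suc m) A i (z(m := 1)) = ((poly_map d (\<lambda>i. lin_form m (A i)) z)(d := 1)) i"
proof (cases "i = d")
  case True
  then show ?thesis using linfun_delta[of "Suc m" A d m, OF A(1)] by simp
next
  case False
  then show ?thesis using i by (simp add: poly_map_lin_form linfun_def A(2))
qed

text \<open>
  Setting the last coordinate to \<open>1\<close>. The last of the forms restricts to the constant \<open>1\<close>.
\<close>

lemma affine_finite_map_of_FG:
  fixes Z :: "(nat => 'a::field) set"
  assumes Z: "\<And>z. z \<in> Z ==> z(m := 1) \<in> X" and FG: "FG UNIV (Suc m) X (Suc d) (linfun (Suc m) A)"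
    and A: "\<And>j. j < Suc m ==> A d j = (if j = m then 1 else 0)" "\<And>i. i < d ==> A i m = 0"
  shows "affine_finite_map m d Z (\<lambda>i. lin_form m (A i))"
proof -
  let ?n = "Suc m" and ?L = "\<lambda>i. lin_form m (A i)"
  note lift = linfun_affine[of m A d, OF A]
  have Lf: "?L i \<in> mpols UNIV m" for i
    using lin_form_in_forms[of m "A i" UNIV] by (auto simp: forms_def)
  obtain U where U: "finite U" "\<forall>v\<in>U. hp UNIV ?n (snd v) (fst v)"
    "\<forall>t f. hp UNIV ?n t f --> (\<exists>b. (\<forall>v\<in>U. hp UNIV (Suc d) t (b v)) \<and>
      (\<forall>x\<in>X. linfun ?n A d x \<noteq> 0 --> f x = (\<Sum>v\<in>U. b v (\<lambda>j. linfun ?n A j x) * (fst v x / linfun ?n A d x ^ snd v))))"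
    using FG_coefficients[OF FG lessI] by (elim exE conjE)
  have "finite_over Z (poly_map d ?L) (mp_eval ` mpols UNIV d) (mp_eval ` mpols UNIV m)"
  proof (rule finite_over_family[OF U(1), where g = "\<lambda>v z. fst v (z(m := 1))"])
    fix v assume "v \<in> U"
    from dehomogenize[OF bspec[OF U(2) this] subfield_UNIV]
    obtain f where "f \<in> mpols UNIV m" "\<forall>z. mp_eval f z = fst v (z(m := 1))" by (elim bexE)
    then show "(\<lambda>z. fst v (z(m := 1))) \<in> mp_eval ` mpols UNIV m" by (intro image_eqI[of _ _ f]) auto
  next
    fix p assume "p \<in> mp_eval ` mpols (UNIV :: 'a set) m"
    then obtain f where f: "f \<in> mpols UNIV m" "p = mp_eval f" by blast
    obtain t F where F: "hp UNIV ?n t F" "\<forall>x. x m \<noteq> 0 --> F x = x m ^ t * mp_eval f (dehom m x)"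
      using homogenize[OF f(1) subfield_UNIV] by (elim exE conjE)
    obtain b where b: "\<forall>v\<in>U. hp UNIV (Suc d) t (b v)"
      "\<forall>x\<in>X. linfun ?n A d x \<noteq> 0 --> F x = (\<Sum>v\<in>U. b v (\<lambda>j. linfun ?n A j x) * (fst v x / linfun ?n A d x ^ snd v))"
      using U(3)[rule_format, OF F(1)] by (elim exE conjE)
    have B: "(\<lambda>y. \<Sum>v\<in>J. b v (y(d := 1))) \<in> mp_eval ` mpols UNIV d" if J: "J \<subseteq> U" for J
    proof -
      have "hp UNIV (Suc d) t (\<lambda>y. \<Sum>v\<in>J. b v y)" by (rule hp_sum) (use b(1) J in blast)
      from dehomogenize[OF this subfield_UNIV]
      obtain h where "h \<in> mpols UNIV d" "\<forall>y. mp_eval h y = (\<Sum>v\<in>J. b v (y(d := 1)))" by (elim bexE)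
      then show ?thesis by (intro image_eqI[of _ _ h]) auto
    qed
    have eq: "p z = (\<Sum>v\<in>U. b v ((poly_map d ?L z)(d := 1)) * fst v (z(m := 1)))" if z: "z \<in> Z" and zv: "mp_eval f (dehom m (z(m := 1))) = mp_eval f z" for z
    proof -
      let ?z = "z(m := 1)"
      have one: "linfun ?n A d ?z = 1" using lift[of d z] by simp
      have bv: "b v (\<lambda>j. linfun ?n A j ?z) = b v ((poly_map d ?L z)(d := 1))" if "v \<in> U" for v
        by (rule hp_cong[OF bspec[OF b(1) that]]) (rule lift)
      have "p z = F ?z" using F(2)[rule_format, of ?z] zv f(2) by simp
      also have "... = (\<Sum>v\<in>U. b v (\<lambda>j. linfun ?n A j ?z) * fst v ?z)"
        using bspec[OF b(2) Z[OF z]] unfolding one by simp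
      also have "... = (\<Sum>v\<in>U. b v ((poly_map d ?L z)(d := 1)) * fst v ?z)"
        by (intro sum.cong refl) (simp add: bv del: fun_upd_apply)
      finally show ?thesis .
    qed
    have zv: "mp_eval f (dehom m (z(m := 1))) = mp_eval f z" for z
      unfolding mp_eval_def by (intro sum.cong prod.cong arg_cong2[of _ _ _ _ "(*)"] refl) (use f(1) in \<open>auto simp: mpols_def dehom_def\<close>)
    show "\<exists>b. (\<forall>J\<subseteq>U. (\<lambda>y. \<Sum>i\<in>J. b i y) \<in> mp_eval ` mpols UNIV d) \<and>
        (\<forall>z\<in>Z. p z = (\<Sum>v\<in>U. b v (poly_map d ?L z) * fst v (z(m := 1))))"
      by (intro exI[of _ "\<lambda>v y. b v (y(d := 1))"] conjI allI impI ballI B eq zv)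
  qed
  then show ?thesis unfolding affine_finite_map_def using Lf by blast
qed

theorem affine_normalization:
  fixes Z :: "(nat => 'a::alg_closed_field) set"
  assumes k: "is_subfield k" "infinite k" and K: "is_subfield K" "k \<subseteq> K" and alg: "\<And>x::'a. algebraic_over k x"
    and sz: "sized k I sz" "\<And>x. x \<in> I ==> h x \<le> max 1 (sz x)" and Z: "affine_variety K m Z"
  shows "\<exists>L. (\<forall>i<affine_dim m Z. L i \<in> forms k m 1 \<and>
      (\<forall>j<m. h (lin_coeff (L i) j) \<le> real (2 ^ m) * affine_degree m Z ^ (m - affine_dim m Z))) \<and>
    affine_finite_map m (affine_dim m Z) Z L \<and>
    (\<forall>y\<in>vecs (affine_dim m Z). finite {z \<in> Z. poly_map (affine_dim m Z) L z = y} \<and>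
       real (card {z \<in> Z. poly_map (affine_dim m Z) L z = y}) \<le> affine_degree m Z)"
proof -
  interpret closed_correspondence "dehom m" "pts True (Suc m)" "affine_closed K m" "zclosed True K (Suc m) :: (nat => 'a) set => bool"
    by (rule affine_correspondence[OF K(1)])
  have infU: "infinite (UNIV :: 'a set)" using k(2) finite_subset[of k UNIV] by auto
  have Zc: "affine_closed K m Z" and Zne: "Z \<noteq> {}" using Z by (simp_all add: affine_variety_def irreducible_closed_def)
  have Zv: "Z \<subseteq> vecs m" using Zc by (auto simp: affine_closed_def)
  have sub: "mpols K m \<subseteq> mpols UNIV m" by (auto simp: mpols_def)
  have ZU: "affine_closed UNIV m Z"
    using Zc unfolding affine_closed_def by (elim exE conjE) (intro exI conjI subset_trans[OF _ sub])
  let ?X = "{y \<in> pts True (Suc m). dehom m y \<in> Z}"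
  have irr: "irreducible_closed (zclosed True K (Suc m)) ?X"
    using irreducible_pre Z unfolding affine_variety_def by blast
  define d D where dD: "d = affine_dim m Z" "D = affine_degree m Z"
  note dd = affine_dim_degree[OF infU ZU Zne]
  have d': "d = degree (hpoly (Suc m) ?X)" using dD(1) dd(1) by simp
  have D': "D = fact d * coeff (hpoly (Suc m) ?X) d" unfolding dD(2) dd(2) d' ..
  obtain A where A: "\<forall>i\<le>d. \<forall>j<Suc m. A i j \<in> I \<and> sz (A i j) \<le> (2 * D) ^ (Suc m - 1 - d)" "FG UNIV (Suc m) ?X (Suc d) (linfun (Suc m) A)"
    "(\<forall>j<Suc m. A d j = (if j = Suc m - 1 then 1 else 0))" "\<forall>i<d. A i (Suc m - 1) = 0"
    "\<forall>y. finite {x\<in>?X. \<forall>i<Suc d. linfun (Suc m) A i x = y i} \<and> real (card {x\<in>?X. \<forall>i<Suc d. linfun (Suc m) A i x = y i}) \<le> D" "D \<ge> 1"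
    using normalization_over_base[OF k K alg sz(1) irr _ d' D'] by auto
  let ?L = "\<lambda>i. lin_form m (A i)"
  have lift: "z(m := 1) \<in> ?X" if "z \<in> Z" for z
    using that Zv upd_pts[of z m] dehom_upd[of z m] by auto
  have Ad: "A d j = (if j = m then 1 else 0)" if "j < Suc m" for j using A(3) that by simp
  have Am: "A i m = 0" if "i < d" for i using A(4) that by simp
  have fib: "finite {z \<in> Z. poly_map d ?L z = y} \<and> real (card {z \<in> Z. poly_map d ?L z = y}) \<le> D" for y
  proof -
    let ?S = "{x\<in>?X. \<forall>i<Suc d. linfun (Suc m) A i x = (y(d := 1)) i}"
    have sub: "{z \<in> Z. poly_map d ?L z = y} \<subseteq> dehom m ` ?S"
    proof
      fix z assume "z \<in> {z \<in> Z. poly_map d ?L z = y}"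
      then have z: "z \<in> Z" "poly_map d ?L z = y" by blast+
      have "linfun (Suc m) A i (z(m := 1)) = (y(d := 1)) i" if "i < Suc d" for i
      proof -
        have "linfun (Suc m) A i (z(m := 1)) = ((poly_map d ?L z)(d := 1)) i" by (rule linfun_affine[where A = A, OF Ad Am that])
        then show ?thesis by (simp only: z(2))
      qed
      then have "z(m := 1) \<in> ?S" using lift[OF z(1)] by blast
      then have "dehom m (z(m := 1)) \<in> dehom m ` ?S" by (rule imageI)
      moreover have "dehom m (z(m := 1)) = z" by (rule dehom_upd) (use z(1) Zv in blast)
      ultimately show "z \<in> dehom m ` ?S" by (simp del: fun_upd_apply)
    qed
    show ?thesis by (rule card_bound_image[OF sub]) (rule A(5)[rule_format])
  qed
  have ht: "?L i \<in> forms k m 1 \<and> (\<forall>j<m. h (lin_coeff (?L i) j) \<le> real (2 ^ m) * D ^ (m - d))" if "i < d" for i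
    by (rule lin_form_height[OF sz A(6)]) (use A(1) that in simp_all)
  show ?thesis
    unfolding dD[symmetric]
    by (intro exI[of _ ?L] conjI affine_finite_map_of_FG[OF lift A(2) Ad Am] ballI allI impI) (use ht fib in blast)+
qed

section \<open>Integral elements of the base field and their heights\<close>

lemma infinite_of_sized: "sized k I sz ==> infinite k"
proof
  assume sz: "sized k I sz" and "finite k"
  then have I: "finite I" by (auto simp: sized_def intro: finite_subset)
  obtain S where "S \<subseteq> I" "card S = Suc (card I)" using sz unfolding sized_def by blast
  then show False using card_mono[OF I, of S] by simp
qed

lemma of_int_inj_char0: "CHAR('a::field) = 0 ==> (of_int a = (of_int b :: 'a)) = (a = b)"
  using of_int_eq_0_iff_char_dvd[of "a - b", where 'a = 'a] by simp

lemma Rationals_sized: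
  fixes sz :: "'a::field => real"
  assumes char: "CHAR('a) = 0" and sz: "\<And>z. sz (of_int z) = \<bar>real_of_int z\<bar>"
  shows "sized (base_set Rationals) (range of_int) sz"
proof -
  have "(of_int z :: 'a) \<in> base_set Rationals" for z
    by (simp, rule exI[of _ z], rule exI[of _ 1]) simp
  moreover have "\<exists>S\<subseteq>range of_int. card S = Suc e \<and> (\<forall>s\<in>S. sz s \<le> max 1 (real e))" for e
  proof (intro exI[of _ "of_int ` {0..int e}"] conjI)
    have "inj_on (of_int :: int => 'a) {0..int e}" by (auto intro: inj_onI simp: of_int_inj_char0[OF char])
    then show "card (of_int ` {0..int e} :: 'a set) = Suc e" by (simp add: card_image)
  qed (auto simp: sz)
  moreover have "x - y \<in> range of_int \<and> x * y \<in> range of_int \<and> sz (x - y) \<le> sz x + sz y \<and> sz (x * y) \<le> sz x * sz y"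
    if xy: "x \<in> range of_int" "y \<in> range of_int" for x y :: 'a
  proof -
    obtain a b where ab: "x = of_int a" "y = of_int b" using xy by blast
    have e: "x - y = of_int (a - b)" "x * y = of_int (a * b)" using ab by simp_all
    show ?thesis unfolding e unfolding ab sz by (auto simp: abs_mult simp del: of_int_diff of_int_mult) (simp add: abs_mult)
  qed
  ultimately show ?thesis
    unfolding sized_def using sz[of 0] sz[of 1] by (auto simp: sz intro: range_eqI[of _ _ 0] range_eqI[of _ _ 1])
qed

text \<open>
  All absolute values at primes are at most \<open>1\<close> on integers.
\<close>

lemma Rationals_height:
  assumes char: "CHAR('a::field) = 0"
  shows "height Rationals (of_int z :: 'a) \<le> max 1 \<bar>real_of_int z\<bar>"
proof -
  let ?x = "of_int z :: 'a"
  obtain a b where ab: "int_frac ?x = (a, b)" by (cases "int_frac ?x")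
  let ?Q = "\<lambda>(a, b). b \<noteq> 0 \<and> ?x = of_int a / of_int b"
  have "\<exists>p. ?Q p" by (rule exI[of _ "(z, 1)"]) simp
  from someI_ex[of ?Q, OF this] have "?Q (int_frac ?x)" unfolding int_frac_def .
  then have b: "b \<noteq> 0" and x: "?x = of_int a / of_int b" by (simp_all add: ab)
  have "of_int b \<noteq> (0 :: 'a)" using of_int_inj_char0[OF char, of b 0] b by simp
  then have "(of_int a :: 'a) = of_int (z * b)" using x by (simp add: field_simps)
  \<comment> \<open>the chosen fraction need not be reduced\<close>
  then have a: "a = z * b" using of_int_inj_char0[OF char] by blast
  have "rat_abs_inf ?x = \<bar>real_of_int z\<bar>" using b by (simp add: rat_abs_inf_def ab a abs_mult)
  moreover have "(if prime p then max 1 (rat_abs p ?x) else 1) = 1" for p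
  proof (cases "prime p \<and> z \<noteq> 0")
    case True
    then have p: "prime p" and z: "z \<noteq> 0" by blast+
    have "multiplicity p a = multiplicity p z + multiplicity p b"
      unfolding a using z b by (intro prime_elem_multiplicity_mult_distrib prime_imp_prime_elem p)
    then have e: "- (int (multiplicity p a) - int (multiplicity p b)) = - int (multiplicity p z)" by simp
    have "real_of_int p ^ multiplicity p z \<ge> 1" using prime_ge_1_int[OF p] by (intro one_le_power) simp
    then have "rat_abs p ?x \<le> 1" unfolding rat_abs_def ab prod.case e unfolding power_int_minus power_int_of_nat
      by (simp add: inverse_le_1_iff)
    then show ?thesis by simp
  qed (auto simp: rat_abs_def)
  then have "Prod_any (\<lambda>p. if prime p then max 1 (rat_abs p ?x) else 1) = 1" by simp
  ultimately show ?thesis by simp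
qed

lemma polys_over_mult:
  assumes F: "is_subfield F" and "a \<in> polys_over F" "b \<in> polys_over F"
  shows "a * b \<in> polys_over F"
proof -
  have "(\<Sum>i\<in>A. coeff a i * coeff b (n - i)) \<in> F" for A n
    by (induction A rule: infinite_finite_induct) (use assms subfieldD[OF F] in \<open>auto simp: polys_over_def\<close>)
  then show ?thesis by (simp add: polys_over_def coeff_mult)
qed

lemma polys_over_diff: "is_subfield F ==> a \<in> polys_over F ==> b \<in> polys_over F ==> a - b \<in> polys_over F"
  by (simp add: polys_over_def subfieldD)

lemma polys_over_1: "is_subfield F ==> 1 \<in> polys_over F"
  by (simp add: polys_over_def subfieldD)

lemma polys_over_0: "is_subfield F ==> 0 \<in> polys_over F"
  by (simp add: polys_over_def subfieldD)

lemma transcendental_inj: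
  assumes "is_subfield F" "\<not> algebraic_over F T" "a \<in> polys_over F" "b \<in> polys_over F"
  shows "poly a T = poly b T \<longleftrightarrow> a = b"
  using polys_over_diff[OF assms(1,3,4)] assms(2) unfolding algebraic_over_def
  by (metis eq_iff_diff_eq_0 poly_diff)

lemma card_polys_over:
  fixes F :: "'a::field set"
  assumes F: "finite F" "0 \<in> F"
  shows "finite {a \<in> polys_over F. degree a \<le> r}" "card F ^ Suc r \<le> card {a \<in> polys_over F. degree a \<le> r}"
proof -
  let ?P = "{a \<in> polys_over F. degree a \<le> r}" and ?L = "{xs. set xs \<subseteq> F \<and> length xs = Suc r}"
  have "?P \<subseteq> Poly ` ?L"
  proof
    fix a assume a: "a \<in> ?P"
    \<comment> \<open>coefficient lists of length \<open>r + 1\<close>\<close>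
    have "a = Poly (map (coeff a) [0..<Suc r])"
    proof (rule poly_eqI)
      fix i
      show "coeff a i = coeff (Poly (map (coeff a) [0..<Suc r])) i"
        using a coeff_eq_0[of a i] by (cases "i < Suc r") (auto simp: coeff_Poly_eq nth_default_def nth_append simp del: upt_Suc)
    qed
    then show "a \<in> Poly ` ?L" using a by (intro image_eqI[of _ _ "map (coeff a) [0..<Suc r]"]) (auto simp: polys_over_def)
  qed
  then show "finite ?P" using finite_lists_length_eq[OF F(1), of "Suc r"] finite_subset by blast
  moreover have "Poly ` ?L \<subseteq> ?P"
  proof
    fix p assume "p \<in> Poly ` ?L"
    then obtain xs where xs: "set xs \<subseteq> F" "length xs = Suc r" "p = Poly xs" by blast
    have "degree p \<le> r" by (rule degree_le) (simp add: xs coeff_Poly_eq nth_default_def)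
    moreover have "coeff p i \<in> F" for i
      using xs F(2) by (auto simp: coeff_Poly_eq nth_default_def)
    ultimately show "p \<in> ?P" by (simp add: polys_over_def)
  qed
  moreover have "inj_on (Poly :: 'a list => 'a poly) ?L"
  proof (rule inj_onI)
    fix xs ys :: "'a list" assume xy: "xs \<in> ?L" "ys \<in> ?L" "Poly xs = Poly ys"
    show "xs = ys"
    proof (rule nth_equalityI)
      fix i assume "i < length xs"
      then show "xs ! i = ys ! i" using arg_cong[OF xy(3), of "\<lambda>p. coeff p i"] xy(1,2)
        by (simp add: coeff_Poly_eq nth_default_def)
    qed (use xy in auto)
  qed
  ultimately show "card F ^ Suc r \<le> card ?P"
    using card_inj_on_le[of Poly ?L ?P] card_lists_length_eq[OF F(1), of "Suc r"] by simp
qed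

lemma subfield_card_ge_2: "is_subfield F ==> finite F ==> card F \<ge> 2"
  using card_mono[of F "{0, 1}"] by (simp add: subfieldD)

text \<open>
  There are \<open>q\<close> to the power \<open>r + 1\<close> polynomials of degree at most \<open>r\<close>, all of size at most \<open>q\<close> to the
  power \<open>r\<close>; take the largest \<open>r\<close> for which the latter is at most \<open>e\<close>.
\<close>

lemma RatFun_sized:
  fixes T :: "'a::field"
  assumes F: "is_subfield F" "finite F" and T: "\<not> algebraic_over F T"
    and sz: "\<And>a. a \<in> polys_over F ==> sz (poly a T) = (if a = 0 then 0 else real (card F) ^ degree a)"
  shows "sized (base_set (RatFun F T)) ((\<lambda>a. poly a T) ` polys_over F) sz"
proof -
  let ?I = "(\<lambda>a. poly a T) ` polys_over F" and ?q = "card F"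
  have q: "?q \<ge> 2" by (rule subfield_card_ge_2[OF F])
  have "?I \<subseteq> base_set (RatFun F T)"
  proof
    fix x assume "x \<in> ?I"
    then obtain a where a: "a \<in> polys_over F" "x = poly a T" by blast
    then show "x \<in> base_set (RatFun F T)" using polys_over_1[OF F(1)]
      by (simp, intro exI[of _ a] exI[of _ 1]) simp
  qed
  moreover have "0 \<in> ?I" "1 \<in> ?I"
    using polys_over_0[OF F(1)] polys_over_1[OF F(1)] by (force intro: image_eqI[of _ _ 0], force intro: image_eqI[of _ _ 1])
  moreover have "sz 0 = 0" "sz 1 = 1"
    using sz[OF polys_over_0[OF F(1)]] sz[OF polys_over_1[OF F(1)]] by simp_all
  moreover have "\<forall>x\<in>?I. sz x \<ge> 0" by (auto simp: sz)
  moreover have "x - y \<in> ?I \<and> x * y \<in> ?I \<and> sz (x - y) \<le> sz x + sz y \<and> sz (x * y) \<le> sz x * sz y"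
    if xy: "x \<in> ?I" "y \<in> ?I" for x y
  proof -
    obtain a b where ab: "a \<in> polys_over F" "b \<in> polys_over F" "x = poly a T" "y = poly b T" using xy by blast
    note d = polys_over_diff[OF F(1) ab(1,2)] and m = polys_over_mult[OF F(1) ab(1,2)]
    have e: "x - y = poly (a - b) T" "x * y = poly (a * b) T" by (simp_all add: ab)
    have "sz (x * y) \<le> sz x * sz y"
      unfolding e(2) sz[OF m] unfolding ab(3,4) sz[OF ab(1)] sz[OF ab(2)] by (simp add: degree_mult_eq power_add)
    moreover have "sz (x - y) \<le> sz x + sz y"
    proof (cases "a - b = 0 \<or> a = 0 \<or> b = 0")
      case True
      then show ?thesis unfolding e(1) sz[OF d] unfolding ab(3,4) sz[OF ab(1)] sz[OF ab(2)] by auto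
    next
      case False
      have "degree (a - b) \<le> max (degree a) (degree b)" by (rule degree_diff_le_max)
      then have "real ?q ^ degree (a - b) \<le> real ?q ^ max (degree a) (degree b)" using q by (intro power_increasing) auto
      also have "... \<le> real ?q ^ degree a + real ?q ^ degree b" by (simp add: max_def)
      finally show ?thesis using False unfolding e(1) sz[OF d] unfolding ab(3,4) sz[OF ab(1)] sz[OF ab(2)] by simp
    qed
    ultimately show ?thesis using d m e by blast
  qed
  moreover have "\<exists>S\<subseteq>?I. card S = Suc e \<and> (\<forall>s\<in>S. sz s \<le> max 1 (real e))" for e
  proof (cases "e = 0")
    case True
    then show ?thesis using \<open>0 \<in> ?I\<close> \<open>sz 0 = 0\<close> by (intro exI[of _ "{0}"]) simp
  next
    case False
    then obtain r where r: "?q ^ r \<le> e" "e < ?q ^ Suc r" using ex_power_ivl1[OF q, of e] by auto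
    let ?P = "{a \<in> polys_over F. degree a \<le> r}"
    have "Suc e \<le> card ?P" using card_polys_over(2)[OF F(2) subfieldD(1)[OF F(1)], of r] r(2) by simp
    then obtain Q where Q: "Q \<subseteq> ?P" "card Q = Suc e" by (rule obtain_subset_with_card_n)
    have "inj_on (\<lambda>a. poly a T) Q" using Q(1) transcendental_inj[OF F(1) T] by (auto simp: inj_on_def)
    then have "card ((\<lambda>a. poly a T) ` Q) = Suc e" using Q(2) by (simp add: card_image)
    moreover have "sz (poly a T) \<le> max 1 (real e)" if a: "a \<in> Q" for a
    proof -
      have a': "a \<in> polys_over F" "degree a \<le> r" using a Q(1) by blast+
      have "real ?q ^ degree a \<le> real ?q ^ r" using a'(2) q by (intro power_increasing) auto
      also have "... \<le> real e" using r(1) by (metis of_nat_le_iff of_nat_power)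
      finally have "real ?q ^ degree a \<le> max 1 (real e)" by linarith
      then show ?thesis unfolding sz[OF a'(1)] by auto
    qed
    ultimately show ?thesis using Q(1) by (intro exI[of _ "(\<lambda>a. poly a T) ` Q"]) blast
  qed
  ultimately show ?thesis unfolding sized_def by simp
qed

text \<open>
  The degree of \<open>w\<close> bounds the exponents, so the greatest one exists.
\<close>

lemma multiplicity_over_mult:
  fixes p :: "'a::field poly"
  assumes F: "is_subfield F" and p: "degree p > 0" and a: "a \<in> polys_over F" "a \<noteq> 0" and w: "w \<in> polys_over F" "w \<noteq> 0"
  shows "multiplicity_over F p w \<le> multiplicity_over F p (a * w)"
proof -
  have bound: "n \<le> degree w" if w: "\<exists>b\<in>polys_over F. w = p ^ n * b" "w \<noteq> 0" for n w
  proof -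
    obtain b where b: "w = p ^ n * b" using w(1) by blast
    have "p \<noteq> 0" "b \<noteq> 0" using p b w(2) by auto
    then have "degree w = n * degree p + degree b" unfolding b by (simp add: degree_mult_eq degree_power_eq)
    then show ?thesis using p by (cases "degree p") auto
  qed
  let ?n = "multiplicity_over F p w"
  have "\<exists>b\<in>polys_over F. w = p ^ ?n * b"
    unfolding multiplicity_over_def
    by (rule GreatestI_nat[of _ 0 "degree w"]) (use w bound in auto)
  then obtain b where b: "b \<in> polys_over F" "w = p ^ ?n * b" by blast
  have "\<exists>b\<in>polys_over F. a * w = p ^ ?n * b"
    using b(2) by (intro bexI[OF _ polys_over_mult[OF F a(1) b(1)]]) (metis mult.left_commute)
  then show ?thesis
    unfolding multiplicity_over_def[of F p "a * w"]
    by (rule Greatest_le_nat[of _ _ "degree (a * w)"]) (use bound a w in auto)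
qed

lemma RatFun_height:
  fixes T :: "'a::field"
  assumes F: "is_subfield F" "finite F" and T: "\<not> algebraic_over F T" and a: "a \<in> polys_over F"
  shows "height (RatFun F T) (poly a T) \<le> max 1 (if a = 0 then 0 else real (card F) ^ degree a)"
proof (cases "a = 0")
  case True
  then show ?thesis by (simp add: ratfun_abs_inf_def ratfun_abs_def cong: if_cong)
next
  case False
  let ?x = "poly a T" and ?q = "real (card F)"
  have q: "?q \<ge> 2" using subfield_card_ge_2[OF F] by simp
  have x0: "?x \<noteq> 0" using transcendental_inj[OF F(1) T a polys_over_0[OF F(1)]] False by simp
  obtain u w where uw: "poly_frac F T ?x = (u, w)" by (cases "poly_frac F T ?x")
  let ?Q = "\<lambda>(u, w). u \<in> polys_over F \<and> w \<in> polys_over F \<and> w \<noteq> 0 \<and> ?x = poly u T / poly w T"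
  have "\<exists>p. ?Q p" using a polys_over_1[OF F(1)] by (intro exI[of _ "(a, 1)"]) simp
  from someI_ex[of ?Q, OF this] have "?Q (poly_frac F T ?x)" unfolding poly_frac_def .
  then have p: "u \<in> polys_over F" "w \<in> polys_over F" "w \<noteq> 0" "?x = poly u T / poly w T" by (simp_all add: uw)
  have "poly w T \<noteq> 0" using transcendental_inj[OF F(1) T p(2) polys_over_0[OF F(1)]] p(3) by simp
  then have "poly u T = poly (a * w) T" using p(4) by (simp add: field_simps)
  then have u: "u = a * w" using transcendental_inj[OF F(1) T p(1) polys_over_mult[OF F(1) a p(2)]] by blast
  have "int (degree u) - int (degree w) = int (degree a)" using False p(3) by (simp add: u degree_mult_eq)
  then have "ratfun_abs_inf F T ?x = ?q ^ degree a" using x0 by (simp add: ratfun_abs_inf_def uw)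
  moreover have "(if monic_irreducible_over F p then max 1 (ratfun_abs F T p ?x) else 1) = 1" for p
  proof (cases "monic_irreducible_over F p")
    case True
    then have "degree p > 0" by (simp add: monic_irreducible_over_def)
    from multiplicity_over_mult[OF F(1) this a False p(2,3)]
    obtain j where j: "multiplicity_over F p u = multiplicity_over F p w + j" unfolding u using le_Suc_ex by blast
    have e: "- (int (degree p) * (int (multiplicity_over F p u) - int (multiplicity_over F p w))) = - int (degree p * j)"
      by (simp add: j)
    have "?q ^ (degree p * j) \<ge> 1" using q by (intro one_le_power) simp
    then have "ratfun_abs F T p ?x \<le> 1"
      using x0 unfolding ratfun_abs_def uw prod.case e unfolding power_int_minus power_int_of_nat by (simp add: inverse_le_1_iff)
    then show ?thesis by simp
  qed simp
  then have "Prod_any (\<lambda>p. if monic_irreducible_over F p then max 1 (ratfun_abs F T p ?x) else 1) = 1" by simp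
  ultimately show ?thesis using False by simp
qed

lemma base_set_subfield:
  fixes k :: "'a::field base_field"
  assumes "is_base_field k"
  shows "is_subfield (base_set k)"
proof (cases k)
  case Rationals
  then have char: "CHAR('a) = 0" using assms by simp
  have nz: "of_int b \<noteq> (0 :: 'a)" if "b \<noteq> 0" for b using of_int_inj_char0[OF char, of b 0] that by simp
  let ?B = "{of_int a / of_int b | a b. b \<noteq> 0} :: 'a set"
  have I: "of_int a / of_int b \<in> ?B" if "b \<noteq> 0" for a b using that by blast
  have "0 \<in> ?B" "1 \<in> ?B" using I[of 1 0] I[of 1 1] by simp_all
  moreover have "x + y \<in> ?B \<and> x - y \<in> ?B \<and> x * y \<in> ?B" if xy: "x \<in> ?B" "y \<in> ?B" for x y
  proof -
    obtain a b c d where f: "b \<noteq> 0" "d \<noteq> 0" "x = of_int a / of_int b" "y = of_int c / of_int d" using xy by blast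
    have e: "x + y = of_int (a * d + c * b) / of_int (b * d)" "x - y = of_int (a * d - c * b) / of_int (b * d)"
      "x * y = of_int (a * c) / of_int (b * d)" using nz[OF f(1)] nz[OF f(2)] by (simp_all add: f field_simps)
    have "b * d \<noteq> 0" using f(1,2) by simp
    then show ?thesis unfolding e by (intro conjI I)
  qed
  moreover have "inverse x \<in> ?B" if x: "x \<in> ?B" for x
  proof -
    obtain a b where f: "b \<noteq> 0" "x = of_int a / of_int b" using x by blast
    show ?thesis using I[of a b] I[of 1 0] by (cases "a = 0") (simp_all add: f)
  qed
  ultimately show ?thesis unfolding Rationals base_set.simps is_subfield_def by blast
next
  case (RatFun F T)
  then have F: "is_subfield F" and T: "\<not> algebraic_over F T" using assms by simp_all
  have nz: "poly b T \<noteq> 0" if "b \<in> polys_over F" "b \<noteq> 0" for b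
    using transcendental_inj[OF F T that(1) polys_over_0[OF F]] that(2) by simp
  let ?B = "{poly a T / poly b T | a b. a \<in> polys_over F \<and> b \<in> polys_over F \<and> b \<noteq> 0}"
  have I: "poly a T / poly b T \<in> ?B" if "a \<in> polys_over F" "b \<in> polys_over F" "b \<noteq> 0" for a b using that by blast
  note m = polys_over_mult[OF F]
  have add: "a + b \<in> polys_over F" if "a \<in> polys_over F" "b \<in> polys_over F" for a b
    using that by (simp add: polys_over_def subfieldD[OF F])
  note one = polys_over_1[OF F]
  have zo: "0 \<in> ?B" "1 \<in> ?B" using I[OF polys_over_0[OF F] one] I[OF one one] by simp_all
  have op: "x + y \<in> ?B \<and> x - y \<in> ?B \<and> x * y \<in> ?B" if xy: "x \<in> ?B" "y \<in> ?B" for x y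
  proof -
    obtain a b c d where f: "a \<in> polys_over F" "b \<in> polys_over F" "b \<noteq> 0" "c \<in> polys_over F" "d \<in> polys_over F" "d \<noteq> 0"
      "x = poly a T / poly b T" "y = poly c T / poly d T" using xy by blast
    have bd: "b * d \<in> polys_over F" "b * d \<noteq> 0" using f m by auto
    have e: "x + y = poly (a * d + c * b) T / poly (b * d) T" "x - y = poly (a * d - c * b) T / poly (b * d) T"
      "x * y = poly (a * c) T / poly (b * d) T" using nz[OF f(2,3)] nz[OF f(5,6)] by (simp_all add: f field_simps)
    show ?thesis unfolding e by (intro conjI I bd add polys_over_diff[OF F] m f)
  qed
  have inv: "inverse x \<in> ?B" if x: "x \<in> ?B" for x
  proof -
    obtain a b where f: "a \<in> polys_over F" "b \<in> polys_over F" "b \<noteq> 0" "x = poly a T / poly b T" using x by blast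
    show ?thesis using I[OF f(2,1)] zo(1) by (cases "a = 0") (simp_all add: f(4))
  qed
  show ?thesis unfolding RatFun base_set.simps is_subfield_def
    by (intro conjI ballI zo inv op[THEN conjunct1] op[THEN conjunct2, THEN conjunct1] op[THEN conjunct2, THEN conjunct2]; assumption)
qed

lemma sized_base_field:
  fixes k :: "'a::field base_field"
  assumes "is_base_field k"
  shows "\<exists>I sz. sized (base_set k) I sz \<and> (\<forall>x\<in>I. height k x \<le> max 1 (sz x))"
proof (cases k)
  case Rationals
  then have char: "CHAR('a) = 0" using assms by simp
  define sz where "sz = (\<lambda>x :: 'a. \<bar>real_of_int (THE z. x = of_int z)\<bar>)"
  have sz: "sz (of_int z) = \<bar>real_of_int z\<bar>" for z
    by (simp add: sz_def of_int_inj_char0[OF char])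
  have "sized (base_set k) (range of_int) sz" unfolding Rationals by (rule Rationals_sized[OF char sz])
  moreover have "\<forall>x\<in>range of_int. height k x \<le> max 1 (sz x)"
    unfolding Rationals using Rationals_height[OF char] by (auto simp: sz simp del: height.simps)
  ultimately show ?thesis by blast
next
  case (RatFun F T)
  then have F: "is_subfield F" "finite F" and T: "\<not> algebraic_over F T" using assms by simp_all
  define sz where "sz = (\<lambda>x. let a = THE a. a \<in> polys_over F \<and> x = poly a T in if a = 0 then 0 else real (card F) ^ degree a)"
  have sz: "sz (poly a T) = (if a = 0 then 0 else real (card F) ^ degree a)" if a: "a \<in> polys_over F" for a
  proof -
    have "(THE b. b \<in> polys_over F \<and> poly a T = poly b T) = a"
      using a transcendental_inj[OF F(1) T a] by (intro the_equality) auto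
    then show ?thesis by (simp add: sz_def)
  qed
  have "sized (base_set k) ((\<lambda>a. poly a T) ` polys_over F) sz"
    unfolding RatFun by (rule RatFun_sized[OF F T sz])
  moreover have "\<forall>x\<in>(\<lambda>a. poly a T) ` polys_over F. height k x \<le> max 1 (sz x)"
    unfolding RatFun using RatFun_height[OF F T] by (auto simp: sz simp del: height.simps)
  ultimately show ?thesis by blast
qed

section \<open>The normalization theorem\<close>

text \<open>
  Doubling and then exponentiation by primitive recursion.
\<close>

lemma computable2_power: "computable2 (\<lambda>_ m. 2 ^ m)"
proof -
  have one: "total_recursive n (\<lambda>_. Suc 0)" for n
    using total_recursive.comp[of "[\<lambda>_. 0]" "\<lambda>xs. Suc (xs ! 0)" n] total_recursive.succ total_recursive.zero by simp
  have s: "total_recursive n (\<lambda>xs. Suc (f xs))" if "total_recursive n f" for n f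
    using total_recursive.comp[of "[f]" "\<lambda>xs. Suc (xs ! 0)" n] total_recursive.succ that by simp
  have "total_recursive 2 (\<lambda>xs. Suc (Suc (xs ! 1)))" by (intro s total_recursive.proj) simp
  from total_recursive.prec[OF total_recursive.zero[of 0], of "\<lambda>xs. Suc (Suc (xs ! 1))"] this
  have "total_recursive 1 (\<lambda>xs. rec_nat 0 (\<lambda>y r. Suc (Suc r)) (hd xs))" by (simp add: numeral_2_eq_2)
  moreover have "rec_nat 0 (\<lambda>y r. Suc (Suc r)) n = 2 * n" for n by (induction n) auto
  ultimately have "total_recursive 1 (\<lambda>xs. 2 * hd xs)" by simp
  from total_recursive.comp[of "[\<lambda>xs. xs ! 1]" "\<lambda>xs. 2 * hd xs" 2] this total_recursive.proj[of 1 2]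
  have "total_recursive 2 (\<lambda>xs. 2 * xs ! 1)" by simp
  from total_recursive.prec[OF one[of 0], of "\<lambda>xs. 2 * xs ! 1"] this
  have "total_recursive 1 (\<lambda>xs. rec_nat (Suc 0) (\<lambda>y r. 2 * r) (hd xs))" by (simp add: numeral_2_eq_2)
  moreover have "rec_nat (Suc 0) (\<lambda>y r. 2 * r) n = 2 ^ n" for n by (induction n) auto
  ultimately have "total_recursive 1 (\<lambda>xs. 2 ^ hd xs)" by simp
  from total_recursive.comp[of "[\<lambda>xs. xs ! 1]" "\<lambda>xs. 2 ^ hd xs" 2] this total_recursive.proj[of 1 2]
  have "total_recursive 2 (\<lambda>xs. 2 ^ (xs ! 1))" by simp
  then show ?thesis unfolding computable2_def by (intro exI[of _ "\<lambda>xs. 2 ^ (xs ! 1)"]) simp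
qed

theorem theorem4p3:
  "\<exists>c :: nat \<Rightarrow> nat \<Rightarrow> nat. computable2 c \<and>
     (\<forall>(k :: 'a::alg_closed_field base_field) K m.
        global_field k K \<and> (\<forall>x. algebraic_over (base_set k) x) \<and> m > 0 \<longrightarrow>
        (\<forall>V. proj_variety K m V \<longrightarrow>
           (\<exists>L. (\<forall>i\<le>proj_dim m V. L i \<in> forms (base_set k) (Suc m) 1 \<and>
                   (\<forall>j\<le>m. height k (lin_coeff (L i) j)
                      \<le> real (c (base_code k) m) * proj_degree m V ^ (m - proj_dim m V))) \<and>
                proj_finite_map m (proj_dim m V) V L \<and>
                (\<forall>Q\<in>proj_space (proj_dim m V).
                   finite {P \<in> V. proj_map (proj_dim m V) L P = Q} \<and>
                   real (card {P \<in> V. proj_map (proj_dim m V) L P = Q}) \<le> proj_degree m V))) \<and>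
        (\<forall>Z. affine_variety K m Z \<longrightarrow>
           (\<exists>L. (\<forall>i<affine_dim m Z. L i \<in> forms (base_set k) m 1 \<and>
                   (\<forall>j<m. height k (lin_coeff (L i) j)
                      \<le> real (c (base_code k) m) * affine_degree m Z ^ (m - affine_dim m Z))) \<and>
                affine_finite_map m (affine_dim m Z) Z L \<and>
                (\<forall>y\<in>vecs (affine_dim m Z).
                   finite {z \<in> Z. poly_map (affine_dim m Z) L z = y} \<and>
                   real (card {z \<in> Z. poly_map (affine_dim m Z) L z = y}) \<le> affine_degree m Z))))"
proof (intro exI[of _ "\<lambda>_ m. 2 ^ m"] conjI[OF computable2_power] allI impI, elim conjE, intro conjI allI impI)
  fix k :: "'a base_field" and K m
  assume gf: "global_field k K" and alg: "\<forall>x. algebraic_over (base_set k) x"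
  have k: "is_subfield (base_set k)" and K: "is_subfield K" "base_set k \<subseteq> K" and kb: "is_base_field k"
    using gf by (auto simp: global_field_def finite_extension_def base_set_subfield)
  obtain I sz where sz: "sized (base_set k) I sz" "\<forall>x\<in>I. height k x \<le> max 1 (sz x)"
    using sized_base_field[OF kb] by blast
  note setting = k infinite_of_sized[OF sz(1)] K alg[rule_format] sz(1) sz(2)[rule_format]
  {
    fix V assume "proj_variety K m V"
    from proj_normalization[OF setting this]
    show "\<exists>L. (\<forall>i\<le>proj_dim m V. L i \<in> forms (base_set k) (Suc m) 1 \<and>
        (\<forall>j\<le>m. height k (lin_coeff (L i) j) \<le> real (2 ^ m) * proj_degree m V ^ (m - proj_dim m V))) \<and>
        proj_finite_map m (proj_dim m V) V L \<and>
        (\<forall>Q\<in>proj_space (proj_dim m V). finite {P \<in> V. proj_map (proj_dim m V) L P = Q} \<and>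
          real (card {P \<in> V. proj_map (proj_dim m V) L P = Q}) \<le> proj_degree m V)" .
  }
  {
    fix Z assume "affine_variety K m Z"
    from affine_normalization[OF setting this]
    show "\<exists>L. (\<forall>i<affine_dim m Z. L i \<in> forms (base_set k) m 1 \<and>
        (\<forall>j<m. height k (lin_coeff (L i) j) \<le> real (2 ^ m) * affine_degree m Z ^ (m - affine_dim m Z))) \<and>
        affine_finite_map m (affine_dim m Z) Z L \<and>
        (\<forall>y\<in>vecs (affine_dim m Z). finite {z \<in> Z. poly_map (affine_dim m Z) L z = y} \<and>
          real (card {z \<in> Z. poly_map (affine_dim m Z) L z = y}) \<le> affine_degree m Z)" .
  }
qed

end
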